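(* Let $r \ge 3$ and let $d_0,d_1\ge 1$ be integers. Then $\mathscr R(r,d_0,d_1)$ is an irreducible and generically reduced component of the scheme $\mathscr F(r,d_0+d_1-2)$ of codimension one foliations of degree $d_0+d_1-2$ on $\mathbb P^r$; that is, it is an irreducible component, and $\mathscr F(r,d_0+d_1-2)$ is reduced at the generic point of $\mathscr R(r,d_0,d_1)$.
   Context: Everything is over $\mathbb C$; $\mathbb P(V)$ is the space of lines in $V$. $H^0(\mathbb P^r,\Omega^1_{\mathbb P^r}(m))$ is identified with the space of polynomial $1$-forms $\omega=\sum_{i=0}^r a_i dx_i$ on $\mathbb C^{r+1}$ with $a_i$ homogeneous of degree $m-1$ and $\sum_i a_i x_i=0$. For such $\omega$, $\mathrm{sing}(\omega)$ denotes its zero set. $\mathscr F(r,d)=\{\omega\in\mathbb P(H^0(\mathbb P^r,\Omega^1_{\mathbb P^r}(d+2))) : \omega\wedge d\omega=0,\ \mathrm{codim}\,\mathrm{sing}(\omega)\ge 2\}$, with the scheme structure given by the Frobenius equations $\omega\wedge d\omega=0$ (on the open set defined by the codimension condition). $\mathscr R(r,d_0,d_1)$ is the closure of the image of the rational map $$\rho:\mathbb P(H^0(\mathbb P^r,\mathcal O(d_0)))\times\mathbb P(H^0(\mathbb P^r,\mathcal O(d_1)))\dashrightarrow \mathbb P(H^0(\mathbb P^r,\Omega^1(d_0+d_1))),\quad (F_0,F_1)\mapsto d_0F_0\,dF_1-d_1F_1\,dF_0 .$$ It is regarded inside $\mathscr F(r,d_0+d_1-2)$ by intersecting with the open condition $\mathrm{codim}\,\mathrm{sing}(\omega)\ge2$.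 *)

theory Defs
  imports
    "HOL-Analysis.Abstract_Topology"
    "HOL-Algebra.QuotRing"
    "HOL-Library.Poly_Mapping"
    "HOL-Library.Extended_Nat"
    "HOL-Library.Function_Algebras"
begin

section \<open>Irreducibility and codimension in topological spaces\<close>

definition irreducible_in :: "'a topology \<Rightarrow> 'a set \<Rightarrow> bool" where
  "irreducible_in X S \<longleftrightarrow> S \<subseteq> topspace X \<and> S \<noteq> {} \<and>
     (\<forall>A B. closedin (subtopology X S) A \<and> closedin (subtopology X S) B \<and> A \<union> B = S
        \<longrightarrow> A = S \<or> B = S)"

definition irreducible_component_of :: "'a topology \<Rightarrow> 'a set \<Rightarrow> bool" where
  "irreducible_component_of X C \<longleftrightarrow>
     irreducible_in X C \<and> (\<forall>D. irreducible_in X D \<and> C \<subseteq> D \<longrightarrow> D = C)"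

text \<open>
  The codimension of an irreducible closed \<open>Y\<close> is the supremum of the lengths of chains of
  irreducible closed sets starting at \<open>Y\<close>; the codimension of \<open>Z\<close> is the infimum over the
  irreducible closed subsets of \<open>Z\<close>, so that the empty set has codimension \<open>\<infinity>\<close>.
\<close>

definition codim :: "'a topology \<Rightarrow> 'a set \<Rightarrow> enat" where
  "codim X Z =
     (INF Y \<in> {Y. Y \<subseteq> Z \<and> closedin X Y \<and> irreducible_in X Y}.
        SUP n \<in> {n. \<exists>C :: nat \<Rightarrow> 'a set. C 0 = Y
                    \<and> (\<forall>i\<le>n. closedin X (C i) \<and> irreducible_in X (C i))
                    \<and> (\<forall>i<n. C i \<subset> C (Suc i))}. enat n)"


section \<open>Projective spaces of lines and their coordinate rings\<close>

text \<open>
  A complex vector space is a linear subspace \<open>V\<close> of a type with scalar multiplication \<open>s\<close>.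
  Since the complex field is infinite, the symmetric algebra of the dual of \<open>V\<close> is the algebra
  of polynomial functions on \<open>V\<close>, and its graded pieces are cut out by \<open>f (c v) = c ^ n * f v\<close>.
  Every linear functional on \<open>V\<close> extends to the whole type; polynomial functions on \<open>V\<close> are
  represented by functions on the type that are 0 outside \<open>V\<close>.
\<close>

inductive_set poly_funs :: "(complex \<Rightarrow> 'v \<Rightarrow> 'v) \<Rightarrow> ('v::ab_group_add \<Rightarrow> complex) set"
  for s :: "complex \<Rightarrow> 'v \<Rightarrow> 'v" where
  const: "(\<lambda>_. c) \<in> poly_funs s"
| linear: "Vector_Spaces.linear s (*) l \<Longrightarrow> l \<in> poly_funs s"
| add: "f \<in> poly_funs s \<Longrightarrow> g \<in> poly_funs s \<Longrightarrow> (\<lambda>v. f v + g v) \<in> poly_funs s"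
| mult: "f \<in> poly_funs s \<Longrightarrow> g \<in> poly_funs s \<Longrightarrow> (\<lambda>v. f v * g v) \<in> poly_funs s"

definition restrict0 :: "'v set \<Rightarrow> ('v \<Rightarrow> complex) \<Rightarrow> 'v \<Rightarrow> complex" where
  "restrict0 V f = (\<lambda>v. if v \<in> V then f v else 0)"

definition coord_ring ::
    "(complex \<Rightarrow> 'v \<Rightarrow> 'v) \<Rightarrow> 'v::ab_group_add set \<Rightarrow> ('v \<Rightarrow> complex) ring" where
  "coord_ring s V =
     \<lparr> carrier = restrict0 V ` poly_funs s,
       monoid.mult = (\<lambda>f g v. f v * g v),
       one = restrict0 V (\<lambda>_. 1),
       ring.zero = (\<lambda>_. 0),
       add = (\<lambda>f g v. f v + g v) \<rparr>"

definition homog_part ::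
    "(complex \<Rightarrow> 'v \<Rightarrow> 'v) \<Rightarrow> 'v::ab_group_add set \<Rightarrow> nat \<Rightarrow> ('v \<Rightarrow> complex) set" where
  "homog_part s V n =
     {f \<in> carrier (coord_ring s V). \<forall>c. \<forall>v\<in>V. f (s c v) = c ^ n * f v}"

definition line :: "(complex \<Rightarrow> 'v \<Rightarrow> 'v) \<Rightarrow> 'v \<Rightarrow> 'v set" where
  "line s v = {s c v | c. True}"

definition proj_space :: "(complex \<Rightarrow> 'v \<Rightarrow> 'v) \<Rightarrow> 'v::ab_group_add set \<Rightarrow> 'v set set" where
  "proj_space s V = line s ` (V - {0})"

definition vanishes_at :: "('v \<Rightarrow> complex) \<Rightarrow> 'v set \<Rightarrow> bool" where
  "vanishes_at f L \<longleftrightarrow> (\<forall>v\<in>L. f v = 0)"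

definition zero_locus ::
    "(complex \<Rightarrow> 'v \<Rightarrow> 'v) \<Rightarrow> 'v::ab_group_add set \<Rightarrow> ('v \<Rightarrow> complex) set \<Rightarrow> 'v set set" where
  "zero_locus s V T = {L \<in> proj_space s V. \<forall>f\<in>T. vanishes_at f L}"

definition zariski_closed ::
    "(complex \<Rightarrow> 'v \<Rightarrow> 'v) \<Rightarrow> 'v::ab_group_add set \<Rightarrow> 'v set set \<Rightarrow> bool" where
  "zariski_closed s V Z \<longleftrightarrow> (\<exists>T. T \<subseteq> (\<Union>n. homog_part s V n) \<and> Z = zero_locus s V T)"

definition zariski ::
    "(complex \<Rightarrow> 'v \<Rightarrow> 'v) \<Rightarrow> 'v::ab_group_add set \<Rightarrow> 'v set topology" where
  "zariski s V =
     topology (\<lambda>U. U \<subseteq> proj_space s V \<and> zariski_closed s V (proj_space s V - U))"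


section \<open>Local rings of closed subschemes of projective space\<close>

text \<open>
  Let \<open>I\<close> be a homogeneous ideal of the coordinate ring \<open>S\<close> of \<open>P(V)\<close>, let \<open>Z\<close> be an irreducible
  set of closed points of \<open>Proj (S/I)\<close>, and let \<open>p\<close> be the homogeneous prime ideal of the
  functions that vanish on \<open>Z\<close>, that is, the generic point of the closure of \<open>Z\<close>. The local ring
  of \<open>Proj (S/I)\<close> at \<open>p\<close> is the degree 0 part of the homogeneous localization of \<open>S/I\<close> at \<open>p\<close>:
  its elements are the fractions \<open>f/g\<close> with \<open>f\<close>, \<open>g\<close> homogeneous of the same degree and \<open>g\<close> not
  in \<open>p\<close>. It depends only on a neighbourhood of the generic point, so it is also the local ring
  of any open subscheme of \<open>Proj (S/I)\<close> that meets \<open>Z\<close>.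
\<close>

definition denoms ::
    "(complex \<Rightarrow> 'v \<Rightarrow> 'v) \<Rightarrow> 'v::ab_group_add set \<Rightarrow> 'v set set \<Rightarrow> nat \<Rightarrow> ('v \<Rightarrow> complex) set" where
  "denoms s V Z n = {g \<in> homog_part s V n. \<not> (\<forall>L\<in>Z. vanishes_at g L)}"

definition fracs ::
    "(complex \<Rightarrow> 'v \<Rightarrow> 'v) \<Rightarrow> 'v::ab_group_add set \<Rightarrow> 'v set set
      \<Rightarrow> (('v \<Rightarrow> complex) \<times> ('v \<Rightarrow> complex)) set" where
  "fracs s V Z = (\<Union>n. homog_part s V n \<times> denoms s V Z n)"

definition frac_rel ::
    "(complex \<Rightarrow> 'v \<Rightarrow> 'v) \<Rightarrow> 'v::ab_group_add set \<Rightarrow> ('v \<Rightarrow> complex) set \<Rightarrow> 'v set set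
      \<Rightarrow> ((('v \<Rightarrow> complex) \<times> ('v \<Rightarrow> complex)) \<times> (('v \<Rightarrow> complex) \<times> ('v \<Rightarrow> complex))) set" where
  "frac_rel s V I Z =
     {((f, g), (f', g')). (f, g) \<in> fracs s V Z \<and> (f', g') \<in> fracs s V Z \<and>
        (\<exists>n. \<exists>h \<in> denoms s V Z n. (\<lambda>v. h v * (f v * g' v - f' v * g v)) \<in> I)}"

definition local_ring ::
    "(complex \<Rightarrow> 'v \<Rightarrow> 'v) \<Rightarrow> 'v::ab_group_add set \<Rightarrow> ('v \<Rightarrow> complex) set \<Rightarrow> 'v set set
      \<Rightarrow> (('v \<Rightarrow> complex) \<times> ('v \<Rightarrow> complex)) set ring" where
  "local_ring s V I Z =
     (let cls = (\<lambda>q. frac_rel s V I Z `` {q}) in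
      \<lparr> carrier = fracs s V Z // frac_rel s V I Z,
        monoid.mult = (\<lambda>x y. \<Union>(f, g)\<in>x. \<Union>(f', g')\<in>y.
                         cls (\<lambda>v. f v * f' v, \<lambda>v. g v * g' v)),
        one = cls (restrict0 V (\<lambda>_. 1), restrict0 V (\<lambda>_. 1)),
        ring.zero = cls (\<lambda>_. 0, restrict0 V (\<lambda>_. 1)),
        add = (\<lambda>x y. \<Union>(f, g)\<in>x. \<Union>(f', g')\<in>y.
                 cls (\<lambda>v. f v * g' v + f' v * g v, \<lambda>v. g v * g' v)) \<rparr>)"

definition reduced_ring :: "('a, 'b) ring_scheme \<Rightarrow> bool" where
  "reduced_ring R \<longleftrightarrow>
     cring R \<and> (\<forall>x \<in> carrier R. \<forall>n::nat. x [^]\<^bsub>R\<^esub> n = \<zero>\<^bsub>R\<^esub> \<longrightarrow> x = \<zero>\<^bsub>R\<^esub>)"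


section \<open>Polynomials and polynomial 1-forms\<close>

text \<open>Polynomials in the variables \<open>x\<^sub>0, x\<^sub>1, \<dots>\<close>; a monomial is its exponent vector.\<close>

type_synonym mono = "nat \<Rightarrow>\<^sub>0 nat"
type_synonym mpoly = "mono \<Rightarrow>\<^sub>0 complex"

definition pvar :: "nat \<Rightarrow> mpoly" where
  "pvar i = Poly_Mapping.single (Poly_Mapping.single i 1) 1"

definition pconst :: "complex \<Rightarrow> mpoly" where
  "pconst c = Poly_Mapping.single 0 c"

definition peval :: "mpoly \<Rightarrow> (nat \<Rightarrow> complex) \<Rightarrow> complex" where
  "peval p x = (\<Sum>\<alpha>\<in>Poly_Mapping.keys p. Poly_Mapping.lookup p \<alpha> *
     (\<Prod>i\<in>Poly_Mapping.keys \<alpha>. x i ^ Poly_Mapping.lookup \<alpha> i))"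

definition pderiv_var :: "nat \<Rightarrow> mpoly \<Rightarrow> mpoly" where
  "pderiv_var i p = (\<Sum>\<alpha>\<in>Poly_Mapping.keys p.
     Poly_Mapping.single (\<alpha> - Poly_Mapping.single i 1)
       (of_nat (Poly_Mapping.lookup \<alpha> i) * Poly_Mapping.lookup p \<alpha>))"

definition homog_polys :: "nat \<Rightarrow> nat \<Rightarrow> mpoly set" where
  "homog_polys r n = {p. \<forall>\<alpha>\<in>Poly_Mapping.keys p.
     Poly_Mapping.keys \<alpha> \<subseteq> {..r} \<and>
     (\<Sum>i\<in>Poly_Mapping.keys \<alpha>. Poly_Mapping.lookup \<alpha> i) = n}"

text \<open>
  The 1-form \<open>\<Sum>i\<le>r. a\<^sub>i dx\<^sub>i\<close> is the family of its coefficients, with \<open>a\<^sub>i = 0\<close> for \<open>i > r\<close>.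
  The space \<open>one_forms r m\<close> is \<open>H\<^sup>0(P\<^sup>r, \<Omega>\<^sup>1(m))\<close>; it is used only for \<open>m \<ge> 2\<close>.
\<close>

type_synonym form = "nat \<Rightarrow> mpoly"

definition one_forms :: "nat \<Rightarrow> nat \<Rightarrow> form set" where
  "one_forms r m = {\<omega>. (\<forall>i\<le>r. \<omega> i \<in> homog_polys r (m - 1)) \<and> (\<forall>i>r. \<omega> i = 0) \<and>
     (\<Sum>i\<le>r. \<omega> i * pvar i) = 0}"

definition fscale :: "complex \<Rightarrow> form \<Rightarrow> form" where
  "fscale c \<omega> = (\<lambda>i. pconst c * \<omega> i)"

text \<open>The coefficient of \<open>dx\<^sub>i \<and> dx\<^sub>j\<close> in \<open>d\<omega>\<close>, and that of \<open>dx\<^sub>i \<and> dx\<^sub>j \<and> dx\<^sub>k\<close> in \<open>\<omega> \<and> d\<omega>\<close>.\<close>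

definition dform :: "form \<Rightarrow> nat \<Rightarrow> nat \<Rightarrow> mpoly" where
  "dform \<omega> i j = pderiv_var i (\<omega> j) - pderiv_var j (\<omega> i)"

definition wedge_d :: "form \<Rightarrow> nat \<Rightarrow> nat \<Rightarrow> nat \<Rightarrow> mpoly" where
  "wedge_d \<omega> i j k = \<omega> i * dform \<omega> j k - \<omega> j * dform \<omega> i k + \<omega> k * dform \<omega> i j"

definition integrable_form :: "nat \<Rightarrow> form \<Rightarrow> bool" where
  "integrable_form r \<omega> \<longleftrightarrow> (\<forall>i\<le>r. \<forall>j\<le>r. \<forall>k\<le>r. wedge_d \<omega> i j k = 0)"

definition vscale :: "complex \<Rightarrow> (nat \<Rightarrow> complex) \<Rightarrow> nat \<Rightarrow> complex" where
  "vscale c x = (\<lambda>i. c * x i)"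

text \<open>\<open>C\<^sup>r\<^sup>+\<^sup>1\<close> is the space of sequences supported on \<open>{0, \<dots>, r}\<close>.\<close>

definition affine_space :: "nat \<Rightarrow> (nat \<Rightarrow> complex) set" where
  "affine_space r = {x. \<forall>i>r. x i = 0}"

definition sing :: "nat \<Rightarrow> form \<Rightarrow> (nat \<Rightarrow> complex) set set" where
  "sing r \<omega> = {L \<in> proj_space vscale (affine_space r). \<forall>x\<in>L. \<forall>i\<le>r. peval (\<omega> i) x = 0}"


section \<open>Foliations and rational components\<close>

definition foliations :: "nat \<Rightarrow> nat \<Rightarrow> form set set" where
  "foliations r d =
     {line fscale \<omega> | \<omega>. \<omega> \<in> one_forms r (d + 2) \<and> \<omega> \<noteq> 0 \<and> integrable_form r \<omega> \<and>
        codim (zariski vscale (affine_space r)) (sing r \<omega>) \<ge> 2}"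

text \<open>
  The homogeneous ideal of the scheme structure on \<open>foliations r d\<close>: it is generated by the
  coefficients of \<open>\<omega> \<and> d\<omega>\<close>, seen as quadratic functions of \<open>\<omega>\<close>.
\<close>

definition frobenius_ideal :: "nat \<Rightarrow> nat \<Rightarrow> (form \<Rightarrow> complex) set" where
  "frobenius_ideal r d =
     Idl\<^bsub>coord_ring fscale (one_forms r (d + 2))\<^esub>
       {restrict0 (one_forms r (d + 2)) (\<lambda>\<omega>. Poly_Mapping.lookup (wedge_d \<omega> i j k) \<alpha>)
         | i j k \<alpha>. i \<le> r \<and> j \<le> r \<and> k \<le> r}"

text \<open>
  Only closed points are represented. Since the scheme is of finite type over the complex
  numbers, its irreducible components correspond to those of the space of its closed points.
\<close>

definition foliations_topology :: "nat \<Rightarrow> nat \<Rightarrow> form set topology" where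
  "foliations_topology r d =
     subtopology (zariski fscale (one_forms r (d + 2))) (foliations r d)"

definition foliations_local_ring ::
    "nat \<Rightarrow> nat \<Rightarrow> form set set \<Rightarrow> ((form \<Rightarrow> complex) \<times> (form \<Rightarrow> complex)) set ring" where
  "foliations_local_ring r d Z =
     local_ring fscale (one_forms r (d + 2)) (frobenius_ideal r d) Z"

definition rho :: "nat \<Rightarrow> nat \<Rightarrow> nat \<Rightarrow> mpoly \<Rightarrow> mpoly \<Rightarrow> form" where
  "rho r d0 d1 F0 F1 = (\<lambda>i. if i \<le> r
     then of_nat d0 * F0 * pderiv_var i F1 - of_nat d1 * F1 * pderiv_var i F0 else 0)"

definition rational_closure :: "nat \<Rightarrow> nat \<Rightarrow> nat \<Rightarrow> form set set" where
  "rational_closure r d0 d1 =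
     zariski fscale (one_forms r (d0 + d1)) closure_of
       {line fscale (rho r d0 d1 F0 F1) | F0 F1.
          F0 \<in> homog_polys r d0 \<and> F1 \<in> homog_polys r d1 \<and> F0 \<noteq> 0 \<and> F1 \<noteq> 0 \<and>
          rho r d0 d1 F0 F1 \<noteq> 0}"

definition rational_foliations :: "nat \<Rightarrow> nat \<Rightarrow> nat \<Rightarrow> form set set" where
  "rational_foliations r d0 d1 =
     rational_closure r d0 d1 \<inter> foliations r (d0 + d1 - 2)"


section \<open>Well-definedness of the topologies and of the Frobenius ideal\<close>

lemma vector_space_vscale: "vector_space vscale"
  by unfold_locales (auto simp: vscale_def algebra_simps fun_eq_iff)

lemma pconst_simps: "pconst (a + b) = pconst a + pconst b" "pconst (a * b) = pconst a * pconst b"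
   "pconst 1 = 1"
  by (auto simp: pconst_def Poly_Mapping.single_add Poly_Mapping.mult_single)

lemma vector_space_fscale: "vector_space fscale"
  by unfold_locales (auto simp: fscale_def pconst_simps algebra_simps fun_eq_iff)

lemma affine_subspace: "module.subspace vscale (affine_space r)"
proof -
  interpret vector_space vscale by (rule vector_space_vscale)
  show ?thesis by (rule subspaceI) (auto simp: affine_space_def vscale_def)
qed

lemma keys_pconst_mult: "Poly_Mapping.keys (pconst c * p) \<subseteq> Poly_Mapping.keys p"
  using keys_mult[of "pconst c" p] by (auto simp: pconst_def split: if_splits)

lemma homog_polys_closed:
  "0 \<in> homog_polys r n" "p \<in> homog_polys r n \<Longrightarrow> q \<in> homog_polys r n \<Longrightarrow> p + q \<in> homog_polys r n"
  "p \<in> homog_polys r n \<Longrightarrow> pconst c * p \<in> homog_polys r n"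
  using Poly_Mapping.keys_add[of p q] keys_pconst_mult[of c p] by (auto simp: homog_polys_def)

lemma one_forms_subspace: "module.subspace fscale (one_forms r m)"
proof -
  interpret vector_space fscale by (rule vector_space_fscale)
  show ?thesis
    by (rule subspaceI) 
      (auto simp: one_forms_def fscale_def homog_polys_closed distrib_right sum.distrib mult.assoc
          simp flip: sum_distrib_left)
qed

lemma cring_coord_ring: "cring (coord_ring s V)"
proof -
  let ?R = "coord_ring s V"
  have car: "x \<in> carrier ?R \<longleftrightarrow> (\<exists>f\<in>poly_funs s. x = restrict0 V f)" for x
    by (auto simp: coord_ring_def)
  have ops: "x \<oplus>\<^bsub>?R\<^esub> y = (\<lambda>v. x v + y v)" "x \<otimes>\<^bsub>?R\<^esub> y = (\<lambda>v. x v * y v)"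
    "\<zero>\<^bsub>?R\<^esub> = (\<lambda>_. 0)" "\<one>\<^bsub>?R\<^esub> = restrict0 V (\<lambda>_. 1)" for x y
    by (auto simp: coord_ring_def)
  have z: "(\<lambda>_. 0) \<in> carrier ?R"
    unfolding car by (rule bexI[OF _ poly_funs.const[of 0]]) (auto simp: restrict0_def)
  have o: "restrict0 V (\<lambda>_. 1) \<in> carrier ?R"
    unfolding car by (rule bexI[OF _ poly_funs.const[of 1]]) (auto simp: restrict0_def)
  have ad: "(\<lambda>v. x v + y v) \<in> carrier ?R" if xy: "x \<in> carrier ?R" "y \<in> carrier ?R" for x y
  proof -
    from xy(1)[unfolded car] obtain f where f: "f \<in> poly_funs s" "x = restrict0 V f" by (rule bexE)
    from xy(2)[unfolded car] obtain g where g: "g \<in> poly_funs s" "y = restrict0 V g" by (rule bexE)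
    show ?thesis
      unfolding car by (rule bexI[OF _ poly_funs.add[OF f(1) g(1)]]) (simp add: restrict0_def f(2) g(2) fun_eq_iff)
  qed
  have mu: "(\<lambda>v. x v * y v) \<in> carrier ?R" if xy: "x \<in> carrier ?R" "y \<in> carrier ?R" for x y
  proof -
    from xy(1)[unfolded car] obtain f where f: "f \<in> poly_funs s" "x = restrict0 V f" by (rule bexE)
    from xy(2)[unfolded car] obtain g where g: "g \<in> poly_funs s" "y = restrict0 V g" by (rule bexE)
    show ?thesis
      unfolding car by (rule bexI[OF _ poly_funs.mult[OF f(1) g(1)]]) (simp add: restrict0_def f(2) g(2) fun_eq_iff)
  qed
  have mi: "(\<lambda>v. - x v) \<in> carrier ?R" if "x \<in> carrier ?R" for x
  proof -
    from that[unfolded car] obtain f where f: "f \<in> poly_funs s" "x = restrict0 V f" by (rule bexE)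
    show ?thesis
      unfolding car by (rule bexI[OF _ poly_funs.mult[OF poly_funs.const[of "-1"] f(1)]]) (simp add: restrict0_def f(2) fun_eq_iff)
  qed
  have un: "(\<lambda>v. restrict0 V (\<lambda>_. 1) v * x v) = x" if "x \<in> carrier ?R" for x
  proof -
    from that[unfolded car] obtain f where f: "x = restrict0 V f" by (rule bexE)
    show ?thesis unfolding f by (simp add: restrict0_def fun_eq_iff)
  qed
  show ?thesis
  proof (rule cringI)
    show "abelian_group ?R"
    proof (rule abelian_groupI)
      fix x assume "x \<in> carrier ?R"
      then show "\<exists>y\<in>carrier ?R. y \<oplus>\<^bsub>?R\<^esub> x = \<zero>\<^bsub>?R\<^esub>"
        by (intro bexI[OF _ mi]) (simp_all add: ops)
    qed (simp_all add: ops z ad ac_simps)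
    show "Group.comm_monoid ?R"
    proof (rule comm_monoidI)
      show "x \<otimes>\<^bsub>?R\<^esub> y = y \<otimes>\<^bsub>?R\<^esub> x" for x y by (simp add: ops mult.commute)
    qed (simp_all add: ops o mu un mult.assoc)
  qed (simp add: ops algebra_simps)
qed

context
  fixes s :: "complex \<Rightarrow> 'v \<Rightarrow> 'v::ab_group_add" and V
  assumes vs: "vector_space s" and sub: "module.subspace s V"
begin

interpretation vector_space s by (rule vs)

lemma homog_part_mult:
  assumes "f \<in> homog_part s V m" "g \<in> homog_part s V n"
  shows "(\<lambda>v. f v * g v) \<in> homog_part s V (m + n)"
proof -
  interpret R: cring "coord_ring s V" by (rule cring_coord_ring)
  have "f \<otimes>\<^bsub>coord_ring s V\<^esub> g \<in> carrier (coord_ring s V)"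
    using assms by (intro R.m_closed) (auto simp: homog_part_def)
  then have "(\<lambda>v. f v * g v) \<in> carrier (coord_ring s V)" by (simp add: coord_ring_def)
  then show ?thesis using assms
    by (simp add: homog_part_def power_add)
qed

lemma homog_part_one: "restrict0 V (\<lambda>_. 1) \<in> homog_part s V 0"
  using subspace_scale[OF sub]
  by (auto simp: homog_part_def coord_ring_def restrict0_def poly_funs.intros)

lemma line_self: "v \<in> line s v"
  unfolding line_def by (auto intro!: exI[of _ 1])

lemma vanishes_at_line: "f \<in> homog_part s V n \<Longrightarrow> v \<in> V \<Longrightarrow> vanishes_at f (line s v) \<longleftrightarrow> f v = 0"
  using line_self[of v] by (auto simp: vanishes_at_def homog_part_def line_def)

lemma istopology_zariski:
  "istopology (\<lambda>U. U \<subseteq> proj_space s V \<and> zariski_closed s V (proj_space s V - U))"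
  unfolding istopology_def
proof (intro conjI allI impI; (elim conjE)?)
  fix A B assume A: "A \<subseteq> proj_space s V" "zariski_closed s V (proj_space s V - A)"
    and B: "B \<subseteq> proj_space s V" "zariski_closed s V (proj_space s V - B)"
  from A(2) obtain S where S: "S \<subseteq> (\<Union>n. homog_part s V n)" "proj_space s V - A = zero_locus s V S"
    by (auto simp: zariski_closed_def)
  from B(2) obtain T where T: "T \<subseteq> (\<Union>n. homog_part s V n)" "proj_space s V - B = zero_locus s V T"
    by (auto simp: zariski_closed_def)
  let ?U = "{(\<lambda>v. f v * g v) | f g. f \<in> S \<and> g \<in> T}"
  have U: "?U \<subseteq> (\<Union>n. homog_part s V n)"
  proof
    fix h assume "h \<in> ?U"
    then obtain f g where h: "h = (\<lambda>v. f v * g v)" "f \<in> S" "g \<in> T" by blast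
    obtain m n where "f \<in> homog_part s V m" "g \<in> homog_part s V n" using S(1) T(1) h(2,3) by blast
    from homog_part_mult[OF this] show "h \<in> (\<Union>n. homog_part s V n)" unfolding h(1) by blast
  qed
  have *: "(\<forall>f\<in>X. vanishes_at f (line s v)) \<longleftrightarrow> (\<forall>f\<in>X. f v = 0)" 
    if "X \<subseteq> (\<Union>n. homog_part s V n)" "v \<in> V" for X v
  proof (rule ball_cong[OF refl])
    fix f assume "f \<in> X"
    with that(1) obtain n where "f \<in> homog_part s V n" by blast
    from vanishes_at_line[OF this that(2)] show "vanishes_at f (line s v) = (f v = 0)" .
  qed
  have "zero_locus s V ?U = zero_locus s V S \<union> zero_locus s V T"
  proof (rule Set.set_eqI)
    fix L
    show "(L \<in> zero_locus s V ?U) = (L \<in> zero_locus s V S \<union> zero_locus s V T)"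
    proof (cases "L \<in> proj_space s V")
      case True
      then obtain v where v: "v \<in> V" "L = line s v" by (auto simp: proj_space_def)
      have "(\<forall>h\<in>?U. h v = 0) \<longleftrightarrow> (\<forall>f\<in>S. f v = 0) \<or> (\<forall>g\<in>T. g v = 0)"
      proof
        assume h: "\<forall>h\<in>?U. h v = 0"
        show "(\<forall>f\<in>S. f v = 0) \<or> (\<forall>g\<in>T. g v = 0)"
        proof (rule ccontr)
          assume "\<not> ?thesis"
          then obtain f g where fg: "f \<in> S" "g \<in> T" "f v \<noteq> 0" "g v \<noteq> 0" by blast
          then have "(\<lambda>v. f v * g v) \<in> ?U" by blast
          with h have "f v * g v = 0" by (rule bspec)
          with fg show False by simp
        qed
      qed auto
      then show ?thesis using True *[OF U v(1)] *[OF S(1) v(1)] *[OF T(1) v(1)]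
        unfolding zero_locus_def v(2) by simp
    qed (simp add: zero_locus_def)
  qed
  then have "proj_space s V - A \<inter> B = zero_locus s V ?U" using S(2) T(2) by blast
  with U show "zariski_closed s V (proj_space s V - A \<inter> B)" unfolding zariski_closed_def by blast
  show "A \<inter> B \<subseteq> proj_space s V" using A by blast
next
  fix \<K> assume K: "\<forall>K\<in>\<K>. K \<subseteq> proj_space s V \<and> zariski_closed s V (proj_space s V - K)"
  then show "\<Union>\<K> \<subseteq> proj_space s V" by blast
  from K have "\<forall>K\<in>\<K>. \<exists>T. T \<subseteq> (\<Union>n. homog_part s V n) \<and> proj_space s V - K = zero_locus s V T"
    by (auto simp: zariski_closed_def)
  then obtain T where T: "\<And>K. K \<in> \<K> \<Longrightarrow> T K \<subseteq> (\<Union>n. homog_part s V n)"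
    "\<And>K. K \<in> \<K> \<Longrightarrow> proj_space s V - K = zero_locus s V (T K)" by metis
  have "proj_space s V - \<Union>\<K> = zero_locus s V (\<Union>K\<in>\<K>. T K)"
    using T(2) by (auto simp: zero_locus_def set_eq_iff)
  then show "zariski_closed s V (proj_space s V - \<Union>\<K>)"
    unfolding zariski_closed_def by (intro exI[of _ "\<Union>K\<in>\<K>. T K"] conjI UN_least T(1))
qed

lemma openin_zariski: "openin (zariski s V) U \<longleftrightarrow> U \<subseteq> proj_space s V \<and> zariski_closed s V (proj_space s V - U)"
  unfolding zariski_def using istopology_zariski by (simp add: topology_inverse')

lemma topspace_zariski: "topspace (zariski s V) = proj_space s V"
proof -
  have "zero_locus s V {restrict0 V (\<lambda>_. 1)} = {}"
    using vanishes_at_line[OF homog_part_one] 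
    by (auto simp: zero_locus_def proj_space_def) (auto simp: restrict0_def)
  then have "zariski_closed s V (proj_space s V - proj_space s V)"
    unfolding zariski_closed_def using homog_part_one by (intro exI[of _ "{restrict0 V (\<lambda>_. 1)}"]) auto
  then show ?thesis unfolding topspace_def openin_zariski by blast
qed

lemma closedin_zariski: "closedin (zariski s V) Z \<longleftrightarrow> zariski_closed s V Z"
proof -
  have "zariski_closed s V Z \<Longrightarrow> Z \<subseteq> proj_space s V"
    unfolding zariski_closed_def zero_locus_def by blast
  then show ?thesis unfolding closedin_def openin_zariski topspace_zariski
    by (metis Diff_subset double_diff order_refl)
qed

end

lemma lookup_pderiv_var:
  "Poly_Mapping.lookup (pderiv_var i p) \<alpha> =
     of_nat (Poly_Mapping.lookup \<alpha> i + 1) * Poly_Mapping.lookup p (\<alpha> + Poly_Mapping.single i 1)"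
proof -
  let ?e = "Poly_Mapping.single i (1::nat)"
  have *: "\<beta> - ?e = \<alpha> \<longleftrightarrow> \<beta> = \<alpha> + ?e" if "Poly_Mapping.lookup \<beta> i \<noteq> 0" for \<beta>
  proof
    assume "\<beta> - ?e = \<alpha>"
    moreover have "\<beta> = (\<beta> - ?e) + ?e" using that
      by (intro poly_mapping_eqI) (auto simp: lookup_add lookup_minus lookup_single when_def)
    ultimately show "\<beta> = \<alpha> + ?e" by simp
  qed simp
  have "Poly_Mapping.lookup (pderiv_var i p) \<alpha> = (\<Sum>\<beta>\<in>Poly_Mapping.keys p.
     (of_nat (Poly_Mapping.lookup \<beta> i) * Poly_Mapping.lookup p \<beta> when \<beta> - ?e = \<alpha>))"
    by (simp add: pderiv_var_def lookup_sum lookup_single)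
  also have "\<dots> = (\<Sum>\<beta>\<in>Poly_Mapping.keys p. if \<beta> = \<alpha> + ?e then of_nat (Poly_Mapping.lookup \<beta> i) * Poly_Mapping.lookup p \<beta> else 0)"
    using * by (intro sum.cong) (auto simp: when_def)
  also have "\<dots> = of_nat (Poly_Mapping.lookup \<alpha> i + 1) * Poly_Mapping.lookup p (\<alpha> + ?e)"
    by (subst sum.delta) (auto simp: lookup_add in_keys_iff)
  finally show ?thesis .
qed

definition coeffs_poly :: "(form \<Rightarrow> mpoly) \<Rightarrow> bool" where
  "coeffs_poly \<phi> \<longleftrightarrow> (\<forall>\<alpha>. (\<lambda>\<omega>. Poly_Mapping.lookup (\<phi> \<omega>) \<alpha>) \<in> poly_funs fscale)"

lemma poly_funs_sum: "finite A \<Longrightarrow> (\<And>a. a \<in> A \<Longrightarrow> f a \<in> poly_funs s) \<Longrightarrow> (\<lambda>v. \<Sum>a\<in>A. f a v) \<in> poly_funs s"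
  by (induction A rule: finite_induct) (auto intro: poly_funs.intros)

lemma finite_decomp: "finite {(\<beta>, \<gamma>). \<beta> + \<gamma> = (\<alpha>::mono)}"
proof -
  let ?A = "{\<beta>::mono. Poly_Mapping.lookup \<beta> \<in> {f. (\<forall>x. (x \<in> Poly_Mapping.keys \<alpha> \<longrightarrow> f x \<in> {..Poly_Mapping.lookup \<alpha> x}) \<and> (x \<notin> Poly_Mapping.keys \<alpha> \<longrightarrow> f x = 0))}}"
  have A: "finite ?A"
  proof (rule finite_subset)
    let ?M = "Max (Poly_Mapping.lookup \<alpha> ` Poly_Mapping.keys \<alpha>)"
    show "?A \<subseteq> Poly_Mapping.lookup -` {f. (\<forall>x. (x \<in> Poly_Mapping.keys \<alpha> \<longrightarrow> f x \<in> {..?M}) \<and> (x \<notin> Poly_Mapping.keys \<alpha> \<longrightarrow> f x = 0))}"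
      by (auto intro: order_trans)
    show "finite \<dots>"
      by (rule finite_vimageI[OF finite_set_of_finite_funs]) (auto simp: inj_def lookup_inject)
  qed
  show ?thesis
  proof (rule finite_subset)
    show "{(\<beta>, \<gamma>). \<beta> + \<gamma> = \<alpha>} \<subseteq> ?A \<times> ?A"
      by (auto simp: lookup_add in_keys_iff)
    show "finite (?A \<times> ?A)" using A by simp
  qed
qed

lemma lookup_times: "Poly_Mapping.lookup (p * q) \<alpha> =
  (\<Sum>(\<beta>, \<gamma>)\<in>{(\<beta>, \<gamma>). \<beta> + \<gamma> = (\<alpha>::mono)}. Poly_Mapping.lookup p \<beta> * Poly_Mapping.lookup q \<gamma> :: complex)"
proof -
  have "Poly_Mapping.lookup (p * q) \<alpha> = (\<Sum>(a, b). Poly_Mapping.lookup p a * Poly_Mapping.lookup q b when \<alpha> = a + b)"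
    by (simp add: lookup_mult prod_fun_unfold_prod times_poly_mapping.rep_eq)
  also have "\<dots> = (\<Sum>(\<beta>, \<gamma>)\<in>{(\<beta>, \<gamma>). \<beta> + \<gamma> = (\<alpha>::mono)}. (Poly_Mapping.lookup p \<beta> * Poly_Mapping.lookup q \<gamma> when \<alpha> = \<beta> + \<gamma>))"
    by (rule Sum_any.expand_superset) (use finite_decomp[of \<alpha>] in \<open>auto simp: when_def split: if_splits\<close>)
  also have "\<dots> = (\<Sum>(\<beta>, \<gamma>)\<in>{(\<beta>, \<gamma>). \<beta> + \<gamma> = (\<alpha>::mono)}. Poly_Mapping.lookup p \<beta> * Poly_Mapping.lookup q \<gamma>)"
    by (rule sum.cong) (auto simp: when_def)
  finally show ?thesis .
qed

lemma coeffs_poly_times: "coeffs_poly \<phi> \<Longrightarrow> coeffs_poly \<psi> \<Longrightarrow> coeffs_poly (\<lambda>\<omega>. \<phi> \<omega> * \<psi> \<omega>)"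
  unfolding coeffs_poly_def lookup_times case_prod_beta
  by (intro allI poly_funs_sum poly_funs.mult) (use finite_decomp[unfolded case_prod_beta] in auto)

lemma coeffs_poly_add: "coeffs_poly \<phi> \<Longrightarrow> coeffs_poly \<psi> \<Longrightarrow> coeffs_poly (\<lambda>\<omega>. \<phi> \<omega> + \<psi> \<omega>)"
  unfolding coeffs_poly_def lookup_add by (intro allI poly_funs.add) auto

lemma coeffs_poly_diff: assumes "coeffs_poly \<phi>" "coeffs_poly \<psi>" shows "coeffs_poly (\<lambda>\<omega>. \<phi> \<omega> - \<psi> \<omega>)"
  unfolding coeffs_poly_def
proof
  fix \<alpha>
  have "(\<lambda>\<omega>. Poly_Mapping.lookup (\<phi> \<omega>) \<alpha> + (-1) * Poly_Mapping.lookup (\<psi> \<omega>) \<alpha>) \<in> poly_funs fscale"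
    using assms unfolding coeffs_poly_def by (intro poly_funs.add poly_funs.mult poly_funs.const) auto
  then show "(\<lambda>\<omega>. Poly_Mapping.lookup (\<phi> \<omega> - \<psi> \<omega>) \<alpha>) \<in> poly_funs fscale"
    by (simp add: lookup_minus)
qed

lemma lookup_pconst: "Poly_Mapping.lookup (pconst c * p) \<alpha> = c * Poly_Mapping.lookup p \<alpha>"
proof -
  have "pconst c * p = Poly_Mapping.map ((*) c) p" 
    by (simp add: pconst_def mult_map_scale_conv_mult)
  then show ?thesis by (simp add: map.rep_eq when_def)
qed

lemma coeffs_poly_coord: "coeffs_poly (\<lambda>\<omega>. \<omega> i)"
proof -
  have "Vector_Spaces.linear fscale (*) (\<lambda>\<omega>. Poly_Mapping.lookup (\<omega> i) \<alpha>)" for \<alpha>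
  proof -
    interpret vector_space fscale by (rule vector_space_fscale)
    interpret C: vector_space "(*) :: complex \<Rightarrow> complex \<Rightarrow> complex" by unfold_locales (auto simp: algebra_simps)
    show ?thesis by unfold_locales (auto simp: lookup_add fscale_def lookup_pconst)
  qed
  then show ?thesis unfolding coeffs_poly_def by (auto intro: poly_funs.intros)
qed

lemma coeffs_poly_pderiv: "coeffs_poly \<phi> \<Longrightarrow> coeffs_poly (\<lambda>\<omega>. pderiv_var i (\<phi> \<omega>))"
  unfolding coeffs_poly_def lookup_pderiv_var by (intro allI poly_funs.mult poly_funs.const) auto

lemma wedge_d_poly: "(\<lambda>\<omega>. Poly_Mapping.lookup (wedge_d \<omega> i j k) \<alpha>) \<in> poly_funs fscale"
proof -
  have "coeffs_poly (\<lambda>\<omega>. wedge_d \<omega> i j k)"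
    unfolding wedge_d_def dform_def by (intro coeffs_poly_add coeffs_poly_diff coeffs_poly_times coeffs_poly_pderiv coeffs_poly_coord)
  then show ?thesis by (simp add: coeffs_poly_def)
qed

lemma wedge_d_carrier:
  "restrict0 V (\<lambda>\<omega>. Poly_Mapping.lookup (wedge_d \<omega> i j k) \<alpha>) \<in> carrier (coord_ring fscale V)"
  using wedge_d_poly by (auto simp: coord_ring_def)

lemma ideal_frobenius: "ideal (frobenius_ideal r d) (coord_ring fscale (one_forms r (d + 2)))"
proof -
  interpret cring "coord_ring fscale (one_forms r (d + 2))" by (rule cring_coord_ring)
  show ?thesis unfolding frobenius_ideal_def by (rule genideal_ideal) (auto intro: wedge_d_carrier)
qed

end

theory Submission
  imports Defs "Jordan_Normal_Form.Determinant" "HOL-Computational_Algebra.Polynomial"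
begin

text \<open>
  The point is that every homogeneous polynomial \<open>f\<close> on the space of 1-forms that vanishes on the
  image of \<open>rho\<close> has a multiple \<open>g f\<close> in the Frobenius ideal, with \<open>g\<close> homogeneous and not vanishing
  on that image. This makes the closure of the image a component, and kills the nilpotents at its
  generic point.

  By a Jacobian criterion it suffices to find one pencil \<open>(F0, F1)\<close> at which every solution of the
  linearized Frobenius equations is a value of the differential of \<open>rho\<close>. For \<open>d1 \<le> d0\<close> we take
  \<open>F0 = x\<^sub>0^d0 + x\<^sub>1^d0 + x\<^sub>2^d0\<close> and \<open>F1 = x\<^sub>1^d1 + 2 x\<^sub>2^d1 + x\<^sub>3^d1\<close>, up to the factors \<open>1/d0\<close> and
  \<open>1/d1\<close>: the singular locus of this pencil is small enough for the division lemmas of de Rham and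
  Saito type, which for these polynomials are explicit computations with monomials.

  For the codimension condition, two coefficients of a general rational form have a nonzero
  resultant. If a closed set of their common zeros is joined with a point outside of it, the
  result is contained in a cone on which the resultant vanishes, so the set is two steps below
  the whole space.
\<close>

section \<open>Algebras of polynomial functions\<close>

text \<open>Equality of tangent spaces at one point usually gives smoothness through dimension
  theory and regular local rings. Here that step is done by hand: expanding along transverse
  directions and eliminating puts a multiple of \<open>f\<close> into the ideal. The obstacle is
  that this computation takes place over the parameters \<open>z\<close> of the pencils, while the
  multiplier has to be a function of the form. The tangential coordinates of a pencil are
  \<open>z\<close> plus quadratic terms, a dominant map without polynomial inverse in general. So
  the identity over \<open>z\<close> is expanded in generators independent over the functions of
  these coordinates, and one coefficient is the wanted identity.

  The multiplier is nonzero at some pencil, and the codimension condition holds where two other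
  polynomials are nonzero. The pairs \<open>(F0, F1)\<close> form a vector space, so all three are
  nonzero at a common pencil.

  The order \<open>d1 \<le> d0\<close> is no restriction, since exchanging \<open>F0\<close> and
  \<open>F1\<close> only changes the sign of \<open>rho\<close>. It enters through degrees: the
  cofactor of smaller degree in the linearized equations is closed, the other exact up to a multiple
  of \<open>dF1\<close>.\<close>

inductive_set polyalg :: "('a \<Rightarrow> complex) set \<Rightarrow> ('a \<Rightarrow> complex) set" for X where
  const: "(\<lambda>_. c) \<in> polyalg X"
| gen: "x \<in> X \<Longrightarrow> x \<in> polyalg X"
| add: "f \<in> polyalg X \<Longrightarrow> g \<in> polyalg X \<Longrightarrow> (\<lambda>a. f a + g a) \<in> polyalg X"
| mult: "f \<in> polyalg X \<Longrightarrow> g \<in> polyalg X \<Longrightarrow> (\<lambda>a. f a * g a) \<in> polyalg X"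

text \<open>The generators of \<open>polyalg\<close> are a parameter so that the same closure rules
  serve functions on a vector space, on a parameter space, on a product of the two, and of one
  variable.\<close>

lemma poly_funs_eq_polyalg: "poly_funs s = polyalg {l. Vector_Spaces.linear s (*) l}"
proof (intro equalityI subsetI)
  fix f assume "f \<in> poly_funs s"
  then show "f \<in> polyalg {l. Vector_Spaces.linear s (*) l}"
    by induction (auto intro: polyalg.intros)
next
  fix f assume "f \<in> polyalg {l. Vector_Spaces.linear s (*) l}"
  then show "f \<in> poly_funs s"
    by induction (auto intro: poly_funs.intros)
qed

lemma polyalg_minus: "f \<in> polyalg X \<Longrightarrow> g \<in> polyalg X \<Longrightarrow> (\<lambda>a. f a - g a) \<in> polyalg X"
  using polyalg.add[OF _ polyalg.mult[OF polyalg.const[of "-1"]], of f X g] by simp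

lemma polyalg_uminus: "f \<in> polyalg X \<Longrightarrow> (\<lambda>a. - f a) \<in> polyalg X"
  using polyalg.mult[OF polyalg.const[of "-1"], of f X] by simp

lemma polyalg_sum: "(\<And>i. i \<in> A \<Longrightarrow> f i \<in> polyalg X) \<Longrightarrow> (\<lambda>a. \<Sum>i\<in>A. f i a) \<in> polyalg X"
  by (induction A rule: infinite_finite_induct) (auto intro: polyalg.intros)

lemma polyalg_prod: "(\<And>i. i \<in> A \<Longrightarrow> f i \<in> polyalg X) \<Longrightarrow> (\<lambda>a. \<Prod>i\<in>A. f i a) \<in> polyalg X"
  by (induction A rule: infinite_finite_induct) (auto intro: polyalg.intros)

lemma polyalg_power: "f \<in> polyalg X \<Longrightarrow> (\<lambda>a. f a ^ n) \<in> polyalg X"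
  by (induction n) (auto intro: polyalg.intros)

lemmas polyalg_intros = polyalg.const polyalg.add polyalg.mult polyalg_minus polyalg_uminus
  polyalg_sum polyalg_prod polyalg_power

text \<open>Whether a substitution preserves polynomials is decided on generators, because
  composition with a fixed map respects sums and products.\<close>

lemma polyalg_comp:
  assumes "f \<in> polyalg X" and "\<And>x. x \<in> X \<Longrightarrow> (\<lambda>a. x (\<phi> a)) \<in> polyalg Y"
  shows "(\<lambda>a. f (\<phi> a)) \<in> polyalg Y"
  using assms(1) by induction (auto intro: polyalg.intros assms(2))

section \<open>Polynomial functions of one complex variable\<close>

abbreviation univ_polys :: "(complex \<Rightarrow> complex) set" where
  "univ_polys \<equiv> polyalg {\<lambda>c. c}"

lemma univ_polys_var: "(\<lambda>c. c) \<in> univ_polys"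
  by (rule polyalg.gen) simp

lemma univ_polysE:
  assumes "f \<in> univ_polys" obtains p where "f = poly p"
proof -
  have "\<exists>p. f = poly p"
    using assms
  proof induction
    case (const c) show ?case by (rule exI[of _ "[:c:]"]) auto
  next
    case (gen x) then show ?case by (intro exI[of _ "[:0, 1:]"]) auto
  next
    case (add f g)
    then obtain p q where "f = poly p" "g = poly q" by blast
    then show ?case by (intro exI[of _ "p + q"]) auto
  next
    case (mult f g)
    then obtain p q where "f = poly p" "g = poly q" by blast
    then show ?case by (intro exI[of _ "p * q"]) auto
  qed
  then show ?thesis using that by blast
qed

lemma univ_polys_finite_zeros:
  assumes "f \<in> univ_polys" "f a \<noteq> 0" shows "finite {c. f c = 0}"
proof -
  obtain p where p: "f = poly p" using assms(1) by (rule univ_polysE)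
  then have "p \<noteq> 0" using assms(2) by auto
  then show ?thesis unfolding p by (rule poly_roots_finite)
qed

lemma univ_polys_eq_0:
  assumes "f \<in> univ_polys" "infinite {c. f c = 0}" shows "f a = 0"
  using univ_polys_finite_zeros[OF assms(1)] assms(2) by blast

text \<open>Two finite zero sets do not exhaust the complex numbers. Applied along lines, this is
  the source of the irreducibility statements below.\<close>

lemma univ_polys_common_nonzero:
  assumes "f \<in> univ_polys" "g \<in> univ_polys" "f a \<noteq> 0" "g b \<noteq> 0"
  obtains c where "f c \<noteq> 0" "g c \<noteq> 0"
proof -
  have "finite ({c. f c = 0} \<union> {c. g c = 0})"
    using univ_polys_finite_zeros[OF assms(1,3)] univ_polys_finite_zeros[OF assms(2,4)] by simp
  then have "\<exists>c. c \<notin> {c. f c = 0} \<union> {c. g c = 0}"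
    by (rule ex_new_if_finite[OF infinite_UNIV_char_0])
  then show ?thesis using that by auto
qed

text \<open>The components multiply by convolution. The bound \<open>N\<close> travels with the
  family because the degree of a function is not visible in its values, and the vanishing beyond
  \<open>N\<close> makes the double sum of a product a triangular one.\<close>

lemma polyalg_homog_decomp:
  assumes "f \<in> polyalg X" and "\<And>x c a. x \<in> X \<Longrightarrow> x (act c a) = c * x a"
  obtains F N where "\<And>k. F k \<in> polyalg X" "\<And>k c a. F k (act c a) = c ^ k * F k a"
    "\<And>k. k > N \<Longrightarrow> F k = (\<lambda>_. 0)" "\<And>a. f a = (\<Sum>k\<le>N. F k a)"
proof -
  define D where "D F N f \<longleftrightarrow> (\<forall>k. F k \<in> polyalg X) \<and> (\<forall>k c a. F k (act c a) = c ^ k * F k a) \<and>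
    (\<forall>k>N. F k = (\<lambda>_. 0)) \<and> (\<forall>a. f a = (\<Sum>k\<le>N. F k a))"
    for F :: "nat \<Rightarrow> 'a \<Rightarrow> complex" and N :: nat and f
  have "\<exists>F N. D F N f" using assms(1)
  proof induction
    case (const c)
    have "D (\<lambda>k. if k = 0 then (\<lambda>_. c) else (\<lambda>_. 0)) 0 (\<lambda>_. c)"
      unfolding D_def by (auto intro: polyalg.const)
    then show ?case by blast
  next
    case (gen x)
    then have "D (\<lambda>k. if k = 1 then x else (\<lambda>_. 0)) 1 x"
      unfolding D_def by (auto intro: polyalg.const polyalg.gen simp: assms(2))
    then show ?case by blast
  next
    case (add f g)
    then obtain F N G M where F: "D F N f" and G: "D G M g" by blast
    have FN: "(\<Sum>k\<le>N + M. F k a) = (\<Sum>k\<le>N. F k a)" and GM: "(\<Sum>k\<le>N + M. G k a) = (\<Sum>k\<le>M. G k a)" for a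
      using F G unfolding D_def by (auto intro!: sum.mono_neutral_right, metis not_le, metis not_le)
    have "D (\<lambda>k a. F k a + G k a) (N + M) (\<lambda>a. f a + g a)"
      unfolding D_def
    proof (intro conjI allI impI)
      fix a show "f a + g a = (\<Sum>k\<le>N + M. F k a + G k a)"
        using F G by (simp add: sum.distrib FN GM) (simp add: D_def)
    qed (use F G in \<open>auto simp: D_def algebra_simps intro: polyalg.add\<close>)
    then show ?case by blast
  next
    case (mult f g)
    then obtain F N G M where F: "D F N f" and G: "D G M g" by blast
    have "D (\<lambda>k a. \<Sum>i\<le>k. F i a * G (k - i) a) (N + M) (\<lambda>a. f a * g a)"
      unfolding D_def
    proof (intro conjI allI impI)
      fix k show "(\<lambda>a. \<Sum>i\<le>k. F i a * G (k - i) a) \<in> polyalg X"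
        using F G by (intro polyalg_intros) (auto simp: D_def)
    next
      fix k c a
      have "F i (act c a) * G (k - i) (act c a) = c ^ k * (F i a * G (k - i) a)" if "i \<le> k" for i
      proof -
        have "c ^ k = c ^ i * c ^ (k - i)" using that by (simp flip: power_add)
        then show ?thesis using F G by (simp add: D_def)
      qed
      then show "(\<Sum>i\<le>k. F i (act c a) * G (k - i) (act c a)) = c ^ k * (\<Sum>i\<le>k. F i a * G (k - i) a)"
        by (simp add: sum_distrib_left)
    next
      fix k assume k: "k > N + M"
      have "F i a * G (k - i) a = 0" for i a
      proof (cases "i > N")
        case True then show ?thesis using F by (simp add: D_def)
      next
        case False then have "k - i > M" using k by simp
        then show ?thesis using G by (simp add: D_def)
      qed
      then show "(\<lambda>a. \<Sum>i\<le>k. F i a * G (k - i) a) = (\<lambda>_. 0)" by (intro ext sum.neutral) blast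
    next
      fix a
      have "f a * g a = (\<Sum>i\<le>N. F i a) * (\<Sum>j\<le>M. G j a)" using F G by (simp add: D_def)
      also have "\<dots> = (\<Sum>(i, j)\<in>{..N} \<times> {..M}. F i a * G j a)"
        by (simp add: sum_product sum.cartesian_product)
      also have "\<dots> = (\<Sum>(i, j)\<in>{(i, j). i + j \<le> N + M}. F i a * G j a)"
      proof (rule sum.mono_neutral_left)
        show "finite {(i, j). i + j \<le> N + M}"
          by (rule finite_subset[of _ "{..N + M} \<times> {..N + M}"]) auto
        show "\<forall>x\<in>{(i, j). i + j \<le> N + M} - {..N} \<times> {..M}. (case x of (i, j) \<Rightarrow> F i a * G j a) = 0"
          using F G by (auto simp: D_def not_le) (metis not_le)+
      qed auto
      also have "\<dots> = (\<Sum>k\<le>N + M. \<Sum>i\<le>k. F i a * G (k - i) a)"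
        by (rule sum.triangle_reindex_eq)
      finally show "f a * g a = (\<Sum>k\<le>N + M. \<Sum>i\<le>k. F i a * G (k - i) a)" .
    qed
    then show ?case by blast
  qed
  then show ?thesis using that unfolding D_def by blast
qed

text \<open>A Vandermonde argument: subtracting \<open>2 ^ Suc N\<close> times the value at
  \<open>c\<close> from the value at \<open>2 * c\<close> removes the top component and multiplies
  component \<open>k\<close> by \<open>2 ^ k - 2 ^ Suc N\<close>, which is nonzero. Restricting to
  \<open>c \<noteq> 0\<close> makes room for ideals that are stable under invertible scalings
  only.\<close>

lemma homog_components_in_subspace:
  fixes F :: "nat \<Rightarrow> 'a \<Rightarrow> complex"
  assumes sub: "\<And>f g. f \<in> M \<Longrightarrow> g \<in> M \<Longrightarrow> (\<lambda>a. f a + g a) \<in> M" "\<And>c f. f \<in> M \<Longrightarrow> (\<lambda>a. c * f a) \<in> M"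
    and M: "\<And>c. c \<noteq> 0 \<Longrightarrow> (\<lambda>a. \<Sum>k\<le>N. c ^ k * F k a) \<in> M" and "k \<le> N"
  shows "F k \<in> M"
  using M \<open>k \<le> N\<close>
proof (induction N arbitrary: F k)
  case 0
  from "0.prems"(1)[of 1] "0.prems"(2) show ?case by simp
next
  case (Suc N)
  have *: "(\<lambda>a. (2 ^ k - 2 ^ Suc N) * F k a) \<in> M" if "k \<le> N" for k
  proof (rule Suc.IH[OF _ that])
    fix c :: complex assume c: "c \<noteq> 0"
    have "(\<lambda>a. (\<Sum>k\<le>Suc N. (2 * c) ^ k * F k a) + (- (2 ^ Suc N)) * (\<Sum>k\<le>Suc N. c ^ k * F k a)) \<in> M"
      using c by (intro sub Suc.prems) auto
    also have "(\<lambda>a. (\<Sum>k\<le>Suc N. (2 * c) ^ k * F k a) + (- (2 ^ Suc N)) * (\<Sum>k\<le>Suc N. c ^ k * F k a))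
       = (\<lambda>a. \<Sum>k\<le>N. c ^ k * ((2 ^ k - 2 ^ Suc N) * F k a))"
      by (simp add: fun_eq_iff sum_distrib_left power_mult_distrib algebra_simps
          sum_negf flip: sum.distrib)
    finally show "\<dots> \<in> M" .
  qed
  have F: "F k \<in> M" if "k \<le> N" for k
  proof -
    have "(2::nat) ^ k \<noteq> 2 ^ Suc N" using that by (subst power_inject_exp) auto
    then have "of_nat (2 ^ k) \<noteq> (of_nat (2 ^ Suc N) :: complex)" unfolding of_nat_eq_iff .
    then have "(2::complex) ^ k \<noteq> 2 ^ Suc N" by simp
    then have "F k = (\<lambda>a. (1 / (2 ^ k - 2 ^ Suc N)) * ((2 ^ k - 2 ^ Suc N) * F k a))" by (auto simp: fun_eq_iff)
    also have "\<dots> \<in> M" by (intro sub *[OF that])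
    finally show ?thesis .
  qed
  show ?case
  proof (cases "k \<le> N")
    case False
    then have k: "k = Suc N" using Suc.prems(2) by simp
    have z: "(\<lambda>a. 0) \<in> M" using sub(2)[OF F[of 0], of 0] by simp
    have s: "(\<lambda>a. \<Sum>k\<in>A. F k a) \<in> M" if "A \<subseteq> {..N}" for A
      using finite_subset[OF that finite_atMost] that
      by (induction A rule: finite_induct) (auto intro!: sub F z)
    have "F k = (\<lambda>a. (\<Sum>k\<le>Suc N. 1 ^ k * F k a) + (-1) * (\<Sum>k\<le>N. F k a))" unfolding k by (simp add: fun_eq_iff)
    also have "\<dots> \<in> M" by (intro sub Suc.prems s) auto
    finally show ?thesis .
  qed (rule F)
qed

section \<open>First-order expansions\<close>

lemma linear_functional_simps:
  assumes "Vector_Spaces.linear s (*) (l :: _ \<Rightarrow> complex)"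
  shows "l (x + y) = l x + l y" "l (s c x) = c * l x" "l 0 = 0" "l (x - y) = l x - l y"
    "l (sum f A) = (\<Sum>a\<in>A. l (f a))"
proof -
  interpret l: Vector_Spaces.linear s "(*)" l by fact
  show "l (x + y) = l x + l y" by (rule l.add)
  show "l (s c x) = c * l x" by (rule l.scale)
  show "l 0 = 0" by (rule l.zero)
  show "l (x - y) = l x - l y" by (rule l.diff)
  show "l (sum f A) = (\<Sum>a\<in>A. l (f a))" by (rule l.sum)
qed

lemma linear_functionalI:
  assumes "vector_space s" "\<And>x y. l (x + y) = l x + l y" "\<And>c x. l (s c x) = c * l x"
  shows "Vector_Spaces.linear s (*) (l :: _ \<Rightarrow> complex)"
proof -
  interpret vector_space s by fact
  interpret C: vector_space "(*) :: complex \<Rightarrow> complex \<Rightarrow> complex"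
    by unfold_locales (auto simp: algebra_simps)
  show ?thesis by unfold_locales (auto simp: assms)
qed

text \<open>The second-order displacement \<open>z\<close> allows the derivative to be read off
  along quadratically parametrized curves, not just along lines. The polynomial remainder makes the
  value \<open>L y\<close> unique.\<close>

definition derivative_at :: "(complex \<Rightarrow> 'v::ab_group_add \<Rightarrow> 'v) \<Rightarrow> ('v \<Rightarrow> complex) \<Rightarrow> 'v \<Rightarrow> ('v \<Rightarrow> complex) \<Rightarrow> bool" where
  "derivative_at s f v L \<longleftrightarrow> Vector_Spaces.linear s (*) L \<and>
     (\<forall>y z. \<exists>g\<in>univ_polys. \<forall>c. f (v + s c y + s (c\<^sup>2) z) = f v + c * L y + c\<^sup>2 * g c)"

text \<open>After division by \<open>c\<close> the difference of both sides is a polynomial with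
  zeros at all \<open>c \<noteq> 0\<close>, hence also at 0.\<close>

lemma first_order_unique:
  assumes "g \<in> univ_polys" "h \<in> univ_polys" "\<And>c. c * a + c\<^sup>2 * g c = c * b + c\<^sup>2 * h c"
  shows "a = b"
proof -
  have p: "(\<lambda>c. a - b + c * (g c - h c)) \<in> univ_polys"
    by (intro polyalg_intros assms univ_polys_var)
  have "a - b + c * (g c - h c) = 0" if "c \<noteq> 0" for c
  proof -
    have "c * (a - b + c * (g c - h c)) = 0"
      using assms(3)[of c] by (simp add: algebra_simps power2_eq_square)
    then show ?thesis using that by simp
  qed
  then have "- {0} \<subseteq> {c. a - b + c * (g c - h c) = 0}" by auto
  then have "infinite {c. a - b + c * (g c - h c) = 0}"
    using infinite_UNIV_char_0[where ?'a = complex] by (metis finite_subset finite.emptyI finite_insert finite_compl)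
  from univ_polys_eq_0[OF p this, of 0] show ?thesis by simp
qed

lemma poly_funs_derivative:
  assumes "vector_space s" and "f \<in> poly_funs s"
  obtains L where "derivative_at s f v L"
proof -
  have "\<exists>L. derivative_at s f v L"
    using assms(2)
  proof induction
    case (const c)
    have "derivative_at s (\<lambda>_. c) v (\<lambda>_. 0)"
      unfolding derivative_at_def by (auto intro!: linear_functionalI assms(1) bexI[of _ "\<lambda>_. 0"] polyalg.const)
    then show ?case by blast
  next
    case (linear l)
    note l = linear_functional_simps[OF linear]
    have "derivative_at s l v l"
      unfolding derivative_at_def
    proof (intro conjI allI linear)
      fix y z show "\<exists>g\<in>univ_polys. \<forall>c. l (v + s c y + s (c\<^sup>2) z) = l v + c * l y + c\<^sup>2 * g c"
        by (intro bexI[of _ "\<lambda>_. l z"] polyalg.const) (simp add: l)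
    qed
    then show ?case by blast
  next
    case (add f g)
    then obtain L L' where L: "derivative_at s f v L" and L': "derivative_at s g v L'" by blast
    have lin: "Vector_Spaces.linear s (*) L" "Vector_Spaces.linear s (*) L'"
      using L L' by (auto simp: derivative_at_def)
    have "derivative_at s (\<lambda>v. f v + g v) v (\<lambda>v. L v + L' v)"
      unfolding derivative_at_def
    proof (intro conjI allI linear_functionalI assms(1))
      fix y z
      obtain p where p: "p \<in> univ_polys" "\<And>c. f (v + s c y + s (c\<^sup>2) z) = f v + c * L y + c\<^sup>2 * p c"
        using L unfolding derivative_at_def by blast
      obtain q where q: "q \<in> univ_polys" "\<And>c. g (v + s c y + s (c\<^sup>2) z) = g v + c * L' y + c\<^sup>2 * q c"
        using L' unfolding derivative_at_def by blast
      show "\<exists>h\<in>univ_polys. \<forall>c. f (v + s c y + s (c\<^sup>2) z) + g (v + s c y + s (c\<^sup>2) z) =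
              f v + g v + c * (L y + L' y) + c\<^sup>2 * h c"
        by (intro bexI[of _ "\<lambda>c. p c + q c"] polyalg_intros p q) (simp only: p(2) q(2), simp add: algebra_simps)
    qed (simp_all add: linear_functional_simps[OF lin(1)] linear_functional_simps[OF lin(2)] algebra_simps)
    then show ?case by blast
  next
    case (mult f g)
    then obtain L L' where L: "derivative_at s f v L" and L': "derivative_at s g v L'" by blast
    have lin: "Vector_Spaces.linear s (*) L" "Vector_Spaces.linear s (*) L'"
      using L L' by (auto simp: derivative_at_def)
    have "derivative_at s (\<lambda>v. f v * g v) v (\<lambda>y. f v * L' y + g v * L y)"
      unfolding derivative_at_def
    proof (intro conjI allI linear_functionalI assms(1))
      fix y z
      obtain p where p: "p \<in> univ_polys" "\<And>c. f (v + s c y + s (c\<^sup>2) z) = f v + c * L y + c\<^sup>2 * p c"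
        using L unfolding derivative_at_def by blast
      obtain q where q: "q \<in> univ_polys" "\<And>c. g (v + s c y + s (c\<^sup>2) z) = g v + c * L' y + c\<^sup>2 * q c"
        using L' unfolding derivative_at_def by blast
      show "\<exists>h\<in>univ_polys. \<forall>c. f (v + s c y + s (c\<^sup>2) z) * g (v + s c y + s (c\<^sup>2) z) =
              f v * g v + c * (f v * L' y + g v * L y) + c\<^sup>2 * h c"
        \<comment> \<open>The witness collects the terms of order at least two in the product of
          both expansions and divides them by \<open>c\<^sup>2\<close>.\<close>
        by (intro bexI[of _ "\<lambda>c. f v * q c + g v * p c + L y * L' y + c * (L y * q c + L' y * p c) + c\<^sup>2 * (p c * q c)"]
            polyalg_intros p q univ_polys_var) (simp only: p(2) q(2), simp add: algebra_simps power2_eq_square)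
    qed (simp_all add: linear_functional_simps[OF lin(1)] linear_functional_simps[OF lin(2)] algebra_simps)
    then show ?case by blast
  qed
  then show ?thesis using that by blast
qed

lemma derivative_at_unique_value:
  assumes "derivative_at s f v L" "g \<in> univ_polys"
    and "\<And>c. f (v + s c y + s (c\<^sup>2) z) = f v + c * a + c\<^sup>2 * g c"
  shows "L y = a"
proof -
  obtain p where p: "p \<in> univ_polys" "\<And>c. f (v + s c y + s (c\<^sup>2) z) = f v + c * L y + c\<^sup>2 * p c"
    using assms(1) unfolding derivative_at_def by blast
  have "f v + c * L y + c\<^sup>2 * p c = f v + c * a + c\<^sup>2 * g c" for c
    unfolding p(2)[symmetric] by (rule assms(3))
  then have "c * L y + c\<^sup>2 * p c = c * a + c\<^sup>2 * g c" for c
    by (metis add.assoc add_left_cancel)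
  then show ?thesis by (rule first_order_unique[OF p(1) assms(2)])
qed

lemma derivative_at_combination:
  assumes "vector_space s" "derivative_at s f v L" "\<And>i. i \<in> A \<Longrightarrow> derivative_at s (g i) v (K i)"
  shows "derivative_at s (\<lambda>x. f x + (\<Sum>i\<in>A. r i * g i x)) v (\<lambda>x. L x + (\<Sum>i\<in>A. r i * K i x))"
  unfolding derivative_at_def
proof (intro conjI allI linear_functionalI assms(1))
  fix y z
  obtain p where p: "p \<in> univ_polys" "\<And>c. f (v + s c y + s (c\<^sup>2) z) = f v + c * L y + c\<^sup>2 * p c"
    using assms(2) unfolding derivative_at_def by blast
  have "\<forall>i\<in>A. \<exists>q. q \<in> univ_polys \<and> (\<forall>c. g i (v + s c y + s (c\<^sup>2) z) = g i v + c * K i y + c\<^sup>2 * q c)"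
    using assms(3) unfolding derivative_at_def by blast
  then obtain q where q: "\<And>i. i \<in> A \<Longrightarrow> q i \<in> univ_polys"
      "\<And>i c. i \<in> A \<Longrightarrow> g i (v + s c y + s (c\<^sup>2) z) = g i v + c * K i y + c\<^sup>2 * q i c" by metis
  show "\<exists>h\<in>univ_polys. \<forall>c. f (v + s c y + s (c\<^sup>2) z) + (\<Sum>i\<in>A. r i * g i (v + s c y + s (c\<^sup>2) z)) =
          f v + (\<Sum>i\<in>A. r i * g i v) + c * (L y + (\<Sum>i\<in>A. r i * K i y)) + c\<^sup>2 * h c"
    by (intro bexI[of _ "\<lambda>c. p c + (\<Sum>i\<in>A. r i * q i c)"] polyalg_intros p q)
      (simp only: p(2) q(2) cong: sum.cong, simp add: algebra_simps sum.distrib sum_distrib_left)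
next
  have lin: "Vector_Spaces.linear s (*) L" "\<And>i. i \<in> A \<Longrightarrow> Vector_Spaces.linear s (*) (K i)"
    using assms by (auto simp: derivative_at_def)
  show "L (x + y) + (\<Sum>i\<in>A. r i * K i (x + y)) = L x + (\<Sum>i\<in>A. r i * K i x) + (L y + (\<Sum>i\<in>A. r i * K i y))" for x y
    by (simp add: linear_functional_simps[OF lin(1)] linear_functional_simps[OF lin(2)] algebra_simps sum.distrib cong: sum.cong)
  show "L (s c x) + (\<Sum>i\<in>A. r i * K i (s c x)) = c * (L x + (\<Sum>i\<in>A. r i * K i x))" for c x
    by (simp add: linear_functional_simps[OF lin(1)] linear_functional_simps[OF lin(2)] algebra_simps sum_distrib_left cong: sum.cong)
qed

section \<open>Hadamard expansions in several directions\<close>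

abbreviation "shift_coords s \<equiv>
  {\<lambda>p. l (fst p) | l. Vector_Spaces.linear s (*) l} \<union> {\<lambda>p. snd p j | j :: nat. True}"

text \<open>An algebraic Taylor formula: the increment lies in the ideal of the displacement
  coefficients, with quotients polynomial in the base point and the displacement together. The joint
  dependence is what later turns the quotients into entries of a matrix of polynomials.\<close>

lemma hadamard:
  assumes "vector_space s" and "f \<in> poly_funs s"
  shows "\<exists>B. (\<forall>j. B j \<in> polyalg (shift_coords s)) \<and>
    (\<forall>v a. f (v + (\<Sum>j<n. s (a j) (y j))) - f v = (\<Sum>j<n. a j * B j (v, a)))"
proof -
  have lin: "(\<lambda>p. l (fst p)) \<in> polyalg (shift_coords s)" if "Vector_Spaces.linear s (*) l" for l
    by (rule polyalg.gen) (use that in auto)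
  have sn: "(\<lambda>p. snd p j) \<in> polyalg (shift_coords s)" for j
    by (rule polyalg.gen) auto
  have fst_poly: "(\<lambda>p. f (fst p)) \<in> polyalg (shift_coords s)" if "f \<in> poly_funs s" for f
    using that unfolding poly_funs_eq_polyalg by (rule polyalg_comp) (rule lin, simp)
  show ?thesis
    using assms(2)
  proof induction
    case (const c)
    show ?case by (intro exI[of _ "\<lambda>_ _. 0"]) (auto intro: polyalg.const)
  next
    case (linear l)
    show ?case
      by (intro exI[of _ "\<lambda>j _. l (y j)"])
        (auto intro: polyalg.const simp: linear_functional_simps[OF linear])
  next
    case (add f g)
    then obtain B C where B: "\<forall>j. B j \<in> polyalg (shift_coords s)"
        "\<forall>v a. f (v + (\<Sum>j<n. s (a j) (y j))) - f v = (\<Sum>j<n. a j * B j (v, a))"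
      and C: "\<forall>j. C j \<in> polyalg (shift_coords s)"
        "\<forall>v a. g (v + (\<Sum>j<n. s (a j) (y j))) - g v = (\<Sum>j<n. a j * C j (v, a))" by blast
    show ?case
    proof (intro exI[of _ "\<lambda>j p. B j p + C j p"] conjI allI)
      fix v a
      have "f (v + (\<Sum>j<n. s (a j) (y j))) + g (v + (\<Sum>j<n. s (a j) (y j))) - (f v + g v) =
        (f (v + (\<Sum>j<n. s (a j) (y j))) - f v) + (g (v + (\<Sum>j<n. s (a j) (y j))) - g v)" by simp
      then show "f (v + (\<Sum>j<n. s (a j) (y j))) + g (v + (\<Sum>j<n. s (a j) (y j))) - (f v + g v) =
        (\<Sum>j<n. a j * (B j (v, a) + C j (v, a)))"
        unfolding B(2)[rule_format] C(2)[rule_format] by (simp add: algebra_simps sum.distrib)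
    qed (use B C in \<open>auto intro: polyalg_intros\<close>)
  next
    case (mult f g)
    then obtain B C where B: "\<forall>j. B j \<in> polyalg (shift_coords s)"
        "\<forall>v a. f (v + (\<Sum>j<n. s (a j) (y j))) - f v = (\<Sum>j<n. a j * B j (v, a))"
      and C: "\<forall>j. C j \<in> polyalg (shift_coords s)"
        "\<forall>v a. g (v + (\<Sum>j<n. s (a j) (y j))) - g v = (\<Sum>j<n. a j * C j (v, a))" by blast
    show ?case
    \<comment> \<open>An increment of a product is \<open>df * g + f * dg + df * dg\<close>; the
      mixed term is expanded through the second factor.\<close>
    proof (intro exI[of _ "\<lambda>j p. B j p * g (fst p) + f (fst p) * C j p + (\<Sum>i<n. snd p i * B i p) * C j p"] conjI allI)
      fix v a
      have *: "f (v + (\<Sum>j<n. s (a j) (y j))) = f v + (\<Sum>j<n. a j * B j (v, a))"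
        "g (v + (\<Sum>j<n. s (a j) (y j))) = g v + (\<Sum>j<n. a j * C j (v, a))"
        using B(2) C(2) by (metis add_diff_cancel_left' add_diff_eq)+
      show "f (v + (\<Sum>j<n. s (a j) (y j))) * g (v + (\<Sum>j<n. s (a j) (y j))) - f v * g v =
        (\<Sum>j<n. a j * (B j (v, a) * g (fst (v, a)) + f (fst (v, a)) * C j (v, a) + (\<Sum>i<n. snd (v, a) i * B i (v, a)) * C j (v, a)))"
        unfolding * by (simp add: algebra_simps sum.distrib sum_distrib_left)
    next
      fix j show "(\<lambda>p. B j p * g (fst p) + f (fst p) * C j p + (\<Sum>i<n. snd p i * B i p) * C j p) \<in> polyalg (shift_coords s)"
        by (intro polyalg_intros B(1)[rule_format] C(1)[rule_format] fst_poly mult.hyps sn)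
    qed
  qed
qed

text \<open>The quotients are not unique, but their values at zero displacement are. Displacing
  along \<open>y j\<close> alone leaves \<open>c * p c\<close>, and the constant term of
  \<open>p\<close> is the derivative.\<close>

lemma hadamard_at_0:
  assumes vs: "vector_space s" and "derivative_at s f v L" and "j < n"
    and B: "\<And>j. B j \<in> polyalg (shift_coords s)"
    "\<And>v a. f (v + (\<Sum>j<n. s (a j) (y j))) - f v = (\<Sum>j<n. a j * B j (v, a))"
  shows "B j (v, \<lambda>_. 0) = L (y j)"
proof -
  interpret vector_space s by fact
  have B1: "(\<lambda>c. B j (v, \<lambda>i. if i = j then c else 0)) \<in> univ_polys"
  proof (rule polyalg_comp[OF B(1)])
    have "(\<lambda>c. if i = j then c else 0) \<in> univ_polys" for i
      by (cases "i = j") (auto intro: polyalg.const univ_polys_var)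
    then show "(\<lambda>c. x (v, \<lambda>i. if i = j then c else 0)) \<in> univ_polys" if "x \<in> shift_coords s" for x
      using that by (auto intro: polyalg.const)
  qed
  then obtain p where p: "(\<lambda>c. B j (v, \<lambda>i. if i = j then c else 0)) = poly p" by (rule univ_polysE)
  obtain a q where pq: "p = pCons a q" by (cases p)
  have "L (y j) = a"
  proof (rule derivative_at_unique_value[OF assms(2)])
    have "poly q \<in> univ_polys"
    proof -
      have "(\<lambda>x. \<Sum>i\<le>degree q. coeff q i * x ^ i) \<in> univ_polys"
        by (intro polyalg_intros univ_polys_var)
      then show ?thesis by (simp add: poly_altdef[abs_def])
    qed
    then show "poly q \<in> univ_polys" .
    fix c
    have "f (v + s c (y j)) - f v = c * poly p c"
      using B(2)[of v "\<lambda>i. if i = j then c else 0"] \<open>j < n\<close> p[THEN fun_cong, of c]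
      by (simp add: if_distrib[of "\<lambda>c. s c _"] if_distrib[of "\<lambda>c. c * _"] cong: if_cong)
    then show "f (v + s c (y j) + s (c\<^sup>2) 0) = f v + c * a + c\<^sup>2 * poly q c"
      by (simp add: pq algebra_simps power2_eq_square)
  qed
  moreover have "(\<lambda>i. if i = j then 0 else 0) = (\<lambda>_. 0 :: complex)" by auto
  then have "B j (v, \<lambda>_. 0) = a"
    using p[THEN fun_cong, of 0] pq by simp
  ultimately show ?thesis by simp
qed

section \<open>Elimination and descent for polynomial functions\<close>

text \<open>Nakayama's lemma by elimination without division. The matrix is the identity at
  \<open>e\<close>, so every pivot is nonzero there and the product of the pivots is an admissible
  multiplier.\<close>

lemma nakayama_elimination:
  fixes n :: nat
  assumes "\<And>i j. i < n \<Longrightarrow> j < n \<Longrightarrow> B i j \<in> polyalg X"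
    and "\<And>i j. i < n \<Longrightarrow> j < n \<Longrightarrow> B i j e = (if i = j then 1 else 0)"
    and "\<And>i. i < n \<Longrightarrow> (\<lambda>a. \<Sum>j<n. B i j a * x j a) \<in> J"
    and J: "\<And>f g. f \<in> J \<Longrightarrow> g \<in> J \<Longrightarrow> (\<lambda>a. f a + g a) \<in> J"
      "\<And>f g. f \<in> polyalg X \<Longrightarrow> g \<in> J \<Longrightarrow> (\<lambda>a. f a * g a) \<in> J"
  shows "\<exists>\<Delta>\<in>polyalg X. \<Delta> e \<noteq> 0 \<and> (\<forall>j<n. (\<lambda>a. \<Delta> a * x j a) \<in> J)"
  using assms(1-3)
proof (induction n arbitrary: B)
  case 0
  show ?case by (intro bexI[of _ "\<lambda>_. 1"]) (auto intro: polyalg.const)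
next
  case (Suc n)
  \<comment> \<open>Cross-multiplication with the pivot \<open>B n n\<close> cancels column
    \<open>n\<close>, and the reduced matrix is again the identity at \<open>e\<close>.\<close>
  define C where "C i j = (\<lambda>a. B n n a * B i j a - B i n a * B n j a)" for i j
  have "\<exists>\<Delta>\<in>polyalg X. \<Delta> e \<noteq> 0 \<and> (\<forall>j<n. (\<lambda>a. \<Delta> a * x j a) \<in> J)"
  proof (rule Suc.IH)
    fix i j assume "i < n" "j < n"
    then show "C i j \<in> polyalg X" "C i j e = (if i = j then 1 else 0)"
      unfolding C_def by (auto intro!: polyalg_intros Suc.prems(1) simp: Suc.prems(2))
  next
    fix i assume i: "i < n"
    have "(\<lambda>a. B n n a * (\<Sum>j<Suc n. B i j a * x j a) + (- B i n a) * (\<Sum>j<Suc n. B n j a * x j a)) \<in> J"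
      using i by (intro J polyalg_uminus Suc.prems) auto
    also have "(\<lambda>a. B n n a * (\<Sum>j<Suc n. B i j a * x j a) + (- B i n a) * (\<Sum>j<Suc n. B n j a * x j a))
        = (\<lambda>a. \<Sum>j<n. C i j a * x j a)"
      by (simp add: C_def fun_eq_iff sum_distrib_left algebra_simps sum_negf flip: sum.distrib)
    finally show "(\<lambda>a. \<Sum>j<n. C i j a * x j a) \<in> J" .
  qed
  then obtain \<Delta> where D: "\<Delta> \<in> polyalg X" "\<Delta> e \<noteq> 0" "\<And>j. j < n \<Longrightarrow> (\<lambda>a. \<Delta> a * x j a) \<in> J" by blast
  have B: "B i j \<in> polyalg X" if "i \<le> n" "j \<le> n" for i j using Suc.prems(1) that by simp
  have z: "(\<lambda>a. 0) \<in> J" using J(2)[OF polyalg.const[of 0] Suc.prems(3)[of n]] by simp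
  have "(\<lambda>a. \<Sum>j\<in>A. B n j a * (\<Delta> a * x j a)) \<in> J" if "A \<subseteq> {..<n}" for A
    using finite_subset[OF that finite_lessThan] that
  proof (induction A rule: finite_induct)
    case (insert j A)
    then have "(\<lambda>a. B n j a * (\<Delta> a * x j a) + (\<Sum>j\<in>A. B n j a * (\<Delta> a * x j a))) \<in> J"
      by (intro J(1)[OF J(2)[OF B D(3)]]) auto
    then show ?case using insert.hyps by simp
  qed (simp add: z)
  then have S: "(\<lambda>a. \<Sum>j<n. B n j a * (\<Delta> a * x j a)) \<in> J" by simp
  show ?case
  proof (intro bexI[of _ "\<lambda>a. \<Delta> a * B n n a"] conjI allI impI polyalg_intros D(1) B)
    show "\<Delta> e * B n n e \<noteq> 0" using D(2) Suc.prems(2)[of n n] by simp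
    fix j assume "j < Suc n"
    show "(\<lambda>a. \<Delta> a * B n n a * x j a) \<in> J"
    proof (cases "j < n")
      case True
      from J(2)[OF B[of n n] D(3)[OF True]] show ?thesis by (simp add: mult_ac)
    next
      case False
      then have j: "j = n" using \<open>j < Suc n\<close> by simp
      \<comment> \<open>Back substitution: the terms of the last row with \<open>j < n\<close> are
        already in \<open>J\<close> after multiplication by \<Delta>, which isolates the last
        unknown.\<close>
      have "(\<lambda>a. \<Delta> a * (\<Sum>j<Suc n. B n j a * x j a) + (-1) * (\<Sum>j<n. B n j a * (\<Delta> a * x j a))) \<in> J"
        by (intro J D S Suc.prems polyalg.const) auto
      also have "(\<lambda>a. \<Delta> a * (\<Sum>j<Suc n. B n j a * x j a) + (-1) * (\<Sum>j<n. B n j a * (\<Delta> a * x j a)))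
          = (\<lambda>a. \<Delta> a * B n n a * x j a)"
        unfolding j by (simp add: fun_eq_iff sum_distrib_left algebra_simps sum_negf)
      finally show ?thesis .
    qed
  qed auto
qed

text \<open>
  A finitely generated torsion-free module over the pulled back functions \<open>\<phi> \<circ> t\<close> is, up to
  a common denominator, contained in a free module on some of its generators.
\<close>

lemma free_submodule:
  fixes b :: "nat \<Rightarrow> 'a \<Rightarrow> complex" and t :: "'a \<Rightarrow> 'b"
  assumes dom: "\<And>\<phi> \<psi>. \<phi> \<in> polyalg X \<Longrightarrow> \<psi> \<in> polyalg X \<Longrightarrow> \<exists>z. \<phi> (t z) \<noteq> 0 \<Longrightarrow> \<exists>z. \<psi> (t z) \<noteq> 0
    \<Longrightarrow> \<exists>z. \<phi> (t z) * \<psi> (t z) \<noteq> 0"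
  shows "\<exists>m (e :: nat \<Rightarrow> 'a \<Rightarrow> complex) d D. d \<in> polyalg X \<and> (\<exists>z. d (t z) \<noteq> 0) \<and>
    (\<forall>j<n. \<forall>l<m. D j l \<in> polyalg X) \<and>
    (\<forall>j<n. \<forall>z. d (t z) * b j z = (\<Sum>l<m. D j l (t z) * e l z)) \<and>
    (\<forall>\<phi>. (\<forall>l<m. \<phi> l \<in> polyalg X) \<longrightarrow> (\<forall>z. (\<Sum>l<m. \<phi> l (t z) * e l z) = 0) \<longrightarrow> (\<forall>l<m. \<forall>z. \<phi> l (t z) = 0))"
    (is "\<exists>m e d D. ?P n m e d D")
proof (induction n)
  case 0
  show ?case by (rule exI[of _ 0], intro exI[of _ "\<lambda>_. 1"]) (auto intro: polyalg.const)
next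
  case (Suc n)
  then obtain m d D and e :: "nat \<Rightarrow> 'a \<Rightarrow> complex" where IH: "?P n m e d D" by blast
  then have d: "d \<in> polyalg X" "\<exists>z. d (t z) \<noteq> 0"
    and D: "\<And>j l. j < n \<Longrightarrow> l < m \<Longrightarrow> D j l \<in> polyalg X"
      "\<And>j z. j < n \<Longrightarrow> d (t z) * b j z = (\<Sum>l<m. D j l (t z) * e l z)"
    by auto
  have e: "\<phi> l (t z) = 0" if "\<And>l. l < m \<Longrightarrow> \<phi> l \<in> polyalg X" "\<And>z. (\<Sum>l<m. \<phi> l (t z) * e l z) = 0" "l < m"
    for \<phi> l z
    using IH[THEN conjunct2, THEN conjunct2, THEN conjunct2, THEN conjunct2, rule_format, of \<phi> l z] that by blast
  show ?case
  \<comment> \<open>Either a nonzero multiple of \<open>b n\<close> is a combination of the old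
    generators, and only the denominator grows, or \<open>b n\<close> itself is a further
    independent generator.\<close>
  proof (cases "\<exists>\<phi> \<psi>. (\<forall>l<m. \<phi> l \<in> polyalg X) \<and> \<psi> \<in> polyalg X \<and> (\<exists>z. \<psi> (t z) \<noteq> 0) \<and>
      (\<forall>z. \<psi> (t z) * b n z = (\<Sum>l<m. \<phi> l (t z) * e l z))")
    case True
    then obtain \<phi> \<psi> where phi: "\<And>l. l < m \<Longrightarrow> \<phi> l \<in> polyalg X" and psi: "\<psi> \<in> polyalg X" "\<exists>z. \<psi> (t z) \<noteq> 0"
      and rel: "\<And>z. \<psi> (t z) * b n z = (\<Sum>l<m. \<phi> l (t z) * e l z)" by blast
    let ?D = "\<lambda>j l a. if j = n then d a * \<phi> l a else \<psi> a * D j l a"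
    show ?thesis
    proof (rule exI[of _ m], rule exI[of _ e], rule exI[of _ "\<lambda>a. d a * \<psi> a"], rule exI[of _ ?D],
        intro conjI allI impI)
      show "(\<lambda>a. d a * \<psi> a) \<in> polyalg X" by (intro polyalg_intros d psi)
      show "\<exists>z. d (t z) * \<psi> (t z) \<noteq> 0" by (rule dom[OF d(1) psi(1) d(2) psi(2)])
    next
      fix j l assume jl: "j < Suc n" "l < m"
      show "?D j l \<in> polyalg X"
      proof (cases "j = n")
        case False
        then have "j < n" using jl by simp
        then show ?thesis using D(1) False jl psi by (auto intro: polyalg_intros)
      qed (use jl d phi in \<open>auto intro: polyalg_intros\<close>)
    next
      fix j z assume j: "j < Suc n"
      show "d (t z) * \<psi> (t z) * b j z = (\<Sum>l<m. ?D j l (t z) * e l z)"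
      proof (cases "j = n")
        case True
        then show ?thesis using rel[of z] by (simp add: mult.assoc flip: sum_distrib_left)
      next
        case False
        then have "d (t z) * b j z = (\<Sum>l<m. D j l (t z) * e l z)" using D(2) j by simp
        then have "\<psi> (t z) * (d (t z) * b j z) = \<psi> (t z) * (\<Sum>l<m. D j l (t z) * e l z)" by simp
        then show ?thesis using False by (simp add: mult_ac sum_distrib_left)
      qed
    qed (rule e; simp)
  next
    case False
    let ?e = "\<lambda>l. if l = m then b n else e l"
    let ?D = "\<lambda>j l. if j = n then (if l = m then d else (\<lambda>_. 0)) else if l = m then (\<lambda>_. 0) else D j l"
    have e': "(\<Sum>l<Suc m. \<phi> l (t z) * ?e l z) = (\<Sum>l<m. \<phi> l (t z) * e l z) + \<phi> m (t z) * b n z" for \<phi> z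
      by simp
    show ?thesis
    proof (rule exI[of _ "Suc m"], rule exI[of _ ?e], rule exI[of _ d], rule exI[of _ ?D],
        intro conjI allI impI d)
      fix j l assume "j < Suc n" "l < Suc m"
      then show "?D j l \<in> polyalg X" using D(1) d(1) by (auto intro: polyalg.const)
    next
      fix j z assume j: "j < Suc n"
      show "d (t z) * b j z = (\<Sum>l<Suc m. ?D j l (t z) * ?e l z)"
        unfolding e' using D(2) j by (cases "j = n") auto
    next
      fix \<phi> l z
      assume phi: "\<forall>l<Suc m. \<phi> l \<in> polyalg X" and s: "\<forall>z. (\<Sum>l<Suc m. \<phi> l (t z) * ?e l z) = 0"
        and l: "l < Suc m"
      have rel: "\<phi> m (t z) * b n z = (\<Sum>l<m. (- \<phi> l (t z)) * e l z)" for z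
        using s[rule_format, of z] unfolding e' by (simp add: sum_negf add_eq_0_iff)
      have m: "\<phi> m (t z) = 0" for z
      proof (rule ccontr)
        assume z: "\<phi> m (t z) \<noteq> 0"
        have "\<exists>\<phi> \<psi>. (\<forall>l<m. \<phi> l \<in> polyalg X) \<and> \<psi> \<in> polyalg X \<and> (\<exists>z. \<psi> (t z) \<noteq> 0) \<and>
          (\<forall>z. \<psi> (t z) * b n z = (\<Sum>l<m. \<phi> l (t z) * e l z))"
          by (rule exI[of _ "\<lambda>l a. - \<phi> l a"], rule exI[of _ "\<phi> m"])
            (use phi z rel in \<open>auto intro: polyalg_uminus\<close>)
        with False show False by blast
      qed
      show "\<phi> l (t z) = 0"
      proof (cases "l = m")
        case False
        then have "l < m" using l by simp
        show ?thesis
          by (rule e[OF _ _ \<open>l < m\<close>]) (use phi s m in \<open>auto simp: e'\<close>)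
      qed (simp add: m)
    qed
  qed
qed

section \<open>Separation of variables on a product\<close>

abbreviation "prod_gens X Y \<equiv> {\<lambda>p. x (fst p) | x. x \<in> X} \<union> {\<lambda>p. y (snd p) | y. y \<in> Y}"

text \<open>This is the decomposition of a tensor product of two polynomial algebras. Lists of terms
  are convenient because sums concatenate and products run over all pairs.\<close>

lemma polyalg_separate:
  assumes "f \<in> polyalg (prod_gens X Y)"
  shows "\<exists>xs. set xs \<subseteq> polyalg X \<times> polyalg Y \<and> (\<forall>z u. f (z, u) = (\<Sum>(b, q)\<leftarrow>xs. b z * q u))"
  using assms
proof induction
  case (const c)
  show ?case by (rule exI[of _ "[(\<lambda>_. c, \<lambda>_. 1)]"]) (auto intro: polyalg.const)
next
  case (gen x)
  then consider x' where "x = (\<lambda>p. x' (fst p))" "x' \<in> X" | y where "x = (\<lambda>p. y (snd p))" "y \<in> Y" by blast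
  then show ?case
  proof cases
    case 1
    then show ?thesis by (intro exI[of _ "[(x', \<lambda>_. 1)]"]) (auto intro: polyalg.const polyalg.gen)
  next
    case 2
    then show ?thesis by (intro exI[of _ "[(\<lambda>_. 1, y)]"]) (auto intro: polyalg.const polyalg.gen)
  qed
next
  case (add f g)
  then obtain xs ys where "set xs \<subseteq> polyalg X \<times> polyalg Y" "\<forall>z u. f (z, u) = (\<Sum>(b, q)\<leftarrow>xs. b z * q u)"
    "set ys \<subseteq> polyalg X \<times> polyalg Y" "\<forall>z u. g (z, u) = (\<Sum>(b, q)\<leftarrow>ys. b z * q u)" by blast
  then show ?case by (intro exI[of _ "xs @ ys"]) auto
next
  case (mult f g)
  then obtain xs ys where xs: "set xs \<subseteq> polyalg X \<times> polyalg Y" "\<forall>z u. f (z, u) = (\<Sum>(b, q)\<leftarrow>xs. b z * q u)"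
    and ys: "set ys \<subseteq> polyalg X \<times> polyalg Y" "\<forall>z u. g (z, u) = (\<Sum>(b, q)\<leftarrow>ys. b z * q u)" by blast
  let ?m = "\<lambda>(b, q) (b', q'). (\<lambda>z. b z * b' z :: complex, \<lambda>u. q u * q' u :: complex)"
  have *: "(\<Sum>(b, q)\<leftarrow>xs. b z * q u) * (\<Sum>(b, q)\<leftarrow>ys. b z * q u) =
    (\<Sum>(b, q)\<leftarrow>concat (map (\<lambda>p. map (?m p) ys) xs). b z * q u)" for z u
  proof (induction xs)
    case (Cons p xs)
    have "(\<Sum>(b, q)\<leftarrow>map (?m p) ys. b z * q u) = (case p of (b, q) \<Rightarrow> b z * q u) * (\<Sum>(b, q)\<leftarrow>ys. b z * q u)"
      by (induction ys) (auto simp: algebra_simps split: prod.split)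
    then show ?case using Cons.IH by (simp add: distrib_right)
  qed simp
  show ?case
    by (rule exI[of _ "concat (map (\<lambda>p. map (?m p) ys) xs)"])
      (use xs ys in \<open>auto simp: * intro!: polyalg_intros\<close>)
qed

text \<open>All functions have to share the factors \<open>b j\<close>, since these become the
  generators of a single module. Each new function appends its own terms and the remaining
  coefficients are padded with 0.\<close>

lemma polyalg_separate_family:
  fixes n :: nat
  assumes "\<And>i. i < n \<Longrightarrow> f i \<in> polyalg (prod_gens X Y)"
  shows "\<exists>N b q. (\<forall>j<N. b j \<in> polyalg X) \<and> (\<forall>i<n. \<forall>j<N. q i j \<in> polyalg Y) \<and>
    (\<forall>i<n. \<forall>z u. f i (z, u) = (\<Sum>j<(N::nat). b j z * q i j u))"
    (is "\<exists>N b q. ?P n N b q")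
  using assms
proof (induction n)
  case 0
  show ?case by (intro exI[of _ 0] exI) simp
next
  case (Suc n)
  have "\<exists>N b q. ?P n N b q" by (rule Suc.IH) (rule Suc.prems, simp)
  then obtain N b q where "?P n N b q" by (elim exE)
  then have b: "\<forall>j<N. b j \<in> polyalg X" and q: "\<forall>i<n. \<forall>j<N. q i j \<in> polyalg Y"
    and f: "\<forall>i<n. \<forall>z u. f i (z, u) = (\<Sum>j<N. b j z * q i j u)" by auto
  obtain xs where xs: "set xs \<subseteq> polyalg X \<times> polyalg Y" "\<forall>z u. f n (z, u) = (\<Sum>(b, q)\<leftarrow>xs. b z * q u)"
    using polyalg_separate[OF Suc.prems[of n]] by blast
  let ?N = "N + length xs"
  have nth: "xs ! k \<in> polyalg X \<times> polyalg Y" if "k < length xs" for k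
    using xs(1) that nth_mem by blast
  have split: "(\<Sum>j<?N. F j) = (\<Sum>j<N. F j) + (\<Sum>k<length xs. F (N + k))" for F :: "nat \<Rightarrow> complex"
    using sum.atLeastLessThan_shift_bounds[of F 0 N "length xs"]
    by (simp add: sum.atLeastLessThan_concat[of 0 N ?N F, symmetric] lessThan_atLeast0 add.commute)
  show ?case
  proof (rule exI[of _ ?N], rule exI[of _ "\<lambda>j. if j < N then b j else fst (xs ! (j - N))"],
      rule exI[of _ "\<lambda>i j. if i < n then (if j < N then q i j else (\<lambda>_. 0)) else
        (if j < N then (\<lambda>_. 0) else snd (xs ! (j - N)))"], intro conjI allI impI)
    fix j assume "j < ?N"
    then show "(if j < N then b j else fst (xs ! (j - N))) \<in> polyalg X"
      using b nth[of "j - N"] by (auto simp: mem_Times_iff)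
  next
    fix i j assume "j < ?N"
    then show "(if i < n then (if j < N then q i j else (\<lambda>_. 0)) else
        (if j < N then (\<lambda>_. 0) else snd (xs ! (j - N)))) \<in> polyalg Y"
      using q nth[of "j - N"] by (auto simp: mem_Times_iff intro: polyalg.const)
  next
    fix i z u assume "i < Suc n"
    then consider "i < n" | "i = n" by linarith
    then show "f i (z, u) = (\<Sum>j<?N. (if j < N then b j else fst (xs ! (j - N))) z *
        (if i < n then (if j < N then q i j else (\<lambda>_. 0)) else
        (if j < N then (\<lambda>_. 0) else snd (xs ! (j - N)))) u)"
    proof cases
      case 2
      then show ?thesis using xs(2)
        by (simp add: split sum_list_sum_nth atLeast0LessThan case_prod_beta)
    qed (use f in \<open>simp add: split\<close>)
  qed
qed

section \<open>Polynomials on coordinate spaces\<close>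

lemma polyalg_cong: "f \<in> polyalg X \<Longrightarrow> (\<And>x. x \<in> X \<Longrightarrow> x a = x a') \<Longrightarrow> f a = f a'"
  by (induction rule: polyalg.induct) auto

abbreviation coords :: "'i set \<Rightarrow> (('i \<Rightarrow> complex) \<Rightarrow> complex) set" where
  "coords I \<equiv> {\<lambda>z. z i | i. i \<in> I}"

lemma coords_on_line:
  assumes "f \<in> polyalg (coords I)" shows "(\<lambda>c. f (\<lambda>i. a i + c * b i)) \<in> univ_polys"
  by (rule polyalg_comp[OF assms]) (auto intro!: polyalg_intros univ_polys_var)

lemma coords_common_nonzero:
  assumes "f \<in> polyalg (coords I)" "g \<in> polyalg (coords I)" "f a \<noteq> 0" "g b \<noteq> 0"
  obtains z where "f z \<noteq> 0" "g z \<noteq> 0"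
proof -
  let ?l = "\<lambda>c i. a i + c * (b i - a i)"
  obtain c where "f (?l c) \<noteq> 0" "g (?l c) \<noteq> 0"
    by (rule univ_polys_common_nonzero[OF coords_on_line[OF assms(1), of a "\<lambda>i. b i - a i"]
          coords_on_line[OF assms(2), of a "\<lambda>i. b i - a i"], where a = 0 and b = 1])
      (use assms(3,4) in auto)
  then show ?thesis by (rule that)
qed

text \<open>
  A polynomial map tangent to the identity at the origin is dominant: compare the lowest
  homogeneous part of a polynomial before and after composition.
\<close>

lemma near_identity_dominant:
  fixes t :: "('i \<Rightarrow> complex) \<Rightarrow> 'i \<Rightarrow> complex"
  assumes "f \<in> polyalg (coords I)" and zero: "\<And>z. f (t z) = 0"
    and t: "\<And>z i. i \<in> I \<Longrightarrow> t z i = z i + Q z i" and Q: "\<And>c z i. i \<in> I \<Longrightarrow> Q (\<lambda>i. c * z i) i = c\<^sup>2 * Q z i"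
  shows "f a = 0"
proof -
  obtain F N where F: "\<And>k. F k \<in> polyalg (coords I)" "\<And>k c a. F k (\<lambda>i. c * a i) = c ^ k * F k a"
    "\<And>k. k > N \<Longrightarrow> F k = (\<lambda>_. 0)" "\<And>a. f a = (\<Sum>k\<le>N. F k a)"
    by (rule polyalg_homog_decomp[OF assms(1), of "\<lambda>c a i. c * a i"]) auto
  have "F n z = 0" for n z
  proof (induction n arbitrary: z rule: less_induct)
    case (less n)
    show ?case
    proof (cases "n \<le> N")
      case True
      have "\<exists>p. (\<lambda>c. F k (\<lambda>i. z i + c * Q z i)) = poly p" for k
        using univ_polysE[OF coords_on_line[OF F(1)]] by metis
      then obtain p where p: "\<And>k c. F k (\<lambda>i. z i + c * Q z i) = poly (p k) c" by metis
      have p0: "p k = 0" if "k < n" for k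
      proof -
        have "\<forall>c. poly (p k) c = 0" using less[OF that] p[of k] by simp
        then show ?thesis by (simp only: poly_all_0_iff_0)
      qed
      \<comment> \<open>On \<open>I\<close> the point \<open>t (c z)\<close> equals
        \<open>c (z + c Q z)\<close>, so \<open>f (t (c z))\<close> is the sum of
        \<open>c ^ k * poly (p k) c\<close>. Its coefficient at \<open>c ^ n\<close> involves only
        \<open>p k\<close> with \<open>k \<le> n\<close>. Those with \<open>k < n\<close> are zero
        by induction, and the constant term of \<open>p n\<close> is \<open>F n z\<close>.\<close>
      have "poly (\<Sum>k\<le>N. monom 1 k * p k) c = 0" for c
      proof -
        have "f (t (\<lambda>i. c * z i)) = f (\<lambda>i. c * (z i + c * Q z i))"
          by (rule polyalg_cong[OF assms(1)]) (auto simp: t Q algebra_simps power2_eq_square)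
        then have "f (\<lambda>i. c * (z i + c * Q z i)) = 0" by (simp only: zero)
        then have "(\<Sum>k\<le>N. c ^ k * poly (p k) c) = 0" by (simp only: F(4) F(2) p)
        then show ?thesis by (simp add: poly_sum poly_monom)
      qed
      then have "(\<Sum>k\<le>N. monom 1 k * p k) = 0" by (intro poly_all_0_iff_0[THEN iffD1] allI)
      then have "0 = coeff (\<Sum>k\<le>N. monom 1 k * p k) n" by simp
      also have "\<dots> = (\<Sum>k\<le>N. if k = n then coeff (p k) 0 else 0)"
        unfolding coeff_sum by (intro sum.cong) (auto simp: coeff_monom_mult p0 not_le not_less)
      also have "\<dots> = coeff (p n) 0" using True by simp
      also have "\<dots> = F n z" using p[of n 0] by (simp add: poly_0_coeff_0)
      finally show ?thesis by simp
    qed (simp add: F(3))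
  qed
  then show ?thesis by (simp add: F(4))
qed

section \<open>Ideals that cut out a parametrized subvariety to first order\<close>

text \<open>Extending \<open>B\<close> to a basis of the whole type makes the coordinates
  functionals on the whole type, which is what \<open>poly_funs\<close> is generated by.\<close>

lemma dual_functionals:
  assumes "vector_space (s :: complex \<Rightarrow> 'b \<Rightarrow> 'b::ab_group_add)" "\<not> module.dependent s B"
  shows "\<exists>\<tau>. (\<forall>b. Vector_Spaces.linear s (*) (\<tau> b)) \<and>
    (\<forall>b\<in>B. \<forall>b'\<in>B. \<tau> b b' = (if b = b' then 1 else 0))"
proof -
  interpret vector_space s by fact
  let ?E = "extend_basis B"
  note E = independent_extend_basis[OF assms(2)] and sE = span_extend_basis[OF assms(2)]
  show ?thesis
  proof (intro exI[of _ "\<lambda>b v. representation ?E v b"] conjI allI ballI)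
    show "Vector_Spaces.linear s (*) (\<lambda>v. representation ?E v b)" for b
      by (rule linear_functionalI[OF assms(1)])
        (simp_all add: representation_add[OF E] representation_scale[OF E] sE)
    show "representation ?E b' b = (if b = b' then 1 else 0)" if "b \<in> B" "b' \<in> B" for b b'
      using representation_basis[OF E, of b'] extend_basis_superset[OF assms(2)] that by auto
  qed
qed

text \<open>
  \<open>P\<close> parametrizes a subvariety of \<open>V\<close> through \<open>w = P 0\<close> by quadratic polynomials, with tangent space
  spanned by \<open>T\<close> at \<open>w\<close>. The ideal \<open>M\<close> vanishes on it, and its conormal space at \<open>w\<close> is
  everything that \<open>T\<close> allows.
\<close>

locale tangent_chart = vector_space s for s :: "complex \<Rightarrow> 'v \<Rightarrow> 'v::ab_group_add" +
  fixes V T B0 :: "'v set" and M :: "('v \<Rightarrow> complex) set" and w :: 'v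
    and \<theta> :: "'v \<Rightarrow> 'v \<Rightarrow> 'v" and P :: "('v \<Rightarrow> complex) \<Rightarrow> 'v"
  assumes sub: "subspace V" and fin: "finite B0" "V \<subseteq> span B0"
    and T: "independent T" "T \<subseteq> V"
    and wV: "w \<in> V" and \<theta>V: "a \<in> T \<Longrightarrow> b \<in> T \<Longrightarrow> \<theta> a b \<in> V"
    and P: "P z = w + (\<Sum>b\<in>T. s (z b) b) + (\<Sum>a\<in>T. \<Sum>b\<in>T. s (z a * z b) (\<theta> a b))"
    and M: "M \<subseteq> poly_funs s" "f \<in> M \<Longrightarrow> g \<in> M \<Longrightarrow> (\<lambda>v. f v + g v) \<in> M"
      "f \<in> poly_funs s \<Longrightarrow> g \<in> M \<Longrightarrow> (\<lambda>v. f v * g v) \<in> M"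
      "f \<in> M \<Longrightarrow> g \<in> poly_funs s \<Longrightarrow> (\<And>v. v \<in> V \<Longrightarrow> g v = f v) \<Longrightarrow> g \<in> M"
    and M0: "(\<lambda>_. 0) \<in> M"
    and van: "f \<in> M \<Longrightarrow> f (P z) = 0"
    and tan: "v \<in> V \<Longrightarrow> (\<And>f L. f \<in> M \<Longrightarrow> derivative_at s f w L \<Longrightarrow> L v = 0) \<Longrightarrow> v \<in> span T"
begin

lemma vs: "vector_space s" by unfold_locales

lemma finite_T: "finite T"
  using independent_span_bound[OF fin(1) T(1)] T(2) fin(2) by blast

lemma P_V: "P z \<in> V"
  unfolding P by (intro subspace_add[OF sub] subspace_sum[OF sub] subspace_scale[OF sub] wV)
    (use T \<theta>V in auto)

lemma P_0: "P (\<lambda>_. 0) = w"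
  by (simp add: P)

text \<open>Functions in \<open>M\<close> with independent differentials at \<open>w\<close>. The
  independence is recorded by dual vectors \<open>y\<close>, which become the transverse directions
  of the chart.\<close>

definition dual_system :: "nat \<Rightarrow> (nat \<Rightarrow> 'v \<Rightarrow> complex) \<Rightarrow> (nat \<Rightarrow> 'v) \<Rightarrow> (nat \<Rightarrow> 'v \<Rightarrow> complex) \<Rightarrow> bool" where
  "dual_system n f y L \<longleftrightarrow> (\<forall>i<n. f i \<in> M \<and> y i \<in> V \<and> derivative_at s (f i) w (L i)) \<and>
     (\<forall>i<n. \<forall>j<n. L i (y j) = (if i = j then 1 else 0))"

lemma dual_system_bounded:
  assumes "dual_system n f y L" shows "n \<le> card B0"
proof -
  have L: "L i (y j) = (if i = j then 1 else 0)" if "i < n" "j < n" for i j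
    using assms that by (simp add: dual_system_def)
  have lin: "Vector_Spaces.linear s (*) (L i)" if "i < n" for i
    using assms that by (simp add: dual_system_def derivative_at_def)
  have inj: "inj_on y {..<n}"
  proof (rule inj_onI)
    fix i j assume "i \<in> {..<n}" "j \<in> {..<n}" "y i = y j"
    then show "i = j" using L[of i i] L[of i j] by (simp split: if_splits)
  qed
  have "independent (y ` {..<n})"
  proof
    assume dep: "dependent (y ` {..<n})"
    have "\<exists>u. (\<exists>v\<in>y ` {..<n}. u v \<noteq> 0) \<and> (\<Sum>v\<in>y ` {..<n}. s (u v) v) = 0"
      by (rule dependent_finite[THEN iffD1, OF _ dep]) simp
    then obtain u where u: "\<exists>v\<in>y ` {..<n}. u v \<noteq> 0" "(\<Sum>v\<in>y ` {..<n}. s (u v) v) = 0"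
      by (elim exE conjE)
    then obtain i where i: "i < n" "u (y i) \<noteq> 0" by blast
    have "L i (\<Sum>j<n. s (u (y j)) (y j)) = 0"
      using u(2) by (simp add: sum.reindex[OF inj] linear_functional_simps(3)[OF lin[OF i(1)]])
    then have "(\<Sum>j<n. u (y j) * L i (y j)) = 0"
      by (simp only: linear_functional_simps[OF lin[OF i(1)]])
    also have "(\<Sum>j<n. u (y j) * L i (y j)) = (\<Sum>j<n. if j = i then u (y j) else 0)"
      using L i by (intro sum.cong) auto
    finally show False using i by simp
  qed
  moreover have "y ` {..<n} \<subseteq> V" using assms by (auto simp: dual_system_def)
  ultimately have "card (y ` {..<n}) \<le> card B0"
    using independent_span_bound[OF fin(1), of "y ` {..<n}"] fin(2) by simp
  then show ?thesis using card_image[OF inj] by simp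
qed

text \<open>Dual systems have bounded length, so a longest one exists. If the remainder of some
  \<open>v\<close> were outside the span of \<open>T\<close>, then by \<open>tan\<close> some
  element of \<open>M\<close> would have a differential that is nonzero on it, and the system could
  be extended.\<close>

lemma maximal_dual_system:
  shows "\<exists>n f y L. dual_system n f y L \<and> (\<forall>v\<in>V. v - (\<Sum>j<n. s (L j v) (y j)) \<in> span T)"
proof -
  have "\<exists>n f y L. dual_system n f y L \<and> (\<forall>m f y L. dual_system m f y L \<longrightarrow> m \<le> n)"
  proof -
    have "\<exists>n. (\<exists>f y L. dual_system n f y L) \<and> (\<forall>m. (\<exists>f y L. dual_system m f y L) \<longrightarrow> m \<le> n)"
    proof (rule Nat.ex_has_greatest_nat[where P = "\<lambda>n. \<exists>f y L. dual_system n f y L"])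
      show "\<exists>f y L. dual_system 0 f y L" by (simp add: dual_system_def)
      show "\<forall>m. (\<exists>f y L. dual_system m f y L) \<longrightarrow> m \<le> card B0" using dual_system_bounded by blast
    qed
    then show ?thesis by blast
  qed
  then obtain n f y L where d: "dual_system n f y L" and max: "\<And>m f y L. dual_system m f y L \<Longrightarrow> m \<le> n"
    by blast
  have f: "f i \<in> M" "y i \<in> V" "derivative_at s (f i) w (L i)" if "i < n" for i
    using d that by (auto simp: dual_system_def)
  have L: "L i (y j) = (if i = j then 1 else 0)" if "i < n" "j < n" for i j
    using d that by (simp add: dual_system_def)
  have lin: "Vector_Spaces.linear s (*) (L i)" if "i < n" for i
    using f(3)[OF that] by (simp add: derivative_at_def)
  show ?thesis
  proof (intro exI[of _ n] exI[of _ f] exI[of _ y] exI[of _ L] conjI ballI d, rule tan)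
    fix v assume v: "v \<in> V"
    let ?v = "v - (\<Sum>j<n. s (L j v) (y j))"
    show vV: "?v \<in> V"
      using v f(2) by (intro subspace_diff[OF sub] subspace_sum[OF sub] subspace_scale[OF sub]) auto
    have Lv: "L i ?v = 0" if "i < n" for i
    proof -
      have "(\<Sum>j<n. L j v * L i (y j)) = (\<Sum>j<n. if j = i then L j v else 0)"
        using L that by (intro sum.cong) auto
      then show ?thesis using that by (simp add: linear_functional_simps[OF lin[OF that]])
    qed
    fix g K assume g: "g \<in> M" and K: "derivative_at s g w K"
    note K' = linear_functional_simps[OF K[unfolded derivative_at_def, THEN conjunct1]]
    show "K ?v = 0"
    proof (rule ccontr)
      assume nz: "K ?v \<noteq> 0"
      \<comment> \<open>The new vector is normalized to \<open>K ?y = 1\<close> and already killed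
        by the old \<open>L i\<close>; the new function is corrected so that its differential kills
        the old \<open>y j\<close>.\<close>
      let ?y = "s (1 / K ?v) ?v"
      let ?g = "\<lambda>x. g x + (\<Sum>i<n. (- K (y i)) * f i x)" and ?K = "\<lambda>x. K x + (\<Sum>i<n. (- K (y i)) * L i x)"
      have gM: "?g \<in> M"
      proof -
        have "(\<lambda>x. \<Sum>i\<in>A. (- K (y i)) * f i x) \<in> M" if "A \<subseteq> {..<n}" for A
          using finite_subset[OF that finite_lessThan] that
        proof (induction A rule: finite_induct)
          case (insert i A)
          then have "(\<lambda>x. (- K (y i)) * f i x + (\<Sum>i\<in>A. (- K (y i)) * f i x)) \<in> M"
            by (intro M(2) M(3)[OF poly_funs.const] f) auto
          then show ?case using insert.hyps by simp
        qed (simp add: M0)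
        then show ?thesis by (intro M(2) g) auto
      qed
      have dK: "derivative_at s ?g w ?K"
        by (rule derivative_at_combination[OF vs K]) (auto intro: f)
      have "dual_system (Suc n) (f(n := ?g)) (y(n := ?y)) (L(n := ?K))"
        unfolding dual_system_def
      proof (intro conjI allI impI)
        fix i assume "i < Suc n"
        then show "(f(n := ?g)) i \<in> M" "(y(n := ?y)) i \<in> V" "derivative_at s ((f(n := ?g)) i) w ((L(n := ?K)) i)"
          using f gM dK subspace_scale[OF sub vV] by (auto simp: less_Suc_eq)
      next
        fix i j assume ij: "i < Suc n" "j < Suc n"
        have 1: "L i ?y = 0" if "i < n" for i
          using Lv[OF that] by (simp only: linear_functional_simps(2)[OF lin[OF that]] mult_zero_right)
        have 2: "?K ?y = 1"
          using nz 1 by (simp only: K'(2)) simp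
        have 3: "?K (y j) = 0" if "j < n" for j
        proof -
          have "(\<Sum>i<n. (- K (y i)) * L i (y j)) = (\<Sum>i<n. if i = j then - K (y i) else 0)"
            using L that by (intro sum.cong) auto
          then show ?thesis using that by simp
        qed
        show "(L(n := ?K)) i ((y(n := ?y)) j) = (if i = j then 1 else 0)"
          using ij 1 2 3 L by (auto simp: less_Suc_eq)
      qed
      from max[OF this] show False by simp
    qed
  qed
qed

text \<open>The curve with the single nonzero parameter \<open>z b = c\<close> stays in the zero set
  of \<open>f\<close>, and it is exactly \<open>w + c b + c^2 \<theta> b b\<close>. This is where
  the second-order term in \<open>derivative_at\<close> is needed.\<close>

lemma L_vanishes_on_T:
  assumes "f \<in> M" "derivative_at s f w L" "b \<in> T" shows "L b = 0"
proof (rule derivative_at_unique_value[OF assms(2), of "\<lambda>_. 0" b "\<theta> b b"])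
  fix c :: complex
  let ?z = "\<lambda>b'. if b' = b then c else 0"
  have "P ?z = w + (\<Sum>b'\<in>T. if b' = b then s c b else 0) +
      (\<Sum>a\<in>T. \<Sum>b'\<in>T. if b' = b then (if a = b then s (c\<^sup>2) (\<theta> b b) else 0) else 0)"
    unfolding P by (intro arg_cong2[of _ _ _ _ "(+)"] sum.cong refl) (auto simp: power2_eq_square)
  also have "\<dots> = w + s c b + s (c\<^sup>2) (\<theta> b b)"
    using finite_T assms(3) by simp
  finally show "f (w + s c b + s (c\<^sup>2) (\<theta> b b)) = f w + c * 0 + c\<^sup>2 * 0"
    using van[OF assms(1), of ?z] van[OF assms(1), of "\<lambda>_. 0"] by (simp add: P_0)
qed (rule polyalg.const)


text \<open>In coordinates along \<open>T\<close> and along the transverse \<open>y\<close>, the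
  parametrized set is \<open>(t z, u z)\<close>. The functions \<open>f i\<close> and the transverse
  coordinates minus \<open>u z\<close> generate the same ideal near the origin, so a multiple of
  \<open>h\<close> is a combination of the \<open>f i\<close>. What remains is to replace
  coefficients that depend on \<open>z\<close> by functions on \<open>V\<close>.\<close>

proposition multiple_in_ideal:
  assumes h: "h \<in> poly_funs s" and h0: "\<And>z. h (P z) = 0"
  obtains g where "g \<in> poly_funs s" "(\<lambda>v. g v * h v) \<in> M" "\<exists>z. g (P z) \<noteq> 0"
proof -
  obtain c f y L where d: "dual_system c f y L"
    and T_part: "\<And>v. v \<in> V \<Longrightarrow> v - (\<Sum>j<c. s (L j v) (y j)) \<in> span T"
    using maximal_dual_system by blast
  have f: "f i \<in> M" "y i \<in> V" "derivative_at s (f i) w (L i)" "f i \<in> poly_funs s" if "i < c" for i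
    using d that M(1) by (auto simp: dual_system_def)
  have L: "L i (y j) = (if i = j then 1 else 0)" if "i < c" "j < c" for i j
    using d that by (simp add: dual_system_def)
  have linL: "Vector_Spaces.linear s (*) (L i)" if "i < c" for i
    using f(3)[OF that] by (simp add: derivative_at_def)
  have LT: "L i b = 0" if "i < c" "b \<in> T" for i b
    using L_vanishes_on_T f that by blast
  obtain \<tau>0 where lin0: "\<And>b. Vector_Spaces.linear s (*) (\<tau>0 b)"
    and \<tau>0: "\<And>b b'. b \<in> T \<Longrightarrow> b' \<in> T \<Longrightarrow> \<tau>0 b b' = (if b = b' then 1 else 0)"
    using dual_functionals[OF vs T(1)] by blast
  \<comment> \<open>The correction makes \<tau> vanish on every \<open>y j\<close>. On
    \<open>T\<close> it changes nothing, because each \<open>L j\<close> vanishes there.\<close>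
  define \<tau> where "\<tau> b v = \<tau>0 b v - (\<Sum>j<c. L j v * \<tau>0 b (y j))" for b v
  have lin\<tau>: "Vector_Spaces.linear s (*) (\<tau> b)" for b
    by (rule linear_functionalI[OF vs]) (simp_all add: \<tau>_def linear_functional_simps[OF lin0]
      linear_functional_simps[OF linL] algebra_simps sum.distrib sum_distrib_left cong: sum.cong_simp)
  have decomp: "v = (\<Sum>b\<in>T. s (\<tau> b v) b) + (\<Sum>j<c. s (L j v) (y j))" if v: "v \<in> V" for v
  proof -
    let ?v = "v - (\<Sum>j<c. s (L j v) (y j))"
    obtain u where u: "?v = (\<Sum>b\<in>T. s (u b) b)"
      using T_part[OF v] unfolding span_finite[OF finite_T] by blast
    have "u b = \<tau> b v" if b: "b \<in> T" for b
    proof -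
      have "\<tau>0 b ?v = (\<Sum>b'\<in>T. u b' * \<tau>0 b b')"
        unfolding u by (simp add: linear_functional_simps[OF lin0])
      also have "\<dots> = (\<Sum>b'\<in>T. if b' = b then u b' else 0)"
        using \<tau>0 b by (intro sum.cong) auto
      also have "\<dots> = u b" using finite_T b by simp
      finally show ?thesis by (simp add: linear_functional_simps[OF lin0] \<tau>_def)
    qed
    then have "?v = (\<Sum>b\<in>T. s (\<tau> b v) b)" using u by simp
    then show ?thesis by (simp add: algebra_simps)
  qed

  \<comment> \<open>\<open>t z\<close> and \<open>u z\<close> are the tangential and transverse
    coordinates of \<open>P z - w\<close>, and \<sigma> rebuilds a vector of \<open>V\<close> from
    its coordinates.\<close>
  define t where "t z b = z b + (\<Sum>a\<in>T. \<Sum>a'\<in>T. z a * z a' * \<tau> b (\<theta> a a'))" for z b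
  define u where "u z j = (\<Sum>a\<in>T. \<Sum>a'\<in>T. z a * z a' * L j (\<theta> a a'))" for z j
  define \<sigma> where "\<sigma> x x' = w + (\<Sum>b\<in>T. s (x b) b) + (\<Sum>j<c. s (x' j) (y j))" for x x'
  have \<tau>T: "\<tau> b b' = (if b' = b then 1 else 0)" if "b \<in> T" "b' \<in> T" for b b'
    using that \<tau>0 LT by (simp add: \<tau>_def)
  have lincomb: "l (P z - w) = (\<Sum>b\<in>T. z b * l b) + (\<Sum>a\<in>T. \<Sum>a'\<in>T. z a * z a' * l (\<theta> a a'))"
    if "Vector_Spaces.linear s (*) l" for l z
    by (simp add: P linear_functional_simps[OF that])
  have \<tau>P: "\<tau> b (P z - w) = t z b" if "b \<in> T" for b z
  proof -
    have "(\<Sum>b'\<in>T. z b' * \<tau> b b') = (\<Sum>b'\<in>T. if b' = b then z b' else 0)"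
      using \<tau>T that by (intro sum.cong) auto
    then show ?thesis using that finite_T by (simp add: lincomb[OF lin\<tau>] t_def)
  qed
  have LP: "L j (P z - w) = u z j" if "j < c" for j z
    using LT that by (simp add: lincomb[OF linL[OF that]] u_def)
  have coords_V: "v = \<sigma> (\<lambda>b. \<tau> b (v - w)) (\<lambda>j. L j (v - w))" if "v \<in> V" for v
    using decomp[OF subspace_diff[OF sub that wV]] by (simp add: \<sigma>_def algebra_simps)
  have P_\<sigma>: "P z = \<sigma> (t z) (u z)" for z
    by (subst coords_V[OF P_V]) (simp add: \<sigma>_def \<tau>P LP cong: sum.cong_simp)
  have \<sigma>_shift: "\<sigma> (t z) x = P z + (\<Sum>j<c. s (x j - u z j) (y j))" for z x
    unfolding P_\<sigma> by (simp add: \<sigma>_def scale_left_diff_distrib sum_subtractf)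

  let ?Z = "coords T" and ?U = "coords {..<c}"
  define Q where "Q = prod_gens ?Z ?U"
  have zQ: "(\<lambda>p. fst p b) \<in> polyalg Q" if "b \<in> T" for b
    by (rule polyalg.gen) (use that in \<open>auto simp: Q_def\<close>)
  have uQ: "(\<lambda>p. snd p j) \<in> polyalg Q" if "j < c" for j
    by (rule polyalg.gen) (use that in \<open>auto simp: Q_def\<close>)
  have tZ: "(\<lambda>z. t z b) \<in> polyalg ?Z" if "b \<in> T" for b
    unfolding t_def by (intro polyalg_intros) (auto intro: polyalg.gen that)
  have uZ: "(\<lambda>z. u z j) \<in> polyalg ?Z" for j
    unfolding u_def by (intro polyalg_intros) (auto intro: polyalg.gen)
  have fstQ: "(\<lambda>p. q (fst p)) \<in> polyalg Q" if "q \<in> polyalg ?Z" for q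
    by (rule polyalg_comp[OF that]) (use zQ in auto)
  have lP: "(\<lambda>z. l (P z)) \<in> polyalg ?Z" if "Vector_Spaces.linear s (*) l" for l
    by (simp add: P linear_functional_simps[OF that]) (intro polyalg_intros; auto intro: polyalg.gen)
  have XQ: "(\<lambda>p. snd p j - u (fst p) j) \<in> polyalg Q" if "j < c" for j
    by (intro polyalg_intros uQ that fstQ uZ)
  \<comment> \<open>The base point of the expansion is \<open>P z\<close>, where \<open>F\<close>
    vanishes, so the increment is the full value of \<open>F\<close> on the transverse slice through
    \<open>P z\<close>.\<close>
  define expansion where "expansion F B \<longleftrightarrow> (\<forall>j<c. B j \<in> polyalg Q) \<and>
      (\<forall>z x. F (\<sigma> (t z) x) = (\<Sum>j<c. (x j - u z j) * B j (z, x))) \<and>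
      (\<forall>K. derivative_at s F w K \<longrightarrow> (\<forall>j<c. B j (\<lambda>_. 0, \<lambda>_. 0) = K (y j)))" for F B
  have had: "\<exists>B. expansion F B"
    if F: "F \<in> poly_funs s" "\<And>z. F (P z) = 0" for F
  proof -
    obtain B where B: "\<And>j. B j \<in> polyalg (shift_coords s)"
      "\<And>v a. F (v + (\<Sum>j<c. s (a j) (y j))) - F v = (\<Sum>j<c. a j * B j (v, a))"
      using hadamard[OF vs F(1), of y c] by blast
    let ?\<phi> = "\<lambda>p. (P (fst p), \<lambda>j. if j < c then snd p j - u (fst p) j else 0)"
    show ?thesis
      unfolding expansion_def
    proof (rule exI[of _ "\<lambda>j p. B j (?\<phi> p)"], intro conjI allI impI)
      fix j assume "j < c"
      show "(\<lambda>p. B j (?\<phi> p)) \<in> polyalg Q"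
      proof (rule polyalg_comp[OF B(1)])
        fix x assume "x \<in> shift_coords s"
        then consider l where "Vector_Spaces.linear s (*) l" "x = (\<lambda>p. l (fst p))" | j where "x = (\<lambda>p. snd p j)"
          by blast
        then show "(\<lambda>p. x (?\<phi> p)) \<in> polyalg Q"
        proof cases
          case 1 then show ?thesis using fstQ[OF lP] by simp
        next
          case 2 then show ?thesis using XQ[of j] by (cases "j < c") (auto intro: polyalg.const)
        qed
      qed
    next
      fix z x
      show "F (\<sigma> (t z) x) = (\<Sum>j<c. (x j - u z j) * B j (?\<phi> (z, x)))"
        using B(2)[of "P z" "\<lambda>j. if j < c then x j - u z j else 0"] F(2)[of z]
        unfolding fst_conv snd_conv by (simp add: \<sigma>_shift cong: sum.cong_simp)
    next
      fix K j assume K: "derivative_at s F w K" and j: "j < c"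
      have "?\<phi> (\<lambda>_. 0, \<lambda>_. 0) = (w, \<lambda>_. 0)" by (auto simp: P_0 u_def)
      then show "B j (?\<phi> (\<lambda>_. 0, \<lambda>_. 0)) = K (y j)"
        using hadamard_at_0[OF vs K j B] by simp
    qed
  qed
  have "\<forall>i. \<exists>B. i < c \<longrightarrow> expansion (f i) B"
    using had f(4) van[OF f(1)] by blast
  then obtain B where BE: "\<And>i. i < c \<Longrightarrow> expansion (f i) (B i)" by metis
  have B: "\<And>j. j < c \<Longrightarrow> B i j \<in> polyalg Q"
    "\<And>z x. f i (\<sigma> (t z) x) = (\<Sum>j<c. (x j - u z j) * B i j (z, x))"
    "\<And>j. j < c \<Longrightarrow> B i j (\<lambda>_. 0, \<lambda>_. 0) = L i (y j)" if "i < c" for i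
    using BE[OF that, unfolded expansion_def, THEN conjunct1]
      BE[OF that, unfolded expansion_def, THEN conjunct2, THEN conjunct1]
      BE[OF that, unfolded expansion_def, THEN conjunct2, THEN conjunct2] f(3)[OF that] by (simp, fast, fast)
  obtain H where HE: "expansion h H" using had[OF h h0] by blast
  have H: "\<And>j. j < c \<Longrightarrow> H j \<in> polyalg Q"
    "\<And>z x. h (\<sigma> (t z) x) = (\<Sum>j<c. (x j - u z j) * H j (z, x))"
    using HE[unfolded expansion_def, THEN conjunct1]
      HE[unfolded expansion_def, THEN conjunct2, THEN conjunct1] by (simp, fast)

  define X where "X j = (\<lambda>p. snd p j - u (fst p) j)" for j
  define \<phi> where "\<phi> i = (\<lambda>p. f i (\<sigma> (t (fst p)) (snd p)))" for i
  \<comment> \<open>The ideal generated by the pullbacks of the \<open>f i\<close> among functions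
    of the parameter and the transverse coordinates.\<close>
  define J where "J = {F. \<exists>a. (\<forall>i<c. a i \<in> polyalg Q) \<and> F = (\<lambda>p. \<Sum>i<c. a i p * \<phi> i p)}"
  have J_add: "(\<lambda>p. F p + G p) \<in> J" if "F \<in> J" "G \<in> J" for F G
  proof -
    from that obtain a b where "\<forall>i<c. a i \<in> polyalg Q" "F = (\<lambda>p. \<Sum>i<c. a i p * \<phi> i p)"
      "\<forall>i<c. b i \<in> polyalg Q" "G = (\<lambda>p. \<Sum>i<c. b i p * \<phi> i p)" unfolding J_def by blast
    then show ?thesis unfolding J_def
      by (intro CollectI exI[of _ "\<lambda>i p. a i p + b i p"]) (auto intro: polyalg_intros simp: sum.distrib distrib_right)
  qed
  have J_mult: "(\<lambda>p. F p * G p) \<in> J" if "F \<in> polyalg Q" "G \<in> J" for F G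
  proof -
    from that obtain b where "\<forall>i<c. b i \<in> polyalg Q" "G = (\<lambda>p. \<Sum>i<c. b i p * \<phi> i p)"
      unfolding J_def by blast
    then show ?thesis unfolding J_def
      by (intro CollectI exI[of _ "\<lambda>i p. F p * b i p"])
        (auto intro: polyalg_intros that(1) simp: sum_distrib_left mult.assoc)
  qed
  have J_0: "(\<lambda>p. 0) \<in> J"
    unfolding J_def by (intro CollectI exI[of _ "\<lambda>_ _. 0"]) (auto intro: polyalg.const)
  have J_sum: "(\<lambda>p. \<Sum>j\<in>A. F j p) \<in> J" if "finite A" "\<And>j. j \<in> A \<Longrightarrow> F j \<in> J" for A and F :: "nat \<Rightarrow> _"
    using that by (induction A rule: finite_induct) (auto intro!: J_0 J_add)
  \<comment> \<open>At the origin the coefficient matrix has the entries \<open>L i (y j)\<close>,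
    so it is the identity there.\<close>
  have "\<exists>\<Delta>\<in>polyalg Q. \<Delta> (\<lambda>_. 0, \<lambda>_. 0) \<noteq> 0 \<and> (\<forall>j<c. (\<lambda>p. \<Delta> p * X j p) \<in> J)"
  proof (rule nakayama_elimination[where B = B])
    fix i assume i: "i < c"
    have "(\<lambda>p. \<Sum>j<c. B i j p * X j p) = \<phi> i"
      by (rule ext) (simp add: X_def \<phi>_def B(2)[OF i] mult.commute)
    also have "\<dots> = (\<lambda>p. \<Sum>k<c. (if k = i then 1 else 0) * \<phi> k p)"
      using i by (simp add: fun_eq_iff if_distrib[of "\<lambda>x. x * _"] cong: if_cong)
    also have "\<dots> \<in> J"
      unfolding J_def by (intro CollectI exI[of _ "\<lambda>k p. if k = i then 1 else 0"] conjI refl)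
        (auto intro: polyalg.const)
    finally show "(\<lambda>p. \<Sum>j<c. B i j p * X j p) \<in> J" .
  next
    fix F G assume "F \<in> polyalg Q" "G \<in> J" then show "(\<lambda>p. F p * G p) \<in> J" by (rule J_mult)
  next
    fix i j assume "i < c" "j < c"
    then show "B i j \<in> polyalg Q" "B i j (\<lambda>_. 0, \<lambda>_. 0) = (if i = j then 1 else 0)"
      using B(1,3) L by simp_all
  qed (rule J_add)
  then obtain \<Delta> where \<Delta>: "\<Delta> \<in> polyalg Q" "\<Delta> (\<lambda>_. 0, \<lambda>_. 0) \<noteq> 0" "\<And>j. j < c \<Longrightarrow> (\<lambda>p. \<Delta> p * X j p) \<in> J"
    by blast
  have "(\<lambda>p. \<Sum>j<c. H j p * (\<Delta> p * X j p)) \<in> J"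
    by (intro J_sum J_mult H \<Delta>) auto
  also have "(\<lambda>p. \<Sum>j<c. H j p * (\<Delta> p * X j p)) = (\<lambda>p. \<Delta> p * h (\<sigma> (t (fst p)) (snd p)))"
    by (rule ext) (simp add: H(2) X_def sum_distrib_left mult_ac)
  finally obtain a where a: "\<And>i. i < c \<Longrightarrow> a i \<in> polyalg Q"
    "(\<lambda>p. \<Delta> p * h (\<sigma> (t (fst p)) (snd p))) = (\<lambda>p. \<Sum>i<c. a i p * \<phi> i p)"
    unfolding J_def by blast

  \<comment> \<open>Index \<open>c\<close> is reserved for the multiplier, so that it is separated
    with the same factors \<open>b j\<close> as the coefficients \<open>a i\<close>.\<close>
  define F where "F i = (if i = c then \<Delta> else a i)" for i
  have "\<exists>N b q. (\<forall>j<N. b j \<in> polyalg ?Z) \<and> (\<forall>i<Suc c. \<forall>j<N. q i j \<in> polyalg ?U) \<and>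
    (\<forall>i<Suc c. \<forall>z x. F i (z, x) = (\<Sum>j<(N::nat). b j z * q i j x))"
    by (rule polyalg_separate_family) (use a(1) \<Delta>(1) in \<open>auto simp: F_def less_Suc_eq Q_def\<close>)
  then obtain N b q where sep: "(\<forall>j<N. b j \<in> polyalg ?Z) \<and> (\<forall>i<Suc c. \<forall>j<N. q i j \<in> polyalg ?U) \<and>
    (\<forall>i<Suc c. \<forall>z x. F i (z, x) = (\<Sum>j<(N::nat). b j z * q i j x))"
    by (elim exE)
  have q: "q i j \<in> polyalg ?U" if "i \<le> c" "j < N" for i j
    using sep[THEN conjunct2, THEN conjunct1] that by simp
  have F: "F i (z, x) = (\<Sum>j<N. b j z * q i j x)" if "i \<le> c" for i z x
    using sep[THEN conjunct2, THEN conjunct2] that by simp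
  have compt: "(\<lambda>z. g (t z)) \<in> polyalg ?Z" if "g \<in> polyalg ?Z" for g
    by (rule polyalg_comp[OF that]) (use tZ in auto)
  \<comment> \<open>The factors \<open>b j z\<close> need not be functions of \<open>t z\<close>. Up
    to a denominator in \<open>t z\<close> they are combinations of generators \<open>e l\<close>
    independent over such functions, so an identity can be compared coefficient by
    coefficient.\<close>
  have "\<exists>m (e :: nat \<Rightarrow> ('v \<Rightarrow> complex) \<Rightarrow> complex) d D. d \<in> polyalg ?Z \<and> (\<exists>z. d (t z) \<noteq> 0) \<and>
    (\<forall>j<N. \<forall>l<m. D j l \<in> polyalg ?Z) \<and>
    (\<forall>j<N. \<forall>z. d (t z) * b j z = (\<Sum>l<m. D j l (t z) * e l z)) \<and>
    (\<forall>\<phi>. (\<forall>l<m. \<phi> l \<in> polyalg ?Z) \<longrightarrow> (\<forall>z. (\<Sum>l<m. \<phi> l (t z) * e l z) = 0) \<longrightarrow> (\<forall>l<m. \<forall>z. \<phi> l (t z) = 0))"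
  proof (rule free_submodule[where t = t and b = b and n = N and X = "?Z"])
    fix \<phi> \<psi> assume *: "\<phi> \<in> polyalg ?Z" "\<psi> \<in> polyalg ?Z" "\<exists>z. \<phi> (t z) \<noteq> 0" "\<exists>z. \<psi> (t z) \<noteq> 0"
    from *(3) obtain z1 where z1: "\<phi> (t z1) \<noteq> 0" by (elim exE)
    from *(4) obtain z2 where z2: "\<psi> (t z2) \<noteq> 0" by (elim exE)
    obtain z where "\<phi> (t z) \<noteq> 0" "\<psi> (t z) \<noteq> 0"
      by (rule coords_common_nonzero[where f = "\<lambda>z. \<phi> (t z)" and g = "\<lambda>z. \<psi> (t z)",
          OF compt[OF *(1)] compt[OF *(2)] z1 z2])
    then show "\<exists>z. \<phi> (t z) * \<psi> (t z) \<noteq> 0" by (intro exI[of _ z]) simp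
  qed
  then obtain m d D and e :: "nat \<Rightarrow> ('v \<Rightarrow> complex) \<Rightarrow> complex" where
    conj: "d \<in> polyalg ?Z \<and> (\<exists>z. d (t z) \<noteq> 0) \<and>
    (\<forall>j<N. \<forall>l<m. D j l \<in> polyalg ?Z) \<and>
    (\<forall>j<N. \<forall>z. d (t z) * b j z = (\<Sum>l<m. D j l (t z) * e l z)) \<and>
    (\<forall>\<phi>. (\<forall>l<m. \<phi> l \<in> polyalg ?Z) \<longrightarrow> (\<forall>z. (\<Sum>l<m. \<phi> l (t z) * e l z) = 0) \<longrightarrow> (\<forall>l<m. \<forall>z. \<phi> l (t z) = 0))"
    by (elim exE)
  have d': "d \<in> polyalg ?Z" "\<exists>z. d (t z) \<noteq> 0"
    by (rule conj[THEN conjunct1] conj[THEN conjunct2, THEN conjunct1])+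
  have D: "D j l \<in> polyalg ?Z" if "j < N" "l < m" for j l
    using conj[THEN conjunct2, THEN conjunct2, THEN conjunct1] that by simp
  have De: "d (t z) * b j z = (\<Sum>l<m. D j l (t z) * e l z)" if "j < N" for j z
    using conj[THEN conjunct2, THEN conjunct2, THEN conjunct2, THEN conjunct1] that by simp
  have indep: "\<And>\<phi> l z. (\<And>l. l < m \<Longrightarrow> \<phi> l \<in> polyalg ?Z) \<Longrightarrow> (\<And>z. (\<Sum>l<m. \<phi> l (t z) * e l z) = 0) \<Longrightarrow> l < m \<Longrightarrow> \<phi> l (t z) = 0"
    by (rule conj[THEN conjunct2, THEN conjunct2, THEN conjunct2, THEN conjunct2, rule_format])

  define G where "G l i x x' = (\<Sum>j<N. D j l x * q i j x')" for l i x x'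
  have dF: "d (t z) * F i (z, x) = (\<Sum>l<m. G l i (t z) x * e l z)" if "i \<le> c" for i z x
  proof -
    have "d (t z) * F i (z, x) = (\<Sum>j<N. (d (t z) * b j z) * q i j x)"
      unfolding F[OF that] by (simp add: sum_distrib_left mult_ac)
    also have "\<dots> = (\<Sum>j<N. \<Sum>l<m. D j l (t z) * q i j x * e l z)"
    proof (rule sum.cong[OF refl])
      fix j assume "j \<in> {..<N}"
      then have "d (t z) * b j z = (\<Sum>l<m. D j l (t z) * e l z)" by (intro De) simp
      then show "d (t z) * b j z * q i j x = (\<Sum>l<m. D j l (t z) * q i j x * e l z)"
        by (simp only: sum_distrib_right) (simp only: mult_ac)
    qed
    also have "\<dots> = (\<Sum>l<m. G l i (t z) x * e l z)"
      unfolding G_def sum_distrib_right by (rule sum.swap)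
    finally show ?thesis .
  qed
  have \<sigma>Z: "(\<lambda>x. g (\<sigma> x x')) \<in> polyalg ?Z" if "g \<in> poly_funs s" for g x'
    using that unfolding poly_funs_eq_polyalg
  proof (rule polyalg_comp)
    fix l assume "l \<in> {l. Vector_Spaces.linear s (*) l}"
    then have l: "Vector_Spaces.linear s (*) l" by simp
    show "(\<lambda>x. l (\<sigma> x x')) \<in> polyalg ?Z"
      by (simp add: \<sigma>_def linear_functional_simps[OF l]) (intro polyalg_intros; auto intro: polyalg.gen)
  qed
  have GZ: "(\<lambda>x. G l i x x') \<in> polyalg ?Z" if "l < m" for l i x'
    unfolding G_def by (intro polyalg_intros) (use D that in auto)
  \<comment> \<open>Independence of the \<open>e l\<close> gives the relation at
    \<open>x = t z\<close>. Dominance of \<open>t\<close> extends it to all \<open>x\<close>, that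
    is, to all of \<open>V\<close>.\<close>
  have rel: "G l c x x' * h (\<sigma> x x') = (\<Sum>i<c. G l i x x' * f i (\<sigma> x x'))" if l: "l < m" for l x x'
  proof -
    define \<psi> where "\<psi> l x = G l c x x' * h (\<sigma> x x') - (\<Sum>i<c. G l i x x' * f i (\<sigma> x x'))" for l x
    have \<psi>Z: "\<psi> l \<in> polyalg ?Z" if "l < m" for l
      unfolding \<psi>_def by (intro polyalg_minus polyalg_sum polyalg.mult GZ \<sigma>Z h f that) auto
    have s: "(\<Sum>l<m. \<psi> l (t z) * e l z) = 0" for z
    proof -
      have "(\<Sum>l<m. \<psi> l (t z) * e l z) = (\<Sum>l<m. G l c (t z) x' * e l z) * h (\<sigma> (t z) x')
          - (\<Sum>i<c. (\<Sum>l<m. G l i (t z) x' * e l z) * f i (\<sigma> (t z) x'))"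
        unfolding \<psi>_def left_diff_distrib sum_subtractf sum_distrib_right
        by (subst (2) sum.swap) (simp add: mult_ac)
      also have "\<dots> = d (t z) * (F c (z, x') * h (\<sigma> (t z) x') - (\<Sum>i<c. F i (z, x') * f i (\<sigma> (t z) x')))"
        by (simp add: sum_distrib_left right_diff_distrib mult.assoc flip: dF)
      also have "F c (z, x') * h (\<sigma> (t z) x') = (\<Sum>i<c. F i (z, x') * f i (\<sigma> (t z) x'))"
        using fun_cong[OF a(2), of "(z, x')"] by (simp add: F_def \<phi>_def)
      finally show ?thesis by simp
    qed
    have *: "\<psi> l (t z) = 0" for z by (rule indep[of \<psi> l z, OF \<psi>Z s l])
    have "\<psi> l x = 0"
    proof (rule near_identity_dominant[of "\<psi> l" T t "\<lambda>z b. \<Sum>a\<in>T. \<Sum>a'\<in>T. z a * z a' * \<tau> b (\<theta> a a')" x])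
      show "\<psi> l \<in> polyalg ?Z" by (rule \<psi>Z[OF l])
    qed (simp_all add: * t_def sum_distrib_left power2_eq_square mult_ac)
    then show ?thesis by (simp add: \<psi>_def)
  qed

  obtain z0 where z0: "d (t z0) \<noteq> 0" using d'(2) by blast
  have \<Delta>Z: "(\<lambda>z. \<Delta> (z, u z)) \<in> polyalg ?Z"
  proof (rule polyalg_comp[OF \<Delta>(1)])
    fix x assume "x \<in> Q"
    then consider b where "b \<in> T" "x = (\<lambda>p. fst p b)" | j where "x = (\<lambda>p. snd p j)"
      unfolding Q_def by blast
    then show "(\<lambda>z. x (z, u z)) \<in> polyalg ?Z"
    proof cases
      case 1
      have "(\<lambda>z. z b) \<in> polyalg ?Z" by (rule polyalg.gen) (use 1(1) in blast)
      then show ?thesis by (simp only: 1(2) fst_conv)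
    next
      case 2
      show ?thesis by (simp only: 2 snd_conv uZ)
    qed
  qed
  have "u (\<lambda>_. 0) = (\<lambda>_. 0)" by (simp add: u_def fun_eq_iff)
  then have \<Delta>0: "\<Delta> (\<lambda>_. 0, u (\<lambda>_. 0)) \<noteq> 0" using \<Delta>(2) by simp
  \<comment> \<open>Denominator and multiplier have to be nonzero at the same parameter; then some
    coefficient \<open>G l c\<close> is nonzero at \<open>P z\<close>, and it is the multiplier
    sought.\<close>
  obtain z where z: "d (t z) \<noteq> 0" "\<Delta> (z, u z) \<noteq> 0"
    by (rule coords_common_nonzero[where f = "\<lambda>z. d (t z)" and g = "\<lambda>z. \<Delta> (z, u z)" and a = z0
        and b = "\<lambda>_. 0", OF compt[OF d'(1)] \<Delta>Z z0 \<Delta>0])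
  have "d (t z) * F c (z, u z) \<noteq> 0" using z by (simp add: F_def)
  then have "(\<Sum>l<m. G l c (t z) (u z) * e l z) \<noteq> 0"
    unfolding dF[OF order_refl] .
  then obtain l where "l \<in> {..<m}" "G l c (t z) (u z) * e l z \<noteq> 0"
    by (rule sum.not_neutral_contains_not_neutral)
  then have l: "l < m" "G l c (t z) (u z) \<noteq> 0" by auto
  define g where "g i v = G l i (\<lambda>b. \<tau> b (v - w)) (\<lambda>j. L j (v - w))" for i v
  have shift: "(\<lambda>v. K (v - w)) \<in> polyalg {l. Vector_Spaces.linear s (*) l}" if "Vector_Spaces.linear s (*) K" for K
    by (simp add: linear_functional_simps[OF that]) (intro polyalg_intros polyalg.gen CollectI that)
  have g: "g i \<in> poly_funs s" if "i \<le> c" for i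
    unfolding poly_funs_eq_polyalg g_def G_def
  proof (intro polyalg_sum polyalg.mult)
    fix j assume "j \<in> {..<N}"
    then have j: "j < N" by simp
    show "(\<lambda>v. D j l (\<lambda>b. \<tau> b (v - w))) \<in> polyalg {l. Vector_Spaces.linear s (*) l}"
      by (rule polyalg_comp[OF D[OF j l(1)]]) (auto intro: shift lin\<tau>)
    show "(\<lambda>v. q i j (\<lambda>j. L j (v - w))) \<in> polyalg {l. Vector_Spaces.linear s (*) l}"
      by (rule polyalg_comp[OF q[OF that j]]) (auto intro: shift linL)
  qed
  show ?thesis
  proof (rule that[of "g c"])
    show "g c \<in> poly_funs s" by (rule g) simp
    have "(\<lambda>v. \<Sum>i\<in>A. g i v * f i v) \<in> M" if "A \<subseteq> {..<c}" for A
      using finite_subset[OF that finite_lessThan] that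
    proof (induction A rule: finite_induct)
      case (insert i A)
      then have "(\<lambda>v. g i v * f i v + (\<Sum>i\<in>A. g i v * f i v)) \<in> M"
        by (intro M(2) M(3) f g) auto
      then show ?case using insert.hyps by simp
    qed (simp add: M0)
    then have "(\<lambda>v. \<Sum>i<c. g i v * f i v) \<in> M" by simp
    then show "(\<lambda>v. g c v * h v) \<in> M"
    proof (rule M(4))
      show "(\<lambda>v. g c v * h v) \<in> poly_funs s" by (intro poly_funs.mult g h) simp
      fix v assume "v \<in> V"
      from rel[OF l(1), of "\<lambda>b. \<tau> b (v - w)" "\<lambda>j. L j (v - w)"]
      show "g c v * h v = (\<Sum>i<c. g i v * f i v)"
        unfolding coords_V[OF \<open>v \<in> V\<close>, symmetric] by (simp add: g_def)
    qed
    have "D j l (\<lambda>b. \<tau> b (P z - w)) = D j l (t z)" if "j < N" for j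
      by (rule polyalg_cong[OF D[OF that l(1)]]) (auto simp: \<tau>P)
    moreover have "q c j (\<lambda>j. L j (P z - w)) = q c j (u z)" if "j < N" for j
      by (rule polyalg_cong[OF q[OF _ that]]) (auto simp: LP)
    ultimately have "g c (P z) = G l c (t z) (u z)" by (simp add: g_def G_def)
    then show "\<exists>z. g c (P z) \<noteq> 0" using l(2) by metis
  qed
qed

end

section \<open>Calculus of polynomials\<close>

definition mdeg :: "mono \<Rightarrow> nat" where
  "mdeg \<alpha> = (\<Sum>i\<in>Poly_Mapping.keys \<alpha>. Poly_Mapping.lookup \<alpha> i)"

abbreviation cf :: "mpoly \<Rightarrow> mono \<Rightarrow> complex" where
  "cf \<equiv> Poly_Mapping.lookup"

abbreviation unit_mono :: "nat \<Rightarrow> nat \<Rightarrow> mono" where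
  "unit_mono \<equiv> Poly_Mapping.single"

lemma mpoly_sum_monomials: "(\<Sum>\<alpha>\<in>Poly_Mapping.keys p. Poly_Mapping.single \<alpha> (cf p \<alpha>)) = p"
  by (rule poly_mapping_eqI) (auto simp: lookup_sum lookup_single when_def in_keys_iff)

lemma keys_add_mono: "Poly_Mapping.keys (\<alpha> + \<beta> :: mono) = Poly_Mapping.keys \<alpha> \<union> Poly_Mapping.keys \<beta>"
  by (auto simp: in_keys_iff lookup_add)

lemma mdeg_superset: "finite A \<Longrightarrow> Poly_Mapping.keys \<alpha> \<subseteq> A \<Longrightarrow> mdeg \<alpha> = (\<Sum>i\<in>A. Poly_Mapping.lookup \<alpha> i)"
  unfolding mdeg_def by (rule sum.mono_neutral_left) (auto simp: in_keys_iff)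

lemma mdeg_add: "mdeg (\<alpha> + \<beta>) = mdeg \<alpha> + mdeg \<beta>"
proof -
  let ?A = "Poly_Mapping.keys \<alpha> \<union> Poly_Mapping.keys \<beta>"
  have "mdeg (\<alpha> + \<beta>) = (\<Sum>i\<in>?A. Poly_Mapping.lookup \<alpha> i) + (\<Sum>i\<in>?A. Poly_Mapping.lookup \<beta> i)"
    by (simp add: mdeg_def keys_add_mono lookup_add sum.distrib)
  then show ?thesis by (simp add: mdeg_superset[of ?A \<alpha>] mdeg_superset[of ?A \<beta>])
qed

lemma cf_monomial_mult:
  "cf (Poly_Mapping.single \<alpha> c * p) (\<alpha> + \<gamma>) = c * cf p \<gamma>"
  "(\<And>\<gamma>. \<kappa> \<noteq> \<alpha> + \<gamma>) \<Longrightarrow> cf (Poly_Mapping.single \<alpha> c * p) \<kappa> = 0"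
proof -
  have "cf (Poly_Mapping.single \<alpha> c * p) (\<alpha> + \<gamma>) =
    (\<Sum>(\<beta>, \<gamma>')\<in>{(\<alpha>, \<gamma>)}. cf (Poly_Mapping.single \<alpha> c) \<beta> * cf p \<gamma>')"
    unfolding lookup_times
    by (rule sum.mono_neutral_right) (use finite_decomp in \<open>auto simp: lookup_single when_def split: if_splits\<close>)
  then show "cf (Poly_Mapping.single \<alpha> c * p) (\<alpha> + \<gamma>) = c * cf p \<gamma>" by simp
  show "cf (Poly_Mapping.single \<alpha> c * p) \<kappa> = 0" if "\<And>\<gamma>. \<kappa> \<noteq> \<alpha> + \<gamma>"
    unfolding lookup_times by (rule sum.neutral) (use that in \<open>auto simp: lookup_single when_def\<close>)
qed

lemma pderiv_add: "pderiv_var i (p + q) = pderiv_var i p + pderiv_var i q"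
  by (rule poly_mapping_eqI) (simp add: lookup_pderiv_var lookup_add algebra_simps)

lemma pderiv_diff: "pderiv_var i (p - q) = pderiv_var i p - pderiv_var i q"
  by (rule poly_mapping_eqI) (simp add: lookup_pderiv_var lookup_minus algebra_simps)

lemma pderiv_0: "pderiv_var i 0 = 0"
  by (rule poly_mapping_eqI) (simp add: lookup_pderiv_var)

lemma pderiv_sum: "pderiv_var i (\<Sum>a\<in>A. f a) = (\<Sum>a\<in>A. pderiv_var i (f a))"
  by (induction A rule: infinite_finite_induct) (auto simp: pderiv_0 pderiv_add)

lemma pderiv_commute: "pderiv_var i (pderiv_var j p) = pderiv_var j (pderiv_var i p)"
  by (rule poly_mapping_eqI)
    (auto simp: lookup_pderiv_var lookup_add lookup_single when_def ac_simps)

lemma pderiv_single: "pderiv_var i (Poly_Mapping.single \<alpha> c) =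
  Poly_Mapping.single (\<alpha> - unit_mono i 1) (of_nat (Poly_Mapping.lookup \<alpha> i) * c)"
  by (cases "c = 0") (simp_all add: pderiv_var_def)

lemma pderiv_mult: "pderiv_var i (p * q) = pderiv_var i p * q + p * pderiv_var i q"
proof -
  have mono: "pderiv_var i (Poly_Mapping.single \<alpha> a * Poly_Mapping.single \<beta> b) =
      pderiv_var i (Poly_Mapping.single \<alpha> a) * Poly_Mapping.single \<beta> b +
      Poly_Mapping.single \<alpha> a * pderiv_var i (Poly_Mapping.single \<beta> b)" for \<alpha> \<beta> :: mono and a b :: complex
  proof -
    \<comment> \<open>Subtraction of exponents is truncated. If the variable does not occur, this
      identity can fail, but then the derivative has coefficient 0.\<close>
    have 1: "\<alpha> - unit_mono i 1 + \<beta> = \<alpha> + \<beta> - unit_mono i 1" if "Poly_Mapping.lookup \<alpha> i \<noteq> 0" for \<alpha> \<beta> :: mono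
      using that by (intro poly_mapping_eqI) (auto simp: lookup_add lookup_minus lookup_single when_def)
    have "Poly_Mapping.single (\<alpha> - unit_mono i 1 + \<beta>) (of_nat (Poly_Mapping.lookup \<alpha> i) * a * b) =
      Poly_Mapping.single (\<alpha> + \<beta> - unit_mono i 1) (of_nat (Poly_Mapping.lookup \<alpha> i) * a * b)"
      by (cases "Poly_Mapping.lookup \<alpha> i = 0") (simp_all add: 1 del: One_nat_def)
    moreover have "Poly_Mapping.single (\<alpha> + (\<beta> - unit_mono i 1)) (a * (of_nat (Poly_Mapping.lookup \<beta> i) * b)) =
      Poly_Mapping.single (\<alpha> + \<beta> - unit_mono i 1) (a * (of_nat (Poly_Mapping.lookup \<beta> i) * b))"
      using 1[of \<beta> \<alpha>] by (cases "Poly_Mapping.lookup \<beta> i = 0") (simp_all add: add.commute del: One_nat_def)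
    ultimately show ?thesis
      by (simp add: mult_single pderiv_single lookup_add single_add algebra_simps del: One_nat_def)
  qed
  let ?S = "\<lambda>p. \<Sum>\<alpha>\<in>Poly_Mapping.keys p. Poly_Mapping.single \<alpha> (cf p \<alpha>)"
  have "pderiv_var i (?S p * ?S q) = pderiv_var i (?S p) * ?S q + ?S p * pderiv_var i (?S q)"
    by (simp add: sum_product pderiv_sum mono sum.distrib)
  then show ?thesis by (simp only: mpoly_sum_monomials)
qed

lemma pderiv_pconst: "pderiv_var i (pconst c) = 0"
  by (simp add: pconst_def pderiv_single)

lemma pderiv_pconst_mult: "pderiv_var i (pconst c * p) = pconst c * pderiv_var i p"
  by (simp add: pderiv_mult pderiv_pconst)

lemma of_nat_mpoly: "(of_nat n :: mpoly) = pconst (of_nat n)"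
  by (simp add: pconst_def)

lemma pderiv_of_nat_mult: "pderiv_var i (of_nat n * p) = of_nat n * pderiv_var i p"
  by (simp only: of_nat_mpoly pderiv_pconst_mult)

lemma pderiv_pvar: "pderiv_var i (pvar j) = (if i = j then 1 else 0)"
  by (auto simp: pvar_def pderiv_single lookup_single)

lemma pconst_mult_inverse: "c \<noteq> 0 \<Longrightarrow> pconst c * (pconst (1 / c) * p) = p"
  by (simp add: pconst_simps flip: mult.assoc pconst_simps(2))

lemma pconst_eq_0: "pconst c = 0 \<longleftrightarrow> c = 0"
  by (metis pconst_def lookup_single_eq lookup_zero single_zero)

section \<open>Homogeneous polynomials\<close>

lemma mdeg_single [simp]: "mdeg (unit_mono i n) = n"
  by (simp add: mdeg_def)

lemma homog_polys_iff: "p \<in> homog_polys r n \<longleftrightarrow> (\<forall>\<alpha>\<in>Poly_Mapping.keys p. Poly_Mapping.keys \<alpha> \<subseteq> {..r} \<and> mdeg \<alpha> = n)"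
  by (simp add: homog_polys_def mdeg_def)

lemma homog_polysI: "(\<And>\<alpha>. cf p \<alpha> \<noteq> 0 \<Longrightarrow> Poly_Mapping.keys \<alpha> \<subseteq> {..r} \<and> mdeg \<alpha> = n) \<Longrightarrow> p \<in> homog_polys r n"
  by (auto simp: homog_polys_iff in_keys_iff)

lemma homog_polysD: "p \<in> homog_polys r n \<Longrightarrow> cf p \<alpha> \<noteq> 0 \<Longrightarrow> Poly_Mapping.keys \<alpha> \<subseteq> {..r} \<and> mdeg \<alpha> = n"
  by (auto simp: homog_polys_iff in_keys_iff)

lemma homog_uminus: "p \<in> homog_polys r n \<Longrightarrow> - p \<in> homog_polys r n"
  by (rule homog_polysI) (auto dest: homog_polysD)

lemma homog_diff: "p \<in> homog_polys r n \<Longrightarrow> q \<in> homog_polys r n \<Longrightarrow> p - q \<in> homog_polys r n"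
  using homog_polys_closed(2)[of p r n "- q"] homog_uminus[of q r n] by simp

lemma homog_sum: "(\<And>a. a \<in> A \<Longrightarrow> f a \<in> homog_polys r n) \<Longrightarrow> (\<Sum>a\<in>A. f a) \<in> homog_polys r n"
  by (induction A rule: infinite_finite_induct) (auto simp: homog_polys_closed)

lemma homog_mult:
  assumes "p \<in> homog_polys r m" "q \<in> homog_polys r n" shows "p * q \<in> homog_polys r (m + n)"
  unfolding homog_polys_iff
proof
  fix \<alpha> assume "\<alpha> \<in> Poly_Mapping.keys (p * q)"
  then obtain \<beta> \<gamma> where "\<alpha> = \<beta> + \<gamma>" "\<beta> \<in> Poly_Mapping.keys p" "\<gamma> \<in> Poly_Mapping.keys q"
    using keys_mult by blast
  then show "Poly_Mapping.keys \<alpha> \<subseteq> {..r} \<and> mdeg \<alpha> = m + n"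
    using assms by (simp add: keys_add_mono mdeg_add homog_polys_iff)
qed

lemma homog_pconst: "pconst c \<in> homog_polys r 0"
  by (rule homog_polysI) (auto simp: pconst_def lookup_single when_def mdeg_def split: if_splits)

lemma homog_of_nat_mult: "p \<in> homog_polys r n \<Longrightarrow> of_nat k * p \<in> homog_polys r n"
  unfolding of_nat_mpoly by (rule homog_polys_closed(3))

lemma homog_pvar: "i \<le> r \<Longrightarrow> pvar i \<in> homog_polys r 1"
  by (rule homog_polysI) (auto simp: pvar_def lookup_single when_def split: if_splits)

lemma homog_pderiv: "p \<in> homog_polys r n \<Longrightarrow> pderiv_var i p \<in> homog_polys r (n - 1)"
proof (rule homog_polysI)
  fix \<alpha> assume p: "p \<in> homog_polys r n" and "cf (pderiv_var i p) \<alpha> \<noteq> 0"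
  then have "cf p (\<alpha> + unit_mono i 1) \<noteq> 0" by (auto simp: lookup_pderiv_var)
  from homog_polysD[OF p this] show "Poly_Mapping.keys \<alpha> \<subseteq> {..r} \<and> mdeg \<alpha> = n - 1"
    unfolding keys_add_mono mdeg_add by auto
qed

lemma homog_pderiv_outside: "p \<in> homog_polys r n \<Longrightarrow> i > r \<Longrightarrow> pderiv_var i p = 0"
proof (rule poly_mapping_eqI, rule ccontr)
  fix \<alpha> assume p: "p \<in> homog_polys r n" and "i > r" "cf (pderiv_var i p) \<alpha> \<noteq> cf 0 \<alpha>"
  then have "cf p (\<alpha> + unit_mono i 1) \<noteq> 0" by (auto simp: lookup_pderiv_var)
  from homog_polysD[OF p this] show False using \<open>i > r\<close> unfolding keys_add_mono by auto
qed

lemma homog_pderiv_const: "p \<in> homog_polys r 0 \<Longrightarrow> pderiv_var i p = 0"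
proof (rule poly_mapping_eqI, rule ccontr)
  fix \<alpha> assume p: "p \<in> homog_polys r 0" and "cf (pderiv_var i p) \<alpha> \<noteq> cf 0 \<alpha>"
  then have "cf p (\<alpha> + unit_mono i 1) \<noteq> 0" by (auto simp: lookup_pderiv_var)
  from homog_polysD[OF p this] show False unfolding mdeg_add by auto
qed

text \<open>The operator \<open>pvar i * pderiv_var i\<close> is diagonal on monomials with the
  exponent of variable \<open>i\<close> as eigenvalue; the eigenvalues add up to the degree.\<close>

lemma euler_identity:
  assumes "p \<in> homog_polys r n"
  shows "(\<Sum>i\<le>r. pvar i * pderiv_var i p) = of_nat n * p"
proof (rule poly_mapping_eqI)
  fix \<alpha>
  have "cf (pvar i * pderiv_var i p) \<alpha> = of_nat (Poly_Mapping.lookup \<alpha> i) * cf p \<alpha>" for i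
  proof (cases "Poly_Mapping.lookup \<alpha> i = 0")
    case True
    then have "\<alpha> \<noteq> unit_mono i 1 + \<gamma>" for \<gamma> by (auto simp: lookup_add)
    then show ?thesis using True unfolding pvar_def by (simp add: cf_monomial_mult(2))
  next
    case False
    then have "\<alpha> = unit_mono i 1 + (\<alpha> - unit_mono i 1)"
      by (intro poly_mapping_eqI) (auto simp: lookup_add lookup_minus lookup_single when_def)
    then obtain \<gamma> where "\<alpha> = unit_mono i 1 + \<gamma>" by blast
    then show ?thesis unfolding pvar_def
      by (simp only: cf_monomial_mult(1)) (simp add: lookup_pderiv_var lookup_add add.commute)
  qed
  then have "cf (\<Sum>i\<le>r. pvar i * pderiv_var i p) \<alpha> = of_nat (\<Sum>i\<le>r. Poly_Mapping.lookup \<alpha> i) * cf p \<alpha>"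
    by (simp add: lookup_sum sum_distrib_right)
  also have "\<dots> = of_nat n * cf p \<alpha>"
    using homog_polysD[OF assms, of \<alpha>] mdeg_superset[of "{..r}" \<alpha>] by (cases "cf p \<alpha> = 0") auto
  finally show "cf (\<Sum>i\<le>r. pvar i * pderiv_var i p) \<alpha> = cf (of_nat n * p) \<alpha>"
    by (simp add: of_nat_mpoly lookup_pconst)
qed

section \<open>Selecting monomials and homogeneous components\<close>

definition keep :: "(mono \<Rightarrow> bool) \<Rightarrow> mpoly \<Rightarrow> mpoly" where
  "keep P p = (\<Sum>\<alpha>\<in>{\<alpha> \<in> Poly_Mapping.keys p. P \<alpha>}. Poly_Mapping.single \<alpha> (cf p \<alpha>))"

lemma cf_keep: "cf (keep P p) \<alpha> = (if P \<alpha> then cf p \<alpha> else 0)"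
  by (auto simp: keep_def lookup_sum lookup_single when_def in_keys_iff)

lemma keep_add: "keep P (p + q) = keep P p + keep P q"
  by (rule poly_mapping_eqI) (simp add: cf_keep lookup_add)

lemma keep_split: "keep P p + keep (\<lambda>\<alpha>. \<not> P \<alpha>) p = p"
  by (rule poly_mapping_eqI) (simp add: cf_keep lookup_add)

text \<open>If every monomial of \<open>u\<close> translates the condition \<open>Q\<close> to the
  same condition \<open>P\<close>, no monomial of the product is selected in part. This covers
  projection to a degree as well as factors that avoid certain variables.\<close>

lemma keep_mult:
  assumes "\<And>\<beta> \<gamma>. \<beta> \<in> Poly_Mapping.keys u \<Longrightarrow> Q (\<beta> + \<gamma>) \<longleftrightarrow> P \<gamma>"
  shows "keep Q (u * f) = u * keep P f"
proof -
  have 1: "keep Q (u * keep P f) = u * keep P f"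
  proof (rule poly_mapping_eqI)
    fix \<alpha>
    have "Q \<alpha>" if "\<alpha> \<in> Poly_Mapping.keys (u * keep P f)"
      using that keys_mult[of u "keep P f"] assms by (auto simp: in_keys_iff cf_keep split: if_splits)
    then show "cf (keep Q (u * keep P f)) \<alpha> = cf (u * keep P f) \<alpha>"
      by (auto simp: cf_keep in_keys_iff)
  qed
  have 2: "keep Q (u * keep (\<lambda>\<alpha>. \<not> P \<alpha>) f) = 0"
  proof (rule poly_mapping_eqI)
    fix \<alpha>
    have "\<not> Q \<alpha>" if "\<alpha> \<in> Poly_Mapping.keys (u * keep (\<lambda>\<alpha>. \<not> P \<alpha>) f)"
      using that keys_mult[of u "keep (\<lambda>\<alpha>. \<not> P \<alpha>) f"] assms by (auto simp: in_keys_iff cf_keep split: if_splits)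
    then show "cf (keep Q (u * keep (\<lambda>\<alpha>. \<not> P \<alpha>) f)) \<alpha> = cf 0 \<alpha>"
      by (auto simp: cf_keep in_keys_iff)
  qed
  have "keep Q (u * f) = keep Q (u * keep P f + u * keep (\<lambda>\<alpha>. \<not> P \<alpha>) f)"
    by (simp only: keep_split flip: distrib_left)
  then show ?thesis by (simp add: keep_add 1 2)
qed

definition homog_comp :: "nat \<Rightarrow> nat \<Rightarrow> mpoly \<Rightarrow> mpoly" where
  "homog_comp r n = keep (\<lambda>\<alpha>. Poly_Mapping.keys \<alpha> \<subseteq> {..r} \<and> mdeg \<alpha> = n)"

lemma homog_comp_in: "homog_comp r n p \<in> homog_polys r n"
  by (rule homog_polysI) (auto simp: homog_comp_def cf_keep split: if_splits)

lemma homog_comp_id: "p \<in> homog_polys r n \<Longrightarrow> homog_comp r n p = p"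
  by (rule poly_mapping_eqI) (auto simp: homog_comp_def cf_keep dest: homog_polysD)

lemma homog_comp_add: "homog_comp r n (p + q) = homog_comp r n p + homog_comp r n q"
  by (simp add: homog_comp_def keep_add)

lemma homog_comp_diff: "homog_comp r n (p - q) = homog_comp r n p - homog_comp r n q"
  using homog_comp_add[of r n "p - q" q] by simp

lemma homog_comp_mult:
  assumes "u \<in> homog_polys r m"
  shows "homog_comp r n (u * f) = (if m \<le> n then u * homog_comp r (n - m) f else 0)"
proof (cases "m \<le> n")
  case True
  have "keep (\<lambda>\<alpha>. Poly_Mapping.keys \<alpha> \<subseteq> {..r} \<and> mdeg \<alpha> = n) (u * f) =
    u * keep (\<lambda>\<alpha>. Poly_Mapping.keys \<alpha> \<subseteq> {..r} \<and> mdeg \<alpha> = n - m) f"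
    by (rule keep_mult) (use assms True in \<open>auto simp: keys_add_mono mdeg_add homog_polys_iff\<close>)
  then show ?thesis using True by (simp add: homog_comp_def)
next
  case False
  have "keep (\<lambda>\<alpha>. Poly_Mapping.keys \<alpha> \<subseteq> {..r} \<and> mdeg \<alpha> = n) (u * f) = u * keep (\<lambda>_. False) f"
    by (rule keep_mult) (use assms False in \<open>auto simp: keys_add_mono mdeg_add homog_polys_iff\<close>)
  moreover have "keep (\<lambda>_. False) f = 0" by (simp add: keep_def)
  ultimately show ?thesis using False by (simp add: homog_comp_def)
qed

section \<open>Division by pure powers\<close>

definition xpow :: "nat \<Rightarrow> nat \<Rightarrow> mpoly" where
  "xpow i n = Poly_Mapping.single (unit_mono i n) 1"

lemma xpow_nonzero: "xpow i n \<noteq> 0"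
  by (metis lookup_single_eq lookup_zero one_neq_zero xpow_def)

lemma homog_xpow: "i \<le> r \<Longrightarrow> xpow i n \<in> homog_polys r n"
  by (rule homog_polysI) (auto simp: xpow_def lookup_single when_def split: if_splits)

lemma cf_xpow_mult:
  "cf (xpow i n * p) (\<kappa> + unit_mono i n) = cf p \<kappa>"
  "cf (xpow i n * p) \<kappa> \<noteq> 0 \<Longrightarrow> n \<le> Poly_Mapping.lookup \<kappa> i"
proof -
  show "cf (xpow i n * p) (\<kappa> + unit_mono i n) = cf p \<kappa>"
    using cf_monomial_mult(1)[of "unit_mono i n" 1 p \<kappa>] by (simp add: xpow_def add.commute)
  assume "cf (xpow i n * p) \<kappa> \<noteq> 0"
  then obtain \<gamma> where "\<kappa> = unit_mono i n + \<gamma>"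
    using cf_monomial_mult(2)[of \<kappa> "unit_mono i n" 1 p] by (auto simp: xpow_def)
  then show "n \<le> Poly_Mapping.lookup \<kappa> i" by (simp add: lookup_add)
qed

lemma xpow_divides:
  assumes "\<And>\<kappa>. cf f \<kappa> \<noteq> 0 \<Longrightarrow> n \<le> Poly_Mapping.lookup \<kappa> i"
  shows "\<exists>g. f = xpow i n * g"
proof -
  have "unit_mono i n + (\<kappa> - unit_mono i n) = \<kappa>" if "n \<le> Poly_Mapping.lookup \<kappa> i" for \<kappa>
    using that by (intro poly_mapping_eqI) (auto simp: lookup_add lookup_minus lookup_single when_def)
  then have "xpow i n * (\<Sum>\<kappa>\<in>Poly_Mapping.keys f. Poly_Mapping.single (\<kappa> - unit_mono i n) (cf f \<kappa>)) =
    (\<Sum>\<kappa>\<in>Poly_Mapping.keys f. Poly_Mapping.single \<kappa> (cf f \<kappa>))"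
    using assms by (simp add: xpow_def sum_distrib_left mult_single in_keys_iff cong: sum.cong_simp)
  then have "f = xpow i n * (\<Sum>\<kappa>\<in>Poly_Mapping.keys f. Poly_Mapping.single (\<kappa> - unit_mono i n) (cf f \<kappa>))"
    by (simp only: mpoly_sum_monomials)
  then show ?thesis ..
qed

text \<open>Membership in a monomial ideal is decided monomial by monomial; a monomial divisible by
  both powers goes to the first summand.\<close>

lemma xpow_divides_split:
  assumes "\<And>\<kappa>. cf f \<kappa> \<noteq> 0 \<Longrightarrow> n \<le> Poly_Mapping.lookup \<kappa> i \<or> m \<le> Poly_Mapping.lookup \<kappa> j"
  shows "\<exists>g h. f = xpow i n * g + xpow j m * h"
proof -
  let ?P = "\<lambda>\<kappa>. n \<le> Poly_Mapping.lookup \<kappa> i"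
  have "\<exists>g. keep ?P f = xpow i n * g"
    by (rule xpow_divides) (simp add: cf_keep split: if_splits)
  moreover have "\<exists>h. keep (\<lambda>\<kappa>. \<not> ?P \<kappa>) f = xpow j m * h"
    by (rule xpow_divides) (use assms in \<open>auto simp add: cf_keep split: if_splits\<close>)
  ultimately obtain g h where "keep ?P f = xpow i n * g" "keep (\<lambda>\<kappa>. \<not> ?P \<kappa>) f = xpow j m * h" by blast
  then have "f = xpow i n * g + xpow j m * h" using keep_split[of ?P f] by simp
  then show ?thesis by blast
qed

lemma xpow_coprime:
  assumes "i \<noteq> j" "xpow i n * P = xpow j m * Q"
  shows "\<exists>C. P = xpow j m * C \<and> Q = xpow i n * C"
proof -
  have "m \<le> Poly_Mapping.lookup \<kappa> j" if "cf P \<kappa> \<noteq> 0" for \<kappa>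
  proof -
    have "cf (xpow j m * Q) (\<kappa> + unit_mono i n) \<noteq> 0"
      using that by (simp add: cf_xpow_mult(1) flip: assms(2))
    from cf_xpow_mult(2)[OF this] show ?thesis using assms(1) by (simp add: lookup_add lookup_single)
  qed
  then obtain C where C: "P = xpow j m * C" using xpow_divides by blast
  then have "xpow j m * (xpow i n * C) = xpow j m * Q" using assms(2) by (simp add: mult.left_commute)
  then have "Q = xpow i n * C" using xpow_nonzero by (metis mult_left_cancel)
  with C show ?thesis by blast
qed

text \<open>Powers of three distinct variables form a Koszul-exact triple. Modulo the second and
  third power the relation forces \<open>A\<close> to vanish, and after subtracting this part, a
  relation between two coprime powers is left.\<close>

lemma xpow_koszul:
  assumes "i \<noteq> j" "i \<noteq> k" "j \<noteq> k" and eq: "xpow i a * A + xpow j b * B + xpow k c * C = 0"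
  shows "\<exists>E G H. A = xpow j b * E + xpow k c * G \<and> B = - xpow i a * E + xpow k c * H \<and>
    C = - xpow i a * G - xpow j b * H"
proof -
  have "b \<le> Poly_Mapping.lookup \<kappa> j \<or> c \<le> Poly_Mapping.lookup \<kappa> k" if "cf A \<kappa> \<noteq> 0" for \<kappa>
  proof -
    let ?k = "\<kappa> + unit_mono i a"
    have "cf (xpow i a * A) ?k + cf (xpow j b * B) ?k + cf (xpow k c * C) ?k = 0"
      using arg_cong[OF eq, of "\<lambda>p. cf p ?k"] by (simp add: lookup_add)
    then have "cf (xpow j b * B) ?k \<noteq> 0 \<or> cf (xpow k c * C) ?k \<noteq> 0"
      using that by (auto simp: cf_xpow_mult(1))
    then show ?thesis
      using cf_xpow_mult(2)[of j b B ?k] cf_xpow_mult(2)[of k c C ?k] assms(1,2)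
      by (auto simp: lookup_add lookup_single)
  qed
  then obtain E G where A: "A = xpow j b * E + xpow k c * G" using xpow_divides_split by blast
  have "xpow j b * (B + xpow i a * E) = xpow k c * (- C - xpow i a * G)"
    using eq unfolding A by (simp add: algebra_simps add_eq_0_iff2)
  then obtain H where H: "B + xpow i a * E = xpow k c * H" "- C - xpow i a * G = xpow j b * H"
    using xpow_coprime[OF assms(3)] by blast
  have "B = - xpow i a * E + (B + xpow i a * E)" "C = - xpow i a * G - (- C - xpow i a * G)" by simp_all
  then have "B = - xpow i a * E + xpow k c * H" "C = - xpow i a * G - xpow j b * H"
    unfolding H .
  with A show ?thesis by blast
qed

text \<open>The coefficient 2 in \<open>vform\<close> requires nonzero scalars. Dividing by the
  products of two scalars keeps the signs and the shared cofactors consistent in all three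
  equations.\<close>

lemma xpow_koszul_scaled:
  assumes "i \<noteq> j" "i \<noteq> k" "j \<noteq> k" "s \<noteq> 0" "t \<noteq> 0" "u \<noteq> 0"
    and w: "wi = pconst s * xpow i a" "wj = pconst t * xpow j b" "wk = pconst u * xpow k c"
    and eq: "wi * A + wj * B + wk * C = 0"
  shows "\<exists>E G H. A = wj * E + wk * G \<and> B = - wi * E + wk * H \<and> C = - wi * G - wj * H"
proof -
  have "xpow i a * (pconst s * A) + xpow j b * (pconst t * B) + xpow k c * (pconst u * C) = 0"
    using eq by (simp add: w mult_ac)
  from xpow_koszul[OF assms(1-3) this] obtain E G H
    where 1: "pconst s * A = xpow j b * E + xpow k c * G" "pconst t * B = - xpow i a * E + xpow k c * H"
      "pconst u * C = - xpow i a * G - xpow j b * H" by blast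
  define st su tu where "st = pconst (1 / (s * t))" "su = pconst (1 / (s * u))" "tu = pconst (1 / (t * u))"
  have inv: "pconst s * pconst t * st = 1" "pconst s * pconst u * su = 1" "pconst t * pconst u * tu = 1"
    using assms(4-6) by (simp_all add: st_su_tu_def flip: pconst_simps(2)) (simp_all add: pconst_simps(3))
  have "pconst s * (wj * (st * E) + wk * (su * G)) =
      (pconst s * pconst t * st) * (xpow j b * E) + (pconst s * pconst u * su) * (xpow k c * G)"
    by (simp add: w algebra_simps)
  also have "\<dots> = pconst s * A" by (simp add: inv 1)
  finally have A: "A = wj * (st * E) + wk * (su * G)"
    using assms(4) by (simp add: pconst_eq_0)
  have "pconst t * (- wi * (st * E) + wk * (tu * H)) =
      - ((pconst s * pconst t * st) * (xpow i a * E)) + (pconst t * pconst u * tu) * (xpow k c * H)"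
    by (simp add: w algebra_simps)
  also have "\<dots> = pconst t * B" by (simp add: inv 1)
  finally have B: "B = - wi * (st * E) + wk * (tu * H)"
    using assms(5) by (simp add: pconst_eq_0)
  have "pconst u * (- wi * (su * G) - wj * (tu * H)) =
      - ((pconst s * pconst u * su) * (xpow i a * G)) - (pconst t * pconst u * tu) * (xpow j b * H)"
    by (simp add: w algebra_simps)
  also have "\<dots> = pconst u * C" by (simp add: inv 1)
  finally have C: "C = - wi * (su * G) - wj * (tu * H)"
    using assms(6) by (simp add: pconst_eq_0)
  show ?thesis using A B C by blast
qed

section \<open>A pencil with a small singular locus\<close>

text \<open>
  The differentials of \<open>x\<^sub>0\<^sup>a + x\<^sub>1\<^sup>a + x\<^sub>2\<^sup>a\<close> and \<open>x\<^sub>1\<^sup>b + 2 x\<^sub>2\<^sup>b + x\<^sub>3\<^sup>b\<close>, up to constants, with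
  \<open>p = a - 1\<close> and \<open>q = b - 1\<close>. The factor 2 keeps the minor in the columns 1 and 2 nonzero for
  \<open>p = q\<close>. The 2x2 minors have no common zero in codimension 2, which is what division by
  \<open>u \<and> v\<close> needs.
\<close>

definition uform :: "nat \<Rightarrow> nat \<Rightarrow> mpoly" where
  "uform p i = (if i \<le> 2 then xpow i p else 0)"

definition vform :: "nat \<Rightarrow> nat \<Rightarrow> mpoly" where
  "vform q i = (if i = 1 \<or> i = 3 then xpow i q else if i = 2 then pconst 2 * xpow 2 q else 0)"

lemma uform_simps: "uform p 0 = xpow 0 p" "uform p (Suc 0) = xpow 1 p" "uform p 2 = xpow 2 p"
  "uform p 3 = 0" "3 < l \<Longrightarrow> uform p l = 0"
  by (simp_all add: uform_def)

lemma vform_simps: "vform q 0 = 0" "vform q (Suc 0) = xpow 1 q" "vform q 2 = pconst 2 * xpow 2 q"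
  "vform q 3 = xpow 3 q" "3 < l \<Longrightarrow> vform q l = 0"
  by (simp_all add: vform_def)

text \<open>The minor involves only the variables 1 and 2, so multiplication by it does not affect
  whether a monomial lies in the ideal generated by powers of the variables 0 and 3. The part of
  \<open>m\<close> outside this ideal is therefore killed by a nonzero polynomial.\<close>

lemma middle_minor_regular:
  assumes "(xpow 1 p * (pconst 2 * xpow 2 q) - xpow 2 p * xpow 1 q) * m = xpow 0 p' * A + xpow 3 q' * B"
  shows "\<exists>A B. m = xpow 0 p' * A + xpow 3 q' * B"
proof (rule xpow_divides_split, rule ccontr)
  let ?W = "xpow 1 p * (pconst 2 * xpow 2 q) - xpow 2 p * xpow 1 q"
  let ?P = "\<lambda>\<kappa>. \<not> (p' \<le> Poly_Mapping.lookup \<kappa> 0 \<or> q' \<le> Poly_Mapping.lookup \<kappa> 3)"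
  fix \<kappa> assume \<kappa>: "cf m \<kappa> \<noteq> 0" "?P \<kappa>"
  let ?e = "unit_mono 1 p + unit_mono 2 q" and ?e' = "unit_mono 2 p + unit_mono 1 q"
  have W: "?W = Poly_Mapping.single ?e 2 - Poly_Mapping.single ?e' 1"
    by (simp only: xpow_def pconst_def mult_single) (simp add: add.commute)
  have "keep ?P (?W * m) = ?W * keep ?P m"
  proof (rule keep_mult)
    fix \<beta> \<gamma> assume "\<beta> \<in> Poly_Mapping.keys ?W"
    then have "\<beta> = ?e \<or> \<beta> = ?e'"
      unfolding W by (auto simp: in_keys_iff lookup_minus lookup_single when_def split: if_splits)
    then have "Poly_Mapping.lookup \<beta> 0 = 0" "Poly_Mapping.lookup \<beta> 3 = 0"
      by (auto simp: lookup_add lookup_single)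
    then show "?P (\<beta> + \<gamma>) \<longleftrightarrow> ?P \<gamma>" by (simp add: lookup_add)
  qed
  moreover have "keep ?P (?W * m) = 0"
  proof (rule poly_mapping_eqI)
    fix \<gamma>
    have "cf (xpow 0 p' * A) \<gamma> = 0 \<and> cf (xpow 3 q' * B) \<gamma> = 0" if "?P \<gamma>"
      using that cf_xpow_mult(2)[of 0 p' A \<gamma>] cf_xpow_mult(2)[of 3 q' B \<gamma>] by blast
    then show "cf (keep ?P (?W * m)) \<gamma> = cf 0 \<gamma>"
      unfolding assms cf_keep lookup_add by simp
  qed
  moreover have "keep ?P m \<noteq> 0"
    using \<kappa> cf_keep[of ?P m \<kappa>] by (intro notI) simp
  ultimately have "?W = 0" by simp
  \<comment> \<open>This coefficient is 2, or 2 - 1 when both monomials coincide.\<close>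
  then have "cf (Poly_Mapping.single ?e 2 - Poly_Mapping.single ?e' 1) ?e = 0" unfolding W by simp
  then show False by (auto simp: lookup_minus lookup_single when_def split: if_splits)
qed

lemma index_cases: obtains "i = 0" | "i = 1" | "i = 2" | "i = 3" | "(3::nat) < i"
  by linarith

text \<open>The hypothesis says that \<open>u \<and> v \<and> \<mu>\<close> vanishes. The forms
  \<open>u\<close> and \<open>v\<close> live on the indices 0 to 3, so pairs of indices fall into
  three types: both beyond 3, where \<open>\<mu>\<close> is zero; one beyond 3, which is division of
  a vector; and both at most 3, governed by a single equation.\<close>

lemma division_by_pencil:
  fixes \<mu> :: "nat \<Rightarrow> nat \<Rightarrow> mpoly" and p q :: nat
  defines "u \<equiv> uform p" and "v \<equiv> vform q"
  assumes anti: "\<And>i j. \<mu> i j = - \<mu> j i"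
    and eq: "\<And>i j k l. (u i * v j - u j * v i) * \<mu> k l - (u i * v k - u k * v i) * \<mu> j l
      + (u i * v l - u l * v i) * \<mu> j k + (u j * v k - u k * v j) * \<mu> i l
      - (u j * v l - u l * v j) * \<mu> i k + (u k * v l - u l * v k) * \<mu> i j = 0"
  shows "\<exists>\<alpha> \<beta>. \<forall>i j. \<mu> i j = u i * \<alpha> j - u j * \<alpha> i + v i * \<beta> j - v j * \<beta> i"
proof -
  have u: "u 0 = xpow 0 p" "u (Suc 0) = xpow (Suc 0) p" "u 2 = xpow 2 p" "u 3 = 0" "\<And>l. 3 < l \<Longrightarrow> u l = 0"
    and v: "v 0 = 0" "v (Suc 0) = xpow (Suc 0) q" "v 2 = pconst 2 * xpow 2 q" "v 3 = xpow 3 q" "\<And>l. 3 < l \<Longrightarrow> v l = 0"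
    by (simp_all add: u_def v_def uform_simps vform_simps)
  have two: "pconst x * (pconst y * z) = pconst (x * y) * z" "pconst 1 * z = z" for x y z
    by (simp_all add: pconst_simps mult.assoc)
  have ne: "(0::nat) \<noteq> 1" "(3::nat) \<noteq> 0" "(0::nat) \<noteq> 3" "(1::nat) \<noteq> 3" by simp_all
  have nz: "u 0 \<noteq> 0" "v 3 \<noteq> 0" by (simp_all add: u v xpow_nonzero)
  \<comment> \<open>For fixed \<open>l\<close> the equations say that the vector
    \<open>\<mu> k l\<close> is dependent on \<open>u\<close> and \<open>v\<close>. Since
    \<open>v 0 = 0\<close> and \<open>u 3 = 0\<close>, the coefficients can only be the quotients of
    \<open>\<mu> 0 l\<close> by \<open>u 0\<close> and of \<open>\<mu> 3 l\<close> by
    \<open>v 3\<close>; coprimality makes these divisions exact.\<close>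
  have mixed: "\<exists>a b. (\<mu> 0 l = u 0 * a + v 0 * b \<and> \<mu> 1 l = u 1 * a + v 1 * b \<and>
      \<mu> 2 l = u 2 * a + v 2 * b \<and> \<mu> 3 l = u 3 * a + v 3 * b)" if l: "3 < l" for l
  proof -
    have e13: "u 0 * v 1 * \<mu> 3 l - u 0 * v 3 * \<mu> 1 l + u 1 * v 3 * \<mu> 0 l = 0"
      using eq[of 0 1 3 l] by (simp add: u v l)
    have e23: "u 0 * v 2 * \<mu> 3 l - u 0 * v 3 * \<mu> 2 l + u 2 * v 3 * \<mu> 0 l = 0"
      using eq[of 0 2 3 l] by (simp add: u v l)
    have "xpow 0 p * (xpow 1 q * \<mu> 3 l - xpow 3 q * \<mu> 1 l) = xpow 1 p * (- (xpow 3 q * \<mu> 0 l))"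
      using e13 by (simp add: u v algebra_simps add_eq_0_iff2)
    from xpow_coprime[OF ne(1) this] have "\<exists>c. - (xpow 3 q * \<mu> 0 l) = xpow 0 p * c" by blast
    then obtain c where c: "- (xpow 3 q * \<mu> 0 l) = xpow 0 p * c" by (elim exE)
    have "xpow 3 q * \<mu> 0 l = xpow 0 p * (- c)" using arg_cong[OF c, of uminus] by simp
    from xpow_coprime[OF ne(2) this] obtain a where a: "\<mu> 0 l = xpow 0 p * a" by blast
    have "xpow 0 p * (xpow 1 q * \<mu> 3 l) = xpow 3 q * (xpow 0 p * \<mu> 1 l - xpow 1 p * \<mu> 0 l)"
      using e13 by (simp add: u v algebra_simps add_eq_0_iff2)
    from xpow_coprime[OF ne(3) this] obtain c' where "xpow 1 q * \<mu> 3 l = xpow 3 q * c'" by blast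
    from xpow_coprime[OF ne(4) this] obtain b where b: "\<mu> 3 l = xpow 3 q * b" by blast
    have "(u 0 * v 3) * (u k * a + v k * b - \<mu> k l) = 0" if "u 0 * v k * \<mu> 3 l - u 0 * v 3 * \<mu> k l + u k * v 3 * \<mu> 0 l = 0" for k
      using that unfolding a b u v by (simp add: algebra_simps)
    then have "u k * a + v k * b - \<mu> k l = 0" if "u 0 * v k * \<mu> 3 l - u 0 * v 3 * \<mu> k l + u k * v 3 * \<mu> 0 l = 0" for k
      using that nz by (metis mult_eq_0_iff)
    from this[OF e13] this[OF e23] show ?thesis
      by (intro exI[of _ a] exI[of _ b]) (simp add: a b u v)
  qed
  then obtain a b where ab: "\<And>l. 3 < l \<Longrightarrow> \<mu> 0 l = u 0 * a l + v 0 * b l \<and> \<mu> 1 l = u 1 * a l + v 1 * b l \<and>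
      \<mu> 2 l = u 2 * a l + v 2 * b l \<and> \<mu> 3 l = u 3 * a l + v 3 * b l" by metis
  have far: "\<mu> k l = 0" if "3 < k" "3 < l" for k l
  proof -
    have "u 0 * v 3 * \<mu> k l = 0" using eq[of 0 3 k l] that by (simp add: u v)
    then show ?thesis using nz by simp
  qed
  have diag: "\<mu> i i = 0" for i
    using anti[of i i] by (metis add_eq_0_iff2 mult_2 mult_eq_0_iff zero_neq_numeral)
  have main: "u 0 * (v 1 * \<mu> 2 3 - v 2 * \<mu> 1 3 + v 3 * \<mu> 1 2) + v 3 * (u 2 * \<mu> 0 1 - u 1 * \<mu> 0 2)
      + (u 1 * v 2 - u 2 * v 1) * \<mu> 0 3 = 0"
    using eq[of 0 1 2 3] by (simp add: u v algebra_simps)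
  \<comment> \<open>Modulo \<open>u 0\<close> and \<open>v 3\<close> the equation reduces to the
    middle minor times \<open>\<mu> 0 3\<close>.\<close>
  have "(xpow 1 p * (pconst 2 * xpow 2 q) - xpow 2 p * xpow 1 q) * \<mu> 0 3 =
      xpow 0 p * (- (v 1 * \<mu> 2 3 - v 2 * \<mu> 1 3 + v 3 * \<mu> 1 2)) + xpow 3 q * (- (u 2 * \<mu> 0 1 - u 1 * \<mu> 0 2))"
    using main by (simp add: u v algebra_simps add_eq_0_iff2)
  then obtain A B where AB: "\<mu> 0 3 = xpow 0 p * A + xpow 3 q * B"
    using middle_minor_regular by blast
  \<comment> \<open>Substituting the decomposition of \<open>\<mu> 0 3\<close> leaves
    \<open>u 0 * P + v 3 * R = 0\<close>, hence a common cofactor \<open>C\<close>. Each half is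
    then a Koszul relation in three variables.\<close>
  define P where "P = v 1 * \<mu> 2 3 - v 2 * \<mu> 1 3 + v 3 * \<mu> 1 2 + (u 1 * v 2 - u 2 * v 1) * A"
  define R where "R = u 2 * \<mu> 0 1 - u 1 * \<mu> 0 2 + (u 1 * v 2 - u 2 * v 1) * B"
  have "xpow 0 p * P = xpow 3 q * (- R)"
    using main unfolding P_def R_def AB by (simp add: u v algebra_simps add_eq_0_iff2)
  from xpow_coprime[OF ne(3) this] obtain C where C: "P = xpow 3 q * C" "- R = xpow 0 p * C" by blast
  have "xpow 0 p * C + xpow 1 p * (v 2 * B - \<mu> 0 2) + xpow 2 p * (\<mu> 0 1 - v 1 * B) = 0"
    using C(2) unfolding R_def by (simp add: u v algebra_simps add_eq_0_iff2)
  from xpow_koszul[OF _ _ _ this] obtain E G H where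
    1: "C = xpow 1 p * E + xpow 2 p * G" "v 2 * B - \<mu> 0 2 = - xpow 0 p * E + xpow 2 p * H"
      "\<mu> 0 1 - v 1 * B = - xpow 0 p * G - xpow 1 p * H" by auto
  have "v 1 * (\<mu> 2 3 - u 2 * A) + v 2 * (u 1 * A - \<mu> 1 3) + v 3 * (\<mu> 1 2 - C) = 0"
    using C(1) unfolding P_def by (simp add: u v algebra_simps)
  from xpow_koszul_scaled[OF _ _ _ _ _ _ _ v(3) _ this, of 1 3 1 1 q q] obtain E' G' H' where
    2: "\<mu> 2 3 - u 2 * A = v 2 * E' + v 3 * G'" "u 1 * A - \<mu> 1 3 = - v 1 * E' + v 3 * H'"
      "\<mu> 1 2 - C = - v 1 * G' - v 2 * H'" by (auto simp: v two)
  define \<alpha> where "\<alpha> l = (if l = 0 then H else if l = 1 then - G else if l = 2 then E else if l = 3 then A else a l)" for l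
  define \<beta> where "\<beta> l = (if l = 0 then - B else if l = 1 then H' else if l = 2 then - G' else if l = 3 then E' else b l)" for l
  have near: "\<mu> 0 1 = v 1 * B - u 0 * G - u 1 * H" "\<mu> 0 2 = v 2 * B + u 0 * E - u 2 * H"
    "\<mu> 0 3 = u 0 * A + v 3 * B" "\<mu> 1 2 = u 1 * E + u 2 * G - v 1 * G' - v 2 * H'"
    "\<mu> 1 3 = u 1 * A + v 1 * E' - v 3 * H'" "\<mu> 2 3 = u 2 * A + v 2 * E' + v 3 * G'"
    using 1 2 AB by (simp_all add: u v algebra_simps)
  have less: "\<mu> i j = u i * \<alpha> j - u j * \<alpha> i + v i * \<beta> j - v j * \<beta> i" if "i < j" for i j
  proof (cases "3 < j")
    case True
    then show ?thesis using far[of i j] ab[of j]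
      by (cases i rule: index_cases) (simp_all add: \<alpha>_def \<beta>_def u(5) v(5))
  next
    case False
    then have "(i = 0 \<and> j = 1) \<or> (i = 0 \<and> j = 2) \<or> (i = 0 \<and> j = 3) \<or> (i = 1 \<and> j = 2) \<or> (i = 1 \<and> j = 3) \<or> (i = 2 \<and> j = 3)"
      using that by linarith
    then show ?thesis using near by (elim disjE) (auto simp: \<alpha>_def \<beta>_def u v algebra_simps)
  qed
  have "\<mu> i j = u i * \<alpha> j - u j * \<alpha> i + v i * \<beta> j - v j * \<beta> i" for i j
  proof (cases i j rule: linorder_cases)
    case greater
    then show ?thesis using less[of j i] anti[of i j] by simp
  qed (simp_all add: less diag)
  then show ?thesis by blast
qed

text \<open>Division by one form: \<open>v\<close> has powers of three distinct variables as
  coefficients, up to a scalar, and the Koszul relation between them supplies \<gamma> on the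
  indices 1 to 3.\<close>

lemma division_by_vform:
  fixes \<mu> :: "nat \<Rightarrow> nat \<Rightarrow> mpoly" and q :: nat
  defines "v \<equiv> vform q"
  assumes anti: "\<And>i j. \<mu> i j = - \<mu> j i"
    and eq: "\<And>i j k. v i * \<mu> j k - v j * \<mu> i k + v k * \<mu> i j = 0"
  shows "\<exists>\<gamma>. \<forall>i j. \<mu> i j = v i * \<gamma> j - v j * \<gamma> i"
proof -
  let ?S = "{1, 2, 3 :: nat}"
  have v: "v (Suc 0) = xpow (Suc 0) q" "v 2 = pconst 2 * xpow 2 q" "v 3 = xpow 3 q"
    by (simp_all add: v_def vform_simps)
  have v0: "v l = 0" if "l \<notin> ?S" for l
    using that by (cases l rule: index_cases) (auto simp: v_def vform_simps)
  have nz: "v 1 \<noteq> 0" by (simp add: v xpow_nonzero)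
  have two: "pconst 2 * (pconst (1 / 2) * z) = z" "pconst (1 / 2) * (pconst 2 * z) = z" for z
    using pconst_mult_inverse[of 2 z] by (simp_all add: mult_ac)
  have mixed: "\<exists>g. \<mu> 1 l = v 1 * g \<and> \<mu> 2 l = v 2 * g \<and> \<mu> 3 l = v 3 * g" if l: "l \<notin> ?S" for l
  proof -
    have "xpow 1 q * \<mu> 2 l = xpow 2 q * (pconst 2 * \<mu> 1 l)"
      using eq[of 1 2 l] l by (simp add: v v0 mult_ac)
    then have "\<exists>c. \<mu> 2 l = xpow 2 q * c \<and> pconst 2 * \<mu> 1 l = xpow 1 q * c"
      by (intro xpow_coprime) simp_all
    then obtain c where c: "\<mu> 2 l = xpow 2 q * c" "pconst 2 * \<mu> 1 l = xpow 1 q * c" by (elim exE conjE)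
    let ?g = "pconst (1 / 2) * c"
    have m1: "\<mu> 1 l = v 1 * ?g"
      using arg_cong[OF c(2), of "\<lambda>x. pconst (1 / 2) * x"] by (simp only: two) (simp add: v mult_ac)
    have "v 2 * ?g = pconst 2 * (pconst (1 / 2) * (xpow 2 q * c))" by (simp only: v mult_ac)
    then have m2: "\<mu> 2 l = v 2 * ?g" by (simp only: two c(1))
    have "v 1 * (\<mu> 3 l - v 3 * ?g) = 0"
      using eq[of 1 3 l] m1 l by (simp add: v0 algebra_simps)
    then have "\<mu> 3 l = v 3 * ?g" using nz by simp
    with m1 m2 show ?thesis by blast
  qed
  then have "\<forall>l. \<exists>g. l \<notin> ?S \<longrightarrow> \<mu> 1 l = v 1 * g \<and> \<mu> 2 l = v 2 * g \<and> \<mu> 3 l = v 3 * g"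
    by blast
  from choice[OF this] obtain g where
    g: "\<And>l. l \<notin> ?S \<Longrightarrow> \<mu> 1 l = v 1 * g l \<and> \<mu> 2 l = v 2 * g l \<and> \<mu> 3 l = v 3 * g l" by blast
  have far: "\<mu> k l = 0" if "k \<notin> ?S" "l \<notin> ?S" for k l
    using eq[of 1 k l] that nz by (simp add: v0)
  have diag: "\<mu> i i = 0" for i
    using anti[of i i] by (metis add_eq_0_iff2 mult_2 mult_eq_0_iff zero_neq_numeral)
  have "v 1 * \<mu> 2 3 + v 2 * (- \<mu> 1 3) + v 3 * \<mu> 1 2 = 0"
    using eq[of 1 2 3] by simp
  then have "\<exists>E G H. \<mu> 2 3 = v 2 * E + v 3 * G \<and> - \<mu> 1 3 = - v 1 * E + v 3 * H \<and> \<mu> 1 2 = - v 1 * G - v 2 * H"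
    by (intro xpow_koszul_scaled[of 1 2 3 1 2 1 "v 1" q "v 2" q "v 3" q])
      (simp_all add: v pconst_simps(3))
  then obtain E G H where near: "\<mu> 2 3 = v 2 * E + v 3 * G" "- \<mu> 1 3 = - v 1 * E + v 3 * H"
    "\<mu> 1 2 = - v 1 * G - v 2 * H" by (elim exE conjE)
  define \<gamma> where "\<gamma> l = (if l = 1 then H else if l = 2 then - G else if l = 3 then E else g l)" for l
  have near': "\<mu> 1 3 = v 1 * E - v 3 * H" using arg_cong[OF near(2), of uminus] by simp
  have in_out: "\<mu> i j = v i * \<gamma> j - v j * \<gamma> i" if "i \<in> ?S" "j \<notin> ?S" for i j
    using that g[of j] by (auto simp: \<gamma>_def v0)
  have in_in: "\<mu> i j = v i * \<gamma> j - v j * \<gamma> i" if "i \<in> ?S" "j \<in> ?S" "i < j" for i j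
  proof -
    have "(i = 1 \<and> j = 2) \<or> (i = 1 \<and> j = 3) \<or> (i = 2 \<and> j = 3)" using that by auto
    then show ?thesis using near near' by (elim disjE) (auto simp: \<gamma>_def algebra_simps)
  qed
  have "\<mu> i j = v i * \<gamma> j - v j * \<gamma> i" for i j
  proof (cases "i \<in> ?S"; cases "j \<in> ?S")
    assume S: "i \<in> ?S" "j \<in> ?S"
    show ?thesis
    proof (cases i j rule: linorder_cases)
      case greater
      then show ?thesis using in_in[of j i] S anti[of i j] by simp
    qed (use in_in S diag in simp_all)
  next
    assume "i \<notin> ?S" "j \<in> ?S"
    then show ?thesis using in_out[of j i] anti[of i j] by simp
  next
    assume "i \<notin> ?S" "j \<notin> ?S"
    then show ?thesis using far v0 by simp
  qed (rule in_out)
  then show ?thesis by blast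
qed

section \<open>The tangent space of the Frobenius equations\<close>

text \<open>In contrast to \<open>one_forms\<close>, the contraction with the radial field is
  arbitrary, because cofactors obtained by division need not satisfy that condition.\<close>

definition hforms :: "nat \<Rightarrow> nat \<Rightarrow> form set" where
  "hforms r n = {\<alpha>. (\<forall>i\<le>r. \<alpha> i \<in> homog_polys r n) \<and> (\<forall>i>r. \<alpha> i = 0)}"

lemma hformsD: "\<alpha> \<in> hforms r n \<Longrightarrow> \<alpha> i \<in> homog_polys r n"
  by (cases "i \<le> r") (auto simp: hforms_def homog_polys_closed)

lemma hforms_outside: "\<alpha> \<in> hforms r n \<Longrightarrow> i > r \<Longrightarrow> \<alpha> i = 0"
  by (simp add: hforms_def)

lemma dform_anti: "dform \<alpha> i j = - dform \<alpha> j i"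
  by (simp add: dform_def)

lemma hforms_dform: "\<alpha> \<in> hforms r n \<Longrightarrow> dform \<alpha> i j \<in> homog_polys r (n - 1)"
  unfolding dform_def by (intro homog_diff homog_pderiv hformsD)

lemma hforms_dform_outside: "\<alpha> \<in> hforms r n \<Longrightarrow> i > r \<or> j > r \<Longrightarrow> dform \<alpha> i j = 0"
  unfolding dform_def
  using homog_pderiv_outside[OF hformsD, of \<alpha> r n] by (auto simp: hforms_outside pderiv_0)

lemma hforms_dform_const: "\<alpha> \<in> hforms r 0 \<Longrightarrow> dform \<alpha> i j = 0"
  unfolding dform_def using homog_pderiv_const[OF hformsD] by simp

lemma d_dform: "pderiv_var i (dform \<alpha> j k) - pderiv_var j (dform \<alpha> i k) + pderiv_var k (dform \<alpha> i j) = 0"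
  unfolding dform_def pderiv_diff
  by (simp add: pderiv_commute[of j i] pderiv_commute[of k i] pderiv_commute[of k j])

text \<open>Division produces cofactors without any degree; their components of the right degree
  satisfy the same identity. Where that degree would be negative, truncated subtraction says
  nothing, so vanishing is stated explicitly.\<close>

lemma project_division:
  fixes w1 w2 :: form and a b :: nat
  assumes \<mu>: "\<And>i j. \<mu> i j \<in> homog_polys r n" "\<And>i j. i > r \<or> j > r \<Longrightarrow> \<mu> i j = 0"
    and w: "w1 \<in> hforms r a" "w2 \<in> hforms r b"
    and eq: "\<And>i j. \<mu> i j = w1 i * \<alpha> j - w1 j * \<alpha> i + w2 i * \<beta> j - w2 j * \<beta> i"
  shows "\<exists>\<alpha>' \<beta>'. \<alpha>' \<in> hforms r (n - a) \<and> (n < a \<longrightarrow> \<alpha>' = 0) \<and> \<beta>' \<in> hforms r (n - b) \<and> (n < b \<longrightarrow> \<beta>' = 0) \<and>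
    (\<forall>i j. \<mu> i j = w1 i * \<alpha>' j - w1 j * \<alpha>' i + w2 i * \<beta>' j - w2 j * \<beta>' i)"
proof -
  define \<alpha>' where "\<alpha>' i = (if i \<le> r \<and> a \<le> n then homog_comp r (n - a) (\<alpha> i) else 0)" for i
  define \<beta>' where "\<beta>' i = (if i \<le> r \<and> b \<le> n then homog_comp r (n - b) (\<beta> i) else 0)" for i
  have "\<mu> i j = w1 i * \<alpha>' j - w1 j * \<alpha>' i + w2 i * \<beta>' j - w2 j * \<beta>' i" for i j
  proof (cases "i \<le> r \<and> j \<le> r")
    case True
    have "\<mu> i j = homog_comp r n (w1 i * \<alpha> j - w1 j * \<alpha> i + w2 i * \<beta> j - w2 j * \<beta> i)"
      unfolding eq[symmetric] by (simp add: homog_comp_id \<mu>(1))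
    then show ?thesis using True
      by (simp add: homog_comp_add homog_comp_diff homog_comp_mult[OF hformsD[OF w(1)]]
          homog_comp_mult[OF hformsD[OF w(2)]] \<alpha>'_def \<beta>'_def)
  next
    case False
    then consider "i > r" | "j > r" by linarith
    then show ?thesis
      by cases (auto simp: \<mu>(2) \<alpha>'_def \<beta>'_def hforms_outside[OF w(1)] hforms_outside[OF w(2)])
  qed
  moreover have "\<alpha>' \<in> hforms r (n - a)" "\<beta>' \<in> hforms r (n - b)"
    by (auto simp: hforms_def \<alpha>'_def \<beta>'_def homog_comp_in homog_polys_closed)
  moreover have "n < a \<longrightarrow> \<alpha>' = 0" "n < b \<longrightarrow> \<beta>' = 0"
    by (auto simp: \<alpha>'_def \<beta>'_def fun_eq_iff)
  ultimately show ?thesis by blast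
qed

text \<open>The homotopy formula for the radial field: the contraction of \<alpha> with it, divided
  by \<open>n + 1\<close>, is a primitive.\<close>

lemma poincare:
  assumes "\<alpha> \<in> hforms r n" and closed: "\<And>i j. dform \<alpha> i j = 0"
  shows "\<exists>G\<in>homog_polys r (n + 1). \<forall>i. \<alpha> i = pderiv_var i G"
proof
  let ?c = "pconst (1 / of_nat (n + 1))"
  let ?S = "\<Sum>i\<le>r. pvar i * \<alpha> i"
  have "?S \<in> homog_polys r (n + 1)"
    using homog_mult[OF homog_pvar hformsD[OF assms(1)]] by (intro homog_sum) (simp add: add.commute)
  then show G: "?c * ?S \<in> homog_polys r (n + 1)" by (rule homog_polys_closed(3))
  show "\<forall>j. \<alpha> j = pderiv_var j (?c * ?S)"
  proof
    fix j
    show "\<alpha> j = pderiv_var j (?c * ?S)"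
    proof (cases "j \<le> r")
      case True
      have "pderiv_var j ?S = (\<Sum>i\<le>r. (if i = j then \<alpha> i else 0) + pvar i * pderiv_var i (\<alpha> j))"
        unfolding pderiv_sum pderiv_mult pderiv_pvar
        using closed[of j] by (intro sum.cong refl) (auto simp: dform_def)
      also have "\<dots> = \<alpha> j + of_nat n * \<alpha> j"
        using True euler_identity[OF hformsD[OF assms(1)], of j] by (simp add: sum.distrib)
      also have "\<dots> = of_nat (n + 1) * \<alpha> j" by (simp add: algebra_simps)
      finally have "pderiv_var j (?c * ?S) = ?c * (pconst (of_nat (n + 1)) * \<alpha> j)"
        by (simp only: pderiv_pconst_mult of_nat_mpoly)
      also have "\<dots> = \<alpha> j"
        using pconst_mult_inverse[of "of_nat (n + 1)" "\<alpha> j"] of_nat_neq_0[of n, where ?'a = complex]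
        by (simp add: mult.left_commute)
      finally show ?thesis by simp
    next
      case False
      then show ?thesis using homog_pderiv_outside[OF G, of j] hforms_outside[OF assms(1)] by simp
    qed
  qed
qed

lemma vform_closed: "pderiv_var i (vform q j) = pderiv_var j (vform q i)"
proof -
  have *: "pderiv_var i (xpow j q) = 0" if "i \<noteq> j" for i j
    using that by (simp add: xpow_def pderiv_single lookup_single)
  show ?thesis by (cases "i = j") (auto simp: vform_def * pderiv_pconst_mult pderiv_0)
qed

lemma uform_closed: "pderiv_var i (uform p j) = pderiv_var j (uform p i)"
proof -
  have *: "pderiv_var i (xpow j q) = 0" if "i \<noteq> j" for i j q
    using that by (simp add: xpow_def pderiv_single lookup_single)
  show ?thesis by (cases "i = j") (auto simp: uform_def * pderiv_0)
qed

lemma hforms_uform: "3 \<le> r \<Longrightarrow> uform p \<in> hforms r p"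
  by (auto simp: hforms_def uform_def homog_xpow homog_polys_closed)

lemma hforms_vform: "3 \<le> r \<Longrightarrow> vform q \<in> hforms r q"
  by (auto simp: hforms_def vform_def homog_xpow homog_polys_closed)

text \<open>Division gives \<open>d\<beta> = v \<and> \<gamma>\<close>, and another differential
  gives \<open>v \<and> d\<gamma> = 0\<close> with \<gamma> of smaller degree. By induction \<gamma>
  is \<open>dG'\<close> up to a multiple of \<open>v\<close>, so \<open>\<beta> + G' v\<close> is
  closed and the Poincare lemma applies.\<close>

lemma exact_modulo_vform:
  assumes "3 \<le> r" "\<beta> \<in> hforms r n"
    and "\<And>i j k. vform q i * dform \<beta> j k - vform q j * dform \<beta> i k + vform q k * dform \<beta> i j = 0"
  shows "\<exists>G\<in>homog_polys r (n + 1). \<exists>H. \<forall>i. \<beta> i = pderiv_var i G + H * vform q i"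
  using assms(2,3)
proof (induction n arbitrary: \<beta> rule: less_induct)
  case (less n)
  have closed: ?case if dz: "\<And>i j. dform \<beta> i j = 0"
  proof -
    obtain G where "G \<in> homog_polys r (n + 1)" "\<forall>i. \<beta> i = pderiv_var i G"
      using poincare[OF less.prems(1) dz] by blast
    then show ?thesis by (intro bexI[of _ G] exI[of _ 0]) auto
  qed
  show ?case
  proof (cases "n = 0")
    case True
    then show ?thesis using closed hforms_dform_const[of \<beta> r] less.prems(1) by blast
  next
    case False
    obtain \<gamma>0 where "\<forall>i j. dform \<beta> i j = vform q i * \<gamma>0 j - vform q j * \<gamma>0 i"
      using division_by_vform[of "dform \<beta>" q, OF dform_anti less.prems(2)] by blast
    \<comment> \<open>Projection to a degree is stated for two forms; the first one is taken to be
      0, of nominal degree \<open>q\<close>.\<close>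
    then have "\<exists>\<alpha> \<gamma>. \<alpha> \<in> hforms r (n - 1 - q) \<and> (n - 1 < q \<longrightarrow> \<alpha> = 0) \<and> \<gamma> \<in> hforms r (n - 1 - q) \<and> (n - 1 < q \<longrightarrow> \<gamma> = 0) \<and>
      (\<forall>i j. dform \<beta> i j = 0 i * \<alpha> j - 0 j * \<alpha> i + vform q i * \<gamma> j - vform q j * \<gamma> i)"
      by (intro project_division hforms_dform less.prems hforms_dform_outside[OF less.prems(1)] hforms_vform assms(1))
        (auto simp: hforms_def homog_polys_closed)
    then obtain \<gamma> where \<gamma>: "\<gamma> \<in> hforms r (n - 1 - q)" "n - 1 < q \<longrightarrow> \<gamma> = 0"
      and eq: "\<And>i j. dform \<beta> i j = vform q i * \<gamma> j - vform q j * \<gamma> i" by auto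
    show ?thesis
    proof (cases "n - 1 < q")
      case True
      then show ?thesis using \<gamma>(2) eq by (intro closed) simp
    next
      case le: False
      have "vform q i * dform \<gamma> j k - vform q j * dform \<gamma> i k + vform q k * dform \<gamma> i j = 0" for i j k
      proof -
        have "vform q i * dform \<gamma> j k - vform q j * dform \<gamma> i k + vform q k * dform \<gamma> i j =
          - (pderiv_var i (dform \<beta> j k) - pderiv_var j (dform \<beta> i k) + pderiv_var k (dform \<beta> i j))"
          unfolding eq pderiv_diff pderiv_mult dform_def[of \<gamma>]
          using vform_closed[of i q j] vform_closed[of i q k] vform_closed[of j q k] by (simp add: algebra_simps)
        then show ?thesis by (simp only: d_dform) simp
      qed
      then obtain G' H' where G': "G' \<in> homog_polys r (n - 1 - q + 1)" "\<And>i. \<gamma> i = pderiv_var i G' + H' * vform q i"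
        using less.IH[of "n - 1 - q" \<gamma>] \<gamma>(1) False by auto
      define \<beta>' where "\<beta>' i = \<beta> i + G' * vform q i" for i
      have deg: "n - 1 - q + 1 + q = n" using le False by simp
      have "\<beta>' \<in> hforms r n"
        using homog_mult[OF G'(1) hformsD[OF hforms_vform[OF assms(1)]], of q] hformsD[OF less.prems(1)]
          hforms_outside[OF less.prems(1)] hforms_outside[OF hforms_vform[OF assms(1)]]
        unfolding deg by (auto simp: hforms_def \<beta>'_def intro!: homog_polys_closed)
      moreover have "dform \<beta>' i j = 0" for i j
      proof -
        have "dform \<beta>' i j = dform \<beta> i j + pderiv_var i G' * vform q j - pderiv_var j G' * vform q i"
          unfolding dform_def \<beta>'_def pderiv_add pderiv_mult using vform_closed[of i q j] by (simp add: algebra_simps)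
        then show ?thesis by (simp add: eq G'(2) algebra_simps)
      qed
      ultimately obtain G where G: "G \<in> homog_polys r (n + 1)" "\<And>i. \<beta>' i = pderiv_var i G"
        using poincare by blast
      show ?thesis
      proof (intro bexI[OF _ G(1)] exI[of _ "- G'"] allI)
        fix i show "\<beta> i = pderiv_var i G + - G' * vform q i"
          unfolding G(2)[symmetric] \<beta>'_def by simp
      qed
    qed
  qed
qed

text \<open>The coefficients of \<open>\<omega> \<and> d\<eta>\<close>. The linearization of
  \<open>\<omega> \<and> d\<omega>\<close> in direction \<eta> is the sum of both orders of the
  arguments.\<close>

definition wedge_lin :: "form \<Rightarrow> form \<Rightarrow> nat \<Rightarrow> nat \<Rightarrow> nat \<Rightarrow> mpoly" where
  "wedge_lin \<omega> \<eta> i j k = \<omega> i * dform \<eta> j k - \<omega> j * dform \<eta> i k + \<omega> k * dform \<eta> i j"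

text \<open>This is \<open>d(\<omega> \<and> d\<eta>) = d\<omega> \<and> d\<eta>\<close>, a
  consequence of \<open>d d = 0\<close>.\<close>

lemma d_wedge_lin:
  "pderiv_var i (wedge_lin \<omega> \<eta> j k l) - pderiv_var j (wedge_lin \<omega> \<eta> i k l)
    + pderiv_var k (wedge_lin \<omega> \<eta> i j l) - pderiv_var l (wedge_lin \<omega> \<eta> i j k) =
   dform \<omega> i j * dform \<eta> k l - dform \<omega> i k * dform \<eta> j l + dform \<omega> i l * dform \<eta> j k
    + dform \<omega> j k * dform \<eta> i l - dform \<omega> j l * dform \<eta> i k + dform \<omega> k l * dform \<eta> i j"
  (is "?lhs = ?rhs")
proof -
  have dd: "pderiv_var i (dform \<eta> j k) = pderiv_var j (dform \<eta> i k) - pderiv_var k (dform \<eta> i j)" for i j k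
    using d_dform[of i \<eta> j k] by (simp add: algebra_simps add_eq_0_iff2)
  show ?thesis
    unfolding wedge_lin_def pderiv_add pderiv_diff pderiv_mult dform_def[of \<omega>]
    by (simp add: dd[of i j k] dd[of i j l] dd[of i k l] dd[of j k l] algebra_simps)
qed

lemma one_forms_hforms: "\<eta> \<in> one_forms r m \<Longrightarrow> \<eta> \<in> hforms r (m - 1)"
  by (simp add: one_forms_def hforms_def)

lemma pderiv_of_nat: "pderiv_var i (of_nat n) = 0"
  by (simp only: of_nat_mpoly pderiv_pconst)

lemma dform_rho:
  assumes F: "F0 \<in> homog_polys r d0" "F1 \<in> homog_polys r d1"
  shows "dform (rho r d0 d1 F0 F1) i j =
    of_nat (d0 + d1) * (pderiv_var i F0 * pderiv_var j F1 - pderiv_var j F0 * pderiv_var i F1)"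
proof -
  have rho: "rho r d0 d1 F0 F1 i = of_nat d0 * (F0 * pderiv_var i F1) - of_nat d1 * (F1 * pderiv_var i F0)" for i
    using homog_pderiv_outside[OF F(1), of i] homog_pderiv_outside[OF F(2), of i] by (simp add: rho_def mult.assoc)
  show ?thesis
    unfolding dform_def rho pderiv_diff pderiv_of_nat_mult pderiv_commute[of j i]
    by (simp add: pderiv_mult pderiv_commute[of j i] pderiv_of_nat algebra_simps)
qed

text \<open>Cartan's formula for the radial field \<open>R\<close>: the contraction of \<eta> with
  \<open>R\<close> is zero, so the Lie derivative \<open>m \<eta>\<close> equals the contraction of
  \<open>d\<eta>\<close>. Hence it is enough to determine \<open>d\<eta>\<close>.\<close>

lemma form_from_differential:
  assumes "\<eta> \<in> one_forms r m" "m \<ge> 1"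
  shows "of_nat m * \<eta> j = (\<Sum>i\<le>r. pvar i * dform \<eta> i j)"
proof -
  have \<eta>: "\<eta> j \<in> homog_polys r (m - 1)" using one_forms_hforms[OF assms(1)] by (rule hformsD)
  have 0: "(\<Sum>i\<le>r. \<eta> i * pvar i) = 0" "(\<Sum>i\<le>r. pvar i * \<eta> i) = 0"
    using assms(1) by (simp_all add: one_forms_def mult.commute)
  show ?thesis
  proof (cases "j \<le> r")
    case True
    have "(\<Sum>i\<le>r. pderiv_var j (\<eta> i) * pvar i + (if i = j then \<eta> i else 0)) = pderiv_var j (\<Sum>i\<le>r. \<eta> i * pvar i)"
      unfolding pderiv_sum pderiv_mult pderiv_pvar by (intro sum.cong) auto
    then have "(\<Sum>i\<le>r. pvar i * pderiv_var j (\<eta> i)) = - \<eta> j"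
      using True by (simp add: 0 pderiv_0 sum.distrib mult.commute add_eq_0_iff2)
    moreover have "of_nat m = (of_nat (m - 1) + 1 :: mpoly)"
      using assms(2) by (cases m) simp_all
    ultimately show ?thesis
      using euler_identity[OF \<eta>] by (simp add: dform_def right_diff_distrib sum_subtractf distrib_right)
  next
    case False
    then show ?thesis
      using hforms_outside[OF one_forms_hforms[OF assms(1)]] hforms_dform_outside[OF one_forms_hforms[OF assms(1)], of j]
      by (simp add: hforms_dform_outside[OF one_forms_hforms[OF assms(1)]])
  qed
qed

text \<open>Taking \<open>d\<close> of the linearized equation yields
  \<open>u \<and> v \<and> d\<eta> = 0\<close>, so
  \<open>d\<eta> = u \<and> \<alpha> + v \<and> \<beta>\<close>. Another \<open>d\<close> and
  wedging with \<open>v\<close> or \<open>u\<close> give the same equation for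
  \<open>d\<alpha>\<close> and \<open>d\<beta>\<close>, whose degrees are too small for general
  cofactors. This makes \<alpha> and \<beta> differentials, up to a multiple of \<open>v\<close>,
  and contraction with the radial field returns \<eta>.\<close>

proposition tangent_space_at_pencil:
  assumes r: "3 \<le> r" and d: "1 \<le> d1" "d1 \<le> d0"
    and F0: "F0 \<in> homog_polys r d0" "\<And>i. pderiv_var i F0 = uform (d0 - 1) i"
    and F1: "F1 \<in> homog_polys r d1" "\<And>i. pderiv_var i F1 = vform (d1 - 1) i"
    and \<eta>: "\<eta> \<in> one_forms r (d0 + d1)"
    and lin: "\<And>i j k. wedge_lin (rho r d0 d1 F0 F1) \<eta> i j k + wedge_lin \<eta> (rho r d0 d1 F0 F1) i j k = 0"
  shows "\<exists>G0\<in>homog_polys r d0. \<exists>G1\<in>homog_polys r d1. \<eta> = rho r d0 d1 F0 G1 + rho r d0 d1 G0 F1"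
proof -
  define p q where "p = d0 - 1" and "q = d1 - 1"
  have pq: "q \<le> p" "d0 = Suc p" "d1 = Suc q" "d0 + d1 - 1 = Suc (p + q)" using d by (auto simp: p_def q_def)
  let ?\<omega> = "rho r d0 d1 F0 F1"
  define u v where "u = uform p" and "v = vform q"
  note closed = uform_closed[of _ p, folded u_def] vform_closed[of _ q, folded v_def]
  have uH: "u \<in> hforms r p" and vH: "v \<in> hforms r q"
    using hforms_uform hforms_vform r by (auto simp: u_def v_def)
  have \<eta>H: "\<eta> \<in> hforms r (Suc (p + q))" using one_forms_hforms[OF \<eta>] pq by simp
  have d\<omega>: "dform ?\<omega> i j = of_nat (d0 + d1) * (u i * v j - u j * v i)" for i j
    unfolding dform_rho[OF F0(1) F1(1)] F0(2) F1(2) u_def v_def p_def q_def by (simp add: mult.commute)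
  have cancel2: "x = 0" if "2 * x = 0" for x :: mpoly using that by simp
  have "dform ?\<omega> i j * dform \<eta> k l - dform ?\<omega> i k * dform \<eta> j l + dform ?\<omega> i l * dform \<eta> j k
    + dform ?\<omega> j k * dform \<eta> i l - dform ?\<omega> j l * dform \<eta> i k + dform ?\<omega> k l * dform \<eta> i j = 0"
    (is "?W = 0") for i j k l
  proof -
    let ?L = "\<lambda>i j k. wedge_lin ?\<omega> \<eta> i j k + wedge_lin \<eta> ?\<omega> i j k"
    \<comment> \<open>Both summands have the same differential, because the product of 2-forms is
      symmetric; this is the factor 2.\<close>
    have "pderiv_var i (?L j k l) - pderiv_var j (?L i k l) + pderiv_var k (?L i j l) - pderiv_var l (?L i j k) =
      (pderiv_var i (wedge_lin ?\<omega> \<eta> j k l) - pderiv_var j (wedge_lin ?\<omega> \<eta> i k l)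
        + pderiv_var k (wedge_lin ?\<omega> \<eta> i j l) - pderiv_var l (wedge_lin ?\<omega> \<eta> i j k)) +
      (pderiv_var i (wedge_lin \<eta> ?\<omega> j k l) - pderiv_var j (wedge_lin \<eta> ?\<omega> i k l)
        + pderiv_var k (wedge_lin \<eta> ?\<omega> i j l) - pderiv_var l (wedge_lin \<eta> ?\<omega> i j k))"
      by (simp add: pderiv_add)
    also have "\<dots> = 2 * ?W" unfolding d_wedge_lin by (simp add: algebra_simps)
    finally have "2 * ?W = 0" by (simp add: lin pderiv_0)
    then show "?W = 0" by (rule cancel2)
  qed
  note W = this
  have factor: "N * (m1 * x1 - m2 * x2 + m3 * x3 + m4 * x4 - m5 * x5 + m6 * x6) =
      N * m1 * x1 - N * m2 * x2 + N * m3 * x3 + N * m4 * x4 - N * m5 * x5 + N * m6 * x6"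
    for N m1 m2 m3 m4 m5 m6 x1 x2 x3 x4 x5 x6 :: mpoly by (simp add: algebra_simps)
  have "of_nat (d0 + d1) * ((u i * v j - u j * v i) * dform \<eta> k l - (u i * v k - u k * v i) * dform \<eta> j l
      + (u i * v l - u l * v i) * dform \<eta> j k + (u j * v k - u k * v j) * dform \<eta> i l
      - (u j * v l - u l * v j) * dform \<eta> i k + (u k * v l - u l * v k) * dform \<eta> i j) = 0" for i j k l
    unfolding factor by (rule W[unfolded d\<omega>])
  moreover have "(of_nat (d0 + d1) :: mpoly) \<noteq> 0" using d by (simp add: pq del: of_nat_add of_nat_Suc)
  ultimately have "(u i * v j - u j * v i) * dform \<eta> k l - (u i * v k - u k * v i) * dform \<eta> j l
      + (u i * v l - u l * v i) * dform \<eta> j k + (u j * v k - u k * v j) * dform \<eta> i l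
      - (u j * v l - u l * v j) * dform \<eta> i k + (u k * v l - u l * v k) * dform \<eta> i j = 0" for i j k l
    by (metis mult_eq_0_iff)
  then obtain \<alpha>0 \<beta>0 where "\<forall>i j. dform \<eta> i j = u i * \<alpha>0 j - u j * \<alpha>0 i + v i * \<beta>0 j - v j * \<beta>0 i"
    using division_by_pencil[of "dform \<eta>" p q, OF dform_anti] unfolding u_def v_def by blast
  then have "\<exists>\<alpha> \<beta>. \<alpha> \<in> hforms r (p + q - p) \<and> (p + q < p \<longrightarrow> \<alpha> = 0) \<and> \<beta> \<in> hforms r (p + q - q) \<and> (p + q < q \<longrightarrow> \<beta> = 0) \<and>
      (\<forall>i j. dform \<eta> i j = u i * \<alpha> j - u j * \<alpha> i + v i * \<beta> j - v j * \<beta> i)"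
    using hforms_dform[OF \<eta>H] by (intro project_division uH vH hforms_dform_outside[OF \<eta>H]) auto
  then obtain \<alpha> \<beta> where \<alpha>: "\<alpha> \<in> hforms r q" and \<beta>: "\<beta> \<in> hforms r p"
    and d\<eta>: "\<And>i j. dform \<eta> i j = u i * \<alpha> j - u j * \<alpha> i + v i * \<beta> j - v j * \<beta> i" by auto
  have E: "u i * dform \<alpha> j k - u j * dform \<alpha> i k + u k * dform \<alpha> i j +
      (v i * dform \<beta> j k - v j * dform \<beta> i k + v k * dform \<beta> i j) = 0" (is "?E i j k = 0") for i j k
  proof -
    have "?E i j k = - (pderiv_var i (dform \<eta> j k) - pderiv_var j (dform \<eta> i k) + pderiv_var k (dform \<eta> i j))"
      unfolding d\<eta> pderiv_add pderiv_diff pderiv_mult dform_def[of \<alpha>] dform_def[of \<beta>]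
      using closed(1)[of i j] closed(1)[of i k] closed(1)[of j k] closed(2)[of i j] closed(2)[of i k] closed(2)[of j k]
      by (simp add: algebra_simps)
    then show ?thesis by (simp only: d_dform) simp
  qed
  \<comment> \<open>Wedging \<open>E\<close> with \<open>v\<close> removes the terms in
    \<open>d\<beta>\<close>; below, wedging with \<open>u\<close> removes those in
    \<open>d\<alpha>\<close>.\<close>
  have uv\<alpha>: "(u i * v j - u j * v i) * dform \<alpha> k l - (u i * v k - u k * v i) * dform \<alpha> j l
      + (u i * v l - u l * v i) * dform \<alpha> j k + (u j * v k - u k * v j) * dform \<alpha> i l
      - (u j * v l - u l * v j) * dform \<alpha> i k + (u k * v l - u l * v k) * dform \<alpha> i j = 0" (is "?A = 0") for i j k l
  proof -
    have "?A = - (v i * ?E j k l - v j * ?E i k l + v k * ?E i j l - v l * ?E i j k)"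
      by (simp add: algebra_simps)
    then show ?thesis by (simp only: E) simp
  qed
  have uv\<beta>: "(u i * v j - u j * v i) * dform \<beta> k l - (u i * v k - u k * v i) * dform \<beta> j l
      + (u i * v l - u l * v i) * dform \<beta> j k + (u j * v k - u k * v j) * dform \<beta> i l
      - (u j * v l - u l * v j) * dform \<beta> i k + (u k * v l - u l * v k) * dform \<beta> i j = 0" (is "?B = 0") for i j k l
  proof -
    have "?B = u i * ?E j k l - u j * ?E i k l + u k * ?E i j l - u l * ?E i j k"
      by (simp add: algebra_simps)
    then show ?thesis by (simp only: E) simp
  qed
  have divide: "\<exists>\<alpha>' \<beta>'. \<alpha>' \<in> hforms r (n - 1 - p) \<and> (n - 1 < p \<longrightarrow> \<alpha>' = 0) \<and> \<beta>' \<in> hforms r (n - 1 - q) \<and> (n - 1 < q \<longrightarrow> \<beta>' = 0) \<and>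
      (\<forall>i j. dform \<gamma> i j = u i * \<alpha>' j - u j * \<alpha>' i + v i * \<beta>' j - v j * \<beta>' i)"
    if \<gamma>: "\<gamma> \<in> hforms r n" "\<And>i j k l. (u i * v j - u j * v i) * dform \<gamma> k l - (u i * v k - u k * v i) * dform \<gamma> j l
      + (u i * v l - u l * v i) * dform \<gamma> j k + (u j * v k - u k * v j) * dform \<gamma> i l
      - (u j * v l - u l * v j) * dform \<gamma> i k + (u k * v l - u l * v k) * dform \<gamma> i j = 0" for \<gamma> n
  proof -
    obtain \<alpha>0 \<beta>0 where "\<forall>i j. dform \<gamma> i j = u i * \<alpha>0 j - u j * \<alpha>0 i + v i * \<beta>0 j - v j * \<beta>0 i"
      using division_by_pencil[of "dform \<gamma>" p q, OF dform_anti] \<gamma>(2) unfolding u_def v_def by blast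
    then show ?thesis
      by (intro project_division uH vH hforms_dform hforms_dform_outside[OF \<gamma>(1)] \<gamma>(1)) auto
  qed
  \<comment> \<open>The degree \<open>q - 1\<close> of \<open>d\<alpha>\<close> is below both
    \<open>q\<close> and \<open>p\<close>, so both cofactors vanish. This uses
    \<open>q \<le> p\<close>.\<close>
  have "dform \<alpha> i j = 0" for i j
  proof (cases "q = 0")
    case True
    then show ?thesis using \<alpha> hforms_dform_const by blast
  next
    case False
    then show ?thesis using divide[OF \<alpha> uv\<alpha>] pq(1) by auto
  qed
  then obtain G1 where G1: "G1 \<in> homog_polys r (q + 1)" "\<And>i. \<alpha> i = pderiv_var i G1"
    using poincare[OF \<alpha>] by blast
  \<comment> \<open>The degree \<open>p - 1\<close> of \<open>d\<beta>\<close> excludes only the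
    cofactor of \<open>u\<close>.\<close>
  have "v i * dform \<beta> j k - v j * dform \<beta> i k + v k * dform \<beta> i j = 0" for i j k
  proof (cases "p = 0")
    case True
    then show ?thesis using \<beta> hforms_dform_const by simp
  next
    case False
    then obtain \<beta>' where d\<beta>: "\<And>i j. dform \<beta> i j = v i * \<beta>' j - v j * \<beta>' i" using divide[OF \<beta> uv\<beta>] by auto
    show ?thesis unfolding d\<beta> by (simp add: algebra_simps)
  qed
  then obtain G0 H where G0: "G0 \<in> homog_polys r (p + 1)" "\<And>i. \<beta> i = pderiv_var i G0 + H * v i"
    using exact_modulo_vform[OF r \<beta>, of q] unfolding v_def by blast
  have deg: "F0 \<in> homog_polys r d0" "F1 \<in> homog_polys r d1" "G0 \<in> homog_polys r d0" "G1 \<in> homog_polys r d1"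
    using F0 F1 G0 G1 by (simp_all add: pq)
  define c where "c = pconst (1 / of_nat (d0 + d1))"
  have c: "c * (of_nat (d0 + d1) * x) = x" for x
  proof -
    have N: "(of_nat (d0 + d1) :: complex) \<noteq> 0" unfolding of_nat_eq_0_iff using pq(2) by simp
    have "c * (of_nat (d0 + d1) * x) = pconst (1 / of_nat (d0 + d1) * of_nat (d0 + d1)) * x"
      by (simp only: c_def of_nat_mpoly pconst_simps(2) mult.assoc)
    also have "1 / of_nat (d0 + d1) * of_nat (d0 + d1) = (1 :: complex)" using N by (rule nonzero_eq_divide_eq[THEN iffD1, OF _ refl])
    finally show ?thesis by (simp only: pconst_simps(3) mult_1)
  qed
  have dc: "pderiv_var i (c * x) = c * pderiv_var i x" for i x by (simp add: c_def pderiv_pconst_mult)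
  have contract: "(\<Sum>i\<le>r. pvar i * (pderiv_var i A * b)) = of_nat n * A * b" if "A \<in> homog_polys r n" for A b n
    by (simp only: euler_identity[OF that, symmetric] sum_distrib_right mult.assoc)
  \<comment> \<open>The summand \<open>H * v\<close> of \<beta> drops out of
    \<open>v \<and> \<beta>\<close>. The minus sign turns \<open>dF1 \<and> dG0\<close> into the
    order of arguments used by \<open>rho\<close>.\<close>
  have "\<eta> j = rho r d0 d1 F0 (c * G1) j + rho r d0 d1 (- (c * G0)) F1 j" for j
  proof (cases "j \<le> r")
    case True
    have "of_nat (d0 + d1) * \<eta> j = (\<Sum>i\<le>r. pvar i * (pderiv_var i F0 * pderiv_var j G1)
        - pvar i * (pderiv_var i G1 * pderiv_var j F0) + pvar i * (pderiv_var i F1 * pderiv_var j G0)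
        - pvar i * (pderiv_var i G0 * pderiv_var j F1))"
      unfolding form_from_differential[OF \<eta> trans_le_add2[OF d(1)]] d\<eta> G1(2) G0(2)
      by (intro sum.cong refl) (simp add: F0(2) F1(2) u_def v_def p_def q_def algebra_simps)
    also have "\<dots> = of_nat d0 * F0 * pderiv_var j G1 - of_nat d1 * G1 * pderiv_var j F0
        + of_nat d1 * F1 * pderiv_var j G0 - of_nat d0 * G0 * pderiv_var j F1"
      by (simp only: sum_subtractf sum.distrib contract[OF deg(1)] contract[OF deg(2)] contract[OF deg(3)] contract[OF deg(4)])
    finally have "c * (of_nat (d0 + d1) * \<eta> j) = c * (of_nat d0 * F0 * pderiv_var j G1
        - of_nat d1 * G1 * pderiv_var j F0 + of_nat d1 * F1 * pderiv_var j G0 - of_nat d0 * G0 * pderiv_var j F1)"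
      by (rule arg_cong)
    then have \<eta>j: "\<eta> j = c * (of_nat d0 * F0 * pderiv_var j G1
        - of_nat d1 * G1 * pderiv_var j F0 + of_nat d1 * F1 * pderiv_var j G0 - of_nat d0 * G0 * pderiv_var j F1)"
      unfolding c .
    have neg: "pderiv_var j (- (c * G0)) = - (c * pderiv_var j G0)"
      using pderiv_diff[of j 0 "c * G0"] by (simp add: pderiv_0 dc)
    show ?thesis
      by (simp only: \<eta>j rho_def True if_True neg dc) (simp add: algebra_simps)
  next
    case False
    then show ?thesis using hforms_outside[OF \<eta>H] by (simp add: rho_def)
  qed
  then have \<eta>': "\<eta> = rho r d0 d1 F0 (c * G1) + rho r d0 d1 (- (c * G0)) F1" by (intro ext) simp
  have cG: "c * G \<in> homog_polys r n" if "G \<in> homog_polys r n" for G n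
    unfolding c_def using that by (rule homog_polys_closed(3))
  show ?thesis
    by (intro bexI[of _ "- (c * G0)"] bexI[of _ "c * G1"] \<eta>' cG homog_uminus deg)
qed

lemma pencil_exists:
  assumes r: "3 \<le> r" and d: "1 \<le> d0" "1 \<le> d1"
  obtains F0 F1 where "F0 \<in> homog_polys r d0" "F1 \<in> homog_polys r d1"
    "\<And>i. pderiv_var i F0 = uform (d0 - 1) i" "\<And>i. pderiv_var i F1 = vform (d1 - 1) i"
proof -
  have dx: "pconst (1 / of_nat n) * pderiv_var i (xpow j n) = (if i = j then xpow j (n - 1) else 0)"
    if "1 \<le> n" for i j n
  proof (cases "i = j")
    case True
    have "unit_mono j n - unit_mono j 1 = unit_mono j (n - 1)"
      by (rule poly_mapping_eqI) (auto simp: lookup_minus lookup_single when_def)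
    then show ?thesis using that True by (simp add: xpow_def pderiv_single pconst_def mult_single)
  qed (simp add: xpow_def pderiv_single lookup_single)
  let ?F0 = "pconst (1 / of_nat d0) * (xpow 0 d0 + xpow 1 d0 + xpow 2 d0)"
  let ?F1 = "pconst (1 / of_nat d1) * (xpow 1 d1 + pconst 2 * xpow 2 d1 + xpow 3 d1)"
  show ?thesis
  proof (rule that[of ?F0 ?F1])
    show "?F0 \<in> homog_polys r d0" "?F1 \<in> homog_polys r d1"
      using r by (auto intro!: homog_polys_closed homog_xpow)
    fix i
    have "pderiv_var i ?F0 = pconst (1 / of_nat d0) * pderiv_var i (xpow 0 d0) +
      pconst (1 / of_nat d0) * pderiv_var i (xpow 1 d0) + pconst (1 / of_nat d0) * pderiv_var i (xpow 2 d0)"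
      by (simp only: pderiv_pconst_mult pderiv_add distrib_left)
    then show "pderiv_var i ?F0 = uform (d0 - 1) i"
      unfolding dx[OF d(1)] by (cases i rule: index_cases) (simp_all add: uform_def)
    have "pderiv_var i ?F1 = pconst (1 / of_nat d1) * pderiv_var i (xpow 1 d1) +
      pconst 2 * (pconst (1 / of_nat d1) * pderiv_var i (xpow 2 d1)) + pconst (1 / of_nat d1) * pderiv_var i (xpow 3 d1)"
      by (simp only: pderiv_pconst_mult pderiv_add distrib_left mult.left_commute)
    then show "pderiv_var i ?F1 = vform (d1 - 1) i"
      unfolding dx[OF d(2)] by (cases i rule: index_cases) (simp_all add: vform_def)
  qed
qed

section \<open>Irreducible sets and local rings in projective space\<close>

text \<open>Irreducibility stated on functions: the homogeneous ideal of \<open>A\<close> is prime.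
  Nonvanishing of products, and hence of denominators, is read off directly from this form.\<close>

definition prime_set :: "(complex \<Rightarrow> 'v \<Rightarrow> 'v) \<Rightarrow> 'v::ab_group_add set \<Rightarrow> 'v set set \<Rightarrow> bool" where
  "prime_set s V A \<longleftrightarrow> A \<subseteq> proj_space s V \<and> A \<noteq> {} \<and>
    (\<forall>m n. \<forall>f\<in>homog_part s V m. \<forall>g\<in>homog_part s V n.
      (\<forall>L\<in>A. vanishes_at f L \<or> vanishes_at g L) \<longrightarrow>
      (\<forall>L\<in>A. vanishes_at f L) \<or> (\<forall>L\<in>A. vanishes_at g L))"

lemma prime_setD:
  assumes "prime_set s V A" "f \<in> homog_part s V m" "g \<in> homog_part s V n"
    "\<And>L. L \<in> A \<Longrightarrow> vanishes_at f L \<or> vanishes_at g L"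
  shows "(\<forall>L\<in>A. vanishes_at f L) \<or> (\<forall>L\<in>A. vanishes_at g L)"
  using assms unfolding prime_set_def by blast

context
  fixes s :: "complex \<Rightarrow> 'v \<Rightarrow> 'v::ab_group_add" and V
  assumes vs: "vector_space s" and sub: "module.subspace s V"
begin

interpretation vector_space s by (rule vs)

interpretation S: cring "coord_ring s V" by (rule cring_coord_ring)

lemma coord_ring_simps:
  "f \<oplus>\<^bsub>coord_ring s V\<^esub> g = (\<lambda>v. f v + g v)" "f \<otimes>\<^bsub>coord_ring s V\<^esub> g = (\<lambda>v. f v * g v)"
  "\<zero>\<^bsub>coord_ring s V\<^esub> = (\<lambda>_. 0)"
  by (simp_all add: coord_ring_def)

lemma homog_part_carrier: "f \<in> homog_part s V n \<Longrightarrow> f \<in> carrier (coord_ring s V)"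
  by (simp add: homog_part_def)

lemma homog_part_outside: "f \<in> homog_part s V n \<Longrightarrow> v \<notin> V \<Longrightarrow> f v = 0"
  by (auto simp: homog_part_def coord_ring_def restrict0_def)

lemma homog_part_scale: "f \<in> homog_part s V n \<Longrightarrow> v \<in> V \<Longrightarrow> f (s c v) = c ^ n * f v"
  by (simp add: homog_part_def)

lemma homog_part_zero: "(\<lambda>_. 0) \<in> homog_part s V n"
  using S.zero_closed by (simp add: homog_part_def coord_ring_simps)

lemma homog_part_add:
  "f \<in> homog_part s V n \<Longrightarrow> g \<in> homog_part s V n \<Longrightarrow> (\<lambda>v. f v + g v) \<in> homog_part s V n"
  using S.a_closed[of f g] by (simp add: homog_part_def coord_ring_simps algebra_simps)

lemma homog_part_uminus: "f \<in> homog_part s V n \<Longrightarrow> (\<lambda>v. - f v) \<in> homog_part s V n"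
proof -
  assume f: "f \<in> homog_part s V n"
  then obtain g where g: "g \<in> poly_funs s" "f = restrict0 V g" by (auto simp: homog_part_def coord_ring_def)
  have "(\<lambda>v. - f v) = restrict0 V (\<lambda>v. - g v)" by (auto simp: g(2) restrict0_def)
  moreover have "(\<lambda>v. - g v) \<in> poly_funs s"
    using g(1) unfolding poly_funs_eq_polyalg by (rule polyalg_uminus)
  ultimately have "(\<lambda>v. - f v) \<in> carrier (coord_ring s V)" by (simp add: coord_ring_def)
  then show ?thesis using f by (simp add: homog_part_def)
qed

lemma vanishes_at_zero_locus:
  "L \<in> zero_locus s V T \<longleftrightarrow> L \<in> proj_space s V \<and> (\<forall>f\<in>T. vanishes_at f L)"
  by (simp add: zero_locus_def)

lemma closedin_zero_locus: "f \<in> homog_part s V n \<Longrightarrow> closedin (zariski s V) (zero_locus s V {f})"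
  unfolding closedin_zariski[OF vs sub] zariski_closed_def by (intro exI[of _ "{f}"]) auto

lemma in_zariski_closure:
  assumes "A \<subseteq> proj_space s V"
  shows "L \<in> zariski s V closure_of A \<longleftrightarrow> L \<in> proj_space s V \<and>
    (\<forall>n. \<forall>f\<in>homog_part s V n. (\<forall>L'\<in>A. vanishes_at f L') \<longrightarrow> vanishes_at f L)"
proof (intro iffI conjI allI ballI impI)
  assume L: "L \<in> zariski s V closure_of A"
  then show "L \<in> proj_space s V"
    using closure_of_subset_topspace[of "zariski s V" A] topspace_zariski[OF vs sub] by auto
  fix n f assume f: "f \<in> homog_part s V n" "\<forall>L'\<in>A. vanishes_at f L'"
  then have "A \<subseteq> zero_locus s V {f}" using assms by (auto simp: vanishes_at_zero_locus)
  then have "zariski s V closure_of A \<subseteq> zero_locus s V {f}"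
    by (rule closure_of_minimal) (rule closedin_zero_locus[OF f(1)])
  then show "vanishes_at f L" using L by (auto simp: vanishes_at_zero_locus)
next
  assume L: "L \<in> proj_space s V \<and>
    (\<forall>n. \<forall>f\<in>homog_part s V n. (\<forall>L'\<in>A. vanishes_at f L') \<longrightarrow> vanishes_at f L)"
  have "closedin (zariski s V) (zariski s V closure_of A)" by simp
  then obtain T where T: "T \<subseteq> (\<Union>n. homog_part s V n)" "zariski s V closure_of A = zero_locus s V T"
    unfolding closedin_zariski[OF vs sub] zariski_closed_def by blast
  have "A \<subseteq> zero_locus s V T"
    using closure_of_subset[of A "zariski s V"] assms topspace_zariski[OF vs sub] T(2) by simp
  then show "L \<in> zariski s V closure_of A"
    unfolding T(2) vanishes_at_zero_locus using L T(1) by (fastforce simp: vanishes_at_zero_locus)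
qed

lemma irreducible_in_zariski:
  "irreducible_in (zariski s V) A \<longleftrightarrow> prime_set s V A"
proof
  assume irr: "irreducible_in (zariski s V) A"
  have split: "A \<inter> B = A \<or> A \<inter> C = A"
    if "closedin (zariski s V) B" "closedin (zariski s V) C" "A \<subseteq> B \<union> C" for B C
  proof -
    have "closedin (subtopology (zariski s V) A) (A \<inter> B)" "closedin (subtopology (zariski s V) A) (A \<inter> C)"
      using that by (auto simp: closedin_subtopology)
    moreover have "A \<inter> B \<union> A \<inter> C = A" using that by auto
    ultimately show ?thesis using irr unfolding irreducible_in_def by blast
  qed
  show "prime_set s V A"
    unfolding prime_set_def
  proof (intro conjI allI ballI impI)
    show P: "A \<subseteq> proj_space s V" "A \<noteq> {}"
      using irr topspace_zariski[OF vs sub] by (auto simp: irreducible_in_def)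
    fix m n f g assume fg: "f \<in> homog_part s V m" "g \<in> homog_part s V n"
      "\<forall>L\<in>A. vanishes_at f L \<or> vanishes_at g L"
    have "A \<subseteq> zero_locus s V {f} \<union> zero_locus s V {g}"
      using fg(3) P by (auto simp: vanishes_at_zero_locus)
    from split[OF closedin_zero_locus[OF fg(1)] closedin_zero_locus[OF fg(2)] this]
    show "(\<forall>L\<in>A. vanishes_at f L) \<or> (\<forall>L\<in>A. vanishes_at g L)"
      by (auto simp: vanishes_at_zero_locus)
  qed
next
  assume P: "prime_set s V A"
  then have A: "A \<subseteq> proj_space s V" "A \<noteq> {}" by (auto simp: prime_set_def)
  show "irreducible_in (zariski s V) A"
    unfolding irreducible_in_def
  proof (intro conjI allI impI)
    show "A \<subseteq> topspace (zariski s V)" "A \<noteq> {}" using A topspace_zariski[OF vs sub] by auto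
    fix B C assume BC: "closedin (subtopology (zariski s V) A) B \<and> closedin (subtopology (zariski s V) A) C \<and> B \<union> C = A"
    then obtain T U where T: "T \<subseteq> (\<Union>n. homog_part s V n)" "B = zero_locus s V T \<inter> A"
      and U: "U \<subseteq> (\<Union>n. homog_part s V n)" "C = zero_locus s V U \<inter> A"
      unfolding closedin_subtopology closedin_zariski[OF vs sub] zariski_closed_def by blast
    show "B = A \<or> C = A"
    proof (rule ccontr)
      assume "\<not> (B = A \<or> C = A)"
      then obtain L L' where L: "L \<in> A" "L \<notin> B" "L' \<in> A" "L' \<notin> C" using T(2) U(2) by blast
      obtain f where f: "f \<in> T" "\<not> vanishes_at f L" using L(1,2) A(1) T(2) by (auto simp: vanishes_at_zero_locus)
      obtain g where g: "g \<in> U" "\<not> vanishes_at g L'" using L(3,4) A(1) U(2) by (auto simp: vanishes_at_zero_locus)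
      obtain m where m: "f \<in> homog_part s V m" using f(1) T(1) by blast
      obtain n where n: "g \<in> homog_part s V n" using g(1) U(1) by blast
      have "vanishes_at f M \<or> vanishes_at g M" if "M \<in> A" for M
      proof -
        have "M \<in> B \<or> M \<in> C" using BC that by blast
        then show ?thesis using T(2) U(2) f(1) g(1) by (auto simp: vanishes_at_zero_locus)
      qed
      from prime_setD[OF P m n this] show False using f(2) g(2) L(1,3) by blast
    qed
  qed
qed

text \<open>A homogeneous function vanishes on \<open>B\<close> exactly if it vanishes on
  \<open>A\<close>, and primality depends on nothing else.\<close>

lemma prime_set_between:
  assumes "prime_set s V A" "A \<subseteq> B" "B \<subseteq> zariski s V closure_of A"
  shows "prime_set s V B"
proof -
  have A: "A \<subseteq> proj_space s V" "A \<noteq> {}" using assms(1) by (auto simp: prime_set_def)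
  have van: "(\<forall>L\<in>B. vanishes_at f L) \<longleftrightarrow> (\<forall>L\<in>A. vanishes_at f L)" if "f \<in> homog_part s V n" for f n
    using that assms(2,3) in_zariski_closure[OF A(1)] by blast
  have BP: "B \<subseteq> proj_space s V" using assms(3) in_zariski_closure[OF A(1)] by blast
  show ?thesis
    unfolding prime_set_def
  proof (intro conjI BP allI ballI impI)
    show "B \<noteq> {}" using A(2) assms(2) by blast
    fix m n f g assume fg: "f \<in> homog_part s V m" "g \<in> homog_part s V n"
      "\<forall>L\<in>B. vanishes_at f L \<or> vanishes_at g L"
    show "(\<forall>L\<in>B. vanishes_at f L) \<or> (\<forall>L\<in>B. vanishes_at g L)"
      unfolding van[OF fg(1)] van[OF fg(2)] using prime_setD[OF assms(1) fg(1,2)] fg(3) assms(2) by blast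
  qed
qed

text \<open>Suppose an irreducible \<open>D\<close> inside \<open>F\<close> contains
  \<open>Z\<close>, and let \<open>f\<close> vanish on \<open>Z\<close>. The product
  \<open>g f\<close> lies in \<open>I\<close> and vanishes on \<open>D\<close>, while
  \<open>g\<close> is nonzero somewhere on \<open>Z\<close>; so \<open>f\<close> vanishes on
  \<open>D\<close>. Hence \<open>D\<close> lies in the closure of \<open>A\<close>.\<close>

lemma irreducible_componentI:
  assumes A: "A \<subseteq> proj_space s V" and F: "F \<subseteq> proj_space s V"
    and Z: "Z = zariski s V closure_of A \<inter> F" "prime_set s V Z"
    and I: "\<And>f L. f \<in> I \<Longrightarrow> L \<in> F \<Longrightarrow> vanishes_at f L"
    and mult: "\<And>n f. f \<in> homog_part s V n \<Longrightarrow> (\<And>L. L \<in> Z \<Longrightarrow> vanishes_at f L) \<Longrightarrow>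
      \<exists>m. \<exists>g\<in>denoms s V Z m. (\<lambda>v. g v * f v) \<in> I"
  shows "irreducible_component_of (subtopology (zariski s V) F) Z"
proof -
  have sub_irr: "irreducible_in (subtopology (zariski s V) F) D \<longleftrightarrow> D \<subseteq> F \<and> prime_set s V D" for D
  proof -
    have "irreducible_in (subtopology (zariski s V) F) D \<longleftrightarrow> D \<subseteq> F \<and> irreducible_in (zariski s V) D"
      unfolding irreducible_in_def subtopology_subtopology topspace_subtopology
      by (cases "D \<subseteq> F") (auto simp: Int_absorb1)
    then show ?thesis by (simp add: irreducible_in_zariski)
  qed
  have "D = Z" if D: "D \<subseteq> F" "prime_set s V D" "Z \<subseteq> D" for D
  proof (rule equalityI)
    show "D \<subseteq> Z"
    proof
      fix L assume L: "L \<in> D"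
      have "L \<in> zariski s V closure_of A"
        unfolding in_zariski_closure[OF A]
      proof (intro conjI allI ballI impI)
        show "L \<in> proj_space s V" using L D(1) F by blast
        fix n f assume f: "f \<in> homog_part s V n" "\<forall>L'\<in>A. vanishes_at f L'"
        have "vanishes_at f L'" if "L' \<in> Z" for L'
          using that f in_zariski_closure[OF A] Z(1) by blast
        then obtain m g where g: "g \<in> denoms s V Z m" "(\<lambda>v. g v * f v) \<in> I" using mult[OF f(1)] by blast
        have gh: "g \<in> homog_part s V m" using g(1) by (simp add: denoms_def)
        have "vanishes_at f M \<or> vanishes_at g M" if M: "M \<in> D" for M
        proof -
          obtain v where v: "v \<in> V" "M = line s v" using M D(1) F by (auto simp: proj_space_def)
          have "g v * f v = 0"
            using I[OF g(2), of M] M D(1) line_self[OF vs sub, of v] unfolding v(2) vanishes_at_def by blast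
          then show ?thesis
            unfolding v(2) vanishes_at_line[OF vs sub f(1) v(1)] vanishes_at_line[OF vs sub gh v(1)] by auto
        qed
        from prime_setD[OF D(2) f(1) gh this] show "vanishes_at f L"
          using L D(3) g(1) by (auto simp: denoms_def)
      qed
      then show "L \<in> Z" using L D(1) Z(1) by blast
    qed
  qed (rule D(3))
  then show ?thesis
    unfolding irreducible_component_of_def sub_irr using Z by blast
qed

section \<open>The local ring at the generic point\<close>

context
  fixes I :: "('v \<Rightarrow> complex) set" and Z :: "'v set set"
  assumes I: "ideal I (coord_ring s V)" and Z: "prime_set s V Z"
begin

interpretation I: ideal I "coord_ring s V" by (rule I)

lemma I_closed:
  "(\<lambda>_. 0) \<in> I" "f \<in> I \<Longrightarrow> g \<in> I \<Longrightarrow> (\<lambda>v. f v + g v) \<in> I"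
  "f \<in> homog_part s V n \<Longrightarrow> g \<in> I \<Longrightarrow> (\<lambda>v. f v * g v) \<in> I"
proof -
  show "(\<lambda>_. 0) \<in> I" using I.zero_closed by (simp add: coord_ring_simps)
  show "f \<in> I \<Longrightarrow> g \<in> I \<Longrightarrow> (\<lambda>v. f v + g v) \<in> I" using I.a_closed[of f g] by (simp add: coord_ring_simps)
  show "f \<in> homog_part s V n \<Longrightarrow> g \<in> I \<Longrightarrow> (\<lambda>v. f v * g v) \<in> I"
    using I.I_l_closed[of g f] homog_part_carrier[of f n] by (simp add: coord_ring_simps)
qed

lemma denoms_mult: "f \<in> denoms s V Z m \<Longrightarrow> g \<in> denoms s V Z n \<Longrightarrow> (\<lambda>v. f v * g v) \<in> denoms s V Z (m + n)"
proof -
  assume "f \<in> denoms s V Z m" "g \<in> denoms s V Z n"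
  then have f: "f \<in> homog_part s V m" "\<not> (\<forall>L\<in>Z. vanishes_at f L)"
    and g: "g \<in> homog_part s V n" "\<not> (\<forall>L\<in>Z. vanishes_at g L)" by (auto simp: denoms_def)
  obtain L where L: "L \<in> Z" "\<not> vanishes_at f L" "\<not> vanishes_at g L"
    using prime_setD[OF Z f(1) g(1)] f(2) g(2) by blast
  then obtain v where v: "v \<in> V" "L = line s v" using Z by (auto simp: prime_set_def proj_space_def)
  have "\<not> vanishes_at (\<lambda>v. f v * g v) L"
    using L(2,3) unfolding v(2) vanishes_at_line[OF vs sub f(1) v(1)] vanishes_at_line[OF vs sub g(1) v(1)]
      vanishes_at_line[OF vs sub homog_part_mult[OF vs sub f(1) g(1)] v(1)] by simp
  then show ?thesis using L(1) homog_part_mult[OF vs sub f(1) g(1)] by (auto simp: denoms_def)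
qed

lemma denoms_homog: "f \<in> denoms s V Z m \<Longrightarrow> f \<in> homog_part s V m"
  by (simp add: denoms_def)

lemma denoms_one: "restrict0 V (\<lambda>_. 1) \<in> denoms s V Z 0"
proof -
  obtain L where "L \<in> Z" using Z by (auto simp: prime_set_def)
  moreover then obtain v where "v \<in> V" "L = line s v" using Z by (auto simp: prime_set_def proj_space_def)
  ultimately show ?thesis
    using homog_part_one[OF vs sub] vanishes_at_line[OF vs sub homog_part_one[OF vs sub]]
    by (auto simp: denoms_def restrict0_def intro!: bexI[of _ L])
qed

definition "fr = frac_rel s V I Z"
definition "fadd p q = (\<lambda>v. fst p v * snd q v + fst q v * snd p v, \<lambda>v. snd p v * snd q v)"
  for p q :: "('v \<Rightarrow> complex) \<times> ('v \<Rightarrow> complex)"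
definition "fmul p q = (\<lambda>v. fst p v * fst q v, \<lambda>v. snd p v * snd q v)"
  for p q :: "('v \<Rightarrow> complex) \<times> ('v \<Rightarrow> complex)"
definition "fone = (restrict0 V (\<lambda>_. 1 :: complex), restrict0 V (\<lambda>_. 1 :: complex))"
definition "fzero = (\<lambda>_ :: 'v. 0 :: complex, restrict0 V (\<lambda>_. 1 :: complex))"

lemma fracsE: "p \<in> fracs s V Z \<Longrightarrow> (\<And>n. fst p \<in> homog_part s V n \<Longrightarrow> snd p \<in> denoms s V Z n \<Longrightarrow> P) \<Longrightarrow> P"
  by (auto simp: fracs_def)

lemma fracsI: "fst p \<in> homog_part s V n \<Longrightarrow> snd p \<in> denoms s V Z n \<Longrightarrow> p \<in> fracs s V Z"
  by (cases p) (auto simp: fracs_def)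

lemma fracs_closed:
  "p \<in> fracs s V Z \<Longrightarrow> q \<in> fracs s V Z \<Longrightarrow> fadd p q \<in> fracs s V Z"
  "p \<in> fracs s V Z \<Longrightarrow> q \<in> fracs s V Z \<Longrightarrow> fmul p q \<in> fracs s V Z"
  "fone \<in> fracs s V Z" "fzero \<in> fracs s V Z"
proof -
  assume "p \<in> fracs s V Z" "q \<in> fracs s V Z"
  then obtain m n where p: "fst p \<in> homog_part s V m" "snd p \<in> denoms s V Z m"
    and q: "fst q \<in> homog_part s V n" "snd q \<in> denoms s V Z n" by (elim fracsE)
  show "fmul p q \<in> fracs s V Z"
    by (rule fracsI[of _ "m + n"]) (simp_all add: fmul_def homog_part_mult[OF vs sub p(1) q(1)] denoms_mult[OF p(2) q(2)])
  have "(\<lambda>v. fst q v * snd p v) \<in> homog_part s V (m + n)"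
    using homog_part_mult[OF vs sub q(1) denoms_homog[OF p(2)]] by (simp add: add.commute)
  then show "fadd p q \<in> fracs s V Z"
    by (intro fracsI[of _ "m + n"])
      (simp_all add: fadd_def homog_part_add homog_part_mult[OF vs sub p(1) denoms_homog[OF q(2)]] denoms_mult[OF p(2) q(2)])
next
  show "fone \<in> fracs s V Z" by (rule fracsI[of _ 0]) (simp_all add: fone_def homog_part_one[OF vs sub] denoms_one)
  show "fzero \<in> fracs s V Z" by (rule fracsI[of _ 0]) (simp_all add: fzero_def homog_part_zero denoms_one)
qed

lemma fr_iff: "(p, q) \<in> fr \<longleftrightarrow> p \<in> fracs s V Z \<and> q \<in> fracs s V Z \<and>
    (\<exists>n. \<exists>h\<in>denoms s V Z n. (\<lambda>v. h v * (fst p v * snd q v - fst q v * snd p v)) \<in> I)"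
  by (cases p; cases q) (auto simp: fr_def frac_rel_def)

lemma frI: "p \<in> fracs s V Z \<Longrightarrow> q \<in> fracs s V Z \<Longrightarrow>
    (\<And>v. fst p v * snd q v = fst q v * snd p v) \<Longrightarrow> (p, q) \<in> fr"
  unfolding fr_iff using denoms_one I_closed(1) by (intro conjI exI[of _ 0] bexI[of _ "restrict0 V (\<lambda>_. 1)"]) auto

lemma equiv_fr: "equiv (fracs s V Z) fr"
proof (rule equivI)
  show "fr \<subseteq> fracs s V Z \<times> fracs s V Z" by (auto simp: fr_iff)
  show "refl_on (fracs s V Z) fr" by (rule refl_onI) (rule frI, simp_all)
  show "sym fr"
  proof (rule symI)
    fix p q assume pq: "(p, q) \<in> fr"
    then obtain n h where h: "h \<in> denoms s V Z n" "(\<lambda>v. h v * (fst p v * snd q v - fst q v * snd p v)) \<in> I"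
      by (auto simp: fr_iff)
    \<comment> \<open>Negation is multiplication by the constant -1, which on \<open>V\<close> is
      homogeneous of degree 0.\<close>
    have "(\<lambda>v. - restrict0 V (\<lambda>_. 1) v * (h v * (fst p v * snd q v - fst q v * snd p v))) \<in> I"
      by (rule I_closed(3)[OF homog_part_uminus[OF homog_part_one[OF vs sub]] h(2)])
    also have "(\<lambda>v. - restrict0 V (\<lambda>_. 1) v * (h v * (fst p v * snd q v - fst q v * snd p v))) =
      (\<lambda>v. h v * (fst q v * snd p v - fst p v * snd q v))"
    proof
      fix v show "- restrict0 V (\<lambda>_. 1) v * (h v * (fst p v * snd q v - fst q v * snd p v)) =
        h v * (fst q v * snd p v - fst p v * snd q v)"
        using homog_part_outside[OF denoms_homog[OF h(1)], of v]
        by (cases "v \<in> V") (simp_all add: restrict0_def algebra_simps)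
    qed
    finally show "(q, p) \<in> fr" using pq h(1) by (auto simp: fr_iff)
  qed
  show "trans fr"
  proof (rule transI)
    fix p q r assume pq: "(p, q) \<in> fr" and qr: "(q, r) \<in> fr"
    then obtain m n h k where h: "h \<in> denoms s V Z n" "(\<lambda>v. h v * (fst p v * snd q v - fst q v * snd p v)) \<in> I"
      and k: "k \<in> denoms s V Z m" "(\<lambda>v. k v * (fst q v * snd r v - fst r v * snd q v)) \<in> I"
      and fr: "p \<in> fracs s V Z" "q \<in> fracs s V Z" "r \<in> fracs s V Z"
      unfolding fr_iff by blast
    from fr obtain a b c where den: "snd p \<in> denoms s V Z a" "snd q \<in> denoms s V Z b" "snd r \<in> denoms s V Z c"
      by (elim fracsE)
    \<comment> \<open>The middle denominator \<open>snd q\<close> remains as an extra factor, which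
      is harmless because products of denominators are denominators.\<close>
    have "(\<lambda>v. (k v * snd r v) * (h v * (fst p v * snd q v - fst q v * snd p v)) +
        (h v * snd p v) * (k v * (fst q v * snd r v - fst r v * snd q v))) \<in> I"
      by (intro I_closed(2) I_closed(3)[OF denoms_homog[OF denoms_mult[OF k(1) den(3)]] h(2)]
          I_closed(3)[OF denoms_homog[OF denoms_mult[OF h(1) den(1)]] k(2)])
    also have "(\<lambda>v. (k v * snd r v) * (h v * (fst p v * snd q v - fst q v * snd p v)) +
        (h v * snd p v) * (k v * (fst q v * snd r v - fst r v * snd q v))) =
      (\<lambda>v. (h v * k v * snd q v) * (fst p v * snd r v - fst r v * snd p v))"
      by (simp add: algebra_simps)
    finally show "(p, r) \<in> fr"
      using denoms_mult[OF denoms_mult[OF h(1) k(1)] den(2)] fr by (auto simp: fr_iff)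
  qed
qed

lemma fadd_congruent: "congruent2 fr fr (\<lambda>p q. fr `` {fadd p q})"
proof (rule congruent2_commuteI[OF equiv_fr])
  fix p q show "fr `` {fadd p q} = fr `` {fadd q p}" by (simp add: fadd_def algebra_simps)
next
  fix r p q assume r: "r \<in> fracs s V Z" and pq: "(p, q) \<in> fr"
  then obtain n h where h: "h \<in> denoms s V Z n" "(\<lambda>v. h v * (fst p v * snd q v - fst q v * snd p v)) \<in> I"
    and fr: "p \<in> fracs s V Z" "q \<in> fracs s V Z" unfolding fr_iff by blast
  obtain a where a: "snd r \<in> denoms s V Z a" using r by (rule fracsE)
  have "(\<lambda>v. (snd r v * snd r v) * (h v * (fst p v * snd q v - fst q v * snd p v))) \<in> I"
    by (rule I_closed(3)[OF denoms_homog[OF denoms_mult[OF a a]] h(2)])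
  also have "(\<lambda>v. (snd r v * snd r v) * (h v * (fst p v * snd q v - fst q v * snd p v))) =
    (\<lambda>v. h v * (fst (fadd r p) v * snd (fadd r q) v - fst (fadd r q) v * snd (fadd r p) v))"
    by (simp add: fadd_def algebra_simps)
  finally have "(fadd r p, fadd r q) \<in> fr"
    unfolding fr_iff using h(1) fracs_closed(1)[OF r] fr by blast
  then show "fr `` {fadd r p} = fr `` {fadd r q}" by (rule equiv_class_eq[OF equiv_fr])
qed

lemma fmul_congruent: "congruent2 fr fr (\<lambda>p q. fr `` {fmul p q})"
proof (rule congruent2_commuteI[OF equiv_fr])
  fix p q show "fr `` {fmul p q} = fr `` {fmul q p}" by (simp add: fmul_def algebra_simps)
next
  fix r p q assume r: "r \<in> fracs s V Z" and pq: "(p, q) \<in> fr"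
  then obtain n h where h: "h \<in> denoms s V Z n" "(\<lambda>v. h v * (fst p v * snd q v - fst q v * snd p v)) \<in> I"
    and fr: "p \<in> fracs s V Z" "q \<in> fracs s V Z" unfolding fr_iff by blast
  obtain a where a: "fst r \<in> homog_part s V a" "snd r \<in> denoms s V Z a" using r by (rule fracsE)
  have "(\<lambda>v. (fst r v * snd r v) * (h v * (fst p v * snd q v - fst q v * snd p v))) \<in> I"
    by (rule I_closed(3)[OF homog_part_mult[OF vs sub a(1) denoms_homog[OF a(2)]] h(2)])
  also have "(\<lambda>v. (fst r v * snd r v) * (h v * (fst p v * snd q v - fst q v * snd p v))) =
    (\<lambda>v. h v * (fst (fmul r p) v * snd (fmul r q) v - fst (fmul r q) v * snd (fmul r p) v))"
    by (simp add: fmul_def algebra_simps)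
  finally have "(fmul r p, fmul r q) \<in> fr"
    unfolding fr_iff using h(1) fracs_closed(2)[OF r] fr by blast
  then show "fr `` {fmul r p} = fr `` {fmul r q}" by (rule equiv_class_eq[OF equiv_fr])
qed

lemma local_ring_simps:
  "carrier (local_ring s V I Z) = fracs s V Z // fr"
  "\<one>\<^bsub>local_ring s V I Z\<^esub> = fr `` {fone}" "\<zero>\<^bsub>local_ring s V I Z\<^esub> = fr `` {fzero}"
  "p \<in> fracs s V Z \<Longrightarrow> q \<in> fracs s V Z \<Longrightarrow> fr `` {p} \<oplus>\<^bsub>local_ring s V I Z\<^esub> fr `` {q} = fr `` {fadd p q}"
  "p \<in> fracs s V Z \<Longrightarrow> q \<in> fracs s V Z \<Longrightarrow> fr `` {p} \<otimes>\<^bsub>local_ring s V I Z\<^esub> fr `` {q} = fr `` {fmul p q}"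
  using UN_equiv_class2[OF equiv_fr equiv_fr fadd_congruent, of p q]
    UN_equiv_class2[OF equiv_fr equiv_fr fmul_congruent, of p q]
  by (simp_all add: local_ring_def fr_def fone_def fzero_def fadd_def fmul_def case_prod_beta)

lemma fadd_fzero: "p \<in> fracs s V Z \<Longrightarrow> fadd fzero p = p" and fmul_fone: "p \<in> fracs s V Z \<Longrightarrow> fmul fone p = p"
proof -
  assume "p \<in> fracs s V Z"
  then obtain n where p: "fst p \<in> homog_part s V n" "snd p \<in> denoms s V Z n" by (rule fracsE)
  have 1: "f v * restrict0 V (\<lambda>_. 1) v = f v" "restrict0 V (\<lambda>_. 1) v * f v = f v"
    if "f \<in> homog_part s V n" for f v
    using homog_part_outside[OF that, of v] by (simp_all add: restrict0_def)
  show "fadd fzero p = p"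
    by (rule prod_eqI) (simp_all add: fadd_def fzero_def 1(1)[OF p(1)] 1(2)[OF denoms_homog[OF p(2)]])
  show "fmul fone p = p"
    by (rule prod_eqI) (simp_all add: fmul_def fone_def 1(2)[OF p(1)] 1(2)[OF denoms_homog[OF p(2)]])
qed

lemma cring_local_ring: "cring (local_ring s V I Z)"
proof -
  let ?R = "local_ring s V I Z"
  note cl = fracs_closed
  have cls: "p \<in> fracs s V Z \<Longrightarrow> fr `` {p} \<in> carrier ?R" for p
    by (simp add: local_ring_simps quotientI)
  have rep: "\<exists>p\<in>fracs s V Z. x = fr `` {p}" if "x \<in> carrier ?R" for x
    using that by (auto simp: local_ring_simps quotient_def)
  show ?thesis
  proof (rule cringI)
    show "abelian_group ?R"
    proof (rule abelian_groupI)
      fix x y assume "x \<in> carrier ?R" "y \<in> carrier ?R"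
      then obtain p q where p: "p \<in> fracs s V Z" "x = fr `` {p}" and q: "q \<in> fracs s V Z" "y = fr `` {q}"
        using rep by meson
      show "x \<oplus>\<^bsub>?R\<^esub> y \<in> carrier ?R" by (simp add: p q local_ring_simps(4) cls cl)
      show "x \<oplus>\<^bsub>?R\<^esub> y = y \<oplus>\<^bsub>?R\<^esub> x"
        by (simp add: p q local_ring_simps(4)) (simp add: fadd_def algebra_simps)
      fix z assume "z \<in> carrier ?R"
      then obtain r where r: "r \<in> fracs s V Z" "z = fr `` {r}" using rep by meson
      show "x \<oplus>\<^bsub>?R\<^esub> y \<oplus>\<^bsub>?R\<^esub> z = x \<oplus>\<^bsub>?R\<^esub> (y \<oplus>\<^bsub>?R\<^esub> z)"
        by (simp add: p q r local_ring_simps(4) cl) (simp add: fadd_def algebra_simps)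
    next
      show "\<zero>\<^bsub>?R\<^esub> \<in> carrier ?R" by (simp add: local_ring_simps(3) cls cl)
      fix x assume "x \<in> carrier ?R"
      then obtain p where p: "p \<in> fracs s V Z" "x = fr `` {p}" using rep by meson
      show "\<zero>\<^bsub>?R\<^esub> \<oplus>\<^bsub>?R\<^esub> x = x" by (simp add: p local_ring_simps(3,4) cl fadd_fzero)
      let ?m = "(\<lambda>v. - fst p v, snd p)"
      obtain n where n: "fst p \<in> homog_part s V n" "snd p \<in> denoms s V Z n" using p(1) by (rule fracsE)
      have m: "?m \<in> fracs s V Z" by (rule fracsI[of _ n]) (simp_all add: n homog_part_uminus)
      have "fr `` {fadd ?m p} = fr `` {fzero}"
        by (rule equiv_class_eq[OF equiv_fr], rule frI[OF cl(1)[OF m p(1)] cl(4)]) (simp add: fadd_def fzero_def)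
      then show "\<exists>y\<in>carrier ?R. y \<oplus>\<^bsub>?R\<^esub> x = \<zero>\<^bsub>?R\<^esub>"
        using m p by (intro bexI[of _ "fr `` {?m}"] cls) (simp_all add: local_ring_simps(3,4))
    qed
    show "Group.comm_monoid ?R"
    proof (rule comm_monoidI)
      fix x y assume "x \<in> carrier ?R" "y \<in> carrier ?R"
      then obtain p q where p: "p \<in> fracs s V Z" "x = fr `` {p}" and q: "q \<in> fracs s V Z" "y = fr `` {q}"
        using rep by meson
      show "x \<otimes>\<^bsub>?R\<^esub> y \<in> carrier ?R" by (simp add: p q local_ring_simps(5) cls cl)
      show "x \<otimes>\<^bsub>?R\<^esub> y = y \<otimes>\<^bsub>?R\<^esub> x"
        by (simp add: p q local_ring_simps(5)) (simp add: fmul_def algebra_simps)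
      fix z assume "z \<in> carrier ?R"
      then obtain r where r: "r \<in> fracs s V Z" "z = fr `` {r}" using rep by meson
      show "x \<otimes>\<^bsub>?R\<^esub> y \<otimes>\<^bsub>?R\<^esub> z = x \<otimes>\<^bsub>?R\<^esub> (y \<otimes>\<^bsub>?R\<^esub> z)"
        by (simp add: p q r local_ring_simps(5) cl) (simp add: fmul_def algebra_simps)
    next
      show "\<one>\<^bsub>?R\<^esub> \<in> carrier ?R" by (simp add: local_ring_simps(2) cls cl)
      fix x assume "x \<in> carrier ?R"
      then obtain p where p: "p \<in> fracs s V Z" "x = fr `` {p}" using rep by meson
      show "\<one>\<^bsub>?R\<^esub> \<otimes>\<^bsub>?R\<^esub> x = x" by (simp add: p local_ring_simps(2,5) cl fmul_fone)
    qed
  next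
    fix x y z assume xyz: "x \<in> carrier ?R" "y \<in> carrier ?R" "z \<in> carrier ?R"
    obtain p where p: "p \<in> fracs s V Z" "x = fr `` {p}" using rep[OF xyz(1)] by blast
    obtain q where q: "q \<in> fracs s V Z" "y = fr `` {q}" using rep[OF xyz(2)] by blast
    obtain r where r: "r \<in> fracs s V Z" "z = fr `` {r}" using rep[OF xyz(3)] by blast
    have "fr `` {fmul (fadd p q) r} = fr `` {fadd (fmul p r) (fmul q r)}"
      by (rule equiv_class_eq[OF equiv_fr], rule frI[OF cl(2)[OF cl(1)[OF p(1) q(1)] r(1)]
          cl(1)[OF cl(2)[OF p(1) r(1)] cl(2)[OF q(1) r(1)]]]) (simp add: fadd_def fmul_def algebra_simps)
    then show "(x \<oplus>\<^bsub>?R\<^esub> y) \<otimes>\<^bsub>?R\<^esub> z = x \<otimes>\<^bsub>?R\<^esub> z \<oplus>\<^bsub>?R\<^esub> y \<otimes>\<^bsub>?R\<^esub> z"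
      by (simp add: p q r local_ring_simps(4,5) cl)
  qed
qed

text \<open>If a fraction is nilpotent, a denominator times a power of its numerator lies in
  \<open>I\<close> and so vanishes on \<open>Z\<close>. By primality the numerator vanishes on
  \<open>Z\<close>, and its multiplier in \<open>I\<close> makes the fraction itself zero.\<close>

lemma reduced_local_ring:
  assumes van: "\<And>f L. f \<in> I \<Longrightarrow> L \<in> Z \<Longrightarrow> vanishes_at f L"
    and mult: "\<And>n f. f \<in> homog_part s V n \<Longrightarrow> (\<And>L. L \<in> Z \<Longrightarrow> vanishes_at f L) \<Longrightarrow>
      \<exists>m. \<exists>g\<in>denoms s V Z m. (\<lambda>v. g v * f v) \<in> I"
  shows "reduced_ring (local_ring s V I Z)"
  unfolding reduced_ring_def
proof (intro conjI ballI allI impI cring_local_ring)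
  let ?R = "local_ring s V I Z"
  fix x n assume "x \<in> carrier ?R" and nil: "x [^]\<^bsub>?R\<^esub> (n::nat) = \<zero>\<^bsub>?R\<^esub>"
  then obtain p where p: "p \<in> fracs s V Z" and x: "x = fr `` {p}"
    by (auto simp: local_ring_simps quotient_def)
  obtain d where d: "fst p \<in> homog_part s V d" "snd p \<in> denoms s V Z d" using p by (rule fracsE)
  \<comment> \<open>Powers are computed on representatives, so that the numerator of
    \<open>x\<close> to the power \<open>n\<close> is explicit.\<close>
  define pw where "pw k = ((fmul p) ^^ k) fone" for k
  have pw: "pw k \<in> fracs s V Z \<and> x [^]\<^bsub>?R\<^esub> k = fr `` {pw k}" for k
  proof (induction k)
    case 0
    show ?case by (simp add: pw_def fracs_closed local_ring_simps(2))
  next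
    case (Suc k)
    have "fmul (pw k) p = pw (Suc k)" by (simp add: pw_def fmul_def algebra_simps)
    then show ?case using Suc p fracs_closed(2)[of "pw k" p] by (simp add: x local_ring_simps(5))
  qed
  have fz: "(pw n, fzero) \<in> fr"
    using nil pw[of n] by (intro eq_equiv_class[OF _ equiv_fr] fracs_closed) (simp_all add: local_ring_simps(3))
  from fz[unfolded fr_iff] obtain m h where h: "h \<in> denoms s V Z m"
    "(\<lambda>v. h v * (fst (pw n) v * snd fzero v - fst fzero v * snd (pw n) v)) \<in> I"
    by (elim conjE exE bexE)
  have "vanishes_at (fst p) L" if "L \<in> Z" for L
  proof (rule ccontr)
    assume "\<not> vanishes_at (fst p) L"
    then have pd: "fst p \<in> denoms s V Z d" using d(1) that by (auto simp: denoms_def)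
    have "\<exists>e. fst (pw k) \<in> denoms s V Z e" for k
    proof (induction k)
      case 0 show ?case using denoms_one by (auto simp: pw_def fone_def)
    next
      case (Suc k) then show ?case using denoms_mult[OF pd] by (auto simp: pw_def fmul_def)
    qed
    then obtain e where "fst (pw n) \<in> denoms s V Z e" by blast
    then have hp: "(\<lambda>v. h v * (fst (pw n) v * restrict0 V (\<lambda>_. 1) v)) \<in> denoms s V Z (m + (e + 0))"
      by (intro denoms_mult h denoms_one)
    then show False using van[OF h(2)] by (auto simp: fzero_def denoms_def)
  qed
  then obtain m' g where g: "g \<in> denoms s V Z m'" "(\<lambda>v. g v * fst p v) \<in> I" using mult[OF d(1)] by blast
  have eq: "(\<lambda>v. g v * (fst p v * snd fzero v - fst fzero v * snd p v)) = (\<lambda>v. g v * fst p v)"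
    using homog_part_outside[OF d(1)] by (auto simp: fzero_def restrict0_def)
  have "(p, fzero) \<in> fr"
    unfolding fr_iff by (intro conjI p fracs_closed(4) exI[of _ m'] bexI[OF _ g(1)]) (simp only: eq g(2))
  then show "x = \<zero>\<^bsub>?R\<^esub>" unfolding x local_ring_simps(3) by (rule equiv_class_eq[OF equiv_fr])
qed

end

end

section \<open>Singular loci of codimension at least two\<close>

text \<open>A linear functional on polynomials for each weight \<phi>. Evaluation at a point and
  extraction of a coefficient in one variable are both of this kind, and therefore both are linear
  in a form.\<close>

definition msum :: "(mono \<Rightarrow> complex) \<Rightarrow> mpoly \<Rightarrow> complex" where
  "msum \<phi> p = (\<Sum>\<alpha>\<in>Poly_Mapping.keys p. cf p \<alpha> * \<phi> \<alpha>)"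

lemma msum_superset: "finite A \<Longrightarrow> Poly_Mapping.keys p \<subseteq> A \<Longrightarrow> msum \<phi> p = (\<Sum>\<alpha>\<in>A. cf p \<alpha> * \<phi> \<alpha>)"
  unfolding msum_def by (rule sum.mono_neutral_left) (auto simp: in_keys_iff)

lemma msum_add: "msum \<phi> (p + q) = msum \<phi> p + msum \<phi> q"
proof -
  let ?A = "Poly_Mapping.keys p \<union> Poly_Mapping.keys q"
  have "Poly_Mapping.keys (p + q) \<subseteq> ?A" by (rule Poly_Mapping.keys_add)
  then show ?thesis
    by (simp add: msum_superset[of ?A] lookup_add distrib_right sum.distrib)
qed

lemma msum_pconst_mult: "msum \<phi> (pconst c * p) = c * msum \<phi> p"
proof -
  have "msum \<phi> (pconst c * p) = (\<Sum>\<alpha>\<in>Poly_Mapping.keys p. cf (pconst c * p) \<alpha> * \<phi> \<alpha>)"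
    by (rule msum_superset) (auto intro: keys_pconst_mult[THEN subsetD])
  then show ?thesis by (simp add: lookup_pconst msum_def sum_distrib_left mult.assoc)
qed

lemma msum_diff: "msum \<phi> (p - q) = msum \<phi> p - msum \<phi> q"
  using msum_add[of \<phi> "p - q" q] by simp

lemma msum_sum: "msum \<phi> (\<Sum>a\<in>A. f a) = (\<Sum>a\<in>A. msum \<phi> (f a))"
proof -
  have "msum \<phi> 0 = 0" by (simp add: msum_def)
  then show ?thesis by (induction A rule: infinite_finite_induct) (auto simp: msum_add)
qed

lemma msum_single: "msum \<phi> (Poly_Mapping.single \<alpha> c) = c * \<phi> \<alpha>"
  by (simp add: msum_def)

definition mval :: "mono \<Rightarrow> (nat \<Rightarrow> complex) \<Rightarrow> complex" where
  "mval \<alpha> x = (\<Prod>i\<in>Poly_Mapping.keys \<alpha>. x i ^ Poly_Mapping.lookup \<alpha> i)"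

lemma peval_msum: "peval p x = msum (\<lambda>\<alpha>. mval \<alpha> x) p"
  by (simp add: peval_def msum_def mval_def)

lemma mval_superset: "finite A \<Longrightarrow> Poly_Mapping.keys \<alpha> \<subseteq> A \<Longrightarrow> mval \<alpha> x = (\<Prod>i\<in>A. x i ^ Poly_Mapping.lookup \<alpha> i)"
  unfolding mval_def by (rule prod.mono_neutral_left) (auto simp: in_keys_iff)

lemma mval_add: "mval (\<alpha> + \<beta>) x = mval \<alpha> x * mval \<beta> x"
proof -
  let ?A = "Poly_Mapping.keys \<alpha> \<union> Poly_Mapping.keys \<beta>"
  have "mval (\<alpha> + \<beta>) x = (\<Prod>i\<in>?A. x i ^ Poly_Mapping.lookup (\<alpha> + \<beta>) i)"
    by (simp add: mval_def keys_add_mono)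
  then show ?thesis
    by (simp add: mval_superset[of ?A] lookup_add power_add prod.distrib)
qed

lemma peval_mult: "peval (p * q) x = peval p x * peval q x"
proof -
  let ?S = "\<lambda>p. \<Sum>\<alpha>\<in>Poly_Mapping.keys p. Poly_Mapping.single \<alpha> (cf p \<alpha>)"
  have "peval (?S p * ?S q) x = peval (?S p) x * peval (?S q) x"
    by (simp add: peval_msum sum_product msum_sum mult_single msum_single mval_add mult_ac)
  then show ?thesis by (simp only: mpoly_sum_monomials)
qed

lemma peval_simps:
  "peval (p + q) x = peval p x + peval q x" "peval (p - q) x = peval p x - peval q x"
  "peval (pconst c) x = c" "peval (of_nat n) x = of_nat n" "peval (pvar i) x = x i"
  "peval 0 x = 0" "peval 1 x = 1" "peval (p ^ k) x = peval p x ^ k"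
proof -
  show c: "peval (pconst c) x = c" for c by (simp add: pconst_def peval_msum msum_single mval_def)
  show "peval (of_nat n) x = of_nat n" by (simp only: of_nat_mpoly c)
  show 1: "peval 1 x = 1" using c[of 1] by (simp add: pconst_simps(3))
  show "peval 0 x = 0" by (simp add: peval_def)
  show "peval (p ^ k) x = peval p x ^ k" by (induction k) (simp_all add: 1 peval_mult)
qed (simp_all add: peval_msum msum_add msum_diff pvar_def msum_single mval_def)

lemma vscale_coordinate: "Vector_Spaces.linear vscale (*) (\<lambda>x. x i)"
proof -
  interpret vector_space vscale by (rule vector_space_vscale)
  interpret C: vector_space "(*) :: complex \<Rightarrow> complex \<Rightarrow> complex" by unfold_locales (auto simp: algebra_simps)
  show ?thesis by unfold_locales (auto simp: vscale_def)
qed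

lemma coordinate_poly: "(\<lambda>x. x i) \<in> poly_funs vscale"
  by (rule poly_funs.linear[OF vscale_coordinate])

lemma msum_form_linear: "Vector_Spaces.linear fscale (*) (\<lambda>\<omega>. msum \<phi> (\<omega> i))"
proof -
  interpret vector_space fscale by (rule vector_space_fscale)
  interpret C: vector_space "(*) :: complex \<Rightarrow> complex \<Rightarrow> complex" by unfold_locales (auto simp: algebra_simps)
  show ?thesis by unfold_locales (auto simp: msum_add fscale_def msum_pconst_mult)
qed

text \<open>\<open>msum (wt1 k x) p\<close> is the coefficient of \<open>x\<^sub>1 ^ k\<close> in \<open>p\<close>, with the other variables evaluated at \<open>x\<close>.\<close>

definition wt1 :: "nat \<Rightarrow> (nat \<Rightarrow> complex) \<Rightarrow> mono \<Rightarrow> complex" where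
  "wt1 k x \<alpha> = (if Poly_Mapping.lookup \<alpha> 1 = k then \<Prod>i\<in>Poly_Mapping.keys \<alpha> - {1}. x i ^ Poly_Mapping.lookup \<alpha> i else 0)"

lemma peval_expand1:
  assumes "p \<in> homog_polys r m"
  shows "peval p x = (\<Sum>k\<le>m. msum (wt1 k x) p * x 1 ^ k)"
proof -
  have "mval \<alpha> x = (\<Sum>k\<le>m. wt1 k x \<alpha> * x 1 ^ k)" if "\<alpha> \<in> Poly_Mapping.keys p" for \<alpha>
  proof -
    have "Poly_Mapping.lookup \<alpha> 1 \<le> mdeg \<alpha>"
      by (cases "1 \<in> Poly_Mapping.keys \<alpha>") (auto simp: mdeg_def in_keys_iff intro: member_le_sum)
    then have le: "Poly_Mapping.lookup \<alpha> 1 \<le> m" using assms that by (simp add: homog_polys_iff)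
    have "mval \<alpha> x = (\<Prod>i\<in>insert 1 (Poly_Mapping.keys \<alpha> - {1}). x i ^ Poly_Mapping.lookup \<alpha> i)"
      by (rule mval_superset) auto
    also have "\<dots> = wt1 (Poly_Mapping.lookup \<alpha> 1) x \<alpha> * x 1 ^ Poly_Mapping.lookup \<alpha> 1"
      by (subst prod.insert) (auto simp: wt1_def)
    also have "\<dots> = (\<Sum>k\<le>m. if k = Poly_Mapping.lookup \<alpha> 1 then wt1 k x \<alpha> * x 1 ^ k else 0)"
      using le by simp
    also have "\<dots> = (\<Sum>k\<le>m. wt1 k x \<alpha> * x 1 ^ k)" by (intro sum.cong) (auto simp: wt1_def)
    finally show ?thesis .
  qed
  then show ?thesis
    unfolding peval_msum msum_def sum_distrib_right
    by (subst sum.swap) (simp add: sum_distrib_left mult.assoc)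
qed

lemma wt1_cong: "(\<And>i. i \<noteq> 1 \<Longrightarrow> x i = y i) \<Longrightarrow> wt1 k x = wt1 k y"
  by (auto simp: wt1_def fun_eq_iff intro!: prod.cong)

lemma msum_wt1_poly: "(\<lambda>x. msum (wt1 k x) p) \<in> poly_funs vscale"
proof -
  have "(\<lambda>x. wt1 k x \<alpha>) \<in> polyalg {l. Vector_Spaces.linear vscale (*) l}" for \<alpha>
  proof (cases "Poly_Mapping.lookup \<alpha> 1 = k")
    case True
    then show ?thesis unfolding wt1_def
      by (simp only: if_True simp_thms) (intro polyalg_prod polyalg_power polyalg.gen CollectI vscale_coordinate)
  qed (simp add: wt1_def polyalg.const)
  then show ?thesis unfolding poly_funs_eq_polyalg msum_def by (intro polyalg_intros)
qed

text \<open>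
  The Sylvester matrix of \<open>A\<close> and \<open>B\<close> with respect to \<open>x\<^sub>1\<close>, for the formal degrees \<open>m\<close> and \<open>m\<close>;
  the columns belong to the powers of \<open>x\<^sub>1\<close>.
\<close>

definition sylv :: "nat \<Rightarrow> mpoly \<Rightarrow> mpoly \<Rightarrow> (nat \<Rightarrow> complex) \<Rightarrow> complex mat" where
  "sylv m A B x = mat (2 * m) (2 * m) (\<lambda>(i, j).
     if i < m then (if i \<le> j \<and> j \<le> i + m then msum (wt1 (j - i) x) B else 0)
     else (if i \<le> j + m \<and> j \<le> i then msum (wt1 (j + m - i) x) A else 0))"

lemma sylv_det_poly:
  assumes "\<And>k. (\<lambda>y. msum (wt1 k (x y)) (A y)) \<in> polyalg X" "\<And>k. (\<lambda>y. msum (wt1 k (x y)) (B y)) \<in> polyalg X"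
  shows "(\<lambda>y. det (sylv m (A y) (B y) (x y))) \<in> polyalg X"
proof -
  have entry: "(\<lambda>y. sylv m (A y) (B y) (x y) $$ (i, j)) \<in> polyalg X" if "i < 2 * m" "j < 2 * m" for i j
    using that assms
    by (cases "i < m"; cases "i \<le> j \<and> j \<le> i + m"; cases "i \<le> j + m \<and> j \<le> i") (auto simp: sylv_def intro: polyalg.const)
  have "(\<lambda>y. \<Sum>p | p permutes {0..<2 * m}. of_int (sign p) * (\<Prod>i = 0..<2 * m. sylv m (A y) (B y) (x y) $$ (i, p i))) \<in> polyalg X"
    by (intro polyalg_intros entry) (auto dest: permutes_in_image)
  moreover have "det (sylv m (A y) (B y) (x y)) =
      (\<Sum>p | p permutes {0..<2 * m}. of_int (sign p) * (\<Prod>i = 0..<2 * m. sylv m (A y) (B y) (x y) $$ (i, p i)))" for y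
    by (simp add: Determinant.det_def sylv_def)
  ultimately show ?thesis by simp
qed

text \<open>At a common zero the vector of powers of \<open>x\<^sub>1\<close> lies in the kernel:
  each row is a shifted copy of one of the two polynomials. The vector is nonzero because its first
  entry is 1.\<close>

lemma sylv_det_common_zero:
  assumes "m \<ge> 1" "A \<in> homog_polys r m" "B \<in> homog_polys r m" "peval A x = 0" "peval B x = 0"
  shows "det (sylv m A B x) = 0"
proof -
  let ?v = "vec (2 * m) (\<lambda>j. x 1 ^ j)" and ?M = "sylv m A B x"
  have M: "?M \<in> carrier_mat (2 * m) (2 * m)" by (simp add: sylv_def)
  have shift: "(\<Sum>j = 0..<2 * m. (if a \<le> j \<and> j \<le> a + m then msum (wt1 (j - a) x) p else 0) * x 1 ^ j) = 0"
    if "p \<in> homog_polys r m" "peval p x = 0" "a < m" for p a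
  proof -
    have "(\<Sum>j = 0..<2 * m. (if a \<le> j \<and> j \<le> a + m then msum (wt1 (j - a) x) p else 0) * x 1 ^ j) =
      (\<Sum>j \<in> (\<lambda>k. k + a) ` {..m}. msum (wt1 (j - a) x) p * x 1 ^ j)"
    proof (rule sum.mono_neutral_cong_right)
      show "(\<lambda>k. k + a) ` {..m} \<subseteq> {0..<2 * m}" using that(3) by auto
      have "j \<in> (\<lambda>k. k + a) ` {..m}" if "a \<le> j" "j \<le> a + m" for j
        using that by (intro image_eqI[of _ _ "j - a"]) auto
      then show "\<forall>j\<in>{0..<2 * m} - (\<lambda>k. k + a) ` {..m}.
          (if a \<le> j \<and> j \<le> a + m then msum (wt1 (j - a) x) p else 0) * x 1 ^ j = 0" by auto
    qed auto
    also have "\<dots> = (\<Sum>k\<le>m. msum (wt1 k x) p * x 1 ^ (k + a))"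
      by (subst sum.reindex) (auto simp: inj_on_def)
    also have "\<dots> = peval p x * x 1 ^ a"
      unfolding peval_expand1[OF that(1)] by (simp add: sum_distrib_right power_add mult.assoc)
    finally show ?thesis using that(2) by simp
  qed
  have "?M *\<^sub>v ?v = 0\<^sub>v (2 * m)"
  proof (rule eq_vecI)
    fix i assume "i < dim_vec (0\<^sub>v (2 * m))"
    then have i: "i < 2 * m" by simp
    have "(?M *\<^sub>v ?v) $ i = (\<Sum>j = 0..<2 * m. ?M $$ (i, j) * x 1 ^ j)"
      using i by (simp add: sylv_def scalar_prod_def)
    also have "\<dots> = 0"
    proof (cases "i < m")
      case True
      have "(\<Sum>j = 0..<2 * m. ?M $$ (i, j) * x 1 ^ j) =
        (\<Sum>j = 0..<2 * m. (if i \<le> j \<and> j \<le> i + m then msum (wt1 (j - i) x) B else 0) * x 1 ^ j)"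
        using i True by (intro sum.cong) (auto simp: sylv_def)
      then show ?thesis using shift[OF assms(3,5) True] by simp
    next
      case False
      have "(\<Sum>j = 0..<2 * m. ?M $$ (i, j) * x 1 ^ j) =
        (\<Sum>j = 0..<2 * m. (if i - m \<le> j \<and> j \<le> i - m + m then msum (wt1 (j - (i - m)) x) A else 0) * x 1 ^ j)"
        using i False by (intro sum.cong) (auto simp: sylv_def)
      then show ?thesis using shift[OF assms(2,4), of "i - m"] i False by simp
    qed
    finally show "(?M *\<^sub>v ?v) $ i = 0\<^sub>v (2 * m) $ i" using i by simp
  qed (simp add: sylv_def)
  moreover have "?v \<noteq> 0\<^sub>v (2 * m)"
  proof
    assume "?v = 0\<^sub>v (2 * m)"
    then have "?v $ 0 = 0\<^sub>v (2 * m) $ 0" by simp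
    then show False using assms(1) by simp
  qed
  ultimately show ?thesis unfolding det_0_iff_vec_prod_zero_field[OF M] by (intro exI[of _ ?v]) auto
qed

text \<open>With \<open>A\<close> reduced to its leading and \<open>B\<close> to its constant term,
  the matrix is diagonal; the rows of \<open>B\<close> are placed first for this reason.\<close>

lemma sylv_det_extreme:
  assumes "\<And>k. k \<le> m \<Longrightarrow> msum (wt1 k x) A = (if k = m then a else 0)" "\<And>k. k \<le> m \<Longrightarrow> msum (wt1 k x) B = (if k = 0 then b else 0)"
    "a \<noteq> 0" "b \<noteq> 0"
  shows "det (sylv m A B x) \<noteq> 0"
proof -
  let ?M = "sylv m A B x"
  have M: "?M \<in> carrier_mat (2 * m) (2 * m)" by (simp add: sylv_def)
  have entry: "?M $$ (i, j) = (if i = j then if i < m then b else a else 0)" if "i < 2 * m" "j < 2 * m" for i j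
    using that by (auto simp: sylv_def assms(1,2))
  have "upper_triangular ?M"
    by (rule upper_triangularI) (use entry M in auto)
  then have "det ?M = prod_list (diag_mat ?M)" using M by (rule det_upper_triangular)
  moreover have "0 \<notin> set (diag_mat ?M)"
    using entry M assms(3,4) by (auto simp: diag_mat_def)
  ultimately show ?thesis by (simp add: prod_list_zero_iff)
qed

section \<open>Homogeneous components and restriction to lines\<close>

abbreviation "lin_funs s \<equiv> {l. Vector_Spaces.linear s (*) l}"

lemma homog_part_of_components:
  assumes vs: "vector_space s" "module.subspace s V" and f: "f \<in> poly_funs s"
  obtains F N where "\<And>k. F k \<in> poly_funs s" "\<And>k c v. F k (s c v) = c ^ k * F k v"
    "\<And>v. f v = (\<Sum>k\<le>N. F k v)" "\<And>k. restrict0 V (F k) \<in> homog_part s V k"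
proof -
  interpret vector_space s by (rule vs(1))
  obtain F N where F: "\<And>k. F k \<in> polyalg (lin_funs s)" "\<And>k c a. F k (s c a) = c ^ k * F k a"
    "\<And>a. f a = (\<Sum>k\<le>N. F k a)"
    by (rule polyalg_homog_decomp[OF f[unfolded poly_funs_eq_polyalg], of s])
      (auto simp: linear_functional_simps)
  show ?thesis
  proof (rule that[of F N])
    show Fp: "F k \<in> poly_funs s" for k unfolding poly_funs_eq_polyalg by (rule F(1))
    show "restrict0 V (F k) \<in> homog_part s V k" for k
      using F(2) Fp subspace_scale[OF vs(2)] by (auto simp: homog_part_def coord_ring_def restrict0_def)
  qed (rule F)+
qed

text \<open>On the line through \<open>v\<close>, the components of \<open>f\<close> separate by
  powers of the scalar.\<close>

lemma homog_component_vanishes: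
  fixes F :: "nat \<Rightarrow> 'v \<Rightarrow> complex"
  assumes F: "\<And>k c v. F k (s c v) = c ^ k * F k v" "\<And>v. f v = (\<Sum>k\<le>N. F k v)"
    and zero: "\<And>c. f (s c v) = 0" and "k \<le> N"
  shows "F k v = 0"
proof -
  have "F k \<in> {h. h v = 0}"
  proof (rule homog_components_in_subspace[where M = "{h. h v = 0}" and N = N and F = F])
    fix c :: complex
    have "(\<Sum>k\<le>N. c ^ k * F k v) = f (s c v)" by (simp add: F)
    then show "(\<lambda>a. \<Sum>k\<le>N. c ^ k * F k a) \<in> {h. h v = 0}" by (simp add: zero)
  qed (use assms in auto)
  then show ?thesis by simp
qed

lemma homog_partE:
  assumes "f \<in> homog_part s V n"
  obtains g where "g \<in> poly_funs s" "f = restrict0 V g"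
  using assms by (auto simp: homog_part_def coord_ring_def)

lemma poly_fun_on_line:
  assumes "vector_space s" "g \<in> poly_funs s"
  shows "(\<lambda>c. g (x + s c y)) \<in> univ_polys"
proof -
  interpret vector_space s by fact
  show ?thesis
    using assms(2) unfolding poly_funs_eq_polyalg
  proof (rule polyalg_comp)
    fix l assume "l \<in> lin_funs s"
    then have "Vector_Spaces.linear s (*) l" by simp
    from linear_functional_simps[OF this] show "(\<lambda>c. l (x + s c y)) \<in> univ_polys"
      by (auto intro!: polyalg_intros univ_polys_var)
  qed
qed

lemma poly_funs_common_nonzero:
  assumes vs: "vector_space s" "module.subspace s V" and f: "f \<in> poly_funs s" "g \<in> poly_funs s"
    and "x \<in> V" "y \<in> V" "f x \<noteq> 0" "g y \<noteq> 0"
  shows "\<exists>z\<in>V. f z \<noteq> 0 \<and> g z \<noteq> 0"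
proof -
  interpret vector_space s by (rule vs(1))
  obtain c where c: "f (x + s c (y - x)) \<noteq> 0" "g (x + s c (y - x)) \<noteq> 0"
    by (rule univ_polys_common_nonzero[OF poly_fun_on_line[OF vs(1) f(1), of x "y - x"]
        poly_fun_on_line[OF vs(1) f(2), of x "y - x"], where a = 0 and b = 1]) (use assms in auto)
  have "x + s c (y - x) \<in> V"
    using assms by (intro subspace_add[OF vs(2)] subspace_scale[OF vs(2)] subspace_diff[OF vs(2)])
  with c show ?thesis by blast
qed

lemma line_scale:
  assumes "vector_space s" "c \<noteq> 0" shows "line s (s c v) = line s v"
proof -
  interpret vector_space s by fact
  have "\<exists>b. s a v = s b (s c v)" for a using assms(2) by (intro exI[of _ "a / c"]) simp
  then show ?thesis by (auto simp: line_def)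
qed

section \<open>Points, lines and joins in projective space\<close>

abbreviation "aff r \<equiv> affine_space r"

abbreviation "Hp r n \<equiv> homog_part vscale (affine_space r) n"

abbreviation "Pspace r \<equiv> proj_space vscale (affine_space r)"

lemmas vaff = vector_space_vscale affine_subspace

definition axis :: "nat \<Rightarrow> nat \<Rightarrow> complex" where
  "axis i = (\<lambda>j. if j = i then 1 else 0)"

lemma axis_aff: "i \<le> r \<Longrightarrow> axis i \<in> aff r"
  by (auto simp: axis_def affine_space_def)

lemma axis_nonzero: "axis i \<noteq> 0"
  by (auto simp: axis_def fun_eq_iff)

lemma in_Pspace: "L \<in> Pspace r \<longleftrightarrow> (\<exists>x\<in>aff r. x \<noteq> 0 \<and> L = line vscale x)"
  by (auto simp: proj_space_def)

lemma PspaceI: "x \<in> aff r \<Longrightarrow> x \<noteq> 0 \<Longrightarrow> line vscale x \<in> Pspace r"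
  unfolding in_Pspace by blast

lemma aff_closed: "x \<in> aff r \<Longrightarrow> y \<in> aff r \<Longrightarrow> x + vscale c y \<in> aff r"
  by (simp add: affine_space_def vscale_def)

lemma prime_set_Pspace: "prime_set vscale (aff r) (Pspace r)"
  unfolding prime_set_def
proof (intro conjI allI ballI impI)
  have "line vscale (axis 0) \<in> Pspace r" by (rule PspaceI[OF axis_aff axis_nonzero]) simp
  then show "Pspace r \<noteq> {}" by blast
  fix m n f g assume f: "f \<in> Hp r m" and g: "g \<in> Hp r n"
    and fg: "\<forall>L\<in>Pspace r. vanishes_at f L \<or> vanishes_at g L"
  obtain f' where f': "f' \<in> poly_funs vscale" "f = restrict0 (aff r) f'" using f by (rule homog_partE)
  obtain g' where g': "g' \<in> poly_funs vscale" "g = restrict0 (aff r) g'" using g by (rule homog_partE)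
  show "(\<forall>L\<in>Pspace r. vanishes_at f L) \<or> (\<forall>L\<in>Pspace r. vanishes_at g L)"
  proof (rule ccontr)
    assume "\<not> ?thesis"
    then obtain x y where xy: "x \<in> aff r" "y \<in> aff r" "x \<noteq> 0" "\<not> vanishes_at f (line vscale x)" "\<not> vanishes_at g (line vscale y)"
      by (auto simp: in_Pspace)
    then have "f' x \<noteq> 0" "g' y \<noteq> 0"
      using vanishes_at_line[OF vaff f] vanishes_at_line[OF vaff g] by (auto simp: f' g' restrict0_def)
    \<comment> \<open>A coordinate is carried along as a third factor, which keeps the common point
      of nonvanishing away from the origin.\<close>
    obtain j where j: "x j \<noteq> 0" using xy(3) by (auto simp: fun_eq_iff)
    obtain z1 where z1: "z1 \<in> aff r" "g' z1 * z1 j \<noteq> 0"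
      using poly_funs_common_nonzero[where f = g' and g = "\<lambda>x. x j", OF vaff g'(1) coordinate_poly xy(2,1) \<open>g' y \<noteq> 0\<close> j] by auto
    obtain z where z: "z \<in> aff r" "f' z \<noteq> 0" "g' z * z j \<noteq> 0"
      using poly_funs_common_nonzero[where f = f' and g = "\<lambda>x. g' x * x j", OF vaff f'(1) poly_funs.mult[OF g'(1) coordinate_poly] xy(1) z1(1) \<open>f' x \<noteq> 0\<close> z1(2)]
      by auto
    have "z \<noteq> 0" using z(3) by auto
    then have "line vscale z \<in> Pspace r" using z(1) unfolding in_Pspace by blast
    moreover have "\<not> vanishes_at f (line vscale z)" "\<not> vanishes_at g (line vscale z)"
      using z vanishes_at_line[OF vaff f z(1)] vanishes_at_line[OF vaff g z(1)] by (auto simp: f' g' restrict0_def)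
    ultimately show False using fg by blast
  qed
qed simp

text \<open>
  Projection from the point \<open>q = axis 1\<close>: an irreducible \<open>Y\<close> on which \<open>A\<close> and \<open>B\<close> vanish misses \<open>q\<close>,
  and its join with \<open>q\<close> misses \<open>axis 0\<close> because the resultant with respect to \<open>x\<^sub>1\<close> vanishes on it.
  Moving along \<open>c * y j\<close> instead of \<open>c\<close> keeps the equations homogeneous.
\<close>

lemma join_chain:
  assumes r: "1 \<le> r" and m: "1 \<le> m" and AB: "A \<in> homog_polys r m" "B \<in> homog_polys r m"
    and Aq: "peval A (axis 1) \<noteq> 0" and res: "det (sylv m A B (axis 0)) \<noteq> 0"
    and Y: "prime_set vscale (aff r) Y"
    and van: "\<And>y. y \<in> aff r \<Longrightarrow> line vscale y \<in> Y \<Longrightarrow> peval A y = 0 \<and> peval B y = 0"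
  shows "\<exists>C. closedin (zariski vscale (aff r)) C \<and> prime_set vscale (aff r) C \<and> Y \<subset> C \<and> C \<subset> Pspace r"
proof -
  let ?q = "axis 1" and ?X = "zariski vscale (aff r)"
  have q: "?q \<in> aff r" using r by (rule axis_aff)
  have YP: "Y \<subseteq> Pspace r" "Y \<noteq> {}" using Y by (auto simp: prime_set_def)
  then obtain L0 where "L0 \<in> Y" "L0 \<in> Pspace r" by blast
  then obtain y0 where y0: "y0 \<in> aff r" "y0 \<noteq> 0" "line vscale y0 \<in> Y" unfolding in_Pspace by blast
  then obtain j where j: "y0 j \<noteq> 0" by (auto simp: fun_eq_iff)
  define mv where "mv c y = y + vscale (c * y j) ?q" for c y
  have mv_aff: "mv c y \<in> aff r" if "y \<in> aff r" for c y
    unfolding mv_def by (rule aff_closed[OF that q])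
  note line_scale = line_scale[OF vector_space_vscale]
  have qY: "line vscale ?q \<notin> Y" using van[OF q] Aq by blast
  have mv_nz: "mv c y \<noteq> 0" if y: "y \<in> aff r" "y \<noteq> 0" "line vscale y \<in> Y" for c y
  proof
    assume mv: "mv c y = 0"
    have "y = mv c y - vscale (c * y j) ?q" by (simp add: mv_def)
    also have "\<dots> = vscale (- (c * y j)) ?q" unfolding mv by (simp add: vscale_def fun_eq_iff)
    finally have eq: "y = vscale (- (c * y j)) ?q" .
    have nz: "- (c * y j) \<noteq> 0"
    proof
      assume "- (c * y j) = 0"
      then have "y = vscale 0 ?q" using eq by (simp only:)
      then show False using y(2) by (auto simp: vscale_def fun_eq_iff)
    qed
    have "line vscale y = line vscale ?q" using line_scale[OF nz, of ?q] unfolding eq[symmetric] .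
    then show False using y(3) qY by simp
  qed
  define J where "J = {line vscale (mv c y) | c y. y \<in> aff r \<and> y \<noteq> 0 \<and> line vscale y \<in> Y}"
  have JP: "J \<subseteq> Pspace r" unfolding J_def using PspaceI[OF mv_aff mv_nz] by blast
  have mv0: "mv 0 y = y" for y by (simp add: mv_def vscale_def fun_eq_iff)
  have YJ: "Y \<subseteq> J"
  proof
    fix L assume L: "L \<in> Y"
    then have "L \<in> Pspace r" using YP by blast
    then obtain y where "y \<in> aff r" "y \<noteq> 0" "L = line vscale y" unfolding in_Pspace by blast
    then show "L \<in> J" unfolding J_def using L
      by (intro CollectI exI[of _ 0] exI[of _ y]) (simp add: mv0)
  qed
  have on_J: "(\<forall>L\<in>J. vanishes_at f L) \<longleftrightarrow> (\<forall>c y. y \<in> aff r \<and> y \<noteq> 0 \<and> line vscale y \<in> Y \<longrightarrow> f (mv c y) = 0)"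
    if f: "f \<in> Hp r n" for f n
  proof (intro iffI allI impI ballI)
    fix c y assume a: "\<forall>L\<in>J. vanishes_at f L" and y: "y \<in> aff r \<and> y \<noteq> 0 \<and> line vscale y \<in> Y"
    have "line vscale (mv c y) \<in> J" unfolding J_def using y by blast
    with a have "vanishes_at f (line vscale (mv c y))" by (rule bspec)
    then show "f (mv c y) = 0" using vanishes_at_line[OF vaff f mv_aff] y by simp
  next
    fix L assume z: "\<forall>c y. y \<in> aff r \<and> y \<noteq> 0 \<and> line vscale y \<in> Y \<longrightarrow> f (mv c y) = 0" and "L \<in> J"
    then obtain c y where "L = line vscale (mv c y)" "y \<in> aff r" "y \<noteq> 0" "line vscale y \<in> Y"
      unfolding J_def by blast
    then show "vanishes_at f L" using vanishes_at_line[OF vaff f mv_aff] z by simp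
  qed
  have shifted: "restrict0 (aff r) (\<lambda>y. f (mv c y)) \<in> Hp r n" if f: "f \<in> Hp r n" for f n c
  proof -
    obtain f' where f': "f' \<in> poly_funs vscale" "f = restrict0 (aff r) f'" using f by (rule homog_partE)
    have "(\<lambda>y. f' (mv c y)) \<in> poly_funs vscale"
      using f'(1) unfolding poly_funs_eq_polyalg
    proof (rule polyalg_comp)
      fix l assume "l \<in> lin_funs vscale"
      then have l: "Vector_Spaces.linear vscale (*) l" by simp
      show "(\<lambda>y. l (mv c y)) \<in> polyalg (lin_funs vscale)"
        using l by (simp add: mv_def linear_functional_simps[OF l])
          (auto intro!: polyalg.add polyalg.mult polyalg.const intro: polyalg.gen vscale_coordinate)
    qed
    moreover have "restrict0 (aff r) (\<lambda>y. f (mv c y)) = restrict0 (aff r) (\<lambda>y. f' (mv c y))"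
      using mv_aff by (auto simp: f'(2) restrict0_def)
    ultimately have "restrict0 (aff r) (\<lambda>y. f (mv c y)) \<in> carrier (coord_ring vscale (aff r))"
      by (simp add: coord_ring_def)
    moreover have "f (mv c (vscale a y)) = a ^ n * f (mv c y)" if "y \<in> aff r" for a y
    proof -
      have "mv c (vscale a y) = vscale a (mv c y)" by (auto simp: mv_def vscale_def fun_eq_iff algebra_simps)
      then show ?thesis using homog_part_scale[OF vaff f mv_aff[OF that]] by simp
    qed
    moreover have "vscale a y \<in> aff r" if "y \<in> aff r" for a y using that by (simp add: affine_space_def vscale_def)
    ultimately show ?thesis unfolding homog_part_def by (simp add: restrict0_def)
  qed
  have line_poly: "(\<lambda>c. f (mv c y)) \<in> univ_polys" if f: "f \<in> Hp r n" and y: "y \<in> aff r" for f n y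
  proof -
    obtain f' where f': "f' \<in> poly_funs vscale" "f = restrict0 (aff r) f'" using f by (rule homog_partE)
    have "(\<lambda>c. f (mv c y)) = (\<lambda>c. f' (y + vscale c (vscale (y j) ?q)))"
    proof
      fix c
      have "f (mv c y) = f' (mv c y)" using mv_aff[OF y] by (simp add: f'(2) restrict0_def)
      then show "f (mv c y) = f' (y + vscale c (vscale (y j) ?q))"
        by (simp add: mv_def vscale_def mult.assoc)
    qed
    then show ?thesis using poly_fun_on_line[OF vaff(1) f'(1)] by simp
  qed
  have "prime_set vscale (aff r) J"
    unfolding prime_set_def
  proof (intro conjI allI ballI impI JP)
    show "J \<noteq> {}" using YJ YP(2) by blast
    fix n n' f g assume f: "f \<in> Hp r n" and g: "g \<in> Hp r n'" and fg: "\<forall>L\<in>J. vanishes_at f L \<or> vanishes_at g L"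
    let ?R = "\<lambda>f c. restrict0 (aff r) (\<lambda>y. f (mv c y))"
    \<comment> \<open>For fixed \<open>c\<close>, moving the argument gives homogeneous functions,
      and primality of \<open>Y\<close> selects one factor. One of the factors is selected for
      infinitely many \<open>c\<close>; being polynomial in \<open>c\<close>, it vanishes for
      all.\<close>
    have dich: "(\<forall>L\<in>Y. vanishes_at (?R f c) L) \<or> (\<forall>L\<in>Y. vanishes_at (?R g c) L)" for c
    proof (rule prime_setD[OF Y shifted[OF f] shifted[OF g]])
      fix L assume L: "L \<in> Y"
      then have "L \<in> Pspace r" using YP by blast
      then obtain y where y: "y \<in> aff r" "y \<noteq> 0" "L = line vscale y" unfolding in_Pspace by blast
      have "line vscale y \<in> Y" using L y(3) by simp
      then have "line vscale (mv c y) \<in> J" unfolding J_def using y(1,2) by blast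
      with fg have "vanishes_at f (line vscale (mv c y)) \<or> vanishes_at g (line vscale (mv c y))" by (rule bspec)
      then have "f (mv c y) = 0 \<or> g (mv c y) = 0"
        by (simp only: vanishes_at_line[OF vaff f mv_aff[OF y(1)]] vanishes_at_line[OF vaff g mv_aff[OF y(1)]])
      then show "vanishes_at (?R f c) L \<or> vanishes_at (?R g c) L"
        unfolding y(3) vanishes_at_line[OF vaff shifted[OF f] y(1)] vanishes_at_line[OF vaff shifted[OF g] y(1)]
        using y(1) by (simp add: restrict0_def)
    qed
    have "{c. \<forall>L\<in>Y. vanishes_at (?R f c) L} \<union> {c. \<forall>L\<in>Y. vanishes_at (?R g c) L} = UNIV"
      by (rule Set.set_eqI) (simp only: Un_iff mem_Collect_eq UNIV_I dich)
    then have "infinite ({c. \<forall>L\<in>Y. vanishes_at (?R f c) L} \<union> {c. \<forall>L\<in>Y. vanishes_at (?R g c) L})"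
      by (simp only: infinite_UNIV_char_0 not_False_eq_True)
    then have inf: "infinite {c. \<forall>L\<in>Y. vanishes_at (?R f c) L} \<or> infinite {c. \<forall>L\<in>Y. vanishes_at (?R g c) L}"
      unfolding finite_Un de_Morgan_conj .
    have all: "\<forall>L\<in>J. vanishes_at h L" if h: "h \<in> Hp r k" and "infinite {c. \<forall>L\<in>Y. vanishes_at (?R h c) L}" for h k
      unfolding on_J[OF h]
    proof (intro allI impI)
      fix c y assume y: "y \<in> aff r \<and> y \<noteq> 0 \<and> line vscale y \<in> Y"
      have "{c. \<forall>L\<in>Y. vanishes_at (?R h c) L} \<subseteq> {c. h (mv c y) = 0}"
        using y vanishes_at_line[OF vaff shifted[OF h], of y] by (auto simp: restrict0_def)
      then have "infinite {c. h (mv c y) = 0}" using that(2) finite_subset by blast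
      then show "h (mv c y) = 0" using univ_polys_eq_0[OF line_poly[OF h]] y by blast
    qed
    show "(\<forall>L\<in>J. vanishes_at f L) \<or> (\<forall>L\<in>J. vanishes_at g L)"
      using inf all[OF f] all[OF g] by blast
  qed
  then have prime: "prime_set vscale (aff r) (?X closure_of J)"
    by (rule prime_set_between[OF vaff])
      (use closure_of_subset[of J ?X] JP topspace_zariski[OF vaff, of r] in auto)
  have "line vscale ?q \<in> ?X closure_of J"
    unfolding in_zariski_closure[OF vaff JP]
  proof (intro conjI allI ballI impI)
    show "line vscale ?q \<in> Pspace r" by (rule PspaceI[OF q axis_nonzero])
    fix n f assume f: "f \<in> Hp r n" "\<forall>L\<in>J. vanishes_at f L"
    obtain f' where f': "f' \<in> poly_funs vscale" "f = restrict0 (aff r) f'" using f(1) by (rule homog_partE)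
    \<comment> \<open>For \<open>t \<noteq> 0\<close> these points lie on lines of \<open>J\<close>;
      a polynomial in \<open>t\<close> that vanishes there also vanishes at \<open>t = 0\<close>,
      the projection center.\<close>
    have "f' (?q + vscale t y0) = 0" if "t \<noteq> 0" for t
    proof -
      let ?c = "1 / (t * y0 j)"
      have eq: "?q + vscale t y0 = vscale t (mv ?c y0)"
        using that j by (auto simp: mv_def vscale_def fun_eq_iff field_simps)
      have "f (mv ?c y0) = 0" using f(2) y0 unfolding on_J[OF f(1)] by blast
      then have "f (?q + vscale t y0) = 0"
        unfolding eq homog_part_scale[OF vaff f(1) mv_aff[OF y0(1)]] by simp
      then show ?thesis using aff_closed[OF q y0(1)] by (simp add: f'(2) restrict0_def)
    qed
    then have "- {0} \<subseteq> {t. f' (?q + vscale t y0) = 0}" by auto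
    then have "infinite {t. f' (?q + vscale t y0) = 0}"
      using infinite_UNIV_char_0[where ?'a = complex] by (metis finite_subset finite.emptyI finite_insert finite_compl)
    from univ_polys_eq_0[OF poly_fun_on_line[OF vaff(1) f'(1)] this, of 0]
    have "f' ?q = 0" by (simp add: vscale_def plus_fun_def)
    then show "vanishes_at f (line vscale ?q)"
      unfolding vanishes_at_line[OF vaff f(1) q] by (simp add: f'(2) restrict0_def)
  qed
  moreover have "Y \<subseteq> ?X closure_of J"
    using YJ closure_of_subset[of J ?X] JP topspace_zariski[OF vaff, of r] by auto
  ultimately have 1: "Y \<subset> ?X closure_of J" using qY by blast
  have "line vscale (axis 0) \<notin> ?X closure_of J"
  proof
    assume e0: "line vscale (axis 0) \<in> ?X closure_of J"
    let ?D = "\<lambda>x. det (sylv m A B x)"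
    have "?D \<in> poly_funs vscale"
      unfolding poly_funs_eq_polyalg
      using msum_wt1_poly[unfolded poly_funs_eq_polyalg] by (intro sylv_det_poly)
    \<comment> \<open>Closed sets are defined by homogeneous functions, so the determinant is
      replaced by one of its components that is nonzero at \<open>axis 0\<close>.\<close>
    then obtain F N where F: "\<And>k c v. F k (vscale c v) = c ^ k * F k v" "\<And>v. ?D v = (\<Sum>k\<le>N. F k v)"
      "\<And>k. restrict0 (aff r) (F k) \<in> Hp r k"
      by (rule homog_part_of_components[OF vaff, of _ r]) blast
    have "(\<Sum>k\<le>N. F k (axis 0)) \<noteq> 0" using res unfolding F(2) .
    then obtain k where k: "k \<in> {..N}" "F k (axis 0) \<noteq> 0" by (rule sum.not_neutral_contains_not_neutral)
    have "F k (mv c y) = 0" if y: "y \<in> aff r \<and> y \<noteq> 0 \<and> line vscale y \<in> Y" for c y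
    proof (rule homog_component_vanishes[where F = F and N = N, OF F(1) F(2)])
      fix a :: complex
      \<comment> \<open>\<open>mv\<close> changes only \<open>x\<^sub>1\<close>, the variable
        eliminated by the resultant.\<close>
      have w: "wt1 k (vscale a (mv c y)) = wt1 k (vscale a y)" for k
        by (rule wt1_cong) (simp add: mv_def vscale_def axis_def)
      have "sylv m A B (vscale a (mv c y)) = sylv m A B (vscale a y)"
        unfolding sylv_def w ..
      moreover have "?D (vscale a y) = 0"
      \<comment> \<open>The origin lies on every line but spans none, so it is not covered by
        \<open>van\<close>; there both polynomials vanish because their degree is positive.\<close>
      proof (cases "a = 0")
        case True
        have zero: "peval p (vscale 0 y) = 0" if "p \<in> homog_polys r m" for p
        proof -
          have "mval \<alpha> (vscale 0 y) = 0" if "\<alpha> \<in> Poly_Mapping.keys p" for \<alpha>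
          proof -
            have "mdeg \<alpha> \<noteq> 0" using \<open>p \<in> homog_polys r m\<close> that m by (auto simp: homog_polys_iff)
            then obtain i where "i \<in> Poly_Mapping.keys \<alpha>" by (auto simp: mdeg_def)
            then show ?thesis by (auto simp: mval_def vscale_def in_keys_iff intro!: prod_zero)
          qed
          then show ?thesis by (simp add: peval_msum msum_def)
        qed
        show ?thesis unfolding True by (intro sylv_det_common_zero[OF m AB] zero AB)
      next
        case False
        have "vscale a y \<in> aff r" using y by (simp add: affine_space_def vscale_def)
        moreover have "line vscale (vscale a y) \<in> Y" unfolding line_scale[OF False] using y by blast
        ultimately have "peval A (vscale a y) = 0 \<and> peval B (vscale a y) = 0" by (rule van)
        then show ?thesis by (intro sylv_det_common_zero[OF m AB]) simp_all
      qed
      ultimately show "?D (vscale a (mv c y)) = 0" by simp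
    qed (use k in simp)
    then have "\<forall>L\<in>J. vanishes_at (restrict0 (aff r) (F k)) L"
      unfolding on_J[OF F(3)] by (simp add: restrict0_def)
    then have "vanishes_at (restrict0 (aff r) (F k)) (line vscale (axis 0))"
      using e0 F(3) unfolding in_zariski_closure[OF vaff JP] by blast
    then have "restrict0 (aff r) (F k) (axis 0) = 0"
      using vanishes_at_line[OF vaff F(3) axis_aff[of 0 r]] by simp
    then show False using k(2) axis_aff[of 0 r] by (simp add: restrict0_def)
  qed
  moreover have "line vscale (axis 0) \<in> Pspace r" by (rule PspaceI[OF axis_aff axis_nonzero]) simp
  ultimately have "?X closure_of J \<subset> Pspace r"
    using closure_of_subset_topspace[of ?X J] topspace_zariski[OF vaff, of r] by auto
  then show ?thesis using 1 prime by (intro exI[of _ "?X closure_of J"]) simp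
qed

text \<open>Above every irreducible closed \<open>Y\<close> inside \<open>W\<close> stands the chain
  of \<open>Y\<close>, its join with the projection center, and the whole space.\<close>

lemma codim_ge_2:
  assumes "1 \<le> r" "1 \<le> m" "A \<in> homog_polys r m" "B \<in> homog_polys r m"
    "peval A (axis 1) \<noteq> 0" "det (sylv m A B (axis 0)) \<noteq> 0" and W: "W \<subseteq> Pspace r"
    and van: "\<And>y. y \<in> aff r \<Longrightarrow> line vscale y \<in> W \<Longrightarrow> peval A y = 0 \<and> peval B y = 0"
  shows "codim (zariski vscale (aff r)) W \<ge> 2"
  unfolding codim_def
proof (rule INF_greatest)
  let ?X = "zariski vscale (aff r)"
  fix Y assume "Y \<in> {Y. Y \<subseteq> W \<and> closedin ?X Y \<and> irreducible_in ?X Y}"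
  then have Y: "Y \<subseteq> W" "closedin ?X Y" "prime_set vscale (aff r) Y"
    by (auto simp: irreducible_in_zariski[OF vaff])
  have "peval A y = 0 \<and> peval B y = 0" if "y \<in> aff r" "line vscale y \<in> Y" for y
    using van that Y(1) by blast
  then have "\<exists>C. closedin ?X C \<and> prime_set vscale (aff r) C \<and> Y \<subset> C \<and> C \<subset> Pspace r"
    by (intro join_chain[OF assms(1-6) Y(3)])
  then obtain C where C: "closedin ?X C" "prime_set vscale (aff r) C" "Y \<subset> C" "C \<subset> Pspace r"
    by (elim exE conjE)
  define D where "D i = (if i = 0 then Y else if i = 1 then C else Pspace r)" for i :: nat
  have "closedin ?X (Pspace r)" using closedin_topspace[of ?X] by (simp add: topspace_zariski[OF vaff])
  then have irr: "\<forall>i\<le>2. closedin ?X (D i) \<and> irreducible_in ?X (D i)"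
    using Y C prime_set_Pspace by (auto simp: D_def irreducible_in_zariski[OF vaff])
  have chain: "\<forall>i<2. D i \<subset> D (Suc i)" using C by (auto simp: D_def less_2_cases_iff)
  have D0: "D 0 = Y" by (simp add: D_def)
  let ?S = "{n. \<exists>C :: nat \<Rightarrow> (nat \<Rightarrow> complex) set set. C 0 = Y
      \<and> (\<forall>i\<le>n. closedin ?X (C i) \<and> irreducible_in ?X (C i)) \<and> (\<forall>i<n. C i \<subset> C (Suc i))}"
  have "2 \<in> ?S" by (intro CollectI exI[of _ D] conjI D0 irr chain)
  then have "enat 2 \<le> (SUP n \<in> ?S. enat n)" by (rule SUP_upper)
  then show "2 \<le> (SUP n \<in> ?S. enat n)" by (simp only: numeral_eq_enat)
qed

section \<open>The parametrisation of the rational component\<close>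

lemma sum_apply: "(\<Sum>a\<in>A. f a) x = (\<Sum>a\<in>A. f a x)"
  by (induction A rule: infinite_finite_induct) auto

lemma finite_monomials: "finite {\<alpha>::mono. Poly_Mapping.keys \<alpha> \<subseteq> {..r} \<and> mdeg \<alpha> = n}"
proof (rule finite_subset)
  let ?S = "{f. \<forall>x. (x \<in> {..r} \<longrightarrow> f x \<in> {..n}) \<and> (x \<notin> {..r} \<longrightarrow> f x = 0)}"
  show "{\<alpha>::mono. Poly_Mapping.keys \<alpha> \<subseteq> {..r} \<and> mdeg \<alpha> = n} \<subseteq> Poly_Mapping.lookup -` ?S"
  proof
    fix \<alpha> :: mono assume "\<alpha> \<in> {\<alpha>. Poly_Mapping.keys \<alpha> \<subseteq> {..r} \<and> mdeg \<alpha> = n}"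
    then have a: "Poly_Mapping.keys \<alpha> \<subseteq> {..r}" "mdeg \<alpha> = n" by auto
    have "Poly_Mapping.lookup \<alpha> x \<le> n" if "x \<le> r" for x
      using a(2) member_le_sum[of x "{..r}" "Poly_Mapping.lookup \<alpha>"] that
      unfolding mdeg_superset[OF finite_atMost a(1)] by simp
    then show "\<alpha> \<in> Poly_Mapping.lookup -` ?S" using a(1) by (auto simp: in_keys_iff)
  qed
  have "finite ?S" by (rule finite_set_of_finite_funs) simp_all
  then show "finite (Poly_Mapping.lookup -` ?S)"
    by (rule finite_vimageI) (auto simp: inj_def lookup_inject)
qed

text \<open>Finite dimension is what bounds the dual systems and makes the set of tangent directions
  finite.\<close>

lemma one_forms_finite_span: "\<exists>B. finite B \<and> one_forms r m \<subseteq> module.span fscale B"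
proof -
  interpret vector_space fscale by (rule vector_space_fscale)
  let ?A = "{\<alpha>::mono. Poly_Mapping.keys \<alpha> \<subseteq> {..r} \<and> mdeg \<alpha> = m - 1}"
  define E :: "nat \<Rightarrow> mono \<Rightarrow> form" where "E i \<alpha> = (\<lambda>j. if j = i then Poly_Mapping.single \<alpha> 1 else 0)" for i \<alpha>
  let ?B = "case_prod E ` ({..r} \<times> ?A)"
  have "\<omega> \<in> span ?B" if \<omega>: "\<omega> \<in> one_forms r m" for \<omega>
  proof -
    have h: "\<omega> i \<in> homog_polys r (m - 1)" for i using hformsD[OF one_forms_hforms[OF \<omega>]] .
    have "\<omega> = (\<Sum>i\<le>r. \<Sum>\<alpha>\<in>?A. fscale (cf (\<omega> i) \<alpha>) (E i \<alpha>))"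
    proof (rule ext, rule poly_mapping_eqI)
      fix j \<beta>
      have "cf ((\<Sum>i\<le>r. \<Sum>\<alpha>\<in>?A. fscale (cf (\<omega> i) \<alpha>) (E i \<alpha>)) j) \<beta> =
        (\<Sum>i\<le>r. \<Sum>\<alpha>\<in>?A. cf (\<omega> i) \<alpha> * cf (E i \<alpha> j) \<beta>)"
        by (simp add: sum_apply lookup_sum fscale_def lookup_pconst)
      also have "\<dots> = (\<Sum>i\<le>r. if i = j then \<Sum>\<alpha>\<in>?A. if \<alpha> = \<beta> then cf (\<omega> i) \<beta> else 0 else 0)"
        by (intro sum.cong refl) (auto simp: E_def lookup_single when_def intro!: sum.cong sum.neutral)
      also have "\<dots> = (if j \<le> r then if \<beta> \<in> ?A then cf (\<omega> j) \<beta> else 0 else 0)"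
        using finite_monomials[of r "m - 1"] by (simp add: sum.delta)
      also have "\<dots> = cf (\<omega> j) \<beta>"
        using homog_polysD[OF h, of j \<beta>] hforms_outside[OF one_forms_hforms[OF \<omega>], of j] by auto
      finally show "cf (\<omega> j) \<beta> = cf ((\<Sum>i\<le>r. \<Sum>\<alpha>\<in>?A. fscale (cf (\<omega> i) \<alpha>) (E i \<alpha>)) j) \<beta>" ..
    qed
    moreover have "(\<Sum>i\<le>r. \<Sum>\<alpha>\<in>?A. fscale (cf (\<omega> i) \<alpha>) (E i \<alpha>)) \<in> span ?B"
      by (intro span_sum span_scale span_base) auto
    ultimately show ?thesis by simp
  qed
  moreover have "finite ?B" using finite_monomials[of r "m - 1"] by simp
  ultimately show ?thesis by blast
qed

section \<open>Algebra of \<open>rho\<close> and of the Frobenius equations\<close>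

lemma rho_apply:
  assumes "F0 \<in> homog_polys r d0" "F1 \<in> homog_polys r d1"
  shows "rho r d0 d1 F0 F1 i = of_nat d0 * (F0 * pderiv_var i F1) - of_nat d1 * (F1 * pderiv_var i F0)"
  using homog_pderiv_outside[OF assms(1), of i] homog_pderiv_outside[OF assms(2), of i]
  by (simp add: rho_def mult.assoc)

lemma rho_one_forms:
  assumes F: "F0 \<in> homog_polys r d0" "F1 \<in> homog_polys r d1" and d: "1 \<le> d0" "1 \<le> d1"
  shows "rho r d0 d1 F0 F1 \<in> one_forms r (d0 + d1)"
proof -
  have "rho r d0 d1 F0 F1 i \<in> homog_polys r (d0 + d1 - 1)" for i
  proof -
    have "F0 * pderiv_var i F1 \<in> homog_polys r (d0 + (d1 - 1))" "F1 * pderiv_var i F0 \<in> homog_polys r (d1 + (d0 - 1))"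
      by (intro homog_mult F homog_pderiv)+
    moreover have "d0 + (d1 - 1) = d0 + d1 - 1" "d1 + (d0 - 1) = d0 + d1 - 1" using d by auto
    ultimately show ?thesis
      unfolding rho_apply[OF F] by (intro homog_diff homog_of_nat_mult) simp_all
  qed
  moreover have "(\<Sum>i\<le>r. rho r d0 d1 F0 F1 i * pvar i) = 0"
  proof -
    have "(\<Sum>i\<le>r. rho r d0 d1 F0 F1 i * pvar i) =
      of_nat d0 * F0 * (\<Sum>i\<le>r. pvar i * pderiv_var i F1) - of_nat d1 * F1 * (\<Sum>i\<le>r. pvar i * pderiv_var i F0)"
      by (simp add: rho_apply[OF F] algebra_simps sum_subtractf sum_distrib_left)
    then show ?thesis unfolding euler_identity[OF F(1)] euler_identity[OF F(2)] by (simp add: mult_ac)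
  qed
  moreover have "\<forall>i>r. rho r d0 d1 F0 F1 i = 0" by (simp add: rho_def)
  ultimately show ?thesis unfolding one_forms_def by (intro CollectI conjI allI impI) simp_all
qed

lemma integrable_rho:
  assumes F: "F0 \<in> homog_polys r d0" "F1 \<in> homog_polys r d1"
  shows "integrable_form r (rho r d0 d1 F0 F1)"
  unfolding integrable_form_def wedge_d_def dform_rho[OF F] rho_apply[OF F]
  by (simp add: algebra_simps)

lemma rho_swap: "rho r d1 d0 F1 F0 = fscale (- 1) (rho r d0 d1 F0 F1)"
proof -
  have "pconst (- 1) = - 1"
    using pconst_simps(1)[of 1 "- 1"] by (simp add: pconst_simps(3) pconst_def eq_neg_iff_add_eq_0 add.commute)
  then show ?thesis by (simp add: rho_def fscale_def fun_eq_iff)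
qed

lemma rho_add:
  "rho r d0 d1 (F + G) H = rho r d0 d1 F H + rho r d0 d1 G H"
  "rho r d0 d1 H (F + G) = rho r d0 d1 H F + rho r d0 d1 H G"
  by (simp_all add: rho_def fun_eq_iff pderiv_add algebra_simps)

lemma rho_pconst_mult:
  "rho r d0 d1 (pconst c * F) H = fscale c (rho r d0 d1 F H)"
  "rho r d0 d1 H (pconst c * F) = fscale c (rho r d0 d1 H F)"
  by (simp_all add: rho_def fscale_def fun_eq_iff pderiv_pconst_mult) (simp_all add: algebra_simps)

lemma rho_0: "rho r d0 d1 0 H = 0" "rho r d0 d1 H 0 = 0"
  by (simp_all add: rho_def fun_eq_iff pderiv_0)

lemma rho_sum:
  "rho r d0 d1 (\<Sum>a\<in>A. f a) H = (\<Sum>a\<in>A. rho r d0 d1 (f a) H)"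
  "rho r d0 d1 H (\<Sum>a\<in>A. f a) = (\<Sum>a\<in>A. rho r d0 d1 H (f a))"
  by (induction A rule: infinite_finite_induct) (simp_all add: rho_0 rho_add)

text \<open>\<open>rho\<close> is bilinear, so perturbing both polynomials gives an exact quadratic
  expansion. Its shape is the one prescribed for \<open>P\<close> in
  \<open>tangent_chart\<close>.\<close>

lemma rho_perturbation:
  "rho r d0 d1 (F0 + (\<Sum>b\<in>T. pconst (z b) * G b)) (F1 + (\<Sum>b\<in>T. pconst (z b) * H b)) =
    rho r d0 d1 F0 F1 + (\<Sum>b\<in>T. fscale (z b) (rho r d0 d1 F0 (H b) + rho r d0 d1 (G b) F1))
      + (\<Sum>a\<in>T. \<Sum>b\<in>T. fscale (z a * z b) (rho r d0 d1 (G a) (H b)))"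
proof -
  interpret vector_space fscale by (rule vector_space_fscale)
  let ?S = "\<Sum>b\<in>T. pconst (z b) * G b" and ?R = "\<Sum>b\<in>T. pconst (z b) * H b"
  have "rho r d0 d1 F0 ?R = (\<Sum>b\<in>T. fscale (z b) (rho r d0 d1 F0 (H b)))"
    "rho r d0 d1 ?S F1 = (\<Sum>b\<in>T. fscale (z b) (rho r d0 d1 (G b) F1))"
    by (simp_all add: rho_sum rho_pconst_mult)
  moreover have "rho r d0 d1 ?S ?R = (\<Sum>a\<in>T. \<Sum>b\<in>T. fscale (z a * z b) (rho r d0 d1 (G a) (H b)))"
    unfolding rho_sum(1)
    by (rule sum.cong) (simp, simp add: rho_sum(2) rho_pconst_mult scale_sum_right, simp add: mult.commute)
  ultimately show ?thesis by (simp add: rho_add scale_right_distrib sum.distrib)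
qed

lemma wedge_d_expand:
  "wedge_d (\<omega> + fscale c \<eta>) i j k = wedge_d \<omega> i j k
     + pconst c * (wedge_lin \<omega> \<eta> i j k + wedge_lin \<eta> \<omega> i j k) + pconst (c\<^sup>2) * wedge_d \<eta> i j k"
  by (simp add: wedge_d_def wedge_lin_def dform_def fscale_def pderiv_add pderiv_pconst_mult
      pconst_simps power2_eq_square algebra_simps)

lemma wedge_d_fscale: "wedge_d (fscale c \<omega>) i j k = pconst (c\<^sup>2) * wedge_d \<omega> i j k"
  by (simp add: wedge_d_def dform_def fscale_def pderiv_pconst_mult pconst_simps power2_eq_square algebra_simps)

section \<open>The ideal of the Frobenius equations\<close>

lemma (in cring) ideal_if_closed:
  assumes "J \<subseteq> carrier R" "\<zero> \<in> J" "\<And>a b. a \<in> J \<Longrightarrow> b \<in> J \<Longrightarrow> a \<oplus> b \<in> J"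
    "\<And>x a. x \<in> carrier R \<Longrightarrow> a \<in> J \<Longrightarrow> x \<otimes> a \<in> J"
  shows "ideal J R"
proof (rule idealI)
  show "ring R" by (rule ring_axioms)
  show "subgroup J (add_monoid R)"
  proof
    fix a assume a: "a \<in> J"
    then have "(\<ominus> \<one>) \<otimes> a \<in> J" by (intro assms(4)) simp_all
    moreover have "(\<ominus> \<one>) \<otimes> a = \<ominus> a" using a assms(1) by (simp add: l_minus subsetD)
    ultimately show "inv\<^bsub>add_monoid R\<^esub> a \<in> J" by (simp add: a_inv_def)
  qed (use assms in auto)
  fix a x assume "a \<in> J" "x \<in> carrier R"
  then show "x \<otimes> a \<in> J" "a \<otimes> x \<in> J" using assms(4)[of x a] assms(1) m_comm[of x a] by auto
qed

abbreviation "frob_ring r d \<equiv> coord_ring fscale (one_forms r (d + 2))"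

lemmas vone = vector_space_fscale one_forms_subspace

text \<open>The elements of the ring with property \<open>Q\<close> form an ideal containing the
  generators.\<close>

lemma frobenius_induct:
  assumes f: "f \<in> frobenius_ideal r d"
    and gen: "\<And>i j k \<alpha>. i \<le> r \<Longrightarrow> j \<le> r \<Longrightarrow> k \<le> r \<Longrightarrow> Q (restrict0 (one_forms r (d + 2)) (\<lambda>\<omega>. cf (wedge_d \<omega> i j k) \<alpha>))"
    and Q: "Q (\<lambda>_. 0)" "\<And>g h. Q g \<Longrightarrow> Q h \<Longrightarrow> Q (\<lambda>v. g v + h v)"
      "\<And>g h. g \<in> carrier (frob_ring r d) \<Longrightarrow> Q h \<Longrightarrow> Q (\<lambda>v. g v * h v)"
  shows "Q f"
proof -
  interpret cring "frob_ring r d" by (rule cring_coord_ring)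
  note simps = coord_ring_simps[OF vone]
  let ?J = "{f \<in> carrier (frob_ring r d). Q f}"
  have "ideal ?J (frob_ring r d)"
  proof (rule ideal_if_closed)
    show "\<zero>\<^bsub>frob_ring r d\<^esub> \<in> ?J" using Q(1) zero_closed by (simp add: simps)
    fix a b assume "a \<in> ?J" "b \<in> ?J"
    then show "a \<oplus>\<^bsub>frob_ring r d\<^esub> b \<in> ?J" using Q(2)[of a b] a_closed[of a b] by (simp add: simps)
  next
    fix x a assume "x \<in> carrier (frob_ring r d)" "a \<in> ?J"
    then show "x \<otimes>\<^bsub>frob_ring r d\<^esub> a \<in> ?J" using Q(3)[of x a] m_closed[of x a] by (simp add: simps)
  qed auto
  then have "Idl\<^bsub>frob_ring r d\<^esub> {restrict0 (one_forms r (d + 2)) (\<lambda>\<omega>. cf (wedge_d \<omega> i j k) \<alpha>)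
      | i j k \<alpha>. i \<le> r \<and> j \<le> r \<and> k \<le> r} \<subseteq> ?J"
    by (rule genideal_minimal)
      (intro subsetI, elim CollectE exE conjE, simp only: mem_Collect_eq, intro conjI gen wedge_d_carrier)
  then show ?thesis using f unfolding frobenius_ideal_def by blast
qed

lemma frobenius_closed:
  "(\<lambda>_. 0) \<in> frobenius_ideal r d"
  "f \<in> frobenius_ideal r d \<Longrightarrow> g \<in> frobenius_ideal r d \<Longrightarrow> (\<lambda>v. f v + g v) \<in> frobenius_ideal r d"
  "f \<in> carrier (frob_ring r d) \<Longrightarrow> g \<in> frobenius_ideal r d \<Longrightarrow> (\<lambda>v. f v * g v) \<in> frobenius_ideal r d"
  "f \<in> frobenius_ideal r d \<Longrightarrow> f \<in> carrier (frob_ring r d)"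
proof -
  interpret cring "frob_ring r d" by (rule cring_coord_ring)
  interpret I: ideal "frobenius_ideal r d" "frob_ring r d" by (rule ideal_frobenius)
  note simps = coord_ring_simps[OF vone]
  show "(\<lambda>_. 0) \<in> frobenius_ideal r d" using I.zero_closed by (simp add: simps)
  show "f \<in> frobenius_ideal r d \<Longrightarrow> g \<in> frobenius_ideal r d \<Longrightarrow> (\<lambda>v. f v + g v) \<in> frobenius_ideal r d"
    using I.a_closed[of f g] by (simp add: simps)
  show "f \<in> carrier (frob_ring r d) \<Longrightarrow> g \<in> frobenius_ideal r d \<Longrightarrow> (\<lambda>v. f v * g v) \<in> frobenius_ideal r d"
    using I.I_l_closed[of g f] by (simp add: simps)
  show "f \<in> frobenius_ideal r d \<Longrightarrow> f \<in> carrier (frob_ring r d)" using I.Icarr[of f] .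
qed

lemma frobenius_generator:
  assumes "i \<le> r" "j \<le> r" "k \<le> r"
  shows "restrict0 (one_forms r (d + 2)) (\<lambda>\<omega>. cf (wedge_d \<omega> i j k) \<alpha>) \<in> frobenius_ideal r d"
proof -
  interpret cring "frob_ring r d" by (rule cring_coord_ring)
  show ?thesis unfolding frobenius_ideal_def
    by (rule set_mp[OF genideal_self]) (use assms in \<open>auto intro: wedge_d_carrier\<close>)
qed

lemma carrier_scale:
  assumes c: "c \<noteq> 0" and f: "f \<in> carrier (frob_ring r d)"
  shows "(\<lambda>v. f (fscale c v)) \<in> carrier (frob_ring r d)"
proof -
  interpret vector_space fscale by (rule vector_space_fscale)
  obtain g where g: "g \<in> poly_funs fscale" "f = restrict0 (one_forms r (d + 2)) g" using f by (auto simp: coord_ring_def)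
  have "(\<lambda>v. g (fscale c v)) \<in> poly_funs fscale"
    using g(1) unfolding poly_funs_eq_polyalg
  proof (rule polyalg_comp)
    fix l assume l: "l \<in> lin_funs fscale"
    then have "Vector_Spaces.linear fscale (*) l" by simp
    from linear_functional_simps(2)[OF this]
    show "(\<lambda>v. l (fscale c v)) \<in> polyalg (lin_funs fscale)"
      using l by (simp only:) (intro polyalg.mult polyalg.const polyalg.gen)
  qed
  moreover have "fscale c v \<in> one_forms r (d + 2) \<longleftrightarrow> v \<in> one_forms r (d + 2)" for v
    using subspace_scale[OF one_forms_subspace, of v r "d + 2" c]
      subspace_scale[OF one_forms_subspace, of "fscale c v" r "d + 2" "1 / c"] c by auto
  then have "(\<lambda>v. f (fscale c v)) = restrict0 (one_forms r (d + 2)) (\<lambda>v. g (fscale c v))"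
    by (simp add: g(2) restrict0_def fun_eq_iff)
  ultimately show ?thesis by (simp add: coord_ring_def)
qed

lemma frobenius_const_mult:
  assumes "f \<in> frobenius_ideal r d" shows "(\<lambda>v. c * f v) \<in> frobenius_ideal r d"
proof -
  have "restrict0 (one_forms r (d + 2)) (\<lambda>_. c) \<in> carrier (frob_ring r d)"
    by (auto simp: coord_ring_def intro: poly_funs.const)
  from frobenius_closed(3)[OF this assms]
  have "(\<lambda>v. restrict0 (one_forms r (d + 2)) (\<lambda>_. c) v * f v) \<in> frobenius_ideal r d" .
  also have "(\<lambda>v. restrict0 (one_forms r (d + 2)) (\<lambda>_. c) v * f v) = (\<lambda>v. c * f v)"
    using frobenius_closed(4)[OF assms] by (auto simp: coord_ring_def restrict0_def)
  finally show ?thesis .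
qed

text \<open>The generators are quadratic, so scaling multiplies them by \<open>c\<^sup>2\<close>.
  Invertible scaling also preserves the complement of the space of forms, where all ring elements
  are 0.\<close>

lemma frobenius_scale:
  assumes c: "c \<noteq> 0" and "f \<in> frobenius_ideal r d"
  shows "(\<lambda>v. f (fscale c v)) \<in> frobenius_ideal r d"
  using assms(2)
proof (rule frobenius_induct[where Q = "\<lambda>f. (\<lambda>v. f (fscale c v)) \<in> frobenius_ideal r d"])
  interpret vector_space fscale by (rule vector_space_fscale)
  have V: "fscale c v \<in> one_forms r (d + 2) \<longleftrightarrow> v \<in> one_forms r (d + 2)" for v
    using subspace_scale[OF one_forms_subspace, of v r "d + 2" c]
      subspace_scale[OF one_forms_subspace, of "fscale c v" r "d + 2" "1 / c"] c by auto
  fix i j k \<alpha> assume "i \<le> r" "j \<le> r" "k \<le> r"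
  from frobenius_const_mult[OF frobenius_generator[OF this], of "c\<^sup>2" d \<alpha>]
  show "(\<lambda>v. restrict0 (one_forms r (d + 2)) (\<lambda>\<omega>. cf (wedge_d \<omega> i j k) \<alpha>) (fscale c v)) \<in> frobenius_ideal r d"
    by (rule back_subst[of "\<lambda>f. f \<in> frobenius_ideal r d"]) (unfold restrict0_def V, simp add: fun_eq_iff wedge_d_fscale lookup_pconst)
next
  fix g h assume g: "g \<in> carrier (frob_ring r d)" and h: "(\<lambda>v. h (fscale c v)) \<in> frobenius_ideal r d"
  show "(\<lambda>v. g (fscale c v) * h (fscale c v)) \<in> frobenius_ideal r d"
    by (rule frobenius_closed(3)[OF carrier_scale[OF c g] h])
qed (rule frobenius_closed(1), rule frobenius_closed(2))

lemma frobenius_vanishes: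
  assumes "f \<in> frobenius_ideal r d" "\<omega> \<in> one_forms r (d + 2)" "integrable_form r \<omega>"
  shows "f \<omega> = 0"
  using assms(1)
  by (rule frobenius_induct[where Q = "\<lambda>f. f \<omega> = 0"])
    (use assms(2,3) in \<open>auto simp: restrict0_def integrable_form_def\<close>)

text \<open>The ideal is stable under scaling of the argument, which separates the homogeneous components of \<open>g\<close>.\<close>

lemma frobenius_homogeneous_multiplier:
  assumes g: "\<And>k c v. F k (fscale c v) = c ^ k * F k v" "\<And>v. g v = (\<Sum>k\<le>N. F k v)"
    and h: "h \<in> homog_part fscale (one_forms r (d + 2)) n"
    and gh: "(\<lambda>v. g v * h v) \<in> frobenius_ideal r d" and "k \<le> N"
  shows "(\<lambda>v. F k v * h v) \<in> frobenius_ideal r d"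
proof (rule homog_components_in_subspace[where F = "\<lambda>k v. F k v * h v" and N = N and M = "frobenius_ideal r d"])
  fix c :: complex assume c: "c \<noteq> 0"
  \<comment> \<open>Division by \<open>c ^ n\<close> cancels the weight of \<open>h\<close> and
    leaves the weights of the components of \<open>g\<close>.\<close>
  have "(\<lambda>v. 1 / c ^ n * (g (fscale c v) * h (fscale c v))) \<in> frobenius_ideal r d"
    by (intro frobenius_const_mult frobenius_scale[OF c, of "\<lambda>v. g v * h v"] gh)
  also have "(\<lambda>v. 1 / c ^ n * (g (fscale c v) * h (fscale c v))) = (\<lambda>v. \<Sum>k\<le>N. c ^ k * (F k v * h v))"
  proof
    interpret vector_space fscale by (rule vector_space_fscale)
       fix v
    have "h (fscale c v) = c ^ n * h v"
    proof (cases "v \<in> one_forms r (d + 2)")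
      case True
      then show ?thesis by (rule homog_part_scale[OF vone h])
    next
      case False
      then have "fscale c v \<notin> one_forms r (d + 2)"
        using subspace_scale[OF one_forms_subspace, of "fscale c v" r "d + 2" "1 / c"] c by auto
      then show ?thesis using False by (simp add: homog_part_outside[OF vone h])
    qed
    then have "1 / c ^ n * (g (fscale c v) * h (fscale c v)) = (\<Sum>k\<le>N. c ^ k * F k v) * h v"
      using c by (simp add: g)
    then show "1 / c ^ n * (g (fscale c v) * h (fscale c v)) = (\<Sum>k\<le>N. c ^ k * (F k v * h v))"
      by (simp add: sum_distrib_right mult.assoc)
  qed
  finally show "(\<lambda>v. \<Sum>k\<le>N. c ^ k * (F k v * h v)) \<in> frobenius_ideal r d" .
qed (use \<open>k \<le> N\<close> in \<open>simp_all add: frobenius_closed frobenius_const_mult\<close>)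

section \<open>Functions vanishing on the rational component\<close>

text \<open>The preimage of the ideal among functions on the whole type. Derivatives and charts are
  formulated for such functions, while the coordinate ring consists of functions cut off outside the
  space of forms.\<close>

definition frobenius_functions :: "nat \<Rightarrow> nat \<Rightarrow> (form \<Rightarrow> complex) set" where
  "frobenius_functions r d = {f \<in> poly_funs fscale. restrict0 (one_forms r (d + 2)) f \<in> frobenius_ideal r d}"

lemma frobenius_functions_closed:
  "f \<in> frobenius_functions r d \<Longrightarrow> g \<in> frobenius_functions r d \<Longrightarrow> (\<lambda>v. f v + g v) \<in> frobenius_functions r d"
  "f \<in> poly_funs fscale \<Longrightarrow> g \<in> frobenius_functions r d \<Longrightarrow> (\<lambda>v. f v * g v) \<in> frobenius_functions r d"
  "f \<in> frobenius_functions r d \<Longrightarrow> g \<in> poly_funs fscale \<Longrightarrow>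
    (\<And>v. v \<in> one_forms r (d + 2) \<Longrightarrow> g v = f v) \<Longrightarrow> g \<in> frobenius_functions r d"
  "(\<lambda>_. 0) \<in> frobenius_functions r d"
proof -
  let ?V = "one_forms r (d + 2)"
  assume g: "g \<in> frobenius_functions r d"
  have g': "g \<in> poly_funs fscale" "restrict0 ?V g \<in> frobenius_ideal r d" using g by (auto simp: frobenius_functions_def)
  { assume f: "f \<in> frobenius_functions r d"
    have f': "f \<in> poly_funs fscale" "restrict0 ?V f \<in> frobenius_ideal r d" using f by (auto simp: frobenius_functions_def)
    have "restrict0 ?V (\<lambda>v. f v + g v) = (\<lambda>v. restrict0 ?V f v + restrict0 ?V g v)" by (auto simp: restrict0_def)
    then show "(\<lambda>v. f v + g v) \<in> frobenius_functions r d"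
      using frobenius_closed(2)[OF f'(2) g'(2)] poly_funs.add[OF f'(1) g'(1)] unfolding frobenius_functions_def by (intro CollectI conjI) simp_all }
  assume f: "f \<in> poly_funs fscale"
  have "restrict0 ?V (\<lambda>v. f v * g v) = (\<lambda>v. restrict0 ?V f v * restrict0 ?V g v)" by (auto simp: restrict0_def)
  moreover have "restrict0 ?V f \<in> carrier (frob_ring r d)" using f by (simp add: coord_ring_def)
  ultimately show "(\<lambda>v. f v * g v) \<in> frobenius_functions r d"
    using frobenius_closed(3)[of "restrict0 ?V f" r d, OF _ g'(2)] poly_funs.mult[OF f g'(1)] unfolding frobenius_functions_def by (intro CollectI conjI) simp_all
next
  assume f: "f \<in> frobenius_functions r d" and g: "g \<in> poly_funs fscale" "\<And>v. v \<in> one_forms r (d + 2) \<Longrightarrow> g v = f v"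
  have "restrict0 (one_forms r (d + 2)) g = restrict0 (one_forms r (d + 2)) f"
    using g(2) unfolding restrict0_def by (intro ext if_cong refl)
  then show "g \<in> frobenius_functions r d" using f g(1) unfolding frobenius_functions_def by simp
next
  have "restrict0 (one_forms r (d + 2)) (\<lambda>_. 0) = (\<lambda>_. 0)" by (simp add: restrict0_def)
  then show "(\<lambda>_. 0) \<in> frobenius_functions r d"
    using frobenius_closed(1)[of r d] poly_funs.const unfolding frobenius_functions_def by (intro CollectI conjI) simp_all
qed

lemma wedge_lin_outside:
  assumes "\<omega> \<in> one_forms r m" "\<eta> \<in> one_forms r m" "\<not> (i \<le> r \<and> j \<le> r \<and> k \<le> r)"
  shows "wedge_lin \<omega> \<eta> i j k = 0"
  using assms(3) hforms_outside[OF one_forms_hforms[OF assms(1)]] hforms_dform_outside[OF one_forms_hforms[OF assms(2)]]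
  unfolding wedge_lin_def by (auto simp: not_le)

text \<open>Each coefficient of \<open>wedge_d\<close> is an admissible \<open>f\<close>, and its
  derivative is the polarization of the quadratic map.\<close>

lemma linearized_frobenius:
  assumes \<omega>: "\<omega> \<in> one_forms r (d + 2)" and \<eta>: "\<eta> \<in> one_forms r (d + 2)"
    and L: "\<And>f L. f \<in> frobenius_functions r d \<Longrightarrow> derivative_at fscale f \<omega> L \<Longrightarrow> L \<eta> = 0"
  shows "wedge_lin \<omega> \<eta> i j k + wedge_lin \<eta> \<omega> i j k = 0"
proof (cases "i \<le> r \<and> j \<le> r \<and> k \<le> r")
  case False
  then show ?thesis using wedge_lin_outside[OF \<omega> \<eta>] wedge_lin_outside[OF \<eta> \<omega>] by simp
next
  case True
  interpret vector_space fscale by (rule vector_space_fscale)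
  show ?thesis
  proof (rule poly_mapping_eqI)
    fix \<alpha>
    let ?f = "\<lambda>\<omega>. cf (wedge_d \<omega> i j k) \<alpha>"
    have f: "?f \<in> frobenius_functions r d"
      unfolding frobenius_functions_def using True by (intro CollectI conjI wedge_d_poly frobenius_generator) auto
    obtain L where "derivative_at fscale ?f \<omega> L"
      by (rule poly_funs_derivative[OF vector_space_fscale wedge_d_poly])
    note L' = this
    have "L \<eta> = cf (wedge_lin \<omega> \<eta> i j k + wedge_lin \<eta> \<omega> i j k) \<alpha>"
    proof (rule derivative_at_unique_value[OF L', of "\<lambda>_. ?f \<eta>" \<eta> 0])
      fix c
      have z: "\<omega> + fscale c \<eta> + fscale (c\<^sup>2) 0 = \<omega> + fscale c \<eta>" by simp
      show "?f (\<omega> + fscale c \<eta> + fscale (c\<^sup>2) 0) = ?f \<omega> + c * cf (wedge_lin \<omega> \<eta> i j k + wedge_lin \<eta> \<omega> i j k) \<alpha> + c\<^sup>2 * ?f \<eta>"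
        unfolding z wedge_d_expand by (simp only: lookup_add lookup_pconst)
    qed (rule polyalg.const)
    then show "cf (wedge_lin \<omega> \<eta> i j k + wedge_lin \<eta> \<omega> i j k) \<alpha> = cf 0 \<alpha>"
      using L[OF f L'] by simp
  qed
qed

definition pencil_tangents :: "nat \<Rightarrow> nat \<Rightarrow> nat \<Rightarrow> mpoly \<Rightarrow> mpoly \<Rightarrow> form set" where
  "pencil_tangents r d0 d1 F0 F1 = (\<lambda>(G0, G1). rho r d0 d1 F0 G1 + rho r d0 d1 G0 F1) ` (homog_polys r d0 \<times> homog_polys r d1)"

text \<open>
  At the pencil of two Fermat-type polynomials, the tangent space of the Frobenius equations is
  the image of the differential of \<open>rho\<close>, so the general result on tangent charts applies.
\<close>

lemma local_multiplier:
  assumes r: "3 \<le> r" and d: "1 \<le> d1" "d1 \<le> d0"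
    and h: "h \<in> poly_funs fscale"
    and h0: "\<And>F0 F1. F0 \<in> homog_polys r d0 \<Longrightarrow> F1 \<in> homog_polys r d1 \<Longrightarrow> h (rho r d0 d1 F0 F1) = 0"
  shows "\<exists>g\<in>poly_funs fscale. (\<lambda>v. g v * h v) \<in> frobenius_functions r (d0 + d1 - 2) \<and>
    (\<exists>F0\<in>homog_polys r d0. \<exists>F1\<in>homog_polys r d1. g (rho r d0 d1 F0 F1) \<noteq> 0)"
proof -
  interpret vector_space fscale by (rule vector_space_fscale)
  let ?d = "d0 + d1 - 2" and ?M = "frobenius_functions r (d0 + d1 - 2)"
  have d2: "?d + 2 = d0 + d1" and d0: "1 \<le> d0" using d by auto
  let ?V = "one_forms r (d0 + d1)"
  obtain F0 F1 where F0: "F0 \<in> homog_polys r d0" and F1: "F1 \<in> homog_polys r d1"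
    and dF: "\<And>i. pderiv_var i F0 = uform (d0 - 1) i" "\<And>i. pderiv_var i F1 = vform (d1 - 1) i"
    by (rule pencil_exists[OF r d0 d(1)]) blast
  let ?w = "rho r d0 d1 F0 F1" and ?U = "pencil_tangents r d0 d1 F0 F1"
  obtain T where T: "T \<subseteq> ?U" "independent T" "?U \<subseteq> span T"
    using maximal_independent_subset[of ?U] by blast
  \<comment> \<open>Each tangent direction in the basis is lifted to a direction in the space of
    pairs, so that the chart runs through values of \<open>rho\<close>.\<close>
  have "\<forall>b\<in>T. \<exists>p. fst p \<in> homog_polys r d0 \<and> snd p \<in> homog_polys r d1 \<and> b = rho r d0 d1 F0 (snd p) + rho r d0 d1 (fst p) F1"
    using T(1) unfolding pencil_tangents_def by fastforce
  then obtain p where p: "\<forall>b\<in>T. fst (p b) \<in> homog_polys r d0 \<and> snd (p b) \<in> homog_polys r d1 \<and> b = rho r d0 d1 F0 (snd (p b)) + rho r d0 d1 (fst (p b)) F1"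
    unfolding bchoice_iff by (elim exE)
  define G where "G b = fst (p b)" for b
  define H where "H b = snd (p b)" for b
  have G: "G b \<in> homog_polys r d0" and H: "H b \<in> homog_polys r d1" and b: "rho r d0 d1 F0 (H b) + rho r d0 d1 (G b) F1 = b"
    if "b \<in> T" for b using p that by (auto simp: G_def H_def)
  define X where "X z = F0 + (\<Sum>b\<in>T. pconst (z b) * G b)" for z
  define Y where "Y z = F1 + (\<Sum>b\<in>T. pconst (z b) * H b)" for z
  have XY: "X z \<in> homog_polys r d0" "Y z \<in> homog_polys r d1" for z
    unfolding X_def Y_def by (intro homog_polys_closed homog_sum F0 F1 G H, assumption)+
  define P where "P z = rho r d0 d1 (X z) (Y z)" for z
  have rho_V: "rho r d0 d1 A B \<in> ?V" if "A \<in> homog_polys r d0" "B \<in> homog_polys r d1" for A B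
    using that d0 d(1) by (rule rho_one_forms)
  obtain B0 where B0: "finite B0" "?V \<subseteq> span B0" using one_forms_finite_span by blast
  have UV: "?U \<subseteq> ?V"
    unfolding pencil_tangents_def using F0 F1 rho_V by (auto intro!: subspace_add[OF one_forms_subspace])
  interpret C: tangent_chart fscale ?V T B0 ?M ?w "\<lambda>a b. rho r d0 d1 (G a) (H b)" P
  proof (unfold_locales)
    show "subspace ?V" by (rule one_forms_subspace)
    show "T \<subseteq> ?V" using T(1) UV by blast
    show "?w \<in> ?V" by (rule rho_V[OF F0 F1])
    show "rho r d0 d1 (G a) (H b) \<in> ?V" if "a \<in> T" "b \<in> T" for a b by (rule rho_V[OF G[OF that(1)] H[OF that(2)]])
    show "P z = ?w + (\<Sum>b\<in>T. fscale (z b) b) + (\<Sum>a\<in>T. \<Sum>b\<in>T. fscale (z a * z b) (rho r d0 d1 (G a) (H b)))" for z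
      unfolding P_def X_def Y_def rho_perturbation by (simp add: b)
    show "?M \<subseteq> poly_funs fscale" by (auto simp: frobenius_functions_def)
    show "g \<in> ?M" if "f \<in> ?M" "g \<in> poly_funs fscale" "\<And>v. v \<in> ?V \<Longrightarrow> g v = f v" for f g
      by (rule frobenius_functions_closed(3)[OF that(1,2)], rule that(3), unfold d2)
    show "f (P z) = 0" if "f \<in> ?M" for f z
    proof -
      have "restrict0 (one_forms r (?d + 2)) f \<in> frobenius_ideal r ?d" using that by (simp add: frobenius_functions_def)
      from frobenius_vanishes[OF this, of "P z"] show ?thesis
        unfolding d2 P_def using rho_V[OF XY] integrable_rho[OF XY] by (simp add: restrict0_def)
    qed
    show "v \<in> span T" if v: "v \<in> ?V" and L: "\<And>f L. f \<in> ?M \<Longrightarrow> derivative_at fscale f ?w L \<Longrightarrow> L v = 0" for v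
    proof -
      have wv: "?w \<in> one_forms r (?d + 2)" "v \<in> one_forms r (?d + 2)"
        unfolding d2 by (rule rho_V[OF F0 F1], rule v)
      have lin: "wedge_lin ?w v i j k + wedge_lin v ?w i j k = 0" for i j k
        by (rule linearized_frobenius[OF wv], rule L)
      have "\<exists>G0\<in>homog_polys r d0. \<exists>G1\<in>homog_polys r d1. v = rho r d0 d1 F0 G1 + rho r d0 d1 G0 F1"
        by (rule tangent_space_at_pencil[OF r d F0 dF(1) F1 dF(2) v lin])
      then have "v \<in> ?U" by (auto simp: pencil_tangents_def)
      then show ?thesis using T(3) by blast
    qed
  qed (fact T B0 frobenius_functions_closed)+
  obtain g where g: "g \<in> poly_funs fscale" "(\<lambda>v. g v * h v) \<in> ?M" "\<exists>z. g (P z) \<noteq> 0"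
    by (rule C.multiple_in_ideal[OF h]) (auto simp: P_def intro!: h0 XY)
  then obtain z where z: "g (P z) \<noteq> 0" by blast
  show ?thesis
    by (rule bexI[OF _ g(1)], rule conjI[OF g(2)], rule bexI[OF _ XY(1)[of z]], rule bexI[OF _ XY(2)[of z]])
      (use z in \<open>simp add: P_def\<close>)
qed

text \<open>Some homogeneous component of the multiplier is nonzero at a given pencil, and stability
  of the ideal under scaling lets that component replace the whole.\<close>

proposition homogeneous_multiplier:
  assumes r: "3 \<le> r" and d: "1 \<le> d1" "d1 \<le> d0"
    and f: "f \<in> homog_part fscale (one_forms r (d0 + d1)) n"
    and f0: "\<And>F0 F1. F0 \<in> homog_polys r d0 \<Longrightarrow> F1 \<in> homog_polys r d1 \<Longrightarrow> f (rho r d0 d1 F0 F1) = 0"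
  shows "\<exists>m. \<exists>g\<in>homog_part fscale (one_forms r (d0 + d1)) m. (\<lambda>v. g v * f v) \<in> frobenius_ideal r (d0 + d1 - 2) \<and>
    (\<exists>F0\<in>homog_polys r d0. \<exists>F1\<in>homog_polys r d1. g (rho r d0 d1 F0 F1) \<noteq> 0)"
proof -
  let ?V = "one_forms r (d0 + d1)" and ?d = "d0 + d1 - 2"
  have d2: "?d + 2 = d0 + d1" and d0: "1 \<le> d0" using d by auto
  have rho_V: "rho r d0 d1 A B \<in> ?V" if "A \<in> homog_polys r d0" "B \<in> homog_polys r d1" for A B
    using that d0 d(1) by (rule rho_one_forms)
  obtain h where h: "h \<in> poly_funs fscale" "f = restrict0 ?V h" using f by (rule homog_partE)
  have h0: "h (rho r d0 d1 F0 F1) = 0" if "F0 \<in> homog_polys r d0" "F1 \<in> homog_polys r d1" for F0 F1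
    using f0[OF that] rho_V[OF that] by (simp add: h(2) restrict0_def)
  have "\<exists>g\<in>poly_funs fscale. (\<lambda>v. g v * h v) \<in> frobenius_functions r ?d \<and>
      (\<exists>F0\<in>homog_polys r d0. \<exists>F1\<in>homog_polys r d1. g (rho r d0 d1 F0 F1) \<noteq> 0)"
    by (rule local_multiplier[OF r d h(1)]) (rule h0)
  then obtain g F0 F1 where
    g: "g \<in> poly_funs fscale" "(\<lambda>v. g v * h v) \<in> frobenius_functions r ?d"
    and F: "F0 \<in> homog_polys r d0" "F1 \<in> homog_polys r d1" "g (rho r d0 d1 F0 F1) \<noteq> 0"
    by (elim bexE conjE)
  obtain K N where K: "\<And>k c v. K k (fscale c v) = c ^ k * K k v" "\<And>v. g v = (\<Sum>k\<le>N. K k v)"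
    "\<And>k. restrict0 ?V (K k) \<in> homog_part fscale ?V k"
    by (rule homog_part_of_components[OF vone g(1), of r "d0 + d1"]) blast
  have "(\<Sum>k\<le>N. K k (rho r d0 d1 F0 F1)) \<noteq> 0" using F(3) unfolding K(2) .
  then obtain k where k: "k \<in> {..N}" "K k (rho r d0 d1 F0 F1) \<noteq> 0" by (rule sum.not_neutral_contains_not_neutral)
  have eq: "restrict0 (one_forms r (?d + 2)) (\<lambda>v. g v * h v) = (\<lambda>v. g v * f v)"
    unfolding d2 by (auto simp: h(2) restrict0_def)
  have "restrict0 (one_forms r (?d + 2)) (\<lambda>v. g v * h v) \<in> frobenius_ideal r ?d"
    using g(2) unfolding frobenius_functions_def by blast
  then have "(\<lambda>v. g v * f v) \<in> frobenius_ideal r ?d" unfolding eq .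
  moreover have "f \<in> homog_part fscale (one_forms r (?d + 2)) n" unfolding d2 by (rule f)
  ultimately have "k \<le> N \<Longrightarrow> (\<lambda>v. K k v * f v) \<in> frobenius_ideal r ?d"
    by (intro frobenius_homogeneous_multiplier[OF K(1) K(2)])
  then
  have "(\<lambda>v. K k v * f v) \<in> frobenius_ideal r ?d" using k(1) by simp
  moreover have "(\<lambda>v. K k v * f v) = (\<lambda>v. restrict0 ?V (K k) v * f v)"
    by (auto simp: h(2) restrict0_def)
  ultimately have "(\<lambda>v. restrict0 ?V (K k) v * f v) \<in> frobenius_ideal r ?d" by (simp only:)
  moreover have "restrict0 ?V (K k) (rho r d0 d1 F0 F1) \<noteq> 0" using k(2) rho_V[OF F(1,2)] by (simp add: restrict0_def)
  ultimately show ?thesis using K(3)[of k] F(1,2) by blast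
qed

section \<open>The singular locus of a general rational foliation\<close>

lemma homog_pvar_power: "i \<le> r \<Longrightarrow> pvar i ^ n \<in> homog_polys r n"
proof (induction n)
  case 0
  then show ?case using homog_pconst[of 1 r] by (simp add: pconst_simps(3))
next
  case (Suc n)
  then show ?case using homog_mult[OF homog_pvar, of i r "pvar i ^ n" n] by simp
qed

lemma pderiv_pvar_power: "i \<noteq> j \<Longrightarrow> pderiv_var i (pvar j ^ n) = 0"
proof (induction n)
  case 0
  then show ?case using pderiv_of_nat[of i 1] by simp
qed (simp add: pderiv_mult pderiv_pvar)

abbreviation "axis_value \<omega> \<equiv> peval (\<omega> 3) (axis 1)"

abbreviation "axis_resultant m \<omega> \<equiv> det (sylv m (\<omega> 3) (\<omega> 2) (axis 0))"

lemma axis_functions_poly: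
  "(\<lambda>\<omega>. axis_value \<omega>) \<in> poly_funs fscale" "(\<lambda>\<omega>. axis_resultant m \<omega>) \<in> poly_funs fscale"
proof -
  have 1: "(\<lambda>\<omega>. msum \<phi> (\<omega> i)) \<in> poly_funs fscale" for \<phi> i
    by (rule poly_funs.linear[OF msum_form_linear])
  show "(\<lambda>\<omega>. axis_value \<omega>) \<in> poly_funs fscale" unfolding peval_msum by (rule 1)
  show "(\<lambda>\<omega>. axis_resultant m \<omega>) \<in> poly_funs fscale"
    unfolding poly_funs_eq_polyalg
    by (rule sylv_det_poly) (rule 1[unfolded poly_funs_eq_polyalg])+
qed

text \<open>
  For \<open>F0 = x\<^sub>0 ^ d0 + x\<^sub>3 x\<^sub>1 ^ (d0 - 1)\<close> and \<open>F1 = x\<^sub>1 ^ d1 + x\<^sub>2 x\<^sub>0 ^ (d1 - 1)\<close>, the coefficients of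
  \<open>dx\<^sub>2\<close> and \<open>dx\<^sub>3\<close> restrict to multiples of \<open>x\<^sub>0 ^ m\<close> and \<open>x\<^sub>1 ^ m\<close> on the line \<open>x\<^sub>2 = x\<^sub>3 = \<dots> = 0\<close>.
\<close>

lemma axis_functions_nonzero:
  assumes r: "3 \<le> r" and d: "1 \<le> d0" "1 \<le> d1"
  shows "\<exists>F0\<in>homog_polys r d0. \<exists>F1\<in>homog_polys r d1. axis_value (rho r d0 d1 F0 F1) \<noteq> 0 \<and>
    axis_resultant (d0 + d1 - 1) (rho r d0 d1 F0 F1) \<noteq> 0"
proof -
  define F0 where "F0 = pvar 0 ^ d0 + pvar 3 * pvar 1 ^ (d0 - 1)"
  define F1 where "F1 = pvar 1 ^ d1 + pvar 2 * pvar 0 ^ (d1 - 1)"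
  let ?m = "d0 + d1 - 1" and ?w = "rho r d0 d1 F0 F1"
  have e: "d1 + (d0 - Suc 0) = d0 + d1 - Suc 0" using d by auto
  have "pvar 3 * pvar 1 ^ (d0 - 1) \<in> homog_polys r (1 + (d0 - 1))" "pvar 2 * pvar 0 ^ (d1 - 1) \<in> homog_polys r (1 + (d1 - 1))"
    using r by (intro homog_mult homog_pvar homog_pvar_power; simp)+
  then have F0: "F0 \<in> homog_polys r d0" and F1: "F1 \<in> homog_polys r d1"
    unfolding F0_def F1_def using r d by (auto intro!: homog_polys_closed homog_pvar_power)
  have dF: "pderiv_var 2 F0 = 0" "pderiv_var 3 F0 = pvar 1 ^ (d0 - 1)"
    "pderiv_var 2 F1 = pvar 0 ^ (d1 - 1)" "pderiv_var 3 F1 = 0"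
    by (simp_all add: F0_def F1_def pderiv_add pderiv_mult pderiv_pvar pderiv_pvar_power)
  have w: "?w 2 = of_nat d0 * (F0 * pvar 0 ^ (d1 - 1))" "?w 3 = - (of_nat d1 * (F1 * pvar 1 ^ (d0 - 1)))"
    unfolding rho_apply[OF F0 F1] dF by simp_all
  have wh: "?w i \<in> homog_polys r ?m" for i
    using hformsD[OF one_forms_hforms[OF rho_one_forms[OF F0 F1 d]]] .
  have neg: "peval (- p) x = - peval p x" for p x
    using peval_simps(2)[of 0 p x] by (simp add: peval_simps)
  \<comment> \<open>The line joining \<open>axis 0\<close> and \<open>axis 1\<close>, with
    \<open>x\<^sub>1\<close> as parameter; the values at all \<open>t\<close> determine the
    coefficients in the Sylvester matrix.\<close>
  define y where "y t = (\<lambda>j::nat. if j = 0 then 1 else if j = 1 then t else 0 :: complex)" for t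
  have ev: "peval (?w 2) (y t) = of_nat d0" "peval (?w 3) (y t) = - of_nat d1 * t ^ ?m" for t
    unfolding w by (simp_all add: peval_mult peval_simps neg F0_def F1_def y_def mult.assoc e flip: power_add)
  have wt: "wt1 k (y t) = wt1 k (axis 0)" for k t
    by (rule wt1_cong) (auto simp: y_def axis_def)
  have y1: "y t 1 = t" for t by (simp add: y_def)
  have expand: "peval (?w i) (y t) = (\<Sum>k\<le>?m. msum (wt1 k (axis 0)) (?w i) * t ^ k)" for i t
    using peval_expand1[OF wh, of i "y t"] unfolding wt y1 .
  have delta: "(\<Sum>k\<le>?m. (if k = i then a else 0) * t ^ k) = a * t ^ i" if "i \<le> ?m" for i and a t :: complex
  proof -
    have "(\<Sum>k\<le>?m. (if k = i then a else 0) * t ^ k) = (\<Sum>k\<le>?m. if k = i then a * t ^ i else 0)"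
      by (rule sum.cong) simp_all
    then show ?thesis using that by simp
  qed
  have c3: "\<forall>k\<le>?m. msum (wt1 k (axis 0)) (?w 3) = (if k = ?m then - of_nat d1 else 0)"
    unfolding polyfun_eq_coeffs[symmetric] expand[symmetric] ev by (simp only: delta le0 order_refl power_0 mult_1_right simp_thms)
  have c2: "\<forall>k\<le>?m. msum (wt1 k (axis 0)) (?w 2) = (if k = 0 then of_nat d0 else 0)"
    unfolding polyfun_eq_coeffs[symmetric] expand[symmetric] ev by (simp only: delta le0 order_refl power_0 mult_1_right simp_thms)
  have "axis_resultant ?m ?w \<noteq> 0"
    by (rule sylv_det_extreme[where a = "- of_nat d1" and b = "of_nat d0"]) (use c2 c3 d in auto)
  moreover have "axis_value ?w = - of_nat d1"
    unfolding w by (simp add: peval_mult peval_simps neg F1_def axis_def)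
  then have "axis_value ?w \<noteq> 0" using d by simp
  ultimately show ?thesis using F0 F1 by blast
qed

lemma generic_foliation:
  assumes r: "3 \<le> r" and d: "1 \<le> d0" "1 \<le> d1" and \<omega>: "\<omega> \<in> one_forms r (d0 + d1)" "integrable_form r \<omega>"
    and generic: "axis_value \<omega> \<noteq> 0" "axis_resultant (d0 + d1 - 1) \<omega> \<noteq> 0"
  shows "line fscale \<omega> \<in> foliations r (d0 + d1 - 2)"
proof -
  have d2: "d0 + d1 - 2 + 2 = d0 + d1" using d by auto
  have "\<omega> \<noteq> 0" using generic(1) by (auto simp: peval_simps)
  have h: "\<omega> i \<in> homog_polys r (d0 + d1 - 1)" for i
    using hformsD[OF one_forms_hforms[OF \<omega>(1)]] .
  have "codim (zariski vscale (aff r)) (sing r \<omega>) \<ge> 2"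
  proof (rule codim_ge_2[OF _ _ h h generic])
    show "sing r \<omega> \<subseteq> Pspace r" by (auto simp: sing_def)
    fix y assume "line vscale y \<in> sing r \<omega>"
    then have "\<forall>i\<le>r. peval (\<omega> i) y = 0" using line_self[OF vaff, of y] by (auto simp: sing_def)
    then show "peval (\<omega> 3) y = 0 \<and> peval (\<omega> 2) y = 0" using r by simp
  qed (use r d in auto)
  then show ?thesis
    unfolding foliations_def d2 using \<omega> \<open>\<omega> \<noteq> 0\<close> by blast
qed

section \<open>The rational component\<close>

lemma poly_fun_rho_line:
  assumes "f \<in> poly_funs fscale"
  shows "(\<lambda>c. f (rho r d0 d1 (F0 + pconst c * G0) (F1 + pconst c * G1))) \<in> univ_polys"
proof -
  have eq: "rho r d0 d1 (F0 + pconst c * G0) (F1 + pconst c * G1) =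
    rho r d0 d1 F0 F1 + fscale c (rho r d0 d1 F0 G1 + rho r d0 d1 G0 F1) + fscale (c * c) (rho r d0 d1 G0 G1)" for c
    \<comment> \<open>A one-element index set turns the general expansion into one with a single
      parameter.\<close>
    using rho_perturbation[where T = "{()}" and z = "\<lambda>_. c" and G = "\<lambda>_. G0" and H = "\<lambda>_. G1"] by simp
  show ?thesis
    unfolding eq
    using assms unfolding poly_funs_eq_polyalg
  proof (rule polyalg_comp)
    fix l assume "l \<in> lin_funs fscale"
    then have "Vector_Spaces.linear fscale (*) l" by simp
    note l = linear_functional_simps[OF this]
    show "(\<lambda>c. l (rho r d0 d1 F0 F1 + fscale c (rho r d0 d1 F0 G1 + rho r d0 d1 G0 F1) + fscale (c * c) (rho r d0 d1 G0 G1))) \<in> univ_polys"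
      unfolding l by (intro polyalg.add polyalg.mult polyalg.const univ_polys_var)
  qed
qed

text \<open>The segment joining two pairs of polynomials is mapped to a polynomial curve of forms.
  This is irreducibility of the image, obtained from the vector space of pairs.\<close>

lemma rho_common_nonzero:
  assumes f: "f \<in> poly_funs fscale" "g \<in> poly_funs fscale"
    and F: "F0 \<in> homog_polys r d0" "F1 \<in> homog_polys r d1" "f (rho r d0 d1 F0 F1) \<noteq> 0"
    and G: "G0 \<in> homog_polys r d0" "G1 \<in> homog_polys r d1" "g (rho r d0 d1 G0 G1) \<noteq> 0"
  shows "\<exists>H0\<in>homog_polys r d0. \<exists>H1\<in>homog_polys r d1. f (rho r d0 d1 H0 H1) \<noteq> 0 \<and> g (rho r d0 d1 H0 H1) \<noteq> 0"
proof -
  let ?H = "\<lambda>c. rho r d0 d1 (F0 + pconst c * (G0 - F0)) (F1 + pconst c * (G1 - F1))"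
  have H0: "?H 0 = rho r d0 d1 F0 F1" by (simp add: pconst_eq_0[THEN iffD2])
  have H1: "?H 1 = rho r d0 d1 G0 G1" by (simp add: pconst_simps(3))
  have lf: "(\<lambda>c. f (?H c)) \<in> univ_polys" "(\<lambda>c. g (?H c)) \<in> univ_polys"
    by (rule poly_fun_rho_line[OF f(1)], rule poly_fun_rho_line[OF f(2)])
  obtain c where c: "f (?H c) \<noteq> 0" "g (?H c) \<noteq> 0"
    by (rule univ_polys_common_nonzero[OF lf, where a = 0 and b = 1])
      (use F(3) G(3) in \<open>simp_all only: H0 H1 not_False_eq_True\<close>)
  have "F0 + pconst c * (G0 - F0) \<in> homog_polys r d0" "F1 + pconst c * (G1 - F1) \<in> homog_polys r d1"
    by (intro homog_polys_closed homog_diff F G)+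
  then show ?thesis using c by blast
qed

text \<open>An explicit part of the image that consists of foliations. Vanishing and irreducibility
  are tested on it, since membership of other values of \<open>rho\<close> in
  \<open>foliations\<close> is not under control.\<close>

definition generic_rational :: "nat \<Rightarrow> nat \<Rightarrow> nat \<Rightarrow> form set set" where
  "generic_rational r d0 d1 = {line fscale (rho r d0 d1 F0 F1) | F0 F1.
     F0 \<in> homog_polys r d0 \<and> F1 \<in> homog_polys r d1 \<and> axis_value (rho r d0 d1 F0 F1) \<noteq> 0 \<and>
     axis_resultant (d0 + d1 - 1) (rho r d0 d1 F0 F1) \<noteq> 0}"

abbreviation rational_lines :: "nat \<Rightarrow> nat \<Rightarrow> nat \<Rightarrow> form set set" where
  "rational_lines r d0 d1 \<equiv> {line fscale (rho r d0 d1 F0 F1) | F0 F1.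
     F0 \<in> homog_polys r d0 \<and> F1 \<in> homog_polys r d1 \<and> F0 \<noteq> 0 \<and> F1 \<noteq> 0 \<and> rho r d0 d1 F0 F1 \<noteq> 0}"

lemma frobenius_vanishes_on_foliations:
  assumes "f \<in> frobenius_ideal r d" "L \<in> foliations r d" shows "vanishes_at f L"
proof -
  interpret vector_space fscale by (rule vector_space_fscale)
  obtain \<omega> where \<omega>: "\<omega> \<in> one_forms r (d + 2)" "integrable_form r \<omega>" "L = line fscale \<omega>"
    using assms(2) unfolding foliations_def by blast
  have "f (fscale c \<omega>) = 0" for c
  proof (rule frobenius_vanishes[OF assms(1)])
    show "fscale c \<omega> \<in> one_forms r (d + 2)"
      by (rule subspace_scale[OF one_forms_subspace \<omega>(1)])
    show "integrable_form r (fscale c \<omega>)" using \<omega>(2) by (simp add: integrable_form_def wedge_d_fscale)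
  qed
  then show ?thesis by (auto simp: \<omega>(3) line_def vanishes_at_def)
qed

context
  fixes r d0 d1 :: nat
  assumes r: "3 \<le> r" and d0: "1 \<le> d0" and d1: "1 \<le> d1"
begin

abbreviation "W \<equiv> one_forms r (d0 + d1)"
abbreviation "FX \<equiv> zariski fscale W"

lemma rho_W: "F0 \<in> homog_polys r d0 \<Longrightarrow> F1 \<in> homog_polys r d1 \<Longrightarrow> rho r d0 d1 F0 F1 \<in> W"
  by (rule rho_one_forms[OF _ _ d0 d1])

lemma generic_subset_lines: "generic_rational r d0 d1 \<subseteq> rational_lines r d0 d1"
proof
  fix L assume "L \<in> generic_rational r d0 d1"
  then obtain F0 F1 where F: "F0 \<in> homog_polys r d0" "F1 \<in> homog_polys r d1" "axis_value (rho r d0 d1 F0 F1) \<noteq> 0"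
    and L: "L = line fscale (rho r d0 d1 F0 F1)"
    unfolding generic_rational_def by blast
  have nz: "rho r d0 d1 F0 F1 \<noteq> 0" using F(3) by (auto simp: peval_simps)
  moreover have "F0 \<noteq> 0" "F1 \<noteq> 0" using nz rho_0 by auto
  ultimately show "L \<in> rational_lines r d0 d1" using F(1,2) L by blast
qed

lemma rational_lines_subset: "rational_lines r d0 d1 \<subseteq> proj_space fscale W"
proof
  fix L assume "L \<in> rational_lines r d0 d1"
  then obtain F0 F1 where F: "F0 \<in> homog_polys r d0" "F1 \<in> homog_polys r d1" "rho r d0 d1 F0 F1 \<noteq> 0"
    and L: "L = line fscale (rho r d0 d1 F0 F1)" by blast
  show "L \<in> proj_space fscale W" unfolding L proj_space_def using rho_W[OF F(1,2)] F(3) by blast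
qed

lemma generic_subset_foliations: "generic_rational r d0 d1 \<subseteq> foliations r (d0 + d1 - 2)"
proof
  fix L assume "L \<in> generic_rational r d0 d1"
  then obtain F0 F1 where F: "F0 \<in> homog_polys r d0" "F1 \<in> homog_polys r d1"
      "axis_value (rho r d0 d1 F0 F1) \<noteq> 0" "axis_resultant (d0 + d1 - 1) (rho r d0 d1 F0 F1) \<noteq> 0"
    and L: "L = line fscale (rho r d0 d1 F0 F1)"
    unfolding generic_rational_def by blast
  show "L \<in> foliations r (d0 + d1 - 2)"
    unfolding L by (rule generic_foliation[OF r d0 d1 rho_W[OF F(1,2)] integrable_rho[OF F(1,2)] F(3,4)])
qed

lemma generic_nonzero:
  assumes f: "f \<in> poly_funs fscale" "F0 \<in> homog_polys r d0" "F1 \<in> homog_polys r d1" "f (rho r d0 d1 F0 F1) \<noteq> 0"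
  shows "\<exists>F0\<in>homog_polys r d0. \<exists>F1\<in>homog_polys r d1. f (rho r d0 d1 F0 F1) \<noteq> 0 \<and>
    axis_value (rho r d0 d1 F0 F1) * axis_resultant (d0 + d1 - 1) (rho r d0 d1 F0 F1) \<noteq> 0"
proof -
  obtain G0 G1 where G: "G0 \<in> homog_polys r d0" "G1 \<in> homog_polys r d1"
    "axis_value (rho r d0 d1 G0 G1) * axis_resultant (d0 + d1 - 1) (rho r d0 d1 G0 G1) \<noteq> 0"
    using axis_functions_nonzero[OF r d0 d1] by auto
  show ?thesis
    by (rule rho_common_nonzero[where g = "\<lambda>\<omega>. axis_value \<omega> * axis_resultant (d0 + d1 - 1) \<omega>",
        OF f(1) poly_funs.mult[OF axis_functions_poly] f(2-4) G])
qed

text \<open>A function that is nonzero at one value of \<open>rho\<close> is nonzero at a generic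
  one as well, so the generic part is dense. The right side also ranges over pairs with
  \<open>rho\<close> equal to 0, which define no line.\<close>

lemma generic_vanishing:
  assumes f: "f \<in> homog_part fscale W n"
  shows "(\<forall>L\<in>generic_rational r d0 d1. vanishes_at f L) \<longleftrightarrow>
    (\<forall>F0\<in>homog_polys r d0. \<forall>F1\<in>homog_polys r d1. f (rho r d0 d1 F0 F1) = 0)"
proof
  obtain h where h: "h \<in> poly_funs fscale" "f = restrict0 W h" using f by (rule homog_partE)
  assume van: "\<forall>L\<in>generic_rational r d0 d1. vanishes_at f L"
  show "\<forall>F0\<in>homog_polys r d0. \<forall>F1\<in>homog_polys r d1. f (rho r d0 d1 F0 F1) = 0"
  proof (intro ballI, rule ccontr)
    fix F0 F1 assume F: "F0 \<in> homog_polys r d0" "F1 \<in> homog_polys r d1" "f (rho r d0 d1 F0 F1) \<noteq> 0"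
    then have "h (rho r d0 d1 F0 F1) \<noteq> 0" by (simp add: h(2) restrict0_def rho_W)
    from generic_nonzero[OF h(1) F(1,2) this] obtain G0 G1 where G: "G0 \<in> homog_polys r d0" "G1 \<in> homog_polys r d1"
      "h (rho r d0 d1 G0 G1) \<noteq> 0" "axis_value (rho r d0 d1 G0 G1) * axis_resultant (d0 + d1 - 1) (rho r d0 d1 G0 G1) \<noteq> 0"
      by (elim bexE conjE)
    have "line fscale (rho r d0 d1 G0 G1) \<in> generic_rational r d0 d1"
      unfolding generic_rational_def using G(1,2,4) by auto
    then have "f (rho r d0 d1 G0 G1) = 0"
      using van vanishes_at_line[OF vone f rho_W[OF G(1,2)]] by blast
    then show False using G(3) by (simp add: h(2) restrict0_def rho_W[OF G(1,2)])
  qed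
next
  assume "\<forall>F0\<in>homog_polys r d0. \<forall>F1\<in>homog_polys r d1. f (rho r d0 d1 F0 F1) = 0"
  then show "\<forall>L\<in>generic_rational r d0 d1. vanishes_at f L"
    unfolding generic_rational_def using vanishes_at_line[OF vone f rho_W] by blast
qed

lemma lines_vanishing:
  assumes "f \<in> homog_part fscale W n" "\<forall>L\<in>generic_rational r d0 d1. vanishes_at f L" "L \<in> rational_lines r d0 d1"
  shows "vanishes_at f L"
  using assms(3) vanishes_at_line[OF vone assms(1) rho_W] assms(2)[unfolded generic_vanishing[OF assms(1)]] by blast

lemma prime_set_generic: "prime_set fscale W (generic_rational r d0 d1)"
  unfolding prime_set_def
proof (intro conjI allI ballI impI)
  show "generic_rational r d0 d1 \<subseteq> proj_space fscale W"
    using generic_subset_lines rational_lines_subset by blast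
  show "generic_rational r d0 d1 \<noteq> {}"
    unfolding generic_rational_def using axis_functions_nonzero[OF r d0 d1] by blast
  fix m n f g assume f: "f \<in> homog_part fscale W m" and g: "g \<in> homog_part fscale W n"
    and fg: "\<forall>L\<in>generic_rational r d0 d1. vanishes_at f L \<or> vanishes_at g L"
  have "\<forall>L\<in>generic_rational r d0 d1. vanishes_at (\<lambda>v. f v * g v) L"
    using fg by (auto simp: vanishes_at_def)
  then have fg0: "\<forall>F0\<in>homog_polys r d0. \<forall>F1\<in>homog_polys r d1. f (rho r d0 d1 F0 F1) * g (rho r d0 d1 F0 F1) = 0"
    unfolding generic_vanishing[OF homog_part_mult[OF vone f g]] .
  obtain f' where f': "f' \<in> poly_funs fscale" "f = restrict0 W f'" using f by (rule homog_partE)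
  obtain g' where g': "g' \<in> poly_funs fscale" "g = restrict0 W g'" using g by (rule homog_partE)
  show "(\<forall>L\<in>generic_rational r d0 d1. vanishes_at f L) \<or> (\<forall>L\<in>generic_rational r d0 d1. vanishes_at g L)"
  proof (rule ccontr)
    assume "\<not> ?thesis"
    from this[unfolded generic_vanishing[OF f] generic_vanishing[OF g]]
    obtain F0 F1 G0 G1 where F: "F0 \<in> homog_polys r d0" "F1 \<in> homog_polys r d1" "f (rho r d0 d1 F0 F1) \<noteq> 0"
      and G: "G0 \<in> homog_polys r d0" "G1 \<in> homog_polys r d1" "g (rho r d0 d1 G0 G1) \<noteq> 0" by blast
    have "f' (rho r d0 d1 F0 F1) \<noteq> 0" "g' (rho r d0 d1 G0 G1) \<noteq> 0"
      using F G by (simp_all add: f'(2) g'(2) restrict0_def rho_W)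
    from rho_common_nonzero[OF f'(1) g'(1) F(1,2) this(1) G(1,2) this(2)]
    obtain H0 H1 where H: "H0 \<in> homog_polys r d0" "H1 \<in> homog_polys r d1"
      "f' (rho r d0 d1 H0 H1) \<noteq> 0" "g' (rho r d0 d1 H0 H1) \<noteq> 0" by (elim bexE conjE)
    then have "f (rho r d0 d1 H0 H1) \<noteq> 0" "g (rho r d0 d1 H0 H1) \<noteq> 0"
      by (simp_all add: f'(2) g'(2) restrict0_def rho_W)
    then show False using fg0 H(1,2) by auto
  qed
qed

lemma rational_foliations_eq:
  "rational_foliations r d0 d1 = FX closure_of rational_lines r d0 d1 \<inter> foliations r (d0 + d1 - 2)"
  by (simp only: rational_foliations_def rational_closure_def)

lemma generic_subset_rational: "generic_rational r d0 d1 \<subseteq> rational_foliations r d0 d1"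
proof -
  have "rational_lines r d0 d1 \<subseteq> FX closure_of rational_lines r d0 d1"
    by (rule closure_of_subset) (unfold topspace_zariski[OF vone], rule rational_lines_subset)
  with generic_subset_lines have "generic_rational r d0 d1 \<subseteq> FX closure_of rational_lines r d0 d1"
    by (rule order_trans)
  then show ?thesis unfolding rational_foliations_eq by (rule Int_greatest) (rule generic_subset_foliations)
qed

text \<open>Functions vanishing on the generic part vanish at all values of \<open>rho\<close>,
  hence on the closure of all rational lines.\<close>

lemma vanishes_on_rational:
  assumes f: "f \<in> homog_part fscale W n"
  shows "(\<forall>L\<in>rational_foliations r d0 d1. vanishes_at f L) \<longleftrightarrow> (\<forall>L\<in>generic_rational r d0 d1. vanishes_at f L)"
proof (intro iffI ballI)
  fix L assume "\<forall>L\<in>rational_foliations r d0 d1. vanishes_at f L" "L \<in> generic_rational r d0 d1"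
  then show "vanishes_at f L" using generic_subset_rational by blast
next
  fix L assume van: "\<forall>L\<in>generic_rational r d0 d1. vanishes_at f L" and L: "L \<in> rational_foliations r d0 d1"
  have "\<forall>L\<in>rational_lines r d0 d1. vanishes_at f L" using lines_vanishing[OF f van] by (intro ballI)
  then show "vanishes_at f L"
    using L f unfolding rational_foliations_eq Int_iff in_zariski_closure[OF vone rational_lines_subset] by blast
qed

lemma prime_set_rational: "prime_set fscale W (rational_foliations r d0 d1)"
proof (rule prime_set_between[OF vone prime_set_generic generic_subset_rational])
  have P: "generic_rational r d0 d1 \<subseteq> proj_space fscale W" using prime_set_generic by (simp add: prime_set_def)
  show "rational_foliations r d0 d1 \<subseteq> FX closure_of generic_rational r d0 d1"
  proof
    fix L assume L: "L \<in> rational_foliations r d0 d1"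
    have "L \<in> proj_space fscale W"
      using L unfolding rational_foliations_eq Int_iff in_zariski_closure[OF vone rational_lines_subset] by blast
    then show "L \<in> FX closure_of generic_rational r d0 d1"
      unfolding in_zariski_closure[OF vone P] using vanishes_on_rational L by blast
  qed
qed

text \<open>A multiplier that is nonzero at some pencil is also nonzero somewhere on the generic
  part, hence is a denominator at the generic point.\<close>

lemma multiplier:
  assumes le: "d1 \<le> d0" and f: "f \<in> homog_part fscale W n" "\<And>L. L \<in> rational_foliations r d0 d1 \<Longrightarrow> vanishes_at f L"
  shows "\<exists>m. \<exists>g\<in>denoms fscale W (rational_foliations r d0 d1) m. (\<lambda>v. g v * f v) \<in> frobenius_ideal r (d0 + d1 - 2)"
proof -
  have van: "\<forall>L\<in>rational_foliations r d0 d1. vanishes_at f L" using f(2) by (intro ballI)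
  have "f (rho r d0 d1 F0 F1) = 0" if "F0 \<in> homog_polys r d0" "F1 \<in> homog_polys r d1" for F0 F1
    using van that unfolding vanishes_on_rational[OF f(1)] generic_vanishing[OF f(1)] by blast
  then have "\<exists>m. \<exists>g\<in>homog_part fscale W m. (\<lambda>v. g v * f v) \<in> frobenius_ideal r (d0 + d1 - 2) \<and>
      (\<exists>F0\<in>homog_polys r d0. \<exists>F1\<in>homog_polys r d1. g (rho r d0 d1 F0 F1) \<noteq> 0)"
    by (intro homogeneous_multiplier[OF r d1 le f(1)])
  then obtain m g F0 F1 where g: "g \<in> homog_part fscale W m" "(\<lambda>v. g v * f v) \<in> frobenius_ideal r (d0 + d1 - 2)"
    and F: "F0 \<in> homog_polys r d0" "F1 \<in> homog_polys r d1" "g (rho r d0 d1 F0 F1) \<noteq> 0"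
    by (elim exE bexE conjE)
  have "\<not> (\<forall>L\<in>rational_foliations r d0 d1. vanishes_at g L)"
    unfolding vanishes_on_rational[OF g(1)] generic_vanishing[OF g(1)] using F by blast
  then have "g \<in> denoms fscale W (rational_foliations r d0 d1) m"
    unfolding denoms_def using g(1) by (intro CollectI conjI)
  then show ?thesis using g(2) by blast
qed

lemma rational_component:
  assumes le: "d1 \<le> d0"
  shows "irreducible_component_of (foliations_topology r (d0 + d1 - 2)) (rational_foliations r d0 d1)
    \<and> reduced_ring (foliations_local_ring r (d0 + d1 - 2) (rational_foliations r d0 d1))"
proof
  have d2: "d0 + d1 - 2 + 2 = d0 + d1" using d0 d1 by auto
  have F: "foliations r (d0 + d1 - 2) \<subseteq> proj_space fscale W"
    unfolding foliations_def proj_space_def d2 by blast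
  show "irreducible_component_of (foliations_topology r (d0 + d1 - 2)) (rational_foliations r d0 d1)"
    unfolding foliations_topology_def d2
    by (rule irreducible_componentI[OF vone rational_lines_subset F rational_foliations_eq prime_set_rational,
        where I = "frobenius_ideal r (d0 + d1 - 2)"])
      (erule (1) frobenius_vanishes_on_foliations, erule multiplier[OF le], assumption)
  have I: "ideal (frobenius_ideal r (d0 + d1 - 2)) (coord_ring fscale W)"
    using ideal_frobenius[of r "d0 + d1 - 2"] unfolding d2 .
  show "reduced_ring (foliations_local_ring r (d0 + d1 - 2) (rational_foliations r d0 d1))"
    unfolding foliations_local_ring_def d2
  proof (rule reduced_local_ring[OF vone I prime_set_rational])
    fix f L assume "f \<in> frobenius_ideal r (d0 + d1 - 2)" "L \<in> rational_foliations r d0 d1"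
    then show "vanishes_at f L" using frobenius_vanishes_on_foliations by (simp add: rational_foliations_def)
  qed (erule multiplier[OF le], assumption)
qed

end

lemma rational_foliations_swap: "rational_foliations r d0 d1 = rational_foliations r d1 d0"
proof -
  have "line fscale (rho r d1 d0 F1 F0) = line fscale (rho r d0 d1 F0 F1)"
    and "rho r d1 d0 F1 F0 = 0 \<longleftrightarrow> rho r d0 d1 F0 F1 = 0" for d0 d1 F0 F1
  proof -
    interpret vector_space fscale by (rule vector_space_fscale)
    show "line fscale (rho r d1 d0 F1 F0) = line fscale (rho r d0 d1 F0 F1)"
      unfolding rho_swap[of r d1 d0] by (rule line_scale[OF vector_space_fscale]) simp
    show "rho r d1 d0 F1 F0 = 0 \<longleftrightarrow> rho r d0 d1 F0 F1 = 0"
      unfolding rho_swap[of r d1 d0] by simp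
  qed
  note swap = this
  have "rational_lines r d0 d1 \<subseteq> rational_lines r d1 d0" for d0 d1
  proof
    fix L assume "L \<in> rational_lines r d0 d1"
    then obtain F0 F1 where F: "F0 \<in> homog_polys r d0" "F1 \<in> homog_polys r d1" "F0 \<noteq> 0" "F1 \<noteq> 0" "rho r d0 d1 F0 F1 \<noteq> 0"
      and L: "L = line fscale (rho r d0 d1 F0 F1)" by blast
    have "rho r d1 d0 F1 F0 \<noteq> 0" using F(5) swap(2)[where ?d0.0 = d0 and ?d1.0 = d1] by simp
    then show "L \<in> rational_lines r d1 d0"
      unfolding L swap(1)[where ?d0.0 = d0 and ?d1.0 = d1, symmetric] using F by blast
  qed
  then have "rational_lines r d0 d1 = rational_lines r d1 d0" by (intro equalityI)
  then show ?thesis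
    unfolding rational_foliations_def rational_closure_def by (simp only: add.commute)
qed

theorem theorem1:
  fixes r d0 d1 :: nat
  assumes "r \<ge> 3" and "d0 \<ge> 1" and "d1 \<ge> 1"
  shows "irreducible_component_of (foliations_topology r (d0 + d1 - 2))
           (rational_foliations r d0 d1)
       \<and> reduced_ring (foliations_local_ring r (d0 + d1 - 2) (rational_foliations r d0 d1))"
proof (cases "d1 \<le> d0")
  case True
  then show ?thesis by (rule rational_component[OF assms])
next
  case False
  then have "d0 \<le> d1" by simp
  from rational_component[OF assms(1,3,2) this] show ?thesis
    by (simp only: add.commute[of d1 d0] rational_foliations_swap[of r d1 d0])
qed

end
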